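(* Let $p,k\ge1$ be integers, $m:[0,1]\times\mathbb{R}^p\to\mathbb{R}$ and $\sigma:[0,1]\to[0,\infty)$ measurable, $(\varepsilon_t)_{t\in\mathbb{Z}}$ i.i.d. real random variables, and consider the real-valued process $$Y_{n,t}=m(t/n,Y_{n,t-1},\ldots,Y_{n,t-p})+\sigma(t/n)\varepsilon_t,\quad 1\le t\le n,$$ with the initial conditions specified in the context, and $X_{n,t}=(Y_{n,t-p+1},\ldots,Y_{n,t})$. Write $|\mathbf{y}|=\sum_{i=1}^p|y_i|$ for $\mathbf{y}\in\mathbb{R}^p$. Assume: (E21) $\sigma$ is $k$-times continuously differentiable, $\inf_{u\in[0,1]}\sigma(u)>0$ and $\max_{0\le\ell\le k}\sup_{u\in[0,1]}|\sigma^{(\ell)}(u)|<\infty$. (E22) For all $\mathbf{y}\in\mathbb{R}^p$, $u\mapsto m(u,\mathbf{y})$ is $k$-times continuously differentiable, with $\ell$-th derivative $\partial_1^{(\ell)}m$. There exist nonnegative numbers $\{\beta_{i,u}:1\le i\le p,u\in[0,1]\}$ with $\sup_{u\in[0,1]}\sum_{i=1}^p\beta_{i,u}<1$ and positive numbers $\beta_0,q',C_1,C_2$ such that for all $(u,\mathbf{y})\in[0,1]\times\mathbb{R}^p$, $|m(u,\mathbf{y})|\le\sum_{i=1}^p\beta_{i,u}|y_i|+\beta_0$ and $\max_{1\le\ell\le k}\sup_{u\in[0,1]}|\partial_1^{(\ell)}m(u,\mathbf{y})|\le C_1|\mathbf{y}|^{q'}+C_2$. (E23) For some $d_0\ge1$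 with $d_0-q'k>0$, $\varepsilon_1$ has a finite moment of order $d_0$ and has a density $f_\varepsilon$ that is $k$-times continuously differentiable, positive everywhere and such that $\int|y|^{d_0+(1-q')s}|f_\varepsilon^{(s)}(y)|\,dy<\infty$ for $s=0,\ldots,k$. Set $d_1=d_0-q'k$ and $V_0(x_1,\ldots,x_p)=\sum_{i=1}^p(1+|x_i|)^{d_1}$. Then the triangular array of Markov chains $\{X_{n,t}:1\le t\le n,n\ge1\}$ is $V_0$-locally stationary, and for each integer $j\ge1$ the map $u\mapsto\pi_{u,j}$ is $k$-times continuously differentiable from $[0,1]$ to $\mathcal{M}_{V_0}(\mathbb{R}^{pj})$.
   Context: Let $R_u(\mathbf{x},dy)=\frac1{\sigma(u)}f_\varepsilon\left(\frac{y-m(u,x_p,\ldots,x_1)}{\sigma(u)}\right)dy$ for $\mathbf{x}=(x_1,\ldots,x_p)\in\mathbb{R}^p$, and let $Q_u$ be the Markov kernel on $\mathbb{R}^p$ given by $Q_u(\mathbf{x},d\mathbf{y})=R_u(\mathbf{x},dy_p)\prod_{i=1}^{p-1}\delta_{x_{i+1}}(dy_i)$ (the transition of $(Y_{t-p+1}(u),\ldots,Y_t(u))$, where $Y_t(u)=m(u,Y_{t-1}(u),\ldots,Y_{t-p}(u))+\sigma(u)\varepsilon_t$). $\pi_u$ is the (unique) invariant probability measure of $Q_u$. Initial conditions: $(Y_{n,t})_{t\le0}$ is a stationary $p$-order Markov process with transition kernel $R_0$ (so $X_{n,0}\sim\pi_0$), and for $1\le t\le n$, $\varepsilon_t$ is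 independent of $(Y_{n,s})_{s<t}$. For measurable $V:\mathbb{R}^p\to[1,\infty)$ and $j\ge1$, $\mathcal{M}_V(\mathbb{R}^{pj})$ is the Banach space of signed measures $\mu$ on $(\mathbb{R}^p)^j$ with $\|\mu\|_V:=\sup\{\int g\,d\mu: g\text{ measurable},\ |g(\mathbf{x}_1,\ldots,\mathbf{x}_j)|\le V(\mathbf{x}_1)+\cdots+V(\mathbf{x}_j)\}<\infty$. $\pi_{u,j}(d\mathbf{x}_1,\ldots,d\mathbf{x}_j)=\pi_u(d\mathbf{x}_1)Q_u(\mathbf{x}_1,d\mathbf{x}_2)\cdots Q_u(\mathbf{x}_{j-1},d\mathbf{x}_j)$, and $\pi^{(n)}_{t,j}$ is the law of $(X_{n,t},\ldots,X_{n,t+j-1})$. The array is $V$-locally stationary if for every $j\ge1$ there is $C_j>0$, not depending on $u,n,t$, such that $\|\pi^{(n)}_{t,j}-\pi_{u,j}\|_V\le C_j\left[|u-\frac tn|+\frac1n\right]$ for all $u\in[0,1]$, $n\ge1$, $1\le t\le n-j+1$. Derivatives at the endpoints of $[0,1]$ are one-sided. *)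

theory Defs
  imports "HOL-Probability.Probability"
begin

section \<open>Functions of class \<open>C\<^sup>k\<close> on a subset of the line\<close>

text \<open>Derivatives are taken within \<open>S\<close>, hence one-sided at the endpoints of an interval.\<close>

definition nderiv :: "real set \<Rightarrow> (real \<Rightarrow> real) \<Rightarrow> nat \<Rightarrow> real \<Rightarrow> real" where
  "nderiv S f l = ((\<lambda>g u. vector_derivative g (at u within S)) ^^ l) f"

definition Ck_on :: "nat \<Rightarrow> real set \<Rightarrow> (real \<Rightarrow> real) \<Rightarrow> bool" where
  "Ck_on k S f \<longleftrightarrow>
     (\<forall>l<k. nderiv S f l differentiable_on S) \<and> continuous_on S (nderiv S f k)"


section \<open>Signed measures and the weighted norm\<close>

text \<open>A signed measure on \<open>M\<close> is a real-valued countably additive function on \<open>sets M\<close>. Like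
  \<^term>\<open>measure M\<close>, it is extended by \<open>0\<close> to non-measurable sets.\<close>

definition signed_measure :: "'a measure \<Rightarrow> ('a set \<Rightarrow> real) \<Rightarrow> bool" where
  "signed_measure M \<mu> \<longleftrightarrow> \<mu> {} = 0 \<and> (\<forall>A. A \<notin> sets M \<longrightarrow> \<mu> A = 0) \<and>
     (\<forall>A :: nat \<Rightarrow> 'a set. range A \<subseteq> sets M \<longrightarrow> disjoint_family A \<longrightarrow>
        (\<lambda>i. \<mu> (A i)) sums \<mu> (\<Union>i. A i))"

text \<open>The upper variation, i.e.\ the positive part in the Jordan decomposition
  (\<open>ennreal\<close> sends negative numbers to \<open>0\<close>); the negative part is the upper variation of \<open>-\<mu>\<close>.\<close>

definition upper_variation :: "'a measure \<Rightarrow> ('a set \<Rightarrow> real) \<Rightarrow> 'a measure" where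
  "upper_variation M \<mu> = measure_of (space M) (sets M)
     (\<lambda>A. SUP B\<in>{B \<in> sets M. B \<subseteq> A}. ennreal (\<mu> B))"

definition signed_integral :: "'a measure \<Rightarrow> ('a set \<Rightarrow> real) \<Rightarrow> ('a \<Rightarrow> real) \<Rightarrow> real" where
  "signed_integral M \<mu> g =
     (\<integral>x. g x \<partial>upper_variation M \<mu>) - (\<integral>x. g x \<partial>upper_variation M (\<lambda>A. - \<mu> A))"

text \<open>The supremum is taken in \<open>[0,\<infinity>]\<close>; it is nonnegative because \<open>g = 0\<close> is admissible. The value
  \<open>0\<close> that the Bochner integral gives to non-integrable functions is harmless: for nonnegative
  \<open>W\<close> not integrable with respect to the total variation, bounded truncations of
  \<open>W\<close> (with the sign of the Hahn decomposition) already make the supremum infinite.\<close>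

definition weighted_norm :: "'a measure \<Rightarrow> ('a \<Rightarrow> real) \<Rightarrow> ('a set \<Rightarrow> real) \<Rightarrow> ennreal" where
  "weighted_norm M W \<mu> =
     (SUP g\<in>{g \<in> borel_measurable M. \<forall>x\<in>space M. \<bar>g x\<bar> \<le> W x}. ennreal (signed_integral M \<mu> g))"

definition weighted_measures :: "'a measure \<Rightarrow> ('a \<Rightarrow> real) \<Rightarrow> ('a set \<Rightarrow> real) set" where
  "weighted_measures M W = {\<mu>. signed_measure M \<mu> \<and> weighted_norm M W \<mu> < \<infinity>}"

text \<open>\<open>k\<close>-times continuous differentiability on \<open>S\<close> of a map into the normed space
  \<^term>\<open>weighted_measures M W\<close>: \<open>D l\<close> is its \<open>l\<close>-th derivative, all limits being taken in the
  weighted norm.\<close>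

definition Ck_on_measures ::
  "nat \<Rightarrow> real set \<Rightarrow> 'a measure \<Rightarrow> ('a \<Rightarrow> real) \<Rightarrow> (real \<Rightarrow> 'a set \<Rightarrow> real) \<Rightarrow> bool" where
  "Ck_on_measures k S M W f \<longleftrightarrow>
     (\<exists>D :: nat \<Rightarrow> real \<Rightarrow> 'a set \<Rightarrow> real.
        (\<forall>u\<in>S. D 0 u = f u) \<and>
        (\<forall>l\<le>k. \<forall>u\<in>S. D l u \<in> weighted_measures M W) \<and>
        (\<forall>l<k. \<forall>u\<in>S.
           ((\<lambda>v. weighted_norm M W (\<lambda>A. (D l v A - D l u A) / (v - u) - D (Suc l) u A)) \<longlongrightarrow> 0)
             (at u within S)) \<and>
        (\<forall>u\<in>S. ((\<lambda>v. weighted_norm M W (\<lambda>A. D k v A - D k u A)) \<longlongrightarrow> 0) (at u within S)))"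


section \<open>The Markov kernels\<close>

text \<open>Vectors of \<open>\<real>\<^sup>p\<close> are functions on \<open>{1..p}\<close> (extensional outside), and elements of
  \<open>(\<real>\<^sup>p)\<^sup>j\<close> are functions on \<open>{1..j}\<close> with values in \<open>\<real>\<^sup>p\<close>.\<close>

abbreviation Rp :: "nat \<Rightarrow> (nat \<Rightarrow> real) measure" where
  "Rp p \<equiv> \<Pi>\<^sub>M i\<in>{1..p}. borel"

abbreviation Rpj :: "nat \<Rightarrow> nat \<Rightarrow> (nat \<Rightarrow> nat \<Rightarrow> real) measure" where
  "Rpj p j \<equiv> \<Pi>\<^sub>M i\<in>{1..j}. Rp p"

text \<open>The function \<open>m u\<close> takes the most recent value first, whereas a state
  \<open>(x\<^sub>1, \<dots>, x\<^sub>p)\<close> of the chain lists the values chronologically.\<close>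

definition rev_vec :: "nat \<Rightarrow> (nat \<Rightarrow> real) \<Rightarrow> nat \<Rightarrow> real" where
  "rev_vec p x = (\<lambda>i\<in>{1..p}. x (p + 1 - i))"

definition R_kernel ::
  "nat \<Rightarrow> (real \<Rightarrow> (nat \<Rightarrow> real) \<Rightarrow> real) \<Rightarrow> (real \<Rightarrow> real) \<Rightarrow> (real \<Rightarrow> real) \<Rightarrow>
   real \<Rightarrow> (nat \<Rightarrow> real) \<Rightarrow> real measure" where
  "R_kernel p m \<sigma> f u x =
     density lborel (\<lambda>y. ennreal (1 / \<sigma> u * f ((y - m u (rev_vec p x)) / \<sigma> u)))"

definition Q_kernel ::
  "nat \<Rightarrow> (real \<Rightarrow> (nat \<Rightarrow> real) \<Rightarrow> real) \<Rightarrow> (real \<Rightarrow> real) \<Rightarrow> (real \<Rightarrow> real) \<Rightarrow>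
   real \<Rightarrow> (nat \<Rightarrow> real) \<Rightarrow> (nat \<Rightarrow> real) measure" where
  "Q_kernel p m \<sigma> f u x =
     (\<Pi>\<^sub>M i\<in>{1..p}. if i = p then R_kernel p m \<sigma> f u x else return borel (x (i + 1)))"

definition invariant_prob ::
  "'a measure \<Rightarrow> ('a \<Rightarrow> 'a measure) \<Rightarrow> 'a measure \<Rightarrow> bool" where
  "invariant_prob S Q \<mu> \<longleftrightarrow> prob_space \<mu> \<and> sets \<mu> = sets S \<and> \<mu> \<bind> Q = \<mu>"

text \<open>Any fact about \<open>inv_law\<close> requires existence and uniqueness of the invariant probability
  measure, which are not assumed anywhere.\<close>

definition inv_law :: "'a measure \<Rightarrow> ('a \<Rightarrow> 'a measure) \<Rightarrow> 'a measure" where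
  "inv_law S Q = (THE \<mu>. invariant_prob S Q \<mu>)"

text \<open>The law \<open>\<mu>(dx\<^sub>1) Q(x\<^sub>1, dx\<^sub>2) \<cdots> Q(x\<^bsub>j-1\<^esub>, dx\<^sub>j)\<close> on \<open>S\<^sup>j\<close>, for \<open>j \<ge> 1\<close>.\<close>

primrec chain_law ::
  "'a measure \<Rightarrow> 'a measure \<Rightarrow> ('a \<Rightarrow> 'a measure) \<Rightarrow> nat \<Rightarrow> (nat \<Rightarrow> 'a) measure" where
  "chain_law S \<mu> Q 0 = return (\<Pi>\<^sub>M i\<in>{1..0}. S) (\<lambda>_. undefined)"
| "chain_law S \<mu> Q (Suc j) =
     chain_law S \<mu> Q j \<bind>
       (\<lambda>z. distr (if j = 0 then \<mu> else Q (z j)) (\<Pi>\<^sub>M i\<in>{1..Suc j}. S) (\<lambda>y. z(Suc j := y)))"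

definition stat_law ::
  "nat \<Rightarrow> (real \<Rightarrow> (nat \<Rightarrow> real) \<Rightarrow> real) \<Rightarrow> (real \<Rightarrow> real) \<Rightarrow> (real \<Rightarrow> real) \<Rightarrow>
   real \<Rightarrow> nat \<Rightarrow> (nat \<Rightarrow> nat \<Rightarrow> real) measure" where
  "stat_law p m \<sigma> f u j =
     chain_law (Rp p) (inv_law (Rp p) (Q_kernel p m \<sigma> f u)) (Q_kernel p m \<sigma> f u) j"


section \<open>Processes\<close>

definition state :: "nat \<Rightarrow> (int \<Rightarrow> 'w \<Rightarrow> real) \<Rightarrow> int \<Rightarrow> 'w \<Rightarrow> nat \<Rightarrow> real" where
  "state p Y t \<omega> = (\<lambda>i\<in>{1..p}. Y (t - int p + int i) \<omega>)"

definition past_path :: "(int \<Rightarrow> 'w \<Rightarrow> real) \<Rightarrow> int \<Rightarrow> 'w \<Rightarrow> int \<Rightarrow> real" where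
  "past_path Y t \<omega> = (\<lambda>s\<in>{..<t}. Y s \<omega>)"

definition past_algebra :: "'w measure \<Rightarrow> (int \<Rightarrow> 'w \<Rightarrow> real) \<Rightarrow> int \<Rightarrow> 'w measure" where
  "past_algebra M Y t = vimage_algebra (space M) (past_path Y t) (\<Pi>\<^sub>M s\<in>{..<t}. borel)"

definition stationary_upto_0 :: "'w measure \<Rightarrow> (int \<Rightarrow> 'w \<Rightarrow> real) \<Rightarrow> bool" where
  "stationary_upto_0 M Y \<longleftrightarrow>
     (\<forall>h\<ge>0. distr M (\<Pi>\<^sub>M s\<in>{..0}. borel) (\<lambda>\<omega>. \<lambda>s\<in>{..0}. Y (s - h) \<omega>) =
            distr M (\<Pi>\<^sub>M s\<in>{..0}. borel) (\<lambda>\<omega>. \<lambda>s\<in>{..0}. Y s \<omega>))"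

definition markov_upto_0 ::
  "'w measure \<Rightarrow> nat \<Rightarrow> ((nat \<Rightarrow> real) \<Rightarrow> real measure) \<Rightarrow> (int \<Rightarrow> 'w \<Rightarrow> real) \<Rightarrow> bool" where
  "markov_upto_0 M p R Y \<longleftrightarrow>
     (\<forall>t\<le>0. \<forall>A\<in>sets borel. AE \<omega> in M.
        real_cond_exp M (past_algebra M Y t) (indicator {\<omega>\<in>space M. Y t \<omega> \<in> A}) \<omega> =
        measure (R (state p Y (t - 1) \<omega>)) A)"

text \<open>The law of \<open>(X\<^sub>t, \<dots>, X\<^bsub>t+j-1\<^esub>)\<close>.\<close>

definition block_law ::
  "'w measure \<Rightarrow> 'a measure \<Rightarrow> (int \<Rightarrow> 'w \<Rightarrow> 'a) \<Rightarrow> int \<Rightarrow> nat \<Rightarrow> (nat \<Rightarrow> 'a) measure" where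
  "block_law M S X t j =
     distr M (\<Pi>\<^sub>M i\<in>{1..j}. S) (\<lambda>\<omega>. \<lambda>i\<in>{1..j}. X (t + int i - 1) \<omega>)"

definition sum_weight :: "('a \<Rightarrow> real) \<Rightarrow> nat \<Rightarrow> (nat \<Rightarrow> 'a) \<Rightarrow> real" where
  "sum_weight V j z = (\<Sum>i=1..j. V (z i))"

definition locally_stationary ::
  "'w measure \<Rightarrow> 'a measure \<Rightarrow> ('a \<Rightarrow> real) \<Rightarrow> (nat \<Rightarrow> int \<Rightarrow> 'w \<Rightarrow> 'a) \<Rightarrow>
   (real \<Rightarrow> nat \<Rightarrow> (nat \<Rightarrow> 'a) measure) \<Rightarrow> bool" where
  "locally_stationary M S V X \<pi> \<longleftrightarrow>
     (\<forall>j\<ge>1. \<exists>C>0. \<forall>u\<in>{0..1}. \<forall>n\<ge>1. \<forall>t\<in>{1..int n - int j + 1}.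
        weighted_norm (\<Pi>\<^sub>M i\<in>{1..j}. S) (sum_weight V j)
          (\<lambda>A. measure (block_law M S (X n) t j) A - measure (\<pi> u j) A)
        \<le> ennreal (C * (\<bar>u - real_of_int t / real n\<bar> + 1 / real n)))"

end

theory Submission
  imports Defs
begin

text \<open>The laws are studied through the functionals they induce on the functions bounded by a weight, for the
  decreasing scale of weights \<open>N\<^bsup>d0 - q' l\<^esup>\<close>, \<open>l \<le> k\<close>, with \<open>N\<close> the size of the state. The \<open>i\<close>-th
  derivative with respect to \<open>u\<close> of the transition density takes test functions of weight \<open>l + i\<close> to functions of
  weight \<open>l\<close>: every derivative costs one step in the scale.

  In each weight a drift condition, together with a minorization after \<open>p\<close> steps, makes every product
  \<open>P\<^bsub>u\<^sub>1\<^esub> \<cdots> P\<^bsub>u\<^sub>n\<^esub>\<close> contract geometrically. Differentiating \<open>\<pi>\<^sub>u P\<^sub>u = \<pi>\<^sub>u\<close> gives for the \<open>l\<close>-th derivative of \<open>\<pi>\<^sub>u\<close> an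
  equation that involves only lower derivatives of \<open>\<pi>\<^sub>u\<close> and the Poisson solution \<open>\<Sum>\<^sub>n (P\<^sub>u\<^sup>n g - \<pi>\<^sub>u g)\<close>; this
  defines the derivatives by recursion, and the laws of blocks follow by composing with further kernels.

  The law of the chain at time \<open>t\<close> is \<open>\<pi>\<^sub>0 P\<^bsub>1/n\<^esub> \<cdots> P\<^bsub>t/n\<^esub>\<close>. Replacing \<open>\<pi>\<^bsub>(s-1)/n\<^esub>\<close> by \<open>\<pi>\<^bsub>s/n\<^esub>\<close> one step at a time costs
  \<open>O(1/n)\<close> by the Lipschitz continuity of \<open>u \<mapsto> \<pi>\<^sub>u\<close>, and the later kernels damp these errors geometrically.\<close>

section \<open>Functionals on weighted spaces of functions\<close>

text \<open>A derivative in \<open>u\<close> of the density at a state of size \<open>N\<close>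
  costs a factor of order \<open>N\<close> to the power \<open>q'\<close>, through the growth of the
  derivatives of \<open>m\<close>; lowering the exponent of the weight by \<open>q'\<close> at each
  order pays for it exactly. Functionals replace signed measures because compositions with kernels
  and limits are immediate for them; what is linear and continuous under dominated pointwise
  convergence is turned into a signed measure only at the end. Two obstacles shape the analysis.
  First, no single integrable function is at hand that dominates the densities for all nearby
  \<open>u\<close>: a supremum over shifts of the derivatives of \<open>f\<close> need not be
  integrable. The dominating functions therefore vary with \<open>u\<close> but share one integral,
  and dominated convergence is used with varying bounds. Second, for \<open>p > 1\<close> a
  transition moves all coordinates but one deterministically, so a single step cannot be minorized.
  Since the array changes its parameter at every step, contraction is needed for products with
  arbitrary parameters and not merely for powers of one kernel.\<close>

definition wball :: "'a measure \<Rightarrow> ('a \<Rightarrow> real) \<Rightarrow> real \<Rightarrow> ('a \<Rightarrow> real) set" where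
  "wball M w c = {g \<in> borel_measurable M. \<forall>x\<in>space M. \<bar>g x\<bar> \<le> c * w x}"

text \<open>Continuity under dominated pointwise convergence encodes countable additivity and
  finiteness of the weighted norm in one clause; boundedness is derived from it in
  \<open>wfunctional_bounded\<close>.\<close>

definition wfunctional :: "'a measure \<Rightarrow> ('a \<Rightarrow> real) \<Rightarrow> (('a \<Rightarrow> real) \<Rightarrow> real) \<Rightarrow> bool" where
  "wfunctional M w L \<longleftrightarrow>
     (\<forall>g h a b c d. g \<in> wball M w c \<longrightarrow> h \<in> wball M w d \<longrightarrow>
        L (\<lambda>x. a * g x + b * h x) = a * L g + b * L h) \<and>
     (\<forall>G c. (\<forall>n::nat. G n \<in> wball M w c) \<longrightarrow> (\<forall>x\<in>space M. (\<lambda>n. G n x) \<longlonglongrightarrow> 0) \<longrightarrow>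
        (\<lambda>n. L (G n)) \<longlonglongrightarrow> 0)"

lemma wballD: "g \<in> wball M w c \<Longrightarrow> g \<in> borel_measurable M"
  "g \<in> wball M w c \<Longrightarrow> x \<in> space M \<Longrightarrow> \<bar>g x\<bar> \<le> c * w x"
  by (auto simp: wball_def)

lemma wballI: "g \<in> borel_measurable M \<Longrightarrow> (\<And>x. x \<in> space M \<Longrightarrow> \<bar>g x\<bar> \<le> c * w x) \<Longrightarrow> g \<in> wball M w c"
  by (auto simp: wball_def)

lemma wball_lincomb:
  assumes "g \<in> wball M w c" "h \<in> wball M w d"
  shows "(\<lambda>x. a * g x + b * h x) \<in> wball M w (\<bar>a\<bar> * c + \<bar>b\<bar> * d)"
proof (rule wballI)
  show "(\<lambda>x. a * g x + b * h x) \<in> borel_measurable M"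
    using assms[THEN wballD(1)] by measurable
  fix x assume "x \<in> space M"
  then have "\<bar>a\<bar> * \<bar>g x\<bar> \<le> \<bar>a\<bar> * (c * w x)" "\<bar>b\<bar> * \<bar>h x\<bar> \<le> \<bar>b\<bar> * (d * w x)"
    using assms[THEN wballD(2)] by (auto intro: mult_left_mono)
  then show "\<bar>a * g x + b * h x\<bar> \<le> (\<bar>a\<bar> * c + \<bar>b\<bar> * d) * w x"
    using abs_triangle_ineq[of "a * g x" "b * h x"] by (simp add: abs_mult algebra_simps)
qed

lemma wball_scale: "g \<in> wball M w c \<Longrightarrow> (\<lambda>x. a * g x) \<in> wball M w (\<bar>a\<bar> * c)"
  using wball_lincomb[of g M w c g c a 0] by simp

lemma wball_diff:
  "g \<in> wball M w c \<Longrightarrow> h \<in> wball M w d \<Longrightarrow> (\<lambda>x. g x - h x) \<in> wball M w (c + d)"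
  using wball_lincomb[of g M w c h d 1 "-1"] by simp

lemma wball_add:
  "g \<in> wball M w c \<Longrightarrow> h \<in> wball M w d \<Longrightarrow> (\<lambda>x. g x + h x) \<in> wball M w (c + d)"
  using wball_lincomb[of g M w c h d 1 1] by simp

lemma wball_mono:
  assumes "g \<in> wball M w c" "\<And>x. x \<in> space M \<Longrightarrow> c * w x \<le> d * v x"
  shows "g \<in> wball M v d"
  using assms by (force simp: wball_def)

lemma wball_const:
  "(\<And>x. x \<in> space M \<Longrightarrow> 1 \<le> w x) \<Longrightarrow> (\<lambda>_. a) \<in> wball M w \<bar>a\<bar>"
  by (rule wballI) (auto simp: mult_le_cancel_left1)

lemma wfunctional_lincomb:
  "wfunctional M w L \<Longrightarrow> g \<in> wball M w c \<Longrightarrow> h \<in> wball M w d \<Longrightarrow>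
     L (\<lambda>x. a * g x + b * h x) = a * L g + b * L h"
  by (simp only: wfunctional_def)

lemma wfunctional_diff:
  "wfunctional M w L \<Longrightarrow> g \<in> wball M w c \<Longrightarrow> h \<in> wball M w d \<Longrightarrow>
     L (\<lambda>x. g x - h x) = L g - L h"
  using wfunctional_lincomb[of M w L g c h d 1 "-1"] by simp

lemma wfunctional_add:
  "wfunctional M w L \<Longrightarrow> g \<in> wball M w c \<Longrightarrow> h \<in> wball M w d \<Longrightarrow>
     L (\<lambda>x. g x + h x) = L g + L h"
  using wfunctional_lincomb[of M w L g c h d 1 1] by simp

lemma wfunctional_scale:
  "wfunctional M w L \<Longrightarrow> g \<in> wball M w c \<Longrightarrow> L (\<lambda>x. a * g x) = a * L g"
  using wfunctional_lincomb[of M w L g c g c a 0] by simp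

lemma wfunctional_tendsto:
  "wfunctional M w L \<Longrightarrow> (\<And>n. G n \<in> wball M w c) \<Longrightarrow>
     (\<And>x. x \<in> space M \<Longrightarrow> (\<lambda>n. G n x) \<longlonglongrightarrow> 0) \<Longrightarrow> (\<lambda>n. L (G n)) \<longlonglongrightarrow> 0"
  by (simp only: wfunctional_def) blast

lemma wfunctional_tendsto_diff:
  assumes L: "wfunctional M w L" and G: "\<And>n. G n \<in> wball M w c" and H: "\<And>n. H n \<in> wball M w d"
    and lim: "\<And>x. x \<in> space M \<Longrightarrow> (\<lambda>n. G n x - H n x) \<longlonglongrightarrow> 0"
  shows "(\<lambda>n. L (G n) - L (H n)) \<longlonglongrightarrow> 0"
  using wfunctional_tendsto[OF L wball_diff[OF G H] lim] wfunctional_diff[OF L G H] by simp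

text \<open>Functionals receive functions on the whole type, so values off \<open>space M\<close>
  have to be seen to be irrelevant. The continuity clause for the constant sequence
  \<open>g - h\<close> gives it.\<close>

lemma wfunctional_cong:
  assumes L: "wfunctional M w L" and g: "g \<in> wball M w c" and h: "h \<in> wball M w d"
    and eq: "\<And>x. x \<in> space M \<Longrightarrow> g x = h x"
  shows "L g = L h"
proof -
  have "(\<lambda>n::nat. L g - L h) \<longlonglongrightarrow> 0"
    by (rule wfunctional_tendsto_diff[OF L g h]) (simp add: eq)
  then show ?thesis by (simp add: LIMSEQ_const_iff)
qed

text \<open>If \<open>L\<close> were unbounded on the unit ball, functions \<open>G n\<close> with
  \<open>|L (G n)| > n + 1\<close>, divided by \<open>n + 1\<close>, would stay in the ball and tend
  to 0 pointwise, while their images stay at least 1 in absolute value.\<close>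

lemma wfunctional_bounded:
  assumes L: "wfunctional M w L" and w: "\<And>x. x \<in> space M \<Longrightarrow> 0 \<le> w x"
  obtains B where "B > 0" "\<And>g c. 0 \<le> c \<Longrightarrow> g \<in> wball M w c \<Longrightarrow> \<bar>L g\<bar> \<le> B * c"
proof -
  have "\<exists>B>0. \<forall>g\<in>wball M w 1. \<bar>L g\<bar> \<le> B"
  proof (rule ccontr)
    assume "\<not> ?thesis"
    then have "\<forall>n::nat. \<exists>g\<in>wball M w 1. real (Suc n) < \<bar>L g\<bar>"
      by (metis not_le of_nat_0_less_iff zero_less_Suc)
    then obtain G where G: "\<And>n. G n \<in> wball M w 1" "\<And>n. real (Suc n) < \<bar>L (G n)\<bar>" by metis
    let ?H = "\<lambda>n x. (1 / real (Suc n)) * G n x"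
    have H: "?H n \<in> wball M w 1" for n
    proof (rule wball_mono[OF wball_scale[OF G(1)]])
      fix x assume "x \<in> space M"
      then show "\<bar>1 / real (Suc n)\<bar> * 1 * w x \<le> 1 * w x"
        using w[of x] by (intro mult_right_mono) auto
    qed
    have lim: "(\<lambda>n. L (?H n)) \<longlonglongrightarrow> 0"
    proof (rule wfunctional_tendsto[OF L H])
      fix x assume x: "x \<in> space M"
      show "(\<lambda>n. ?H n x) \<longlonglongrightarrow> 0"
      proof (rule tendsto_rabs_zero_cancel, rule tendsto_sandwich[where f = "\<lambda>_. 0" and h = "\<lambda>n. w x * (1 / real (Suc n))"])
        show "(\<lambda>n. w x * (1 / real (Suc n))) \<longlonglongrightarrow> 0"
          using tendsto_mult[OF tendsto_const[of "w x"] LIMSEQ_inverse_real_of_nat]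
          by (simp add: inverse_eq_divide)
        show "\<forall>\<^sub>F n in sequentially. \<bar>?H n x\<bar> \<le> w x * (1 / real (Suc n))"
          using wballD(2)[OF G(1) x] by (auto simp: abs_mult divide_simps)
      qed auto
    qed
    have ge: "1 \<le> \<bar>L (?H n)\<bar>" for n
    proof -
      have "L (?H n) = 1 / real (Suc n) * L (G n)" by (rule wfunctional_scale[OF L G(1)])
      moreover have "1 \<le> \<bar>1 / real (Suc n)\<bar> * \<bar>L (G n)\<bar>"
        using G(2)[of n] by (simp add: divide_simps del: of_nat_Suc)
      ultimately show ?thesis by (simp only: abs_mult)
    qed
    obtain N where "norm (L (?H N) - 0) < 1" using LIMSEQ_D[OF lim zero_less_one] by blast
    with ge[of N] show False by simp
  qed
  then obtain B where B: "B > 0" "\<And>g. g \<in> wball M w 1 \<Longrightarrow> \<bar>L g\<bar> \<le> B" by blast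
  have "\<bar>L g\<bar> \<le> B * c" if c: "0 \<le> c" and g: "g \<in> wball M w c" for g c
  proof (cases "c = 0")
    case True
    have "g \<in> wball M w 1" by (rule wball_mono[OF g]) (auto simp: True w)
    moreover have "L g = L (\<lambda>x. 0 * g x)"
      by (rule wfunctional_cong[OF L g wball_scale[OF g]]) (use wballD(2)[OF g] True in auto)
    ultimately show ?thesis using wfunctional_scale[OF L g, of 0] True by simp
  next
    case False
    then have "c > 0" using c by simp
    have "(\<lambda>x. (1/c) * g x) \<in> wball M w 1"
      by (rule wball_mono[OF wball_scale[OF g]]) (use \<open>c > 0\<close> in auto)
    from B(2)[OF this] show ?thesis
      using \<open>c > 0\<close> by (simp add: wfunctional_scale[OF L g, of "1/c", simplified] abs_mult divide_simps)
  qed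
  then show ?thesis using that B(1) by blast
qed

lemma wfunctional_mono:
  assumes L: "wfunctional M w L" and "\<And>x. x \<in> space M \<Longrightarrow> 0 \<le> v x" "\<And>x. x \<in> space M \<Longrightarrow> v x \<le> K * w x"
  shows "wfunctional M v L"
proof -
  have sub: "g \<in> wball M w (\<bar>c\<bar> * K)" if "g \<in> wball M v c" for g c
  proof (rule wball_mono[OF that])
    fix x assume "x \<in> space M"
    then have "c * v x \<le> \<bar>c\<bar> * v x" "\<bar>c\<bar> * v x \<le> \<bar>c\<bar> * (K * w x)"
      using assms(2,3) by (auto intro: mult_right_mono mult_left_mono)
    then show "c * v x \<le> \<bar>c\<bar> * K * w x" by simp
  qed
  show ?thesis
    unfolding wfunctional_def
  proof safe
    show "L (\<lambda>x. a * g x + b * h x) = a * L g + b * L h"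
      if "g \<in> wball M v c" "h \<in> wball M v d" for g h a b c d
      by (rule wfunctional_lincomb[OF L sub sub]) (use that in auto)
    show "(\<lambda>n. L (G n)) \<longlonglongrightarrow> 0" if "\<forall>n::nat. G n \<in> wball M v c" "\<forall>x\<in>space M. (\<lambda>n. G n x) \<longlonglongrightarrow> 0" for G c
      by (rule wfunctional_tendsto[OF L sub]) (use that in auto)
  qed
qed

lemma wfunctional_zero: "wfunctional M w (\<lambda>_. 0)"
  by (simp add: wfunctional_def)

lemma wfunctional_lincomb_functional:
  assumes "wfunctional M w L" "wfunctional M w K"
  shows "wfunctional M w (\<lambda>g. a * L g + b * K g)"
  unfolding wfunctional_def
proof safe
  show "a * L (\<lambda>x. a' * g x + b' * h x) + b * K (\<lambda>x. a' * g x + b' * h x) =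
     a' * (a * L g + b * K g) + b' * (a * L h + b * K h)"
    if "g \<in> wball M w c" "h \<in> wball M w d" for g h a' b' c d
    using that by (simp add: assms[THEN wfunctional_lincomb] algebra_simps)
  show "(\<lambda>n. a * L (G n) + b * K (G n)) \<longlonglongrightarrow> 0"
    if "\<forall>n::nat. G n \<in> wball M w c" "\<forall>x\<in>space M. (\<lambda>n. G n x) \<longlonglongrightarrow> 0" for G c
  proof -
    have "(\<lambda>n. L (G n)) \<longlonglongrightarrow> 0" "(\<lambda>n. K (G n)) \<longlonglongrightarrow> 0"
      using that assms by (blast intro: wfunctional_tendsto)+
    from tendsto_add[OF tendsto_mult_left[OF this(1)] tendsto_mult_left[OF this(2)]]
    show ?thesis by simp
  qed
qed

text \<open>Norm convergence of functionals is expressed by sequences: convergence uniform over the unit ball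
  of the weighted functions amounts to convergence along every sequence of test functions.\<close>

definition fcont :: "'a measure \<Rightarrow> ('a \<Rightarrow> real) \<Rightarrow> (real \<Rightarrow> ('a \<Rightarrow> real) \<Rightarrow> real) \<Rightarrow> bool" where
  "fcont M w L \<longleftrightarrow> (\<forall>u\<in>{0..1}. wfunctional M w (L u)) \<and>
     (\<forall>u\<in>{0..1}. \<forall>U G c. (\<forall>n::nat. U n \<in> {0..1}) \<longrightarrow> U \<longlonglongrightarrow> u \<longrightarrow> (\<forall>n. G n \<in> wball M w c) \<longrightarrow>
        (\<lambda>n. L (U n) (G n) - L u (G n)) \<longlonglongrightarrow> 0)"

definition fderiv :: "'a measure \<Rightarrow> ('a \<Rightarrow> real) \<Rightarrow> (real \<Rightarrow> ('a \<Rightarrow> real) \<Rightarrow> real) \<Rightarrow>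
    (real \<Rightarrow> ('a \<Rightarrow> real) \<Rightarrow> real) \<Rightarrow> bool" where
  "fderiv M w L L' \<longleftrightarrow>
     (\<forall>u\<in>{0..1}. \<forall>U G c. (\<forall>n::nat. U n \<in> {0..1} - {u}) \<longrightarrow> U \<longlonglongrightarrow> u \<longrightarrow> (\<forall>n. G n \<in> wball M w c) \<longrightarrow>
        (\<lambda>n. (L (U n) (G n) - L u (G n)) / (U n - u) - L' u (G n)) \<longlonglongrightarrow> 0)"

lemma fcontD:
  "fcont M w L \<Longrightarrow> u \<in> {0..1} \<Longrightarrow> wfunctional M w (L u)"
  "fcont M w L \<Longrightarrow> u \<in> {0..1} \<Longrightarrow> (\<And>n. U n \<in> {0..1}) \<Longrightarrow> U \<longlonglongrightarrow> u \<Longrightarrow> (\<And>n. G n \<in> wball M w c) \<Longrightarrow>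
        (\<lambda>n. L (U n) (G n) - L u (G n)) \<longlonglongrightarrow> 0"
  unfolding fcont_def by blast+

lemma fderivD:
  "fderiv M w L L' \<Longrightarrow> u \<in> {0..1} \<Longrightarrow> (\<And>n. U n \<in> {0..1} - {u}) \<Longrightarrow> U \<longlonglongrightarrow> u \<Longrightarrow> (\<And>n. G n \<in> wball M w c) \<Longrightarrow>
        (\<lambda>n. (L (U n) (G n) - L u (G n)) / (U n - u) - L' u (G n)) \<longlonglongrightarrow> 0"
  unfolding fderiv_def by blast

lemma fcont_lincomb:
  assumes "fcont M w L" "fcont M w K"
  shows "fcont M w (\<lambda>u g. a * L u g + b * K u g)"
  unfolding fcont_def
proof (intro conjI ballI allI impI)
  show "wfunctional M w (\<lambda>g. a * L u g + b * K u g)" if "u \<in> {0..1}" for u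
    using that assms by (intro wfunctional_lincomb_functional fcontD(1))
  fix u :: real and U :: "nat \<Rightarrow> real" and G :: "nat \<Rightarrow> 'a \<Rightarrow> real" and c assume "u \<in> {0..1::real}" "\<forall>n::nat. U n \<in> {0..1}" "U \<longlonglongrightarrow> u" "\<forall>n. G n \<in> wball M w c"
  then have "(\<lambda>n. L (U n) (G n) - L u (G n)) \<longlonglongrightarrow> 0" "(\<lambda>n. K (U n) (G n) - K u (G n)) \<longlonglongrightarrow> 0"
    using assms by (blast intro: fcontD(2))+
  from tendsto_add[OF tendsto_mult_left[OF this(1), of a] tendsto_mult_left[OF this(2), of b]]
  show "(\<lambda>n. (a * L (U n) (G n) + b * K (U n) (G n)) - (a * L u (G n) + b * K u (G n))) \<longlonglongrightarrow> 0"
    by (simp add: algebra_simps)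
qed

lemma fderiv_lincomb:
  assumes "fderiv M w L L'" "fderiv M w K K'"
  shows "fderiv M w (\<lambda>u g. a * L u g + b * K u g) (\<lambda>u g. a * L' u g + b * K' u g)"
  unfolding fderiv_def
proof (intro ballI allI impI)
  fix u :: real and U :: "nat \<Rightarrow> real" and G :: "nat \<Rightarrow> 'a \<Rightarrow> real" and c assume *: "u \<in> {0..1::real}" "\<forall>n::nat. U n \<in> {0..1} - {u}" "U \<longlonglongrightarrow> u" "\<forall>n. G n \<in> wball M w c"
  then have "(\<lambda>n. (L (U n) (G n) - L u (G n)) / (U n - u) - L' u (G n)) \<longlonglongrightarrow> 0"
     "(\<lambda>n. (K (U n) (G n) - K u (G n)) / (U n - u) - K' u (G n)) \<longlonglongrightarrow> 0"
    using assms by (blast intro: fderivD)+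
  from tendsto_add[OF tendsto_mult_left[OF this(1), of a] tendsto_mult_left[OF this(2), of b]]
  show "(\<lambda>n. (a * L (U n) (G n) + b * K (U n) (G n) - (a * L u (G n) + b * K u (G n))) / (U n - u) -
      (a * L' u (G n) + b * K' u (G n))) \<longlonglongrightarrow> 0"
    by (simp add: algebra_simps add_divide_distrib diff_divide_distrib)
qed

lemma fcont_sum:
  assumes "\<And>i. i \<in> I \<Longrightarrow> fcont M w (L i)"
  shows "fcont M w (\<lambda>u g. \<Sum>i\<in>I. a i * L i u g)"
  using assms
proof (induction I rule: infinite_finite_induct)
  case (insert i I)
  then show ?case
    using fcont_lincomb[of M w "L i" "\<lambda>u g. \<Sum>i\<in>I. a i * L i u g" "a i" 1] by simp
qed (simp_all add: fcont_def wfunctional_zero)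

lemma fderiv_sum:
  assumes "\<And>i. i \<in> I \<Longrightarrow> fderiv M w (L i) (L' i)"
  shows "fderiv M w (\<lambda>u g. \<Sum>i\<in>I. a i * L i u g) (\<lambda>u g. \<Sum>i\<in>I. a i * L' i u g)"
  using assms
proof (induction I rule: infinite_finite_induct)
  case (insert i I)
  then show ?case
    using fderiv_lincomb[of M w "L i" "L' i" "\<lambda>u g. \<Sum>i\<in>I. a i * L i u g" "\<lambda>u g. \<Sum>i\<in>I. a i * L' i u g" "a i" 1]
    by simp
qed (simp_all add: fderiv_def)

text \<open>Order \<open>l\<close> acts on functions of weight \<open>w l\<close>, but its
  difference quotients are tested only on the smaller class of weight \<open>w (Suc l)\<close>, on
  which the next derivative is defined.\<close>

definition smooth_family :: "nat \<Rightarrow> 'a measure \<Rightarrow> (nat \<Rightarrow> 'a \<Rightarrow> real) \<Rightarrow>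
    (nat \<Rightarrow> real \<Rightarrow> ('a \<Rightarrow> real) \<Rightarrow> real) \<Rightarrow> bool" where
  "smooth_family k M w D \<longleftrightarrow> (\<forall>l\<le>k. fcont M (w l) (D l)) \<and>
     (\<forall>l<k. fderiv M (w (Suc l)) (D l) (D (Suc l)))"

definition weight_scale :: "nat \<Rightarrow> 'a measure \<Rightarrow> (nat \<Rightarrow> 'a \<Rightarrow> real) \<Rightarrow> bool" where
  "weight_scale k M w \<longleftrightarrow> (\<forall>l\<le>k. w l \<in> borel_measurable M) \<and> (\<forall>l\<le>k. \<forall>x\<in>space M. 1 \<le> w l x) \<and>
     (\<forall>l m. l \<le> m \<longrightarrow> m \<le> k \<longrightarrow> (\<forall>x\<in>space M. w m x \<le> w l x))"

lemma weight_scale_ge1: "weight_scale k M w \<Longrightarrow> l \<le> k \<Longrightarrow> x \<in> space M \<Longrightarrow> 1 \<le> w l x"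
  by (auto simp: weight_scale_def)

lemma weight_scale_wball:
  assumes "weight_scale k M w" "l \<le> m" "m \<le> k" "0 \<le> c" "g \<in> wball M (w m) c"
  shows "g \<in> wball M (w l) c"
  using assms by (intro wball_mono[of g M "w m" c c "w l"]) (auto simp: weight_scale_def intro!: mult_left_mono)

text \<open>The radii in \<open>wfunctional\<close>, \<open>fcont\<close> and \<open>fderiv\<close>
  are arbitrary reals; this reduces to nonnegative ones, for which inclusions of balls can be
  scaled.\<close>

lemma wball_nonneg_radius:
  assumes "\<And>x. x \<in> space M \<Longrightarrow> 0 \<le> w x" "g \<in> wball M w c"
  shows "g \<in> wball M w \<bar>c\<bar>"
  using assms(2) by (rule wball_mono) (simp add: assms(1) mult_right_mono)

lemma weight_scale_wball_nn:
  assumes "weight_scale k M w" "l \<le> k" "g \<in> wball M (w l) c"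
  shows "g \<in> wball M (w l) \<bar>c\<bar>"
proof -
  have "0 \<le> w l x" if "x \<in> space M" for x
    using weight_scale_ge1[OF assms(1,2) that] by simp
  then show ?thesis using assms(3) by (rule wball_nonneg_radius)
qed

text \<open>\<open>T i u\<close> plays the role of the \<open>i\<close>-th derivative with respect to \<open>u\<close> of a family of kernels acting on
  functions; each derivative costs one step in the scale of weights.\<close>

definition kernel_op :: "nat \<Rightarrow> 'a measure \<Rightarrow> (nat \<Rightarrow> 'a \<Rightarrow> real) \<Rightarrow> 'b measure \<Rightarrow> (nat \<Rightarrow> 'b \<Rightarrow> real) \<Rightarrow>
    (nat \<Rightarrow> real \<Rightarrow> ('b \<Rightarrow> real) \<Rightarrow> 'a \<Rightarrow> real) \<Rightarrow> bool" where
  "kernel_op k MA wA MB wB T \<longleftrightarrow>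
    (\<forall>l i. l + i \<le> k \<longrightarrow> (\<exists>C>0. \<forall>u\<in>{0..1}. \<forall>c\<ge>0. \<forall>g\<in>wball MB (wB (l + i)) c.
        T i u g \<in> wball MA (wA l) (C * c))) \<and>
    (\<forall>i\<le>k. \<forall>x\<in>space MA. fcont MB (wB i) (\<lambda>u g. T i u g x)) \<and>
    (\<forall>i<k. \<forall>x\<in>space MA. fderiv MB (wB (Suc i)) (\<lambda>u g. T i u g x) (\<lambda>u g. T (Suc i) u g x)) \<and>
    (\<forall>l i. l + i < k \<longrightarrow> (\<exists>C>0. \<forall>u\<in>{0..1}. \<forall>v\<in>{0..1}. \<forall>c\<ge>0. \<forall>g\<in>wball MB (wB (Suc (l + i))) c.
        (\<lambda>x. T i v g x - T i u g x) \<in> wball MA (wA l) (C * c * \<bar>v - u\<bar>)))"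

lemma kernel_opD:
  assumes "kernel_op k MA wA MB wB T"
  shows kernel_op_bound: "l + i \<le> k \<Longrightarrow> \<exists>C>0. \<forall>u\<in>{0..1}. \<forall>c\<ge>0. \<forall>g\<in>wball MB (wB (l + i)) c.
        T i u g \<in> wball MA (wA l) (C * c)"
    and kernel_op_fcont: "i \<le> k \<Longrightarrow> x \<in> space MA \<Longrightarrow> fcont MB (wB i) (\<lambda>u g. T i u g x)"
    and kernel_op_fderiv: "i < k \<Longrightarrow> x \<in> space MA \<Longrightarrow> fderiv MB (wB (Suc i)) (\<lambda>u g. T i u g x) (\<lambda>u g. T (Suc i) u g x)"
    and kernel_op_lipschitz: "l + i < k \<Longrightarrow> \<exists>C>0. \<forall>u\<in>{0..1}. \<forall>v\<in>{0..1}. \<forall>c\<ge>0. \<forall>g\<in>wball MB (wB (Suc (l + i))) c.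
        (\<lambda>x. T i v g x - T i u g x) \<in> wball MA (wA l) (C * c * \<bar>v - u\<bar>)"
  using assms unfolding kernel_op_def by blast+

lemma kernel_op_functional:
  "kernel_op k MA wA MB wB T \<Longrightarrow> i \<le> k \<Longrightarrow> u \<in> {0..1} \<Longrightarrow> x \<in> space MA \<Longrightarrow> wfunctional MB (wB i) (\<lambda>g. T i u g x)"
  by (rule fcontD(1)[OF kernel_op_fcont])

section \<open>Smooth families of kernels and functionals\<close>

text \<open>Two replacements: \<open>D (U n)\<close> by \<open>D u\<close> along the moving
  functions \<open>T (U n) (G n)\<close>, which \<open>fcont\<close> allows, and then these
  functions by \<open>T u (G n)\<close> under the fixed functional \<open>D u\<close>. For the
  second one, convergence at each point \<open>x\<close> inside one ball suffices, so the continuity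
  of \<open>T\<close> is only asked pointwise in \<open>x\<close>.\<close>

lemma fcont_comp:
  assumes D: "fcont MA wA D"
    and bound: "\<And>c. \<exists>C. \<forall>u\<in>{0..1}. \<forall>g\<in>wball MB wB c. T u g \<in> wball MA wA C"
    and cont: "\<And>x. x \<in> space MA \<Longrightarrow> fcont MB wB (\<lambda>u g. T u g x)"
  shows "fcont MB wB (\<lambda>u g. D u (T u g))"
proof -
  from bound obtain C where C: "\<And>u c g. u \<in> {0..1} \<Longrightarrow> g \<in> wball MB wB c \<Longrightarrow> T u g \<in> wball MA wA (C c)"
    by metis
  show ?thesis
    unfolding fcont_def
  proof (intro conjI ballI allI impI)
    fix u :: real assume u: "u \<in> {0..1}"
    note Du = fcontD(1)[OF D u] and Tu = fcontD(1)[OF cont u]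
    show "wfunctional MB wB (\<lambda>g. D u (T u g))"
      unfolding wfunctional_def
    proof (intro conjI allI impI)
      fix g h a b c d assume gh: "g \<in> wball MB wB c" "h \<in> wball MB wB d"
      have "D u (T u (\<lambda>x. a * g x + b * h x)) = D u (\<lambda>x. a * T u g x + b * T u h x)"
        by (rule wfunctional_cong[OF Du C[OF u wball_lincomb[OF gh]] wball_lincomb[OF C[OF u gh(1)] C[OF u gh(2)]]])
           (rule wfunctional_lincomb[OF Tu gh])
      also have "\<dots> = a * D u (T u g) + b * D u (T u h)"
        by (rule wfunctional_lincomb[OF Du C[OF u gh(1)] C[OF u gh(2)]])
      finally show "D u (T u (\<lambda>x. a * g x + b * h x)) = a * D u (T u g) + b * D u (T u h)" .
    next
      fix G :: "nat \<Rightarrow> 'b \<Rightarrow> real" and c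
      assume G: "\<forall>n. G n \<in> wball MB wB c" "\<forall>x\<in>space MB. (\<lambda>n. G n x) \<longlonglongrightarrow> 0"
      show "(\<lambda>n. D u (T u (G n))) \<longlonglongrightarrow> 0"
        by (rule wfunctional_tendsto[OF Du C[OF u]], use G in blast, rule wfunctional_tendsto[OF Tu])
           (use G in auto)
    qed
  next
    fix u :: real and U :: "nat \<Rightarrow> real" and G :: "nat \<Rightarrow> 'b \<Rightarrow> real" and c
    assume *: "u \<in> {0..1}" "\<forall>n. U n \<in> {0..1}" "U \<longlonglongrightarrow> u" "\<forall>n. G n \<in> wball MB wB c"
    then have U: "U n \<in> {0..1}" and G: "G n \<in> wball MB wB c" for n by auto
    have "(\<lambda>n. D (U n) (T (U n) (G n)) - D u (T (U n) (G n))) \<longlonglongrightarrow> 0"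
      by (rule fcontD(2)[OF D *(1) U *(3) C[OF U G]])
    moreover have "(\<lambda>n. D u (T (U n) (G n)) - D u (T u (G n))) \<longlonglongrightarrow> 0"
      by (rule wfunctional_tendsto_diff[OF fcontD(1)[OF D *(1)] C[OF U G] C[OF *(1) G]])
         (rule fcontD(2)[OF cont *(1) U *(3) G])
    ultimately show "(\<lambda>n. D (U n) (T (U n) (G n)) - D u (T u (G n))) \<longlonglongrightarrow> 0"
      using tendsto_add by fastforce
  qed
qed

lemma kernel_op_bound':
  assumes "kernel_op k MA wA MB wB T" "weight_scale k MB wB" "l + i \<le> k"
  shows "\<exists>C. \<forall>u\<in>{0..1}. \<forall>g\<in>wball MB (wB (l + i)) c. T i u g \<in> wball MA (wA l) C"
  using kernel_op_bound[OF assms(1,3)] weight_scale_wball_nn[OF assms(2,3)] by (meson abs_ge_zero)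

lemma fcont_mono:
  assumes "fcont M w L" "weight_scale k M v" "w = v l" "l \<le> m" "m \<le> k"
  shows "fcont M (v m) L"
proof -
  have sub: "g \<in> wball M w \<bar>c\<bar>" if "g \<in> wball M (v m) c" for g c
    using weight_scale_wball[OF assms(2,4,5) _ weight_scale_wball_nn[OF assms(2,5) that]] assms(3) by simp
  show ?thesis
    unfolding fcont_def
  proof (intro conjI ballI allI impI)
    show "wfunctional M (v m) (L u)" if "u \<in> {0..1}" for u
      by (rule wfunctional_mono[OF fcontD(1)[OF assms(1) that], of _ 1])
         (use assms(2-5) weight_scale_ge1[OF assms(2), of m] in \<open>auto simp: weight_scale_def intro: order.trans[OF zero_le_one]\<close>)
    fix u :: real and U :: "nat \<Rightarrow> real" and G :: "nat \<Rightarrow> 'a \<Rightarrow> real" and c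
    assume *: "u \<in> {0..1}" "\<forall>n. U n \<in> {0..1}" "U \<longlonglongrightarrow> u" "\<forall>n. G n \<in> wball M (v m) c"
    show "(\<lambda>n. L (U n) (G n) - L u (G n)) \<longlonglongrightarrow> 0"
      by (rule fcontD(2)[OF assms(1) *(1) _ *(3), of _ "\<bar>c\<bar>"]) (use * sub in auto)
  qed
qed

lemma fcont_kernel:
  assumes "kernel_op k MA wA MB wB T" "weight_scale k MB wB" "fcont MA (wA j) D" "j + i \<le> k"
  shows "fcont MB (wB (j + i)) (\<lambda>u g. D u (T i u g))"
  by (rule fcont_comp[OF assms(3) kernel_op_bound'[OF assms(1,2,4)]
        fcont_mono[OF kernel_op_fcont[OF assms(1)] assms(2) refl]]) (use assms(4) in auto)

text \<open>Product rule with three terms: the quotient of \<open>D\<close> at the moving function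
  \<open>T i (U n) (G n)\<close>, the replacement of that function by \<open>T i u (G n)\<close>
  under \<open>D' u\<close>, and \<open>D u\<close> of the quotient of \<open>T i\<close>. The last
  passes to the limit because the Lipschitz clause of \<open>kernel_op\<close> keeps the quotient in
  a fixed ball, so that convergence at each \<open>x\<close> is enough.\<close>

lemma fderiv_kernel:
  assumes T: "kernel_op k MA wA MB wB T" and wsB: "weight_scale k MB wB"
    and D: "fcont MA (wA j) D" and D': "fcont MA (wA (Suc j)) D'" and DD': "fderiv MA (wA (Suc j)) D D'"
    and k: "j + i < k"
  shows "fderiv MB (wB (Suc (j + i))) (\<lambda>u g. D u (T i u g)) (\<lambda>u g. D' u (T i u g) + D u (T (Suc i) u g))"
  unfolding fderiv_def
proof (intro ballI allI impI)
  fix u :: real and U :: "nat \<Rightarrow> real" and G :: "nat \<Rightarrow> 'b \<Rightarrow> real" and c'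
  assume u: "u \<in> {0..1}" and U: "\<forall>n. U n \<in> {0..1} - {u}" "U \<longlonglongrightarrow> u" and G': "\<forall>n. G n \<in> wball MB (wB (Suc (j + i))) c'"
  define c where "c = \<bar>c'\<bar>"
  have c: "c \<ge> 0" by (simp add: c_def)
  have U1: "U n \<in> {0..1} - {u}" and U01: "U n \<in> {0..1}" and Une: "U n \<noteq> u" for n using U by auto
  have G: "G n \<in> wball MB (wB (Suc (j + i))) c" for n
    unfolding c_def using weight_scale_wball_nn[OF wsB _ G'[rule_format]] k by simp
  have Gi: "G n \<in> wball MB (wB m) c" if "m \<le> Suc (j + i)" for n m
    using weight_scale_wball[OF wsB that _ c G] k by simp
  obtain C1 where C1: "\<And>u g. u \<in> {0..1} \<Longrightarrow> g \<in> wball MB (wB (Suc (j + i))) c \<Longrightarrow> T i u g \<in> wball MA (wA (Suc j)) C1"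
    using kernel_op_bound'[OF T wsB, of "Suc j" i c] k by (auto simp del: atLeastAtMost_iff)
  obtain C2 where C2: "\<And>u g. u \<in> {0..1} \<Longrightarrow> g \<in> wball MB (wB (Suc (j + i))) c \<Longrightarrow> T (Suc i) u g \<in> wball MA (wA j) C2"
    using kernel_op_bound'[OF T wsB, of j "Suc i" c] k by (auto simp del: atLeastAtMost_iff)
  obtain C3 where C3: "\<And>u v g. u \<in> {0..1} \<Longrightarrow> v \<in> {0..1} \<Longrightarrow> g \<in> wball MB (wB (Suc (j + i))) c \<Longrightarrow>
       (\<lambda>x. T i v g x - T i u g x) \<in> wball MA (wA j) (C3 * c * \<bar>v - u\<bar>)" "C3 > 0"
    using kernel_op_lipschitz[OF T k] c by blast
  obtain C4 where C4: "\<And>u g. u \<in> {0..1} \<Longrightarrow> g \<in> wball MB (wB (j + i)) c \<Longrightarrow> T i u g \<in> wball MA (wA j) C4"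
    using kernel_op_bound'[OF T wsB, of j i c] k by (auto simp del: atLeastAtMost_iff)
  note Du = fcontD(1)[OF D u] and Du' = fcontD(1)[OF D' u]
  have lim1: "(\<lambda>n. (D (U n) (T i (U n) (G n)) - D u (T i (U n) (G n))) / (U n - u) - D' u (T i (U n) (G n))) \<longlonglongrightarrow> 0"
    by (rule fderivD[OF DD' u U1 U(2) C1[OF U01 G]])
  have lim2: "(\<lambda>n. D' u (T i (U n) (G n)) - D' u (T i u (G n))) \<longlonglongrightarrow> 0"
    by (rule wfunctional_tendsto_diff[OF Du' C1[OF U01 G] C1[OF u G]])
       (rule fcontD(2)[OF kernel_op_fcont[OF T] u U01 U(2) Gi], use k in auto)
  let ?Q = "\<lambda>n x. (1 / (U n - u)) * (T i (U n) (G n) x - T i u (G n) x)"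
  have Q: "?Q n \<in> wball MA (wA j) (C3 * c)" for n
    by (rule wball_mono[OF wball_scale[OF C3(1)[OF u U01 G]]]) (use Une in \<open>simp add: field_simps\<close>)
  have "(\<lambda>n. D u (?Q n) - D u (T (Suc i) u (G n))) \<longlonglongrightarrow> 0"
  proof (rule wfunctional_tendsto_diff[OF Du Q C2[OF u G]])
    fix x assume "x \<in> space MA"
    then have "(\<lambda>n. (T i (U n) (G n) x - T i u (G n) x) / (U n - u) - T (Suc i) u (G n) x) \<longlonglongrightarrow> 0"
      by (intro fderivD[OF kernel_op_fderiv[OF T] u U1 U(2) Gi]) (use k in auto)
    then show "(\<lambda>n. ?Q n x - T (Suc i) u (G n) x) \<longlonglongrightarrow> 0" by simp
  qed
  moreover have "D u (?Q n) = (D u (T i (U n) (G n)) - D u (T i u (G n))) / (U n - u)" for n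
  proof -
    have 1: "T i (U n) (G n) \<in> wball MA (wA j) C4" "T i u (G n) \<in> wball MA (wA j) C4"
      using C4 U01 u Gi by auto
    show ?thesis
      using wfunctional_scale[OF Du wball_diff[OF 1], of "1 / (U n - u)"] wfunctional_diff[OF Du 1]
      by simp
  qed
  ultimately have lim3: "(\<lambda>n. (D u (T i (U n) (G n)) - D u (T i u (G n))) / (U n - u) - D u (T (Suc i) u (G n))) \<longlonglongrightarrow> 0"
    by simp
  show "(\<lambda>n. (D (U n) (T i (U n) (G n)) - D u (T i u (G n))) / (U n - u) -
       (D' u (T i u (G n)) + D u (T (Suc i) u (G n)))) \<longlonglongrightarrow> 0"
    using tendsto_add[OF tendsto_add[OF lim1 lim2] lim3] by (simp add: diff_divide_distrib algebra_simps)
qed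

text \<open>Pascal's rule in the shape that Leibniz's formula needs; it is applied to functionals
  composed with kernels and to real functions alike.\<close>

lemma binomial_sum_Suc:
  fixes a :: "nat \<Rightarrow> nat \<Rightarrow> real"
  shows "(\<Sum>i\<le>l. real (l choose i) * (a (Suc (l - i)) i + a (l - i) (Suc i))) =
         (\<Sum>i\<le>Suc l. real (Suc l choose i) * a (Suc l - i) i)"
proof -
  have "(\<Sum>i\<le>Suc l. real (Suc l choose i) * a (Suc l - i) i) =
        a (Suc l) 0 + (\<Sum>i\<le>l. real (l choose Suc i) * a (l - i) (Suc i)) + (\<Sum>i\<le>l. real (l choose i) * a (l - i) (Suc i))"
    by (subst sum.atMost_Suc_shift) (simp add: sum.distrib algebra_simps)
  moreover have "(\<Sum>i\<le>Suc l. real (l choose i) * a (Suc l - i) i) =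
       a (Suc l) 0 + (\<Sum>i\<le>l. real (l choose Suc i) * a (l - i) (Suc i))"
    by (subst sum.atMost_Suc_shift) simp
  moreover have "(\<Sum>i\<le>Suc l. real (l choose i) * a (Suc l - i) i) = (\<Sum>i\<le>l. real (l choose i) * a (Suc (l - i)) i)"
    by (simp add: Suc_diff_le)
  ultimately show ?thesis by (simp add: sum.distrib algebra_simps)
qed

text \<open>Leibniz's formula: smoothness of a law passes to the law after one more kernel, without
  further loss in the scale.\<close>

lemma smooth_family_kernel:
  assumes T: "kernel_op k MA wA MB wB T" and wsB: "weight_scale k MB wB"
    and D: "smooth_family k MA wA D"
  shows "smooth_family k MB wB (\<lambda>l u g. \<Sum>i\<le>l. real (l choose i) * D (l - i) u (T i u g))"
proof -
  have Dc: "fcont MA (wA l) (D l)" if "l \<le> k" for l using D that by (simp add: smooth_family_def)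
  have Dd: "fderiv MA (wA (Suc l)) (D l) (D (Suc l))" if "l < k" for l using D that by (simp add: smooth_family_def)
  show ?thesis
    unfolding smooth_family_def
  proof (intro conjI allI impI)
    fix l assume l: "l \<le> k"
    show "fcont MB (wB l) (\<lambda>u g. \<Sum>i\<le>l. real (l choose i) * D (l - i) u (T i u g))"
    proof (rule fcont_sum)
      fix i assume "i \<in> {..l}"
      then show "fcont MB (wB l) (\<lambda>u g. D (l - i) u (T i u g))"
        using fcont_kernel[OF T wsB Dc, of "l - i" i] l by simp
    qed
  next
    fix l assume l: "l < k"
    have "fderiv MB (wB (Suc l)) (\<lambda>u g. \<Sum>i\<le>l. real (l choose i) * D (l - i) u (T i u g))
      (\<lambda>u g. \<Sum>i\<le>l. real (l choose i) * (D (Suc (l - i)) u (T i u g) + D (l - i) u (T (Suc i) u g)))"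
    proof (rule fderiv_sum)
      fix i assume "i \<in> {..l}"
      then show "fderiv MB (wB (Suc l)) (\<lambda>u g. D (l - i) u (T i u g))
          (\<lambda>u g. D (Suc (l - i)) u (T i u g) + D (l - i) u (T (Suc i) u g))"
        using fderiv_kernel[OF T wsB Dc Dc Dd, of "l - i" i] l by simp
    qed
    then show "fderiv MB (wB (Suc l)) (\<lambda>u g. \<Sum>i\<le>l. real (l choose i) * D (l - i) u (T i u g))
      (\<lambda>u g. \<Sum>i\<le>Suc l. real (Suc l choose i) * D (Suc l - i) u (T i u g))"
      by (subst (asm) binomial_sum_Suc[where a = "\<lambda>j i. D j _ (T i _ _)"])
  qed
qed

text \<open>The error of the \<open>N\<close>-th approximation is uniform in \<open>n\<close>, so
  the limits in \<open>n\<close> and in \<open>N\<close> may be interchanged.\<close>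

lemma tendsto_0_geometric_approx:
  fixes b :: "nat \<Rightarrow> real"
  assumes a: "\<And>N. (\<lambda>n. a N n) \<longlonglongrightarrow> 0" and ab: "\<And>N n. \<bar>b n - a N n\<bar> \<le> K * \<rho> ^ N" and \<rho>: "0 \<le> \<rho>" "\<rho> < 1"
  shows "b \<longlonglongrightarrow> 0"
proof (rule LIMSEQ_I)
  fix e :: real assume e: "e > 0"
  have "(\<lambda>N. K * \<rho> ^ N) \<longlonglongrightarrow> K * 0"
    by (intro tendsto_intros LIMSEQ_power_zero) (use \<rho> in auto)
  then obtain N where "norm (K * \<rho> ^ N - K * 0) < e / 2"
    using LIMSEQ_D[of _ _ "e/2"] e by (metis half_gt_zero order_refl)
  then have N: "K * \<rho> ^ N < e / 2" by simp
  obtain n0 where n0: "\<And>n. n \<ge> n0 \<Longrightarrow> \<bar>a N n\<bar> < e / 2"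
    using LIMSEQ_D[OF a[of N], of "e/2"] e by auto
  have "norm (b n - 0) < e" if "n \<ge> n0" for n
    using ab[of n N] N n0[OF that] by simp
  then show "\<exists>n0. \<forall>n\<ge>n0. norm (b n - 0) < e" by blast
qed

text \<open>\<open>K\<close> may depend on the radius of the ball but on neither \<open>u\<close>
  nor \<open>g\<close>, so a uniform limit of continuous families is continuous. This serves for the
  limit of the iterates and for the Poisson series.\<close>

lemma fcont_geometric_limit:
  assumes L: "\<And>N. fcont M w (LN N)"
    and approx: "\<And>u g c N. u \<in> {0..1} \<Longrightarrow> g \<in> wball M w c \<Longrightarrow> \<bar>L u g - LN N u g\<bar> \<le> K c * \<rho> ^ N"
    and \<rho>: "0 \<le> \<rho>" "\<rho> < 1"
  shows "fcont M w L"
  unfolding fcont_def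
proof (intro conjI ballI allI impI)
  fix u :: real assume u: "u \<in> {0..1}"
  have lim: "(\<lambda>N. LN N u g) \<longlonglongrightarrow> L u g" if "g \<in> wball M w c" for g c
  proof -
    have "(\<lambda>N. L u g - LN N u g) \<longlonglongrightarrow> 0"
    proof (rule tendsto_rabs_zero_cancel, rule tendsto_sandwich[OF _ _ tendsto_const])
      show "(\<lambda>N. K c * \<rho> ^ N) \<longlonglongrightarrow> 0"
        using tendsto_mult_right_zero[OF LIMSEQ_power_zero, of \<rho> "K c"] \<rho> by simp
    qed (use approx[OF u that] in auto)
    then show ?thesis using Lim_transform[OF tendsto_const[of "L u g"]] tendsto_diff[OF tendsto_const[of "L u g"]] by fastforce
  qed
  show "wfunctional M w (L u)"
    unfolding wfunctional_def
  proof (intro conjI allI impI)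
    fix g h a b c d assume gh: "g \<in> wball M w c" "h \<in> wball M w d"
    have "(\<lambda>N. a * LN N u g + b * LN N u h) \<longlonglongrightarrow> a * L u g + b * L u h"
      by (intro tendsto_intros lim[OF gh(1)] lim[OF gh(2)])
    moreover have "(\<lambda>N. a * LN N u g + b * LN N u h) \<longlonglongrightarrow> L u (\<lambda>x. a * g x + b * h x)"
      using lim[OF wball_lincomb[OF gh, of a b]] by (simp add: wfunctional_lincomb[OF fcontD(1)[OF L u] gh])
    ultimately show "L u (\<lambda>x. a * g x + b * h x) = a * L u g + b * L u h"
      using LIMSEQ_unique by blast
  next
    fix G :: "nat \<Rightarrow> 'a \<Rightarrow> real" and c
    assume G: "\<forall>n. G n \<in> wball M w c" "\<forall>x\<in>space M. (\<lambda>n. G n x) \<longlonglongrightarrow> 0"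
    show "(\<lambda>n. L u (G n)) \<longlonglongrightarrow> 0"
      by (rule tendsto_0_geometric_approx[where a = "\<lambda>N n. LN N u (G n)", OF _ approx[OF u] \<rho>])
         (use G in \<open>auto intro: wfunctional_tendsto[OF fcontD(1)[OF L u]]\<close>)
  qed
next
  fix u :: real and U :: "nat \<Rightarrow> real" and G :: "nat \<Rightarrow> 'a \<Rightarrow> real" and c
  assume *: "u \<in> {0..1}" "\<forall>n. U n \<in> {0..1}" "U \<longlonglongrightarrow> u" "\<forall>n. G n \<in> wball M w c"
  show "(\<lambda>n. L (U n) (G n) - L u (G n)) \<longlonglongrightarrow> 0"
  proof (rule tendsto_0_geometric_approx[where a = "\<lambda>N n. LN N (U n) (G n) - LN N u (G n)", OF _ _ \<rho>])
    show "(\<lambda>n. LN N (U n) (G n) - LN N u (G n)) \<longlonglongrightarrow> 0" for N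
      by (rule fcontD(2)[OF L *(1) _ *(3)]) (use * in auto)
    show "\<bar>L (U n) (G n) - L u (G n) - (LN N (U n) (G n) - LN N u (G n))\<bar> \<le> (2 * K c) * \<rho> ^ N" for N n
      using approx[of "U n" "G n" c N] approx[of u "G n" c N] * by (simp add: algebra_simps abs_le_iff)
  qed
qed

section \<open>Products of uniformly ergodic kernels\<close>

text \<open>The head of the list acts last on the function and is therefore the first transition of
  the chain: appending to the list adds a later transition, prepending an earlier one.\<close>

definition kernel_iter :: "(real \<Rightarrow> ('a \<Rightarrow> real) \<Rightarrow> 'a \<Rightarrow> real) \<Rightarrow> real list \<Rightarrow> ('a \<Rightarrow> real) \<Rightarrow> 'a \<Rightarrow> real" where
  "kernel_iter P us g = foldr P us g"

lemma kernel_iter_simps [simp]: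
  "kernel_iter P [] g = g"
  "kernel_iter P (u # us) g = P u (kernel_iter P us g)"
  "kernel_iter P (us @ vs) g = kernel_iter P us (kernel_iter P vs g)"
  by (simp_all add: kernel_iter_def)

lemma tendsto_0_geometric:
  fixes b :: "nat \<Rightarrow> real"
  assumes "\<And>N. \<bar>b N\<bar> \<le> K * \<rho> ^ N" "0 \<le> \<rho>" "\<rho> < 1"
  shows "b \<longlonglongrightarrow> 0"
proof (rule Lim_null_comparison)
  show "(\<lambda>N. K * \<rho> ^ N) \<longlonglongrightarrow> 0"
    using tendsto_mult_right_zero[OF LIMSEQ_power_zero, of \<rho> K] assms(2,3) by simp
qed (use assms(1) in simp)

lemma kernel_iter_replicate_Suc:
  "kernel_iter P (replicate N u) (P u g) = kernel_iter P (replicate (Suc N) u) g"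
  by (induction N) simp_all

lemma ex_sequence_tendsto:
  fixes v :: real assumes "v \<in> {0..1}"
  obtains U :: "nat \<Rightarrow> real" where "\<And>n. U n \<in> {0..1} - {v}" "U \<longlonglongrightarrow> v"
proof -
  \<comment> \<open>The sign points to the farther end of the interval, so steps of length at most
    one half stay inside.\<close>
  define s where "s = (if v < 1/2 then 1/2 else - 1/2 :: real)"
  show ?thesis
  proof (rule that[of "\<lambda>n. v + s * inverse (real (Suc n))"])
    fix n
    define r where "r = inverse (real (Suc n))"
    have "0 < r" "r \<le> 1" by (auto simp: r_def divide_simps)
    then show "v + s * inverse (real (Suc n)) \<in> {0..1} - {v}"
      using assms unfolding r_def[symmetric] s_def by auto
    have "(\<lambda>n. v + s * inverse (real (Suc n))) \<longlonglongrightarrow> v + s * 0"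
      by (intro tendsto_intros LIMSEQ_inverse_real_of_nat)
    then show "(\<lambda>n. v + s * inverse (real (Suc n))) \<longlonglongrightarrow> v" by simp
  qed
qed

text \<open>Kept apart from smoothness in \<open>u\<close>, so that it covers the transition
  operators, with a Lyapunov function as well as with a weight of the scale, and also the minorizing
  kernel.\<close>

locale markov_ops =
  fixes M :: "'a measure" and V :: "'a \<Rightarrow> real" and P :: "real \<Rightarrow> ('a \<Rightarrow> real) \<Rightarrow> 'a \<Rightarrow> real"
  assumes V_ge1: "\<And>x. x \<in> space M \<Longrightarrow> 1 \<le> V x"
    and op_functional: "\<And>u x. u \<in> {0..1} \<Longrightarrow> x \<in> space M \<Longrightarrow> wfunctional M V (\<lambda>g. P u g x)"
    and op_wball: "\<And>u g c. u \<in> {0..1} \<Longrightarrow> g \<in> wball M V c \<Longrightarrow> \<exists>C. P u g \<in> wball M V C"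
    and op_one: "\<And>u x. u \<in> {0..1} \<Longrightarrow> x \<in> space M \<Longrightarrow> P u (\<lambda>_. 1) x = 1"
begin

lemma const_wball_V: "(\<lambda>_. a) \<in> wball M V \<bar>a\<bar>"
  by (rule wball_const) (rule V_ge1)

lemma op_const: "u \<in> {0..1} \<Longrightarrow> x \<in> space M \<Longrightarrow> P u (\<lambda>_. a) x = a"
  using wfunctional_scale[OF op_functional const_wball_V[of 1], of u x a] op_one by simp

lemma iter_ex_wball:
  assumes "g \<in> wball M V c" "set us \<subseteq> {0..1}"
  shows "\<exists>C. kernel_iter P us g \<in> wball M V C"
  using assms(2) by (induction us) (use assms(1) op_wball in auto)

lemma iter_lincomb:
  assumes "set us \<subseteq> {0..1}" and g: "g \<in> wball M V c" and h: "h \<in> wball M V d" and "x \<in> space M"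
  shows "kernel_iter P us (\<lambda>x. a * g x + b * h x) x = a * kernel_iter P us g x + b * kernel_iter P us h x"
  using assms(1,4)
proof (induction us arbitrary: x)
  case (Cons u us)
  then have u: "u \<in> {0..1}" and us: "set us \<subseteq> {0..1}" by auto
  obtain C where C: "kernel_iter P us (\<lambda>x. a * g x + b * h x) \<in> wball M V C"
    using iter_ex_wball[OF wball_lincomb[OF g h] us] by blast
  obtain C1 where C1: "kernel_iter P us g \<in> wball M V C1" using iter_ex_wball[OF g us] by blast
  obtain C2 where C2: "kernel_iter P us h \<in> wball M V C2" using iter_ex_wball[OF h us] by blast
  note Pu = op_functional[OF u Cons.prems(2)]
  show ?case
    using wfunctional_cong[OF Pu C wball_lincomb[OF C1 C2] Cons.IH[OF us]] wfunctional_lincomb[OF Pu C1 C2]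
    by simp
qed simp

lemma iter_const:
  assumes "set us \<subseteq> {0..1}" "x \<in> space M"
  shows "kernel_iter P us (\<lambda>_. a) x = a"
  using assms
proof (induction us arbitrary: x)
  case (Cons u us)
  then have u: "u \<in> {0..1}" and us: "set us \<subseteq> {0..1}" by auto
  obtain C where C: "kernel_iter P us (\<lambda>_. a) \<in> wball M V C"
    using iter_ex_wball[OF const_wball_V us] by blast
  show ?case
    using wfunctional_cong[OF op_functional[OF u Cons.prems(2)] C const_wball_V Cons.IH[OF us]] op_const u Cons.prems
    by simp
qed simp

lemma iter_diff_const:
  assumes "set us \<subseteq> {0..1}" "g \<in> wball M V c" "x \<in> space M"
  shows "kernel_iter P us (\<lambda>x. g x - a) x = kernel_iter P us g x - a"
  using iter_lincomb[OF assms(1,2) const_wball_V[of 1] assms(3), of 1 "-a"] iter_const[OF assms(1,3)] by simp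

end

text \<open>Stability and contraction are asked for lists of arbitrary parameters: constant lists
  produce the stationary functional, varying ones the laws of the array. Each weight of the scale
  has its own constants.\<close>

locale ergodic_kernels =
  fixes k :: nat and M :: "'a measure" and w :: "nat \<Rightarrow> 'a \<Rightarrow> real"
    and P :: "nat \<Rightarrow> real \<Rightarrow> ('a \<Rightarrow> real) \<Rightarrow> 'a \<Rightarrow> real" and x0 :: 'a
  assumes ws: "weight_scale k M w" and P: "kernel_op k M w M w P"
    and P_one: "\<And>u x. u \<in> {0..1} \<Longrightarrow> x \<in> space M \<Longrightarrow> P 0 u (\<lambda>_. 1) x = 1"
    and x0: "x0 \<in> space M"
    and stable: "\<And>l. l \<le> k \<Longrightarrow> \<exists>C>0. \<forall>us c g. set us \<subseteq> {0..1} \<longrightarrow> 0 \<le> c \<longrightarrow> g \<in> wball M (w l) c \<longrightarrow>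
       kernel_iter (P 0) us g \<in> wball M (w l) (C * c)"
    and contracting: "\<And>l. l \<le> k \<Longrightarrow> \<exists>C>0. \<exists>\<rho>. 0 \<le> \<rho> \<and> \<rho> < 1 \<and> (\<forall>us c g x y. set us \<subseteq> {0..1} \<longrightarrow> 0 \<le> c \<longrightarrow>
       g \<in> wball M (w l) c \<longrightarrow> x \<in> space M \<longrightarrow> y \<in> space M \<longrightarrow>
       \<bar>kernel_iter (P 0) us g x - kernel_iter (P 0) us g y\<bar> \<le> C * c * \<rho> ^ length us * (w l x + w l y))"
begin

abbreviation iter :: "real list \<Rightarrow> ('a \<Rightarrow> real) \<Rightarrow> 'a \<Rightarrow> real" where "iter \<equiv> kernel_iter (P 0)"
abbreviation iterate :: "nat \<Rightarrow> real \<Rightarrow> ('a \<Rightarrow> real) \<Rightarrow> 'a \<Rightarrow> real" where "iterate N u \<equiv> iter (replicate N u)"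

lemmas w_ge1 = weight_scale_ge1[OF ws]
lemmas wball_nn = weight_scale_wball_nn[OF ws]

lemma iter_wball:
  assumes "l \<le> k" obtains C where "C > 0"
    "\<And>us c g. set us \<subseteq> {0..1} \<Longrightarrow> 0 \<le> c \<Longrightarrow> g \<in> wball M (w l) c \<Longrightarrow> iter us g \<in> wball M (w l) (C * c)"
  using stable[OF assms] by blast

lemma const_wball: "l \<le> k \<Longrightarrow> (\<lambda>_. a) \<in> wball M (w l) \<bar>a\<bar>"
  by (rule wball_const) (rule w_ge1)

sublocale markov_ops M "w 0" "P 0"
proof
  show "wfunctional M (w 0) (\<lambda>g. P 0 u g x)" if "u \<in> {0..1}" "x \<in> space M" for u x
    by (rule kernel_op_functional[OF P]) (use that in auto)
  show "\<exists>C. P 0 u g \<in> wball M (w 0) C" if "u \<in> {0..1}" "g \<in> wball M (w 0) c" for u g c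
    using kernel_op_bound'[OF P ws, of 0 0 c] that by (simp del: atLeastAtMost_iff) blast
qed (auto intro: w_ge1 P_one)

lemmas P_functional = op_functional and P_const = op_const

lemma wball_0: "l \<le> k \<Longrightarrow> g \<in> wball M (w l) c \<Longrightarrow> g \<in> wball M (w 0) \<bar>c\<bar>"
  using weight_scale_wball[OF ws _ _ _ wball_nn] by simp

lemma iter_wball_0:
  assumes "l \<le> k" "g \<in> wball M (w l) c" "set us \<subseteq> {0..1}"
  shows "\<exists>C. iter us g \<in> wball M (w 0) C"
  by (rule iter_ex_wball[OF wball_0[OF assms(1,2)] assms(3)])

text \<open>The first bound says that \<open>iter us g\<close>, centred at its value in
  \<open>x\<close>, is small in weighted norm. Earlier transitions \<open>vs\<close> preserve
  constants and are stable, so applying them to the centred function keeps it small; that is the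
  second bound.\<close>

lemma iter_coupling:
  assumes l: "l \<le> k"
  obtains C \<rho> where "C > 0" "0 \<le> \<rho>" "\<rho> < 1"
    "\<And>us c g x. set us \<subseteq> {0..1} \<Longrightarrow> 0 \<le> c \<Longrightarrow> g \<in> wball M (w l) c \<Longrightarrow> x \<in> space M \<Longrightarrow>
      (\<lambda>y. iter us g y - iter us g x) \<in> wball M (w l) (C * c * \<rho> ^ length us * w l x)"
    "\<And>us vs c g x y. set us \<subseteq> {0..1} \<Longrightarrow> set vs \<subseteq> {0..1} \<Longrightarrow> 0 \<le> c \<Longrightarrow>
      g \<in> wball M (w l) c \<Longrightarrow> x \<in> space M \<Longrightarrow> y \<in> space M \<Longrightarrow>
      \<bar>iter us g x - iter (vs @ us) g y\<bar> \<le> C * c * \<rho> ^ length us * w l x * w l y"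
proof -
  obtain C \<rho> where C: "C > 0" "0 \<le> \<rho>" "\<rho> < 1" and
    bd: "\<And>us c g x y. set us \<subseteq> {0..1} \<Longrightarrow> 0 \<le> c \<Longrightarrow>
       g \<in> wball M (w l) c \<Longrightarrow> x \<in> space M \<Longrightarrow> y \<in> space M \<Longrightarrow>
       \<bar>iter us g x - iter us g y\<bar> \<le> C * c * \<rho> ^ length us * (w l x + w l y)"
    using contracting[OF l] by metis
  obtain B where B: "B > 0" "\<And>us c g. set us \<subseteq> {0..1} \<Longrightarrow> 0 \<le> c \<Longrightarrow> g \<in> wball M (w l) c \<Longrightarrow> iter us g \<in> wball M (w l) (B * c)"
    by (rule iter_wball[OF l]) (rule that)
  have 1: "(\<lambda>y. iter us g y - iter us g x) \<in> wball M (w l) ((2 * C) * c * \<rho> ^ length us * w l x)"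
    if us: "set us \<subseteq> {0..1}" and c: "0 \<le> c" and g: "g \<in> wball M (w l) c" and x: "x \<in> space M" for us c g x
  proof (rule wballI)
    show "(\<lambda>y. iter us g y - iter us g x) \<in> borel_measurable M"
      using wballD(1)[OF B(2)[OF us c g]] by simp
    fix y assume y: "y \<in> space M"
    \<comment> \<open>Weights are at least 1, so the sum is at most twice the product; the product
      form puts the factor \<open>w l x\<close> into the radius of a ball in the variable
      \<open>y\<close>.\<close>
    have "w l x + w l y \<le> 2 * (w l x * w l y)"
    proof -
      have "w l x * 1 \<le> w l x * w l y" "1 * w l y \<le> w l x * w l y"
        using w_ge1[OF l x] w_ge1[OF l y] by (intro mult_left_mono mult_right_mono; simp)+
      then show ?thesis by simp
    qed
    moreover have "0 \<le> C * c * \<rho> ^ length us" using C c by simp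
    ultimately have "C * c * \<rho> ^ length us * (w l x + w l y) \<le> C * c * \<rho> ^ length us * (2 * (w l x * w l y))"
      by (rule mult_left_mono)
    with bd[OF us c g y x]
    show "\<bar>iter us g y - iter us g x\<bar> \<le> 2 * C * c * \<rho> ^ length us * w l x * w l y"
      by (simp add: algebra_simps)
  qed
  have 2: "\<bar>iter us g x - iter (vs @ us) g y\<bar> \<le> (B * (2 * C)) * c * \<rho> ^ length us * w l x * w l y"
    if us: "set us \<subseteq> {0..1}" and vs: "set vs \<subseteq> {0..1}" and c: "0 \<le> c" and g: "g \<in> wball M (w l) c" and x: "x \<in> space M"
      and y: "y \<in> space M" for us vs c g x y
  proof -
    have nn: "0 \<le> (2 * C) * c * \<rho> ^ length us * w l x" using C c w_ge1[OF l x] by simp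
    have "\<bar>iter vs (\<lambda>y. iter us g y - iter us g x) y\<bar> \<le> B * ((2 * C) * c * \<rho> ^ length us * w l x) * w l y"
      by (rule wballD(2)[OF B(2)[OF vs nn 1[OF us c g x]] y])
    moreover have "iter vs (\<lambda>y. iter us g y - iter us g x) y =
        iter (vs @ us) g y - iter us g x"
      using iter_diff_const[OF vs _ y] iter_wball_0[OF l g us] by fastforce
    ultimately show ?thesis by (simp add: abs_minus_commute algebra_simps)
  qed
  define K where "K = max (2 * C) (B * (2 * C))"
  show ?thesis
  proof (rule that[of K \<rho>])
    show "K > 0" using C by (simp add: K_def)
    show "(\<lambda>y. iter us g y - iter us g x) \<in> wball M (w l) (K * c * \<rho> ^ length us * w l x)"
      if *: "set us \<subseteq> {0..1}" "0 \<le> c" "g \<in> wball M (w l) c" "x \<in> space M" for us c g x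
    proof (rule wball_mono[OF 1[OF *]])
      fix y assume "y \<in> space M"
      then show "2 * C * c * \<rho> ^ length us * w l x * w l y \<le> K * c * \<rho> ^ length us * w l x * w l y"
        using w_ge1[OF l] *(2,4) C by (intro mult_right_mono) (auto simp: K_def intro: order.trans[OF zero_le_one])
    qed
    show "\<bar>iter us g x - iter (vs @ us) g y\<bar> \<le> K * c * \<rho> ^ length us * w l x * w l y"
      if *: "set us \<subseteq> {0..1}" "set vs \<subseteq> {0..1}" "0 \<le> c" "g \<in> wball M (w l) c" "x \<in> space M" "y \<in> space M" for us vs c g x y
    proof (rule order.trans[OF 2[OF *]])
      show "B * (2 * C) * c * \<rho> ^ length us * w l x * w l y \<le> K * c * \<rho> ^ length us * w l x * w l y"
        using w_ge1[OF l *(5)] w_ge1[OF l *(6)] *(3) C by (intro mult_right_mono) (auto simp: K_def)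
    qed
  qed (use C in auto)
qed

text \<open>A limit of iterates presupposes no invariant measure; the measure is obtained from this
  functional in \<open>ex_stat_measure\<close>.\<close>

definition stat :: "real \<Rightarrow> ('a \<Rightarrow> real) \<Rightarrow> real" where
  "stat u g = lim (\<lambda>N. iterate N u g x0)"

lemma stat_approx:
  assumes l: "l \<le> k"
  obtains C \<rho> where "C > 0" "0 \<le> \<rho>" "\<rho> < 1"
    "\<And>u c g x N. u \<in> {0..1} \<Longrightarrow> 0 \<le> c \<Longrightarrow> g \<in> wball M (w l) c \<Longrightarrow> x \<in> space M \<Longrightarrow>
      \<bar>iterate N u g x - stat u g\<bar> \<le> C * c * \<rho> ^ N * w l x"
proof -
  obtain C \<rho> where C: "C > 0" "0 \<le> \<rho>" "\<rho> < 1" and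
    "\<And>us c g x. set us \<subseteq> {0..1} \<Longrightarrow> 0 \<le> c \<Longrightarrow> g \<in> wball M (w l) c \<Longrightarrow> x \<in> space M \<Longrightarrow>
      (\<lambda>y. iter us g y - iter us g x) \<in> wball M (w l) (C * c * \<rho> ^ length us * w l x)" and
    bd: "\<And>us vs c g x y. set us \<subseteq> {0..1} \<Longrightarrow> set vs \<subseteq> {0..1} \<Longrightarrow> 0 \<le> c \<Longrightarrow>
      g \<in> wball M (w l) c \<Longrightarrow> x \<in> space M \<Longrightarrow> y \<in> space M \<Longrightarrow>
      \<bar>iter us g x - iter (vs @ us) g y\<bar> \<le> C * c * \<rho> ^ length us * w l x * w l y"
    by (rule iter_coupling[OF l]) (rule that)
  have bd': "\<bar>iterate N u g x - iter (replicate (N + n) u) g x0\<bar> \<le> (C * w l x0) * c * \<rho> ^ N * w l x"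
    if "u \<in> {0..1}" "0 \<le> c" "g \<in> wball M (w l) c" "x \<in> space M" for u c g x N n
  proof -
    \<comment> \<open>The \<open>n\<close> additional transitions are prepended, so the two iterates
      share their last \<open>N\<close> transitions and differ by a term of order
      \<open>\<rho> ^ N\<close>.\<close>
    have "replicate n u @ replicate N u = replicate (N + n) u"
      by (metis add.commute replicate_add)
    moreover have "set (replicate m u) \<subseteq> {0..1}" for m using that(1) by (auto simp: set_replicate_conv_if)
    ultimately show ?thesis
      using bd[of "replicate N u" "replicate n u" c g x x0] that x0
      by (simp add: mult_ac del: kernel_iter_simps)
  qed
  show ?thesis
  proof (rule that[of "C * w l x0" \<rho>])
    show "C * w l x0 > 0" using C w_ge1[OF l x0] by simp
    fix u :: real and c g x N assume *: "u \<in> {0..1}" "(0::real) \<le> c" "g \<in> wball M (w l) c" "x \<in> space M"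
    have "Cauchy (\<lambda>N. iterate N u g x0)"
    proof (rule CauchyI')
      fix e :: real assume e: "e > 0"
      have "(\<lambda>N. ((C * w l x0) * c * w l x0) * \<rho> ^ N) \<longlonglongrightarrow> ((C * w l x0) * c * w l x0) * 0"
        by (intro tendsto_intros LIMSEQ_power_zero) (use C in auto)
      then obtain N0 where N0: "\<And>N. N \<ge> N0 \<Longrightarrow> norm (((C * w l x0) * c * w l x0) * \<rho> ^ N - ((C * w l x0) * c * w l x0) * 0) < e"
        using LIMSEQ_D e by meson
      have "dist (iterate N u g x0) (iterate n u g x0) < e" if "N \<ge> N0" "N < n" for N n
        using bd'[OF *(1-3) x0, of N "n - N"] N0[OF that(1)] that(2) by (simp add: dist_real_def algebra_simps)
      then show "\<exists>N0. \<forall>N\<ge>N0. \<forall>n>N. dist (iterate N u g x0) (iterate n u g x0) < e"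
        by blast
    qed
    then have lim: "(\<lambda>N. iterate N u g x0) \<longlonglongrightarrow> stat u g"
      unfolding stat_def by (rule Cauchy_convergent[THEN convergent_LIMSEQ_iff[THEN iffD1]])
    have "(\<lambda>n. \<bar>iterate N u g x - iter (replicate (N + n) u) g x0\<bar>) \<longlonglongrightarrow>
        \<bar>iterate N u g x - stat u g\<bar>"
      using LIMSEQ_ignore_initial_segment[OF lim, of N] by (intro tendsto_intros) (simp add: add.commute)
    then show "\<bar>iterate N u g x - stat u g\<bar> \<le> C * w l x0 * c * \<rho> ^ N * w l x"
      by (rule LIMSEQ_le_const2) (use bd'[OF *] in blast)
  qed (use C in auto)
qed

lemma iter_tendsto_stat:
  assumes "u \<in> {0..1}" "g \<in> wball M (w 0) c" "x \<in> space M"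
  shows "(\<lambda>N. iterate N u g x) \<longlonglongrightarrow> stat u g"
proof -
  obtain C \<rho> where "C > 0" and C: "0 \<le> \<rho>" "\<rho> < 1"
    "\<And>u c g x N. u \<in> {0..1} \<Longrightarrow> 0 \<le> c \<Longrightarrow> g \<in> wball M (w 0) c \<Longrightarrow> x \<in> space M \<Longrightarrow>
      \<bar>iterate N u g x - stat u g\<bar> \<le> C * c * \<rho> ^ N * w 0 x"
    by (rule stat_approx[OF le0]) (rule that)
  have "(\<lambda>N. iterate N u g x - stat u g) \<longlonglongrightarrow> 0"
  proof (rule tendsto_0_geometric[OF _ C(1,2)])
    show "\<bar>iterate N u g x - stat u g\<bar> \<le> (C * \<bar>c\<bar> * w 0 x) * \<rho> ^ N" for N
      using C(3)[OF assms(1) abs_ge_zero wball_nn[OF _ assms(2)] assms(3), of N] by (simp add: mult_ac)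
  qed
  then show ?thesis by (rule LIM_zero_cancel)
qed

lemma iter_fcont: "x \<in> space M \<Longrightarrow> fcont M (w 0) (\<lambda>u g. iterate N u g x)"
proof (induction N)
  case 0
  have "wfunctional M (w 0) (\<lambda>g. g x)"
    using 0 by (simp add: wfunctional_def)
  then show ?case by (simp add: fcont_def)
next
  case (Suc N)
  \<comment> \<open>Splitting off the last transition exhibits the iterate as the functional given
    by the first \<open>N\<close> transitions, composed with one kernel.\<close>
  have "replicate (Suc N) u = replicate N u @ [u]" for u :: real
    by (simp add: replicate_append_same)
  then show ?case
    using fcont_kernel[OF P ws Suc.IH[OF Suc.prems], of 0] by (simp del: replicate_Suc)
qed

lemma stat_fcont: "fcont M (w 0) stat"
proof -
  obtain C \<rho> where "C > 0" and C: "0 \<le> \<rho>" "\<rho> < 1"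
    "\<And>u c g x N. u \<in> {0..1} \<Longrightarrow> 0 \<le> c \<Longrightarrow> g \<in> wball M (w 0) c \<Longrightarrow> x \<in> space M \<Longrightarrow>
      \<bar>iterate N u g x - stat u g\<bar> \<le> C * c * \<rho> ^ N * w 0 x"
    by (rule stat_approx[OF le0]) (rule that)
  show ?thesis
  proof (rule fcont_geometric_limit[OF iter_fcont[OF x0] _ C(1,2)])
    show "\<bar>stat u g - iterate N u g x0\<bar> \<le> (C * \<bar>c\<bar> * w 0 x0) * \<rho> ^ N"
      if "u \<in> {0..1}" "g \<in> wball M (w 0) c" for u g c N
      using C(3)[OF that(1) abs_ge_zero wball_nn[OF _ that(2)] x0, of N] by (simp add: abs_minus_commute algebra_simps)
  qed
qed

lemma stat_const: "u \<in> {0..1} \<Longrightarrow> stat u (\<lambda>_. a) = a"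
  using iter_const[of "replicate _ u" x0 a] x0 unfolding stat_def
  by (subst iter_const) auto

lemma stat_invariant:
  assumes "u \<in> {0..1}" "g \<in> wball M (w 0) c"
  shows "stat u (P 0 u g) = stat u g"
proof -
  obtain d where d: "P 0 u g \<in> wball M (w 0) d"
    using iter_wball_0[OF _ assms(2), of "[u]"] assms(1) by auto
  have "(\<lambda>N. iterate N u (P 0 u g) x0) \<longlonglongrightarrow> stat u (P 0 u g)"
    by (rule iter_tendsto_stat[OF assms(1) d x0])
  moreover have "iterate N u (P 0 u g) x0 = iterate (Suc N) u g x0" for N
    by (simp add: kernel_iter_replicate_Suc del: replicate_Suc)
  ultimately show ?thesis
    using LIMSEQ_Suc[OF iter_tendsto_stat[OF assms x0]] LIMSEQ_unique by (simp del: replicate_Suc)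
qed

lemma stat_bounded:
  assumes "l \<le> k"
  obtains C where "C > 0" "\<And>u c g. u \<in> {0..1} \<Longrightarrow> 0 \<le> c \<Longrightarrow> g \<in> wball M (w l) c \<Longrightarrow> \<bar>stat u g\<bar> \<le> C * c"
proof -
  obtain C where C: "C > 0" "\<And>us c g. set us \<subseteq> {0..1} \<Longrightarrow> 0 \<le> c \<Longrightarrow> g \<in> wball M (w l) c \<Longrightarrow> iter us g \<in> wball M (w l) (C * c)"
    by (rule iter_wball[OF assms]) (rule that)
  show ?thesis
  proof (rule that[of "C * w l x0"])
    show "C * w l x0 > 0" using C(1) w_ge1[OF assms x0] by simp
    fix u :: real and c g assume *: "u \<in> {0..1}" "0 \<le> (c::real)" "g \<in> wball M (w l) c"
    have "(\<lambda>N. \<bar>iterate N u g x0\<bar>) \<longlonglongrightarrow> \<bar>stat u g\<bar>"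
      by (intro tendsto_intros iter_tendsto_stat[OF *(1) wball_0[OF assms *(3)] x0])
    then show "\<bar>stat u g\<bar> \<le> C * w l x0 * c"
      by (rule LIMSEQ_le_const2) (use wballD(2)[OF C(2)[OF _ *(2,3)] x0, of "replicate _ u"] *(1) in \<open>auto simp: set_replicate_conv_if algebra_simps\<close>)
  qed
qed

section \<open>The Poisson equation\<close>

definition poisson :: "real \<Rightarrow> ('a \<Rightarrow> real) \<Rightarrow> 'a \<Rightarrow> real" where
  "poisson u g x = (\<Sum>N. iterate N u g x - stat u g)"

text \<open>All three bounds are comparisons with a geometric series. The bound on the partial sums,
  uniform in \<open>N\<close>, is what lets \<open>P 0 u\<close> be interchanged with the
  series.\<close>

lemma poisson_estimates:
  assumes l: "l \<le> k"
  obtains C \<rho> where "C > 0" "0 \<le> \<rho>" "\<rho> < 1"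
    "\<And>u c g. u \<in> {0..1} \<Longrightarrow> 0 \<le> c \<Longrightarrow> g \<in> wball M (w l) c \<Longrightarrow> poisson u g \<in> wball M (w l) (C * c)"
    "\<And>u c g N. u \<in> {0..1} \<Longrightarrow> 0 \<le> c \<Longrightarrow> g \<in> wball M (w l) c \<Longrightarrow>
       (\<lambda>x. \<Sum>n<N. iterate n u g x - stat u g) \<in> wball M (w l) (C * c)"
    "\<And>u c g N x. u \<in> {0..1} \<Longrightarrow> 0 \<le> c \<Longrightarrow> g \<in> wball M (w l) c \<Longrightarrow> x \<in> space M \<Longrightarrow>
       \<bar>poisson u g x - (\<Sum>n<N. iterate n u g x - stat u g)\<bar> \<le> C * c * w l x * \<rho> ^ N"
proof -
  obtain C \<rho> where C: "C > 0" "0 \<le> \<rho>" "\<rho> < 1" and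
    bd: "\<And>u c g x N. u \<in> {0..1} \<Longrightarrow> 0 \<le> c \<Longrightarrow> g \<in> wball M (w l) c \<Longrightarrow> x \<in> space M \<Longrightarrow>
      \<bar>iterate N u g x - stat u g\<bar> \<le> C * c * \<rho> ^ N * w l x"
    by (rule stat_approx[OF l]) (rule that)
  obtain B where "B > 0" and B: "\<And>us c g. set us \<subseteq> {0..1} \<Longrightarrow> 0 \<le> c \<Longrightarrow> g \<in> wball M (w l) c \<Longrightarrow> iter us g \<in> wball M (w l) (B * c)"
    by (rule iter_wball[OF l]) (rule that)
  have summ: "summable (\<lambda>N. K * \<rho> ^ N)" for K
    using C by (intro summable_mult summable_geometric) auto
  have est: "summable (\<lambda>N. iterate N u g x - stat u g)"
    "\<bar>\<Sum>n. iter (replicate (n + N) u) g x - stat u g\<bar> \<le> (C / (1 - \<rho>)) * c * w l x * \<rho> ^ N"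
    "\<bar>\<Sum>n<N. iterate n u g x - stat u g\<bar> \<le> (C / (1 - \<rho>)) * c * w l x"
    if *: "u \<in> {0..1}" "0 \<le> c" "g \<in> wball M (w l) c" "x \<in> space M" for u c g x N
  proof -
    have nbd: "norm (iterate n u g x - stat u g) \<le> (C * c * w l x) * \<rho> ^ n" for n
      using bd[OF *, of n] by (simp add: algebra_simps)
    show 1: "summable (\<lambda>N. iterate N u g x - stat u g)"
      by (rule summable_comparison_test'[OF summ nbd])
    have nbd2: "norm (iter (replicate (n + N) u) g x - stat u g) \<le> (C * c * w l x * \<rho> ^ N) * \<rho> ^ n" for n
      using nbd[of "n + N"] by (simp add: power_add algebra_simps)
    have "norm (\<Sum>n. iter (replicate (n + N) u) g x - stat u g) \<le> (\<Sum>n. (C * c * w l x * \<rho> ^ N) * \<rho> ^ n)"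
      by (rule norm_suminf_le[OF nbd2 summ])
    also have "\<dots> = (C * c * w l x * \<rho> ^ N) * (1 / (1 - \<rho>))"
      using C by (subst suminf_mult) (auto intro!: summable_geometric simp: suminf_geometric)
    finally show "\<bar>\<Sum>n. iter (replicate (n + N) u) g x - stat u g\<bar> \<le> (C / (1 - \<rho>)) * c * w l x * \<rho> ^ N"
      by (simp add: algebra_simps)
    have "\<bar>\<Sum>n<N. iterate n u g x - stat u g\<bar> \<le> (\<Sum>n<N. (C * c * w l x) * \<rho> ^ n)"
      by (rule order.trans[OF sum_abs sum_mono]) (use nbd in simp)
    also have "\<dots> \<le> (\<Sum>n. (C * c * w l x) * \<rho> ^ n)"
      by (rule sum_le_suminf[OF summ]) (use C * w_ge1[OF l *(4)] in auto)
    also have "\<dots> = (C * c * w l x) * (1 / (1 - \<rho>))"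
      using C by (subst suminf_mult) (auto intro!: summable_geometric simp: suminf_geometric)
    finally show "\<bar>\<Sum>n<N. iterate n u g x - stat u g\<bar> \<le> (C / (1 - \<rho>)) * c * w l x"
      by (simp add: algebra_simps)
  qed
  have meas: "iterate N u g \<in> borel_measurable M"
    if "u \<in> {0..1}" "0 \<le> c" "g \<in> wball M (w l) c" for u c g N
    using wballD(1)[OF B, of "replicate N u" c g] that by (auto simp: set_replicate_conv_if split: if_splits)
  show ?thesis
  proof (rule that[of "C / (1 - \<rho>)" \<rho>])
    fix u :: real and c g assume *: "u \<in> {0..1}" "(0::real) \<le> c" "g \<in> wball M (w l) c"
    show "poisson u g \<in> wball M (w l) (C / (1 - \<rho>) * c)"
    proof (rule wballI)
      show "poisson u g \<in> borel_measurable M"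
        unfolding poisson_def[abs_def] by (intro borel_measurable_suminf borel_measurable_diff meas[OF *]) simp
      show "\<bar>poisson u g x\<bar> \<le> C / (1 - \<rho>) * c * w l x" if "x \<in> space M" for x
        using est(2)[OF * that, of 0] by (simp add: poisson_def)
    qed
    show "(\<lambda>x. \<Sum>n<N. iterate n u g x - stat u g) \<in> wball M (w l) (C / (1 - \<rho>) * c)" for N
      by (rule wballI, intro borel_measurable_sum borel_measurable_diff meas[OF *], simp, rule est(3)[OF *])
    show "\<bar>poisson u g x - (\<Sum>n<N. iterate n u g x - stat u g)\<bar> \<le> C / (1 - \<rho>) * c * w l x * \<rho> ^ N"
      if "x \<in> space M" for x N
      using est(2)[OF * that, of N] suminf_split_initial_segment[OF est(1)[OF * that], of N] by (simp add: poisson_def)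
  qed (use C in auto)
qed

lemma poisson_fcont:
  assumes x: "x \<in> space M" shows "fcont M (w 0) (\<lambda>u g. poisson u g x)"
proof -
  obtain C \<rho> where "C > 0" and C: "0 \<le> \<rho>" "\<rho> < 1"
    "\<And>u c g. u \<in> {0..1} \<Longrightarrow> 0 \<le> c \<Longrightarrow> g \<in> wball M (w 0) c \<Longrightarrow> poisson u g \<in> wball M (w 0) (C * c)"
    "\<And>u c g N. u \<in> {0..1} \<Longrightarrow> 0 \<le> c \<Longrightarrow> g \<in> wball M (w 0) c \<Longrightarrow>
       (\<lambda>x. \<Sum>n<N. iterate n u g x - stat u g) \<in> wball M (w 0) (C * c)"
    "\<And>u c g N x. u \<in> {0..1} \<Longrightarrow> 0 \<le> c \<Longrightarrow> g \<in> wball M (w 0) c \<Longrightarrow> x \<in> space M \<Longrightarrow>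
       \<bar>poisson u g x - (\<Sum>n<N. iterate n u g x - stat u g)\<bar> \<le> C * c * w 0 x * \<rho> ^ N"
    by (rule poisson_estimates[OF le0]) (rule that)
  show ?thesis
  proof (rule fcont_geometric_limit[OF _ _ C(1,2)])
    show "fcont M (w 0) (\<lambda>u g. \<Sum>n<N. iterate n u g x - stat u g)" for N
      using fcont_sum[of "{..<N}" M "w 0" "\<lambda>n u g. iterate n u g x - stat u g" "\<lambda>_. 1"]
        fcont_lincomb[OF iter_fcont[OF x] stat_fcont, where a = 1 and b = "-1"] by simp
    show "\<bar>poisson u g x - (\<Sum>n<N. iterate n u g x - stat u g)\<bar> \<le> (C * \<bar>c\<bar> * w 0 x) * \<rho> ^ N"
      if "u \<in> {0..1}" "g \<in> wball M (w 0) c" for u g c N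
      by (rule C(5)[OF that(1) abs_ge_zero wball_nn[OF _ that(2)] x]) simp
  qed
qed

text \<open>The partial sums satisfy \<open>P 0 u (s g N) = s g (Suc N) - (g - stat u g)\<close> by
  a shift of the index, and \<open>P 0 u\<close> commutes with their limit because they stay in one
  ball. The second identity reads the same shift off the iterates of \<open>P 0 u g\<close>.\<close>

lemma poisson_eq:
  assumes u: "u \<in> {0..1}" and g: "g \<in> wball M (w 0) c" and x: "x \<in> space M"
  shows "poisson u g x - P 0 u (poisson u g) x = g x - stat u g"
    and "poisson u (P 0 u g) x = poisson u g x - (g x - stat u g)"
proof -
  obtain C \<rho> where "C > 0" and C: "0 \<le> \<rho>" "\<rho> < 1"
    "\<And>u c g. u \<in> {0..1} \<Longrightarrow> 0 \<le> c \<Longrightarrow> g \<in> wball M (w 0) c \<Longrightarrow> poisson u g \<in> wball M (w 0) (C * c)"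
    "\<And>u c g N. u \<in> {0..1} \<Longrightarrow> 0 \<le> c \<Longrightarrow> g \<in> wball M (w 0) c \<Longrightarrow>
       (\<lambda>x. \<Sum>n<N. iterate n u g x - stat u g) \<in> wball M (w 0) (C * c)"
    "\<And>u c g N x. u \<in> {0..1} \<Longrightarrow> 0 \<le> c \<Longrightarrow> g \<in> wball M (w 0) c \<Longrightarrow> x \<in> space M \<Longrightarrow>
       \<bar>poisson u g x - (\<Sum>n<N. iterate n u g x - stat u g)\<bar> \<le> C * c * w 0 x * \<rho> ^ N"
    by (rule poisson_estimates[OF le0]) (rule that)
  define s where "s g N x = (\<Sum>n<N. iterate n u g x - stat u g)" for g N x
  have s_lim: "(\<lambda>N. s g N x) \<longlonglongrightarrow> poisson u g x" if "g \<in> wball M (w 0) c" "x \<in> space M" for g x c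
  proof -
    have "(\<lambda>N. poisson u g x - s g N x) \<longlonglongrightarrow> 0"
      unfolding s_def by (rule tendsto_0_geometric[OF _ C(1,2)], rule C(5)[OF u abs_ge_zero wball_nn[OF _ that(1)] that(2)]) simp
    then have "(\<lambda>N. poisson u g x - (poisson u g x - s g N x)) \<longlonglongrightarrow> poisson u g x - 0"
      by (intro tendsto_intros)
    then show ?thesis by simp
  qed
  note gb = wball_nn[OF _ g, simplified]
  have s_ball: "s g N \<in> wball M (w 0) (C * \<bar>c\<bar>)" for N
    using C(4)[OF u abs_ge_zero gb] by (simp add: s_def[abs_def])
  have rep: "set (replicate N u) \<subseteq> {0..1}" for N using u by (auto simp: set_replicate_conv_if)
  have Ps: "P 0 u (s g N) x = s g (Suc N) x - (g x - stat u g)" for N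
  proof (induction N)
    case 0
    then show ?case using P_const[OF u x, of 0] by (simp add: s_def)
  next
    case (Suc N)
    obtain B where B: "iterate N u g \<in> wball M (w 0) B"
      using iter_wball_0[OF _ g rep] by blast
    have "s g (Suc N) = (\<lambda>x. s g N x + (iterate N u g x - stat u g))"
      by (auto simp: s_def)
    then have "P 0 u (s g (Suc N)) x = P 0 u (s g N) x + P 0 u (\<lambda>x. iterate N u g x - stat u g) x"
      using wfunctional_add[OF P_functional[OF u x] s_ball wball_diff[OF B const_wball]] by simp
    also have "P 0 u (\<lambda>x. iterate N u g x - stat u g) x = iterate (Suc N) u g x - stat u g"
      using iter_diff_const[of "[u]", OF _ B x] u by simp
    finally show ?case using Suc.IH by (simp add: s_def)
  qed
  have "(\<lambda>N. P 0 u (poisson u g) x - P 0 u (s g N) x) \<longlonglongrightarrow> 0"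
  proof (rule wfunctional_tendsto_diff[OF P_functional[OF u x] C(3)[OF u abs_ge_zero gb] s_ball])
    show "(\<lambda>n. poisson u g x - s g n x) \<longlonglongrightarrow> 0" if "x \<in> space M" for x
      using tendsto_diff[OF tendsto_const s_lim[OF g that], of "poisson u g x"] by simp
  qed
  moreover have "(\<lambda>N. P 0 u (poisson u g) x - P 0 u (s g N) x) \<longlonglongrightarrow> P 0 u (poisson u g) x - (poisson u g x - (g x - stat u g))"
    unfolding Ps by (intro tendsto_intros LIMSEQ_Suc s_lim[OF g x])
  ultimately show "poisson u g x - P 0 u (poisson u g) x = g x - stat u g"
    using LIMSEQ_unique by fastforce
  obtain B where B: "P 0 u g \<in> wball M (w 0) B"
    using iter_wball_0[OF _ g, of "[u]"] u by auto
  have "s (P 0 u g) N x = s g (Suc N) x - (g x - stat u g)" for N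
  proof -
    have "iterate n u (P 0 u g) x = iterate (Suc n) u g x" for n
      by (simp add: kernel_iter_replicate_Suc del: replicate_Suc)
    then show ?thesis
      unfolding s_def stat_invariant[OF u g] by (subst sum.lessThan_Suc_shift) (simp del: replicate_Suc)
  qed
  then have "(\<lambda>N. s g (Suc N) x - (g x - stat u g)) \<longlonglongrightarrow> poisson u (P 0 u g) x"
    using s_lim[OF B x] by simp
  moreover have "(\<lambda>N. s g (Suc N) x - (g x - stat u g)) \<longlonglongrightarrow> poisson u g x - (g x - stat u g)"
    by (intro tendsto_intros LIMSEQ_Suc s_lim[OF g x])
  ultimately show "poisson u (P 0 u g) x = poisson u g x - (g x - stat u g)"
    using LIMSEQ_unique by blast
qed

lemma poisson_const: "u \<in> {0..1} \<Longrightarrow> x \<in> space M \<Longrightarrow> poisson u (\<lambda>_. a) x = 0"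
  unfolding poisson_def by (subst iter_const) (auto simp: stat_const set_replicate_conv_if)

text \<open>The value on constants does not depend on \<open>u\<close> (total mass at order 0, then
  0), so its difference quotients vanish and the order goes up by induction.\<close>

lemma P_deriv_one:
  assumes "i < k" "u \<in> {0..1}" "x \<in> space M"
  shows "P (Suc i) u (\<lambda>_. a) x = 0"
proof -
  have step: "P (Suc i) v (\<lambda>_. a) x = 0" if i: "i < k" and v: "v \<in> {0..1}" and "\<And>u. u \<in> {0..1} \<Longrightarrow> P i u (\<lambda>_. a) x = b" for i v b
  proof -
    obtain U :: "nat \<Rightarrow> real" where U: "\<And>n. U n \<in> {0..1} - {v}" "U \<longlonglongrightarrow> v"
      by (rule ex_sequence_tendsto[OF v]) (rule that)
    have "(\<lambda>n. (P i (U n) (\<lambda>_. a) x - P i v (\<lambda>_. a) x) / (U n - v) - P (Suc i) v (\<lambda>_. a) x) \<longlonglongrightarrow> 0"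
      by (rule fderivD[OF kernel_op_fderiv[OF P i assms(3)] v U const_wball]) (use v i in auto)
    then show ?thesis using that(3) U(1) v by (simp add: LIMSEQ_const_iff)
  qed
  show ?thesis
    using assms(1,2)
  proof (induction i arbitrary: u)
    case 0
    then show ?case using step[of 0 u a] P_const assms(3) by simp
  next
    case (Suc i)
    then show ?case using step[of "Suc i" u 0] by simp
  qed
qed

end

section \<open>Derivatives of the stationary functional\<close>

context ergodic_kernels
begin

declare sum.cong [fundef_cong]

text \<open>Differentiating \<open>stat u (h - P 0 u h) = 0\<close> formally
  \<open>l \<ge> 1\<close> times equates the \<open>l\<close>-th derivative at
  \<open>h - P 0 u h\<close> with the Leibniz terms in which the kernel carries at least one
  derivative. For \<open>h\<close> the Poisson solution of \<open>g\<close> the left side is the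
  derivative at \<open>g\<close>, because derivatives of the total mass vanish. This is the
  recursion.\<close>

fun stat_deriv :: "nat \<Rightarrow> real \<Rightarrow> ('a \<Rightarrow> real) \<Rightarrow> real" where
  "stat_deriv 0 u g = stat u g"
| "stat_deriv (Suc l) u g =
     (\<Sum>i\<in>{1..Suc l}. real (Suc l choose i) * stat_deriv (Suc l - i) u (P i u (poisson u g)))"

text \<open>Right-hand side of the differentiated invariance equation: only orders below
  \<open>l\<close> of the stationary functional occur.\<close>

definition stat_source :: "nat \<Rightarrow> real \<Rightarrow> ('a \<Rightarrow> real) \<Rightarrow> real" where
  "stat_source l u g = (\<Sum>i\<in>{1..l}. real (l choose i) * stat_deriv (l - i) u (P i u g))"

declare stat_deriv.simps(2) [simp del]

lemma stat_deriv_Suc: "stat_deriv (Suc l) u g = stat_source (Suc l) u (poisson u g)"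
  by (simp add: stat_deriv.simps(2) stat_source_def)

lemma stat_source_0 [simp]: "stat_source 0 u g = 0"
  by (simp add: stat_source_def)

text \<open>The product rule applied to \<open>stat_source l\<close> yields the sum on the left. In
  the binomial identity the index 0 contributes \<open>stat_deriv (Suc l) u (P 0 u g)\<close> on
  both sides, which cancels, and once \<open>stat_deriv l u (P 1 u g)\<close>, which has to be
  added.\<close>

lemma stat_source_Suc:
  "(\<Sum>i\<in>{1..l}. real (l choose i) * (stat_deriv (Suc (l - i)) u (P i u g) + stat_deriv (l - i) u (P (Suc i) u g)))
     + stat_deriv l u (P 1 u g) = stat_source (Suc l) u g"
proof -
  have 1: "(\<Sum>i\<le>n. f i) = f 0 + (\<Sum>i\<in>{1..n}. f i)" for f :: "nat \<Rightarrow> real" and n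
    by (simp add: atMost_atLeast0 sum.atLeast_Suc_atMost)
  show ?thesis
    using binomial_sum_Suc[of l "\<lambda>j i. stat_deriv j u (P i u g)"] unfolding stat_source_def 1 by simp
qed

lemma poisson_bound:
  assumes "l \<le> k"
  shows "\<exists>C. \<forall>u\<in>{0..1}. \<forall>g\<in>wball M (w l) c. poisson u g \<in> wball M (w l) C"
proof -
  obtain C \<rho> where "C > 0" "0 \<le> \<rho>" "\<rho> < 1" and C:
    "\<And>u c g. u \<in> {0..1} \<Longrightarrow> 0 \<le> c \<Longrightarrow> g \<in> wball M (w l) c \<Longrightarrow> poisson u g \<in> wball M (w l) (C * c)"
    and "\<And>u c g N. u \<in> {0..1} \<Longrightarrow> 0 \<le> c \<Longrightarrow> g \<in> wball M (w l) c \<Longrightarrow>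
       (\<lambda>x. \<Sum>n<N. iterate n u g x - stat u g) \<in> wball M (w l) (C * c)"
    "\<And>u c g N x. u \<in> {0..1} \<Longrightarrow> 0 \<le> c \<Longrightarrow> g \<in> wball M (w l) c \<Longrightarrow> x \<in> space M \<Longrightarrow>
       \<bar>poisson u g x - (\<Sum>n<N. iterate n u g x - stat u g)\<bar> \<le> C * c * w l x * \<rho> ^ N"
    by (rule poisson_estimates[OF assms]) (rule that)
  then show ?thesis using wball_nn[OF assms] by (meson abs_ge_zero)
qed

lemma stat_source_fcont:
  assumes "l \<le> k" "\<And>j. j < l \<Longrightarrow> fcont M (w j) (stat_deriv j)"
  shows "fcont M (w l) (stat_source l)"
  unfolding stat_source_def[abs_def]
proof (rule fcont_sum)
  fix i assume "i \<in> {1..l}"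
  then show "fcont M (w l) (\<lambda>u g. stat_deriv (l - i) u (P i u g))"
    using fcont_kernel[OF P ws assms(2), of "l - i" i] assms(1) by simp
qed

lemma stat_deriv_fcont: "l \<le> k \<Longrightarrow> fcont M (w l) (stat_deriv l)"
proof (induction l rule: less_induct)
  case (less l)
  show ?case
  proof (cases l)
    case 0
    then show ?thesis using stat_fcont by (simp add: fcont_def)
  next
    case (Suc n)
    have "fcont M (w l) (\<lambda>u g. stat_source l u (poisson u g))"
    proof (rule fcont_comp[where D = "stat_source l" and T = poisson and wA = "w l" and MA = M])
      show "fcont M (w l) (stat_source l)"
        by (rule stat_source_fcont) (use less in auto)
      show "\<exists>C. \<forall>u\<in>{0..1}. \<forall>g\<in>wball M (w l) c. poisson u g \<in> wball M (w l) C" for c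
        by (rule poisson_bound) fact
      show "fcont M (w l) (\<lambda>u g. poisson u g x)" if "x \<in> space M" for x
        by (rule fcont_mono[OF poisson_fcont[OF that] ws refl _ less.prems]) simp
    qed
    then show ?thesis by (simp add: Suc stat_deriv_Suc[abs_def])
  qed
qed

lemma stat_source_const:
  assumes "l \<le> k" "u \<in> {0..1}"
  shows "stat_source l u (\<lambda>_. a) = 0"
proof -
  have "stat_deriv (l - i) u (P i u (\<lambda>_. a)) = 0" if i: "i \<in> {1..l}" for i
  proof -
    have Du: "wfunctional M (w (l - i)) (stat_deriv (l - i) u)"
      by (rule fcontD(1)[OF stat_deriv_fcont]) (use assms in auto)
    obtain C where C: "P i u (\<lambda>_. a) \<in> wball M (w (l - i)) C"
      using kernel_op_bound'[OF P ws, of "l - i" i "\<bar>a\<bar>"] const_wball[of l a] assms i by fastforce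
    obtain i' where i': "i = Suc i'" using i by (cases i) auto
    have "stat_deriv (l - i) u (P i u (\<lambda>_. a)) = stat_deriv (l - i) u (\<lambda>x. 0 * a)"
      by (rule wfunctional_cong[OF Du C wball_scale[OF const_wball]])
         (use P_deriv_one[of i' u] i i' assms in auto)
    also have "\<dots> = 0"
      using wfunctional_scale[OF Du const_wball[of "l - i" a], of 0] assms by simp
    finally show ?thesis .
  qed
  then show ?thesis by (simp add: stat_source_def)
qed

text \<open>Phrased as independence of the parameter so as to treat order 0, where the value is
  \<open>a\<close>, together with the higher orders, where it is 0.\<close>

lemma stat_deriv_const:
  assumes "l \<le> k" "u \<in> {0..1}" "v \<in> {0..1}"
  shows "stat_deriv l u (\<lambda>_. a) = stat_deriv l v (\<lambda>_. a)"
proof (cases l)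
  case (Suc n)
  have "stat_deriv l u (\<lambda>_. a) = 0" if u: "u \<in> {0..1}" for u
  proof -
    have Su: "wfunctional M (w l) (stat_source l u)"
      by (rule fcontD(1)[OF stat_source_fcont[OF assms(1) stat_deriv_fcont] u]) (use assms in auto)
    obtain C where C: "poisson u (\<lambda>_. a) \<in> wball M (w l) C"
      using poisson_bound[OF assms(1)] const_wball[OF assms(1)] u by blast
    have "stat_source l u (poisson u (\<lambda>_. a)) = stat_source l u (\<lambda>_. 0)"
      by (rule wfunctional_cong[OF Su C const_wball[OF assms(1)]]) (rule poisson_const[OF u])
    then show ?thesis using stat_source_const[OF assms(1) u] by (simp add: Suc stat_deriv_Suc)
  qed
  then show ?thesis using assms by simp
qed (use assms in \<open>simp add: stat_const\<close>)

text \<open>The differentiated invariance equation is recovered from the recursion: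
  \<open>poisson u (P 0 u g)\<close> is \<open>poisson u g\<close> minus \<open>g\<close> up to a
  constant, and the source vanishes on constants.\<close>

lemma stat_deriv_equation:
  assumes l: "l \<le> k" and u: "u \<in> {0..1}" and g: "g \<in> wball M (w l) c"
  shows "stat_deriv l u g - stat_deriv l u (P 0 u g) = stat_source l u g"
proof (cases l)
  case 0
  then show ?thesis using stat_invariant[OF u] g by simp
next
  case (Suc n)
  have Su: "wfunctional M (w l) (stat_source l u)"
    by (rule fcontD(1)[OF stat_source_fcont[OF l stat_deriv_fcont] u]) (use l in auto)
  obtain C1 where C1: "poisson u g \<in> wball M (w l) C1"
    using poisson_bound[OF l] g u by blast
  obtain B where B: "P 0 u g \<in> wball M (w l) B"
    using kernel_op_bound'[OF P ws, of l 0 c] l g u by fastforce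
  obtain C2 where C2: "poisson u (P 0 u g) \<in> wball M (w l) C2"
    using poisson_bound[OF l] B u by blast
  have "stat_source l u (poisson u (P 0 u g)) = stat_source l u (\<lambda>x. poisson u g x - (g x - stat u g))"
    by (rule wfunctional_cong[OF Su C2 wball_diff[OF C1 wball_diff[OF g const_wball[OF l]]]])
       (rule poisson_eq(2)[OF u wball_0[OF l g]])
  also have "\<dots> = stat_source l u (poisson u g) - stat_source l u g"
    using wfunctional_diff[OF Su C1 wball_diff[OF g const_wball[OF l]]] wfunctional_diff[OF Su g const_wball[OF l]]
      stat_source_const[OF l u] by simp
  finally show ?thesis by (simp add: Suc stat_deriv_Suc)
qed

text \<open>Perturbation identity. The increment of order \<open>l\<close> is expressed by
  increments of the source, hence of lower orders, and by an increment of the kernel under the fixed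
  functional at \<open>u\<close>; no continuity of order \<open>l\<close> itself is
  consumed.\<close>

lemma stat_deriv_difference:
  assumes l: "l \<le> k" and u: "u \<in> {0..1}" and v: "v \<in> {0..1}" and g: "g \<in> wball M (w l) c"
  shows "stat_deriv l v g - stat_deriv l u g = stat_source l v (poisson v g) - stat_source l u (poisson v g)
     + stat_deriv l u (\<lambda>x. P 0 v (poisson v g) x - P 0 u (poisson v g) x)"
proof -
  define \<phi> where "\<phi> = poisson v g"
  obtain C where C: "\<phi> \<in> wball M (w l) C"
    using poisson_bound[OF l] g v unfolding \<phi>_def by blast
  obtain B where B: "P 0 v \<phi> \<in> wball M (w l) B" "P 0 u \<phi> \<in> wball M (w l) B"
    using kernel_op_bound'[OF P ws, of l 0 C] l C u v by fastforce
  \<comment> \<open>The Poisson equation at \<open>v\<close> is used for both parameters, so that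
    only the functional changes. At \<open>u\<close>, the term \<open>P 0 v\<close> is then compared
    with \<open>P 0 u\<close>.\<close>
  have D: "stat_deriv l z g = stat_deriv l z \<phi> - stat_deriv l z (P 0 v \<phi>) + stat_deriv l z (\<lambda>_. stat v g)"
    if z: "z \<in> {0..1}" for z
  proof -
    note Dz = fcontD(1)[OF stat_deriv_fcont[OF l] z]
    have "stat_deriv l z g = stat_deriv l z (\<lambda>x. (\<phi> x - P 0 v \<phi> x) + stat v g)"
      by (rule wfunctional_cong[OF Dz g wball_add[OF wball_diff[OF C B(1)] const_wball[OF l]]])
         (use poisson_eq(1)[OF v wball_0[OF l g]] in \<open>simp add: \<phi>_def\<close>)
    then show ?thesis
      using wfunctional_add[OF Dz wball_diff[OF C B(1)] const_wball[OF l]] wfunctional_diff[OF Dz C B(1)] by simp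
  qed
  show ?thesis
    using D[OF u] D[OF v] stat_deriv_const[OF l u v] stat_deriv_equation[OF l v C] stat_deriv_equation[OF l u C]
      wfunctional_diff[OF fcontD(1)[OF stat_deriv_fcont[OF l] u] B]
    by (simp add: \<phi>_def[symmetric])
qed

text \<open>The perturbation identity is divided by the increment. The source is differentiable by
  the induction hypothesis and the product rule, the kernel term tends to
  \<open>stat_deriv l u (P 1 u _)\<close>, and \<open>stat_source_Suc\<close> adds the two up to the
  next source.\<close>

lemma stat_deriv_fderiv: "l < k \<Longrightarrow> fderiv M (w (Suc l)) (stat_deriv l) (stat_deriv (Suc l))"
proof (induction l rule: less_induct)
  case (less l)
  then have l: "l \<le> k" "Suc l \<le> k" by auto
  have source: "fderiv M (w (Suc l)) (stat_source l)
    (\<lambda>u g. \<Sum>i\<in>{1..l}. real (l choose i) * (stat_deriv (Suc (l - i)) u (P i u g) + stat_deriv (l - i) u (P (Suc i) u g)))"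
    unfolding stat_source_def[abs_def]
  proof (rule fderiv_sum)
    fix i assume "i \<in> {1..l}"
    then show "fderiv M (w (Suc l)) (\<lambda>u g. stat_deriv (l - i) u (P i u g))
         (\<lambda>u g. stat_deriv (Suc (l - i)) u (P i u g) + stat_deriv (l - i) u (P (Suc i) u g))"
      using fderiv_kernel[OF P ws stat_deriv_fcont stat_deriv_fcont less.IH, of "l - i" i] l by simp
  qed
  show ?case
    unfolding fderiv_def
  proof (intro ballI allI impI)
    fix u :: real and U :: "nat \<Rightarrow> real" and G :: "nat \<Rightarrow> 'a \<Rightarrow> real" and c'
    assume u: "u \<in> {0..1}" and U: "\<forall>n. U n \<in> {0..1} - {u}" "U \<longlonglongrightarrow> u" and G': "\<forall>n. G n \<in> wball M (w (Suc l)) c'"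
    define c where "c = \<bar>c'\<bar>"
    have c: "c \<ge> 0" by (simp add: c_def)
    have U1: "U n \<in> {0..1} - {u}" and U01: "U n \<in> {0..1}" and Une: "U n \<noteq> u" for n using U by auto
    have G: "G n \<in> wball M (w (Suc l)) c" for n
      unfolding c_def using wball_nn[OF l(2) G'[rule_format]] by simp
    define \<phi> where "\<phi> n = poisson (U n) (G n)" for n
    obtain C' where C': "\<And>u g. u \<in> {0..1} \<Longrightarrow> g \<in> wball M (w (Suc l)) c \<Longrightarrow> poisson u g \<in> wball M (w (Suc l)) C'"
      using poisson_bound[OF l(2)] by blast
    define C where "C = \<bar>C'\<bar>"
    have C: "C \<ge> 0" "\<And>n. \<phi> n \<in> wball M (w (Suc l)) C" "\<And>n. poisson u (G n) \<in> wball M (w (Suc l)) C"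
      unfolding C_def \<phi>_def using wball_nn[OF l(2) C'] U01 u G by auto
    have Cl: "\<phi> n \<in> wball M (w l) C" "\<phi> n \<in> wball M (w 1) C" "\<phi> n \<in> wball M (w 0) C" "G n \<in> wball M (w l) c" "G n \<in> wball M (w 0) c" for n
      using weight_scale_wball[OF ws _ l(2) C(1) C(2)] weight_scale_wball[OF ws _ l(2) c G] by auto
    obtain B where B: "\<And>u g. u \<in> {0..1} \<Longrightarrow> g \<in> wball M (w (Suc l)) C \<Longrightarrow> P 1 u g \<in> wball M (w l) B"
      using kernel_op_bound'[OF P ws, of l 1 C] l by (auto simp del: atLeastAtMost_iff)
    have lk: "l + 0 < k" using less.prems by simp
    obtain K where K: "\<And>u v g. u \<in> {0..1} \<Longrightarrow> v \<in> {0..1} \<Longrightarrow> g \<in> wball M (w (Suc (l + 0))) C \<Longrightarrow>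
       (\<lambda>x. P 0 v g x - P 0 u g x) \<in> wball M (w l) (K * C * \<bar>v - u\<bar>)" "K > 0"
      using kernel_op_lipschitz[OF P lk] C(1) by blast
    note Du = fcontD(1)[OF stat_deriv_fcont[OF l(1)] u]
    have lim1: "(\<lambda>n. (stat_source l (U n) (\<phi> n) - stat_source l u (\<phi> n)) / (U n - u) -
        (\<Sum>i\<in>{1..l}. real (l choose i) * (stat_deriv (Suc (l - i)) u (P i u (\<phi> n)) + stat_deriv (l - i) u (P (Suc i) u (\<phi> n))))) \<longlonglongrightarrow> 0"
      by (rule fderivD[OF source u U1 U(2) C(2)])
    let ?Q = "\<lambda>n x. (1 / (U n - u)) * (P 0 (U n) (\<phi> n) x - P 0 u (\<phi> n) x)"
    have KD: "(\<lambda>x. P 0 (U n) (\<phi> n) x - P 0 u (\<phi> n) x) \<in> wball M (w l) (K * C * \<bar>U n - u\<bar>)" for n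
      by (rule K(1)[OF u U01]) (use C in auto)
    have Q: "?Q n \<in> wball M (w l) (K * C)" for n
      by (rule wball_mono[OF wball_scale[OF KD]]) (use Une in \<open>simp add: field_simps\<close>)
    have "(\<lambda>n. stat_deriv l u (?Q n) - stat_deriv l u (P 1 u (\<phi> n))) \<longlonglongrightarrow> 0"
    proof (rule wfunctional_tendsto_diff[OF Du Q B[OF u C(2)]])
      fix x assume "x \<in> space M"
      then have "(\<lambda>n. (P 0 (U n) (\<phi> n) x - P 0 u (\<phi> n) x) / (U n - u) - P (Suc 0) u (\<phi> n) x) \<longlonglongrightarrow> 0"
        by (intro fderivD[OF kernel_op_fderiv[OF P] u U1 U(2)]) (use l Cl in auto)
      then show "(\<lambda>n. ?Q n x - P 1 u (\<phi> n) x) \<longlonglongrightarrow> 0" by simp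
    qed
    moreover have "stat_deriv l u (?Q n) = stat_deriv l u (\<lambda>x. P 0 (U n) (\<phi> n) x - P 0 u (\<phi> n) x) / (U n - u)" for n
      using wfunctional_scale[OF Du KD, of "1 / (U n - u)"] by simp
    ultimately have lim2: "(\<lambda>n. stat_deriv l u (\<lambda>x. P 0 (U n) (\<phi> n) x - P 0 u (\<phi> n) x) / (U n - u) - stat_deriv l u (P 1 u (\<phi> n))) \<longlonglongrightarrow> 0"
      by simp
    have Su: "wfunctional M (w (Suc l)) (stat_source (Suc l) u)"
      by (rule fcontD(1)[OF stat_source_fcont[OF l(2) stat_deriv_fcont] u]) (use l in auto)
    \<comment> \<open>So far the Poisson solution belongs to the moving parameter. It is replaced by
      the one at \<open>u\<close>; as all of them lie in one ball, convergence at each point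
      suffices.\<close>
    have lim3: "(\<lambda>n. stat_source (Suc l) u (\<phi> n) - stat_source (Suc l) u (poisson u (G n))) \<longlonglongrightarrow> 0"
      by (rule wfunctional_tendsto_diff[OF Su C(2,3)], unfold \<phi>_def)
         (rule fcontD(2)[OF poisson_fcont u U01 U(2) Cl(5)])
    have "(\<lambda>n. (stat_source l (U n) (\<phi> n) - stat_source l u (\<phi> n) + stat_deriv l u (\<lambda>x. P 0 (U n) (\<phi> n) x - P 0 u (\<phi> n) x)) / (U n - u)
       - stat_source (Suc l) u (poisson u (G n))) \<longlonglongrightarrow> 0"
      using tendsto_add[OF tendsto_add[OF lim1 lim2] lim3] unfolding stat_source_Suc[symmetric, of l u "\<phi> _"]
      by (simp add: add_divide_distrib diff_divide_distrib algebra_simps)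
    then show "(\<lambda>n. (stat_deriv l (U n) (G n) - stat_deriv l u (G n)) / (U n - u) - stat_deriv (Suc l) u (G n)) \<longlonglongrightarrow> 0"
      unfolding stat_deriv_difference[OF l(1) u U01 Cl(4)] stat_deriv_Suc \<phi>_def by simp
  qed
qed

lemma stat_deriv_smooth: "smooth_family k M w stat_deriv"
  unfolding smooth_family_def using stat_deriv_fcont stat_deriv_fderiv by simp

text \<open>The perturbation identity at order 0. The increment of the kernel costs one step of the
  scale, hence the weight \<open>w 1\<close> of the test functions.\<close>

lemma stat_lipschitz:
  assumes k: "1 \<le> k"
  obtains C where "C > 0" "\<And>u v c g. u \<in> {0..1} \<Longrightarrow> v \<in> {0..1} \<Longrightarrow> 0 \<le> c \<Longrightarrow> g \<in> wball M (w 1) c \<Longrightarrow>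
     \<bar>stat v g - stat u g\<bar> \<le> C * c * \<bar>v - u\<bar>"
proof -
  obtain A \<rho> where A: "A > 0" "0 \<le> \<rho>" "\<rho> < 1"
    "\<And>u c g. u \<in> {0..1} \<Longrightarrow> 0 \<le> c \<Longrightarrow> g \<in> wball M (w 1) c \<Longrightarrow> poisson u g \<in> wball M (w 1) (A * c)"
    and "\<And>u c g N. u \<in> {0..1} \<Longrightarrow> 0 \<le> c \<Longrightarrow> g \<in> wball M (w 1) c \<Longrightarrow>
       (\<lambda>x. \<Sum>n<N. iterate n u g x - stat u g) \<in> wball M (w 1) (A * c)"
    "\<And>u c g N x. u \<in> {0..1} \<Longrightarrow> 0 \<le> c \<Longrightarrow> g \<in> wball M (w 1) c \<Longrightarrow> x \<in> space M \<Longrightarrow>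
       \<bar>poisson u g x - (\<Sum>n<N. iterate n u g x - stat u g)\<bar> \<le> A * c * w 1 x * \<rho> ^ N"
    by (rule poisson_estimates[OF k]) (rule that)
  obtain K where K: "K > 0" "\<And>u v c g. u \<in> {0..1} \<Longrightarrow> v \<in> {0..1} \<Longrightarrow> 0 \<le> c \<Longrightarrow> g \<in> wball M (w 1) c \<Longrightarrow>
       (\<lambda>x. P 0 v g x - P 0 u g x) \<in> wball M (w 0) (K * c * \<bar>v - u\<bar>)"
    using kernel_op_lipschitz[OF P, of 0 0] k by auto
  obtain B where B: "B > 0" "\<And>u c g. u \<in> {0..1} \<Longrightarrow> 0 \<le> c \<Longrightarrow> g \<in> wball M (w 0) c \<Longrightarrow> \<bar>stat u g\<bar> \<le> B * c"
    by (rule stat_bounded[OF le0]) (rule that)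
  show ?thesis
  proof (rule that[of "B * K * A"])
    fix u v :: real and c g assume *: "u \<in> {0..1}" "v \<in> {0..1}" "0 \<le> c" "g \<in> wball M (w 1) c"
    have "\<bar>stat u (\<lambda>x. P 0 v (poisson v g) x - P 0 u (poisson v g) x)\<bar> \<le> B * (K * (A * c) * \<bar>v - u\<bar>)"
      by (rule B(2)[OF *(1) _ K(2)[OF *(1,2) _ A(4)[OF *(2,3,4)]]]) (use A(1) K(1) *(3) in auto)
    then show "\<bar>stat v g - stat u g\<bar> \<le> B * K * A * c * \<bar>v - u\<bar>"
      using stat_deriv_difference[of 0 u v g, OF _ *(1,2) wball_0[OF k *(4)]] by (simp add: algebra_simps)
  qed (use A B K in auto)
qed

end

section \<open>Drift and minorization\<close>

text \<open>Oscillation against norm: centring at the supremum of \<open>g - \<phi>\<close> turns a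
  bound on the weighted oscillation into one on the function itself.\<close>

lemma ex_center:
  fixes g :: "'a \<Rightarrow> real"
  assumes "\<And>x y. x \<in> A \<Longrightarrow> y \<in> A \<Longrightarrow> \<bar>g x - g y\<bar> \<le> \<phi> x + \<phi> y"
  shows "\<exists>c. \<forall>x\<in>A. \<bar>g x - c\<bar> \<le> \<phi> x"
proof (cases "A = {}")
  case False
  let ?c = "SUP x\<in>A. g x - \<phi> x"
  have le: "g x - \<phi> x \<le> g y + \<phi> y" if "x \<in> A" "y \<in> A" for x y
    using assms[OF that] by linarith
  obtain y0 where "y0 \<in> A" using False by blast
  then have bdd: "bdd_above ((\<lambda>x. g x - \<phi> x) ` A)" using le by (intro bdd_aboveI2[of _ _ "g y0 + \<phi> y0"]) auto
  have "\<bar>g x - ?c\<bar> \<le> \<phi> x" if x: "x \<in> A" for x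
  proof -
    have "g x - \<phi> x \<le> ?c" by (rule cSUP_upper[OF x bdd])
    moreover have "?c \<le> g x + \<phi> x" by (rule cSUP_least[OF False]) (use le x in auto)
    ultimately show ?thesis by linarith
  qed
  then show ?thesis by blast
qed simp

text \<open>The minorization is put in functional form: for a test function dominated by
  \<open>s * \<phi>\<close> with \<open>\<phi> \<ge> 1\<close>, two starting points of a level set
  gain \<open>2 * s * \<eta>\<close> over the trivial bound. No reference measure has to be named,
  and \<open>\<eta>\<close> depends on the level alone, not on the parameters in the list.\<close>

locale harris_ops = markov_ops M V P for M :: "'a measure" and V P +
  fixes \<gamma> K :: real and p :: nat
  assumes op_pos: "\<And>u g c x. u \<in> {0..1} \<Longrightarrow> g \<in> wball M V c \<Longrightarrow> (\<And>x. x \<in> space M \<Longrightarrow> 0 \<le> g x) \<Longrightarrow> x \<in> space M \<Longrightarrow> 0 \<le> P u g x"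
    and V_meas: "V \<in> borel_measurable M"
    and drift: "\<And>u x. u \<in> {0..1} \<Longrightarrow> x \<in> space M \<Longrightarrow> P u V x \<le> \<gamma> * V x + K"
    and \<gamma>: "0 \<le> \<gamma>" "\<gamma> < 1" and K: "0 \<le> K" and p: "1 \<le> p"
    and minor: "\<And>R. \<exists>\<eta>>0. \<forall>us x y g \<phi> c d s. set us \<subseteq> {0..1} \<longrightarrow> length us = p \<longrightarrow> x \<in> space M \<longrightarrow> y \<in> space M \<longrightarrow>
       V x \<le> R \<longrightarrow> V y \<le> R \<longrightarrow> g \<in> wball M V c \<longrightarrow> \<phi> \<in> wball M V d \<longrightarrow> 0 \<le> s \<longrightarrow> (\<forall>z\<in>space M. 1 \<le> \<phi> z) \<longrightarrow>
       (\<forall>z\<in>space M. \<bar>g z\<bar> \<le> s * \<phi> z) \<longrightarrow>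
       \<bar>kernel_iter P us g x - kernel_iter P us g y\<bar> \<le> s * (kernel_iter P us \<phi> x + kernel_iter P us \<phi> y - 2 * \<eta>)"
begin

lemma V_wball: "V \<in> wball M V 1"
  using V_meas V_ge1 by (intro wballI) (auto intro: order.trans[OF zero_le_one])

lemma iter_mono:
  assumes "set us \<subseteq> {0..1}" "g \<in> wball M V c" "h \<in> wball M V d" "\<And>x. x \<in> space M \<Longrightarrow> g x \<le> h x" "x \<in> space M"
  shows "kernel_iter P us g x \<le> kernel_iter P us h x"
  using assms(1,5)
proof (induction us arbitrary: x)
  case (Cons u us)
  then have u: "u \<in> {0..1}" and us: "set us \<subseteq> {0..1}" by auto
  obtain C where C: "kernel_iter P us g \<in> wball M V C" using iter_ex_wball[OF assms(2) us] by blast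
  obtain D where D: "kernel_iter P us h \<in> wball M V D" using iter_ex_wball[OF assms(3) us] by blast
  have "0 \<le> P u (\<lambda>x. kernel_iter P us h x - kernel_iter P us g x) x"
    by (rule op_pos[OF u wball_diff[OF D C] _ Cons.prems(2)]) (use Cons.IH[OF us] in auto)
  then show ?case
    using wfunctional_diff[OF op_functional[OF u Cons.prems(2)] D C] by simp
qed (use assms(4) in simp)

text \<open>The additive constants sum up geometrically, so they stay below
  \<open>K / (1 - \<gamma>)\<close> for lists of any length and any parameters.\<close>

lemma iter_drift:
  assumes "set us \<subseteq> {0..1}" "x \<in> space M"
  shows "kernel_iter P us V x \<le> \<gamma> ^ length us * V x + K * (1 - \<gamma> ^ length us) / (1 - \<gamma>)"
  using assms
proof (induction us arbitrary: x)
  case (Cons u us)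
  then have u: "u \<in> {0..1}" and us: "set us \<subseteq> {0..1}" by auto
  let ?a = "\<gamma> ^ length us" and ?b = "K * (1 - \<gamma> ^ length us) / (1 - \<gamma>)"
  obtain C where C: "kernel_iter P us V \<in> wball M V C" using iter_ex_wball[OF V_wball us] by blast
  have bnd: "(\<lambda>x. ?a * V x + ?b * 1) \<in> wball M V (\<bar>?a\<bar> * 1 + \<bar>?b\<bar> * \<bar>1\<bar>)"
    by (rule wball_lincomb[OF V_wball const_wball_V])
  have "P u (kernel_iter P us V) x \<le> P u (\<lambda>x. ?a * V x + ?b * 1) x"
    using iter_mono[of "[u]", OF _ C bnd _ Cons.prems(2)] u Cons.IH[OF us] by simp
  also have "\<dots> = ?a * P u V x + ?b"
    using wfunctional_lincomb[OF op_functional[OF u Cons.prems(2)] V_wball const_wball_V[of 1], of ?a ?b]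
      op_one[OF u Cons.prems(2)] by simp
  also have "\<dots> \<le> ?a * (\<gamma> * V x + K) + ?b"
    using mult_left_mono[OF drift[OF u Cons.prems(2)], of ?a] \<gamma> by simp
  also have "\<dots> = \<gamma> ^ length (u # us) * V x + K * (1 - \<gamma> ^ length (u # us)) / (1 - \<gamma>)"
    using \<gamma> by (simp add: field_simps)
  finally show ?case by simp
qed simp

definition K' :: real where "K' = K / (1 - \<gamma>)"

lemma K'_nonneg: "0 \<le> K'"
  using K \<gamma> by (simp add: K'_def)

lemma iter_drift':
  assumes "set us \<subseteq> {0..1}" "x \<in> space M"
  shows "kernel_iter P us V x \<le> \<gamma> ^ length us * V x + K'"
proof -
  have "K * (1 - \<gamma> ^ length us) \<le> K * 1" by (rule mult_left_mono) (use K \<gamma> in auto)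
  then have "K * (1 - \<gamma> ^ length us) / (1 - \<gamma>) \<le> K'" using \<gamma> by (simp add: K'_def divide_right_mono)
  with iter_drift[OF assms] show ?thesis by linarith
qed

lemma iter_abs_le:
  assumes "set us \<subseteq> {0..1}" "g \<in> wball M V c" "\<phi> \<in> wball M V d" "\<And>x. x \<in> space M \<Longrightarrow> \<bar>g x\<bar> \<le> s * \<phi> x" "x \<in> space M"
  shows "\<bar>kernel_iter P us g x\<bar> \<le> s * kernel_iter P us \<phi> x"
proof -
  have g': "(\<lambda>x. - 1 * g x) \<in> wball M V (\<bar>- 1\<bar> * c)" by (rule wball_scale[OF assms(2)])
  have 1: "kernel_iter P us (\<lambda>x. s * \<phi> x) x = s * kernel_iter P us \<phi> x"
    using iter_lincomb[OF assms(1,3,3,5), of s 0] by simp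
  have 2: "kernel_iter P us (\<lambda>x. - 1 * g x) x = - kernel_iter P us g x"
    using iter_lincomb[OF assms(1,2,2,5), of "-1" 0] by simp
  have "kernel_iter P us g x \<le> kernel_iter P us (\<lambda>x. s * \<phi> x) x"
    by (rule iter_mono[OF assms(1,2) wball_scale[OF assms(3)] _ assms(5)]) (use assms(4) abs_le_D1 in blast)
  moreover have "kernel_iter P us (\<lambda>x. - 1 * g x) x \<le> kernel_iter P us (\<lambda>x. s * \<phi> x) x"
    by (rule iter_mono[OF assms(1) g' wball_scale[OF assms(3)] _ assms(5)]) (use assms(4) abs_le_D2 in fastforce)
  ultimately show ?thesis using 1 2 by simp
qed

lemma iter_stable:
  assumes us: "set us \<subseteq> {0..1}" and c: "0 \<le> c" and g: "g \<in> wball M V c"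
  shows "kernel_iter P us g \<in> wball M V ((1 + K') * c)"
proof (rule wballI)
  show "kernel_iter P us g \<in> borel_measurable M"
    using iter_ex_wball[OF g us] wballD(1) by blast
  fix x assume x: "x \<in> space M"
  have "\<bar>kernel_iter P us g x\<bar> \<le> c * kernel_iter P us V x"
    by (rule iter_abs_le[OF us g V_wball wballD(2)[OF g] x])
  also have "kernel_iter P us V x \<le> (1 + K') * V x"
  proof -
    have "\<gamma> ^ length us * V x \<le> 1 * V x" "K' * 1 \<le> K' * V x"
      using V_ge1[OF x] \<gamma> K'_nonneg by (intro mult_right_mono mult_left_mono power_le_one; simp)+
    then show ?thesis using iter_drift'[OF us x] by (simp add: algebra_simps)
  qed
  finally have "\<bar>kernel_iter P us g x\<bar> \<le> c * ((1 + K') * V x)"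
    using c by (simp add: mult_left_mono)
  then show "\<bar>kernel_iter P us g x\<bar> \<le> (1 + K') * c * V x"
    by (simp add: mult_ac)
qed

text \<open>Where \<open>V\<close> is large the drift contracts the weighted oscillation; where it is small the
  minorization does, provided that \<open>V\<close> enters the weight with a small coefficient \<open>b\<close>.\<close>

lemma block_contraction:
  obtains b \<alpha> where "0 < b" "\<alpha> < 1" "0 < \<alpha>"
    "\<And>us g c s x y. set us \<subseteq> {0..1} \<Longrightarrow> length us = p \<Longrightarrow> g \<in> wball M V c \<Longrightarrow> 0 \<le> s \<Longrightarrow>
       \<forall>x\<in>space M. \<forall>y\<in>space M. \<bar>g x - g y\<bar> \<le> s * (2 + b * V x + b * V y) \<Longrightarrow>
       x \<in> space M \<Longrightarrow> y \<in> space M \<Longrightarrow>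
       \<bar>kernel_iter P us g x - kernel_iter P us g y\<bar> \<le> \<alpha> * s * (2 + b * V x + b * V y)"
proof -
  \<comment> \<open>Beyond this level half of the gain \<open>1 - \<gamma>\<close> absorbs the
    additive constant \<open>K'\<close> of both points.\<close>
  define R where "R = 4 * K' / (1 - \<gamma>)"
  obtain \<eta>' where \<eta>': "\<eta>' > 0" and min: "\<And>us x y g \<phi> c d s. set us \<subseteq> {0..1} \<Longrightarrow> length us = p \<Longrightarrow> x \<in> space M \<Longrightarrow> y \<in> space M \<Longrightarrow>
       V x \<le> R \<Longrightarrow> V y \<le> R \<Longrightarrow> g \<in> wball M V c \<Longrightarrow> \<phi> \<in> wball M V d \<Longrightarrow> 0 \<le> s \<Longrightarrow> (\<forall>z\<in>space M. 1 \<le> \<phi> z) \<Longrightarrow>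
       (\<forall>z\<in>space M. \<bar>g z\<bar> \<le> s * \<phi> z) \<Longrightarrow>
       \<bar>kernel_iter P us g x - kernel_iter P us g y\<bar> \<le> s * (kernel_iter P us \<phi> x + kernel_iter P us \<phi> y - 2 * \<eta>')"
    using minor[of R] by blast
  define \<eta> where "\<eta> = min \<eta>' 1"
  \<comment> \<open>So small that the additive drift constants of both points, weighted by
    \<open>b\<close>, use up at most half of the gain \<open>2 * \<eta>\<close> of the
    minorization.\<close>
  define b where "b = \<eta> / (2 * K' + 1)"
  define \<gamma>' where "\<gamma>' = (1 + \<gamma>) / 2"
  \<comment> \<open>The first bound serves outside the level set, the other two inside it.\<close>
  define \<delta> where "\<delta> = min (b * (1 - \<gamma>') / (2 + b)) (min (\<eta> / 2) ((1 - \<gamma>) / 2))"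
  have \<eta>: "0 < \<eta>" "\<eta> \<le> 1" "\<eta> \<le> \<eta>'" using \<eta>' by (auto simp: \<eta>_def)
  have b: "0 < b" "2 * b * K' \<le> \<eta>" using \<eta> K'_nonneg by (auto simp: b_def field_simps)
  have \<gamma>': "\<gamma> \<le> \<gamma>'" "\<gamma>' < 1" using \<gamma> by (auto simp: \<gamma>'_def)
  have \<delta>: "0 < \<delta>" "\<delta> \<le> 1/2" "\<delta> * (2 + b) \<le> b * (1 - \<gamma>')" "2 * \<delta> \<le> \<eta>" "\<delta> \<le> 1 - \<gamma>"
  proof -
    have le: "\<delta> \<le> b * (1 - \<gamma>') / (2 + b)" "\<delta> \<le> \<eta> / 2" "\<delta> \<le> (1 - \<gamma>) / 2"
      unfolding \<delta>_def by (rule min.cobounded1 min.coboundedI2[OF min.cobounded1] min.coboundedI2[OF min.cobounded2])+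
    have "\<delta> * (2 + b) \<le> b * (1 - \<gamma>') / (2 + b) * (2 + b)"
      by (rule mult_right_mono[OF le(1)]) (use b in auto)
    then show "\<delta> * (2 + b) \<le> b * (1 - \<gamma>')" using b by simp
    show "0 < \<delta>" using b \<eta> \<gamma> \<gamma>' by (simp add: \<delta>_def)
    show "\<delta> \<le> 1 / 2" "2 * \<delta> \<le> \<eta>" "\<delta> \<le> 1 - \<gamma>" using le(2,3) \<gamma> by auto
  qed
  have main: "\<bar>kernel_iter P us g x - kernel_iter P us g y\<bar> \<le> (1 - \<delta>) * s * (2 + b * V x + b * V y)"
    if us: "set us \<subseteq> {0..1}" and len: "length us = p" and g: "g \<in> wball M V c" and s: "0 \<le> s" and
       osc: "\<forall>x\<in>space M. \<forall>y\<in>space M. \<bar>g x - g y\<bar> \<le> s * (2 + b * V x + b * V y)" and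
       x: "x \<in> space M" and y: "y \<in> space M" for us g c s x y
  proof -
    define \<phi> where "\<phi> x = 1 * 1 + b * V x" for x
    have \<phi>: "\<phi> \<in> wball M V (\<bar>1\<bar> * \<bar>1\<bar> + \<bar>b\<bar> * 1)"
      unfolding \<phi>_def[abs_def] by (rule wball_lincomb[OF const_wball_V V_wball])
    have \<phi>_ge1: "1 \<le> \<phi> z" if "z \<in> space M" for z
      using mult_nonneg_nonneg[of b "V z"] V_ge1[OF that] b by (simp add: \<phi>_def)
    \<comment> \<open>Only the oscillation of \<open>g\<close> is controlled. After centring, the
      function is dominated by \<open>s * \<phi>\<close>, and positivity of the kernels can be
      used.\<close>
    have "\<exists>c. \<forall>x\<in>space M. \<bar>g x - c\<bar> \<le> s * \<phi> x"
      by (rule ex_center) (use osc in \<open>simp add: \<phi>_def algebra_simps\<close>)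
    then obtain a where a: "\<And>x. x \<in> space M \<Longrightarrow> \<bar>g x - a\<bar> \<le> s * \<phi> x" by blast
    define h where "h x = g x - a" for x
    have h: "h \<in> wball M V (c + \<bar>a\<bar>)" unfolding h_def by (rule wball_diff[OF g const_wball_V])
    have hg: "kernel_iter P us h z = kernel_iter P us g z - a" if "z \<in> space M" for z
      unfolding h_def by (rule iter_diff_const[OF us g that])
    define S where "S = V x + V y"
    have S: "S \<ge> 1" using V_ge1[OF x] V_ge1[OF y] by (simp add: S_def)
    have "\<gamma> ^ length us * V z \<le> \<gamma> ^ 1 * V z" if "z \<in> space M" for z
      by (intro mult_right_mono power_decreasing) (use len p \<gamma> V_ge1[OF that] in auto)
    then have dr: "kernel_iter P us V z \<le> \<gamma> * V z + K'" if "z \<in> space M" for z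
      using iter_drift'[OF us that] that by fastforce
    have \<phi>1: "kernel_iter P us \<phi> z = 1 + b * kernel_iter P us V z" if "z \<in> space M" for z
      using iter_lincomb[OF us const_wball_V[of 1] V_wball that, of 1 b] iter_const[OF us that] by (simp add: \<phi>_def[abs_def])
    have "kernel_iter P us \<phi> x + kernel_iter P us \<phi> y \<le> 2 + b * (\<gamma> * V x + K') + b * (\<gamma> * V y + K')"
    proof -
      have "b * kernel_iter P us V z \<le> b * (\<gamma> * V z + K')" if "z \<in> space M" for z
        by (rule mult_left_mono[OF dr[OF that]]) (use b in auto)
      from this[OF x] this[OF y] show ?thesis using \<phi>1[OF x] \<phi>1[OF y] by linarith
    qed
    then have \<phi>2: "kernel_iter P us \<phi> x + kernel_iter P us \<phi> y \<le> 2 + b * \<gamma> * S + 2 * b * K'"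
      by (simp add: S_def algebra_simps)
    have "\<exists>t. \<bar>kernel_iter P us h x - kernel_iter P us h y\<bar> \<le> s * t \<and> t \<le> (1 - \<delta>) * (2 + b * S)"
    proof (cases "V x \<le> R \<and> V y \<le> R")
      case True
      have "\<bar>kernel_iter P us h x - kernel_iter P us h y\<bar> \<le> s * (kernel_iter P us \<phi> x + kernel_iter P us \<phi> y - 2 * \<eta>')"
        by (rule min[OF us len x y _ _ h \<phi> s])
           (use True a \<phi>_ge1 in \<open>auto simp: h_def\<close>)
      moreover have "kernel_iter P us \<phi> x + kernel_iter P us \<phi> y - 2 * \<eta>' \<le> (1 - \<delta>) * (2 + b * S)"
      proof -
        have "\<delta> * (b * S) \<le> (1 - \<gamma>) * (b * S)" by (rule mult_right_mono) (use \<delta> b S in auto)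
        then have "2 - \<eta> + b * \<gamma> * S \<le> (1 - \<delta>) * (2 + b * S)" using \<delta>(4) by (simp add: algebra_simps)
        then show ?thesis using \<phi>2 b(2) \<eta>(3) by linarith
      qed
      ultimately show ?thesis by blast
    next
      case False
      then have SR: "R \<le> S" using V_ge1[OF x] V_ge1[OF y] by (auto simp: S_def)
      have "\<bar>kernel_iter P us h z\<bar> \<le> s * kernel_iter P us \<phi> z" if "z \<in> space M" for z
        by (rule iter_abs_le[OF us h \<phi> _ that]) (use a in \<open>simp add: h_def\<close>)
      from this[OF x] this[OF y]
      have "\<bar>kernel_iter P us h x - kernel_iter P us h y\<bar> \<le> s * (kernel_iter P us \<phi> x + kernel_iter P us \<phi> y)"
        by (simp add: algebra_simps)
      moreover have "kernel_iter P us \<phi> x + kernel_iter P us \<phi> y \<le> (1 - \<delta>) * (2 + b * S)"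
      proof -
        have "2 * K' \<le> (1 - \<gamma>) / 2 * S" using SR \<gamma> by (simp add: R_def field_simps)
        from mult_left_mono[OF this, of b] b have "b * \<gamma> * S + 2 * b * K' \<le> b * \<gamma>' * S"
          by (simp add: \<gamma>'_def algebra_simps)
        moreover have "\<delta> * (2 + b * S) \<le> \<delta> * ((2 + b) * S)"
          by (rule mult_left_mono) (use S \<delta> in \<open>auto simp: algebra_simps\<close>)
        moreover have "\<delta> * (2 + b) * S \<le> b * (1 - \<gamma>') * S" by (rule mult_right_mono) (use S \<delta> in auto)
        ultimately show ?thesis using \<phi>2 by (simp add: algebra_simps)
      qed
      ultimately show ?thesis by blast
    qed
    then obtain t where t: "\<bar>kernel_iter P us h x - kernel_iter P us h y\<bar> \<le> s * t" "t \<le> (1 - \<delta>) * (2 + b * S)" by blast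
    have "s * t \<le> s * ((1 - \<delta>) * (2 + b * S))" by (rule mult_left_mono[OF t(2) s])
    with t(1) show ?thesis using hg[OF x] hg[OF y] by (simp add: S_def algebra_simps)
  qed
  show ?thesis by (rule that[OF b(1) _ _ main]) (use \<delta> in auto)
qed

lemma iter_contraction:
  obtains C \<rho> where "C > 0" "0 \<le> \<rho>" "\<rho> < 1"
    "\<And>us c g x y. set us \<subseteq> {0..1} \<Longrightarrow> 0 \<le> c \<Longrightarrow> g \<in> wball M V c \<Longrightarrow> x \<in> space M \<Longrightarrow> y \<in> space M \<Longrightarrow>
       \<bar>kernel_iter P us g x - kernel_iter P us g y\<bar> \<le> C * c * \<rho> ^ length us * (V x + V y)"
proof -
  obtain b \<alpha> where b: "0 < b" and \<alpha>: "\<alpha> < 1" "0 < \<alpha>" and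
    block: "\<And>us g c s x y. set us \<subseteq> {0..1} \<Longrightarrow> length us = p \<Longrightarrow> g \<in> wball M V c \<Longrightarrow> 0 \<le> s \<Longrightarrow>
       \<forall>x\<in>space M. \<forall>y\<in>space M. \<bar>g x - g y\<bar> \<le> s * (2 + b * V x + b * V y) \<Longrightarrow>
       x \<in> space M \<Longrightarrow> y \<in> space M \<Longrightarrow>
       \<bar>kernel_iter P us g x - kernel_iter P us g y\<bar> \<le> \<alpha> * s * (2 + b * V x + b * V y)"
    by (rule block_contraction) (rule that)
  define S where "S = (1 + K') / b"
  have S: "S > 0" using b K'_nonneg by (simp add: S_def)
  have iter: "\<bar>kernel_iter P us g x - kernel_iter P us g y\<bar> \<le> \<alpha> ^ (length us div p) * (S * c) * (2 + b * V x + b * V y)"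
    if "set us \<subseteq> {0..1}" "0 \<le> c" "g \<in> wball M V c" "x \<in> space M" "y \<in> space M" for us g c x y
    using that
  proof (induction "length us" arbitrary: us x y rule: less_induct)
    case less
    show ?case
    proof (cases "length us < p")
      case True
      have "\<bar>kernel_iter P us g z\<bar> \<le> S * c * (b * V z)" if "z \<in> space M" for z
        using wballD(2)[OF iter_stable[OF less.prems(1-3)] that] b by (simp add: S_def)
      from this[OF less.prems(4)] this[OF less.prems(5)]
      have "\<bar>kernel_iter P us g x - kernel_iter P us g y\<bar> \<le> S * c * (b * V x + b * V y)" by (simp add: algebra_simps)
      also have "\<dots> \<le> S * c * (2 + b * V x + b * V y)"
        by (rule mult_left_mono) (use S less.prems in auto)
      finally show ?thesis using True by simp
    next
      case False
      \<comment> \<open>The front of the list acts last, so the block contraction applies to a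
        function already contracted by the rest.\<close>
      define vs ws where "vs = take p us" and "ws = drop p us"
      have us: "us = vs @ ws" by (simp add: vs_def ws_def)
      have sub: "set vs \<subseteq> {0..1}" "set ws \<subseteq> {0..1}" using less.prems(1) by (auto simp: us)
      have len: "length vs = p" "length us div p = Suc (length ws div p)" "length ws < length us"
        using False p by (auto simp: vs_def ws_def le_div_geq)
      obtain d where d: "kernel_iter P ws g \<in> wball M V d" using iter_ex_wball[OF less.prems(3) sub(2)] by blast
      have "\<bar>kernel_iter P vs (kernel_iter P ws g) x - kernel_iter P vs (kernel_iter P ws g) y\<bar>
          \<le> \<alpha> * (\<alpha> ^ (length ws div p) * (S * c)) * (2 + b * V x + b * V y)"
        by (rule block[OF sub(1) len(1) d _ _ less.prems(4,5)])
           (use \<alpha> S less.prems less.hyps[OF len(3) sub(2)] in auto)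
      then show ?thesis unfolding len(2) by (simp add: us mult_ac)
    qed
  qed
  \<comment> \<open>Chosen so that \<open>\<rho> ^ p = \<alpha>\<close>.\<close>
  define \<rho> where "\<rho> = \<alpha> powr (1 / real p)"
  have \<rho>: "0 \<le> \<rho>" "\<rho> < 1" using \<alpha> p using powr_less_mono2[of "1 / real p" \<alpha> 1] by (auto simp: \<rho>_def)
  \<comment> \<open>An incomplete block loses at most one factor \<open>\<alpha>\<close>, which goes
    into the constant.\<close>
  have pow: "\<alpha> ^ (n div p) \<le> \<rho> ^ n / \<alpha>" for n
  proof -
    have "\<rho> ^ n = \<alpha> powr (real n / real p)"
      using \<alpha> by (simp add: \<rho>_def powr_realpow[symmetric] powr_powr)
    moreover have "real n / real p \<le> real (n div p) + 1"
    proof -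
      have "real n = real p * real (n div p) + real (n mod p)"
        by (metis mult_div_mod_eq of_nat_add of_nat_mult)
      moreover have "real (n mod p) \<le> real p" using p by simp
      ultimately have "real n \<le> real p * (real (n div p) + 1)" by (simp add: algebra_simps)
      then show ?thesis using p by (simp add: field_simps)
    qed
    ultimately have "\<alpha> powr (real (n div p) + 1) \<le> \<rho> ^ n"
      using \<alpha> by (simp add: powr_mono')
    then have "\<alpha> ^ (n div p) * \<alpha> \<le> \<rho> ^ n"
      using \<alpha> by (simp add: powr_add powr_realpow)
    then show ?thesis using \<alpha> by (simp add: field_simps)
  qed
  show ?thesis
  proof (rule that[of "S * (1 + b) / \<alpha>" \<rho>])
    fix us :: "real list" and c g x y assume *: "set us \<subseteq> {0..1}" "0 \<le> (c::real)" "g \<in> wball M V c" "x \<in> space M" "y \<in> space M"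
    have "\<bar>kernel_iter P us g x - kernel_iter P us g y\<bar> \<le> \<alpha> ^ (length us div p) * (S * c) * (2 + b * V x + b * V y)"
      by (rule iter[OF *])
    also have "\<dots> \<le> (\<rho> ^ length us / \<alpha>) * (S * c) * ((1 + b) * (V x + V y))"
      using V_ge1[OF *(4)] V_ge1[OF *(5)] S *(2) b \<alpha> \<rho> pow
      by (intro mult_mono) (auto simp: algebra_simps intro!: divide_nonneg_nonneg add_nonneg_nonneg mult_nonneg_nonneg)
    finally show "\<bar>kernel_iter P us g x - kernel_iter P us g y\<bar> \<le> S * (1 + b) / \<alpha> * c * \<rho> ^ length us * (V x + V y)"
      by (simp add: mult_ac)
  qed (use S b \<alpha> \<rho> in auto)
qed

text \<open>The drift holds for a Lyapunov function that is only comparable with the weight of the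
  scale. The estimates transfer at the cost of constants, with the same rate.\<close>

lemma equivalent_weight:
  assumes A: "A > 0" "\<And>x. x \<in> space M \<Longrightarrow> V x \<le> A * w x" and B: "B > 0" "\<And>x. x \<in> space M \<Longrightarrow> w x \<le> B * V x"
  shows "\<exists>C>0. \<forall>us c g. set us \<subseteq> {0..1} \<longrightarrow> 0 \<le> c \<longrightarrow> g \<in> wball M w c \<longrightarrow> kernel_iter P us g \<in> wball M w (C * c)"
    and "\<exists>C>0. \<exists>\<rho>. 0 \<le> \<rho> \<and> \<rho> < 1 \<and> (\<forall>us c g x y. set us \<subseteq> {0..1} \<longrightarrow> 0 \<le> c \<longrightarrow>
       g \<in> wball M w c \<longrightarrow> x \<in> space M \<longrightarrow> y \<in> space M \<longrightarrow>
       \<bar>kernel_iter P us g x - kernel_iter P us g y\<bar> \<le> C * c * \<rho> ^ length us * (w x + w y))"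
proof -
  have 1: "g \<in> wball M V (B * c)" if "g \<in> wball M w c" "0 \<le> c" for g c
    using that(1) by (rule wball_mono) (use mult_left_mono[OF B(2) that(2)] in \<open>simp add: mult_ac\<close>)
  have 2: "g \<in> wball M w (A * c)" if "g \<in> wball M V c" "0 \<le> c" for g c
    using that(1) by (rule wball_mono) (use mult_left_mono[OF A(2) that(2)] in \<open>simp add: mult_ac\<close>)
  show "\<exists>C>0. \<forall>us c g. set us \<subseteq> {0..1} \<longrightarrow> 0 \<le> c \<longrightarrow> g \<in> wball M w c \<longrightarrow> kernel_iter P us g \<in> wball M w (C * c)"
  proof (intro exI[of _ "A * (1 + K') * B"] conjI allI impI)
    fix us :: "real list" and c g assume *: "set us \<subseteq> {0..1}" "0 \<le> (c::real)" "g \<in> wball M w c"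
    have "kernel_iter P us g \<in> wball M w (A * ((1 + K') * (B * c)))"
      by (intro 2 iter_stable 1 *) (use * B K'_nonneg in auto)
    then show "kernel_iter P us g \<in> wball M w (A * (1 + K') * B * c)" by (simp add: mult_ac)
  qed (use A B K'_nonneg in auto)
  obtain C \<rho> where C: "C > 0" "0 \<le> \<rho>" "\<rho> < 1" and
    bd: "\<And>us c g x y. set us \<subseteq> {0..1} \<Longrightarrow> 0 \<le> c \<Longrightarrow> g \<in> wball M V c \<Longrightarrow> x \<in> space M \<Longrightarrow> y \<in> space M \<Longrightarrow>
       \<bar>kernel_iter P us g x - kernel_iter P us g y\<bar> \<le> C * c * \<rho> ^ length us * (V x + V y)"
    by (rule iter_contraction) (rule that)
  show "\<exists>C>0. \<exists>\<rho>. 0 \<le> \<rho> \<and> \<rho> < 1 \<and> (\<forall>us c g x y. set us \<subseteq> {0..1} \<longrightarrow> 0 \<le> c \<longrightarrow>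
       g \<in> wball M w c \<longrightarrow> x \<in> space M \<longrightarrow> y \<in> space M \<longrightarrow>
       \<bar>kernel_iter P us g x - kernel_iter P us g y\<bar> \<le> C * c * \<rho> ^ length us * (w x + w y))"
  proof (rule exI[of _ "C * B * A"], intro conjI exI[of _ \<rho>] allI impI)
    fix us :: "real list" and c g x y assume *: "set us \<subseteq> {0..1}" "0 \<le> (c::real)" "g \<in> wball M w c" "x \<in> space M" "y \<in> space M"
    have "\<bar>kernel_iter P us g x - kernel_iter P us g y\<bar> \<le> C * (B * c) * \<rho> ^ length us * (V x + V y)"
      by (rule bd[OF *(1) _ 1 *(4,5)]) (use * B in auto)
    also have "\<dots> \<le> C * (B * c) * \<rho> ^ length us * (A * w x + A * w y)"
      by (rule mult_left_mono) (use A *(2,4,5) B C in \<open>auto intro: add_mono\<close>)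
    finally show "\<bar>kernel_iter P us g x - kernel_iter P us g y\<bar> \<le> C * B * A * c * \<rho> ^ length us * (w x + w y)"
      by (simp add: algebra_simps)
  qed (use A B C in auto)
qed

end

section \<open>Signed measures and functionals\<close>

lemma wball_truncate:
  assumes "g \<in> wball M W c" "\<And>x. x \<in> space M \<Longrightarrow> \<bar>h x\<bar> \<le> \<bar>g x\<bar>" "h \<in> borel_measurable M"
  shows "h \<in> wball M W c"
  using assms by (auto simp: wball_def intro: order.trans)

lemma wball_bounded:
  assumes "\<And>x. x \<in> space M \<Longrightarrow> 1 \<le> W x" "h \<in> borel_measurable M" "\<And>x. x \<in> space M \<Longrightarrow> \<bar>h x\<bar> \<le> b" "0 \<le> b"
  shows "h \<in> wball M W b"
proof (rule wballI[OF assms(2)])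
  fix x assume x: "x \<in> space M"
  have "b * 1 \<le> b * W x" by (rule mult_left_mono[OF assms(1)[OF x] assms(4)])
  then show "\<bar>h x\<bar> \<le> b * W x" using assms(3)[OF x] by simp
qed

lemma wball_integrable:
  assumes "integrable \<mu> W" "sets \<mu> = sets M" "g \<in> wball M W c"
  shows "integrable \<mu> g"
proof (rule Bochner_Integration.integrable_bound[OF integrable_mult_right[OF assms(1), of c]])
  show "g \<in> borel_measurable \<mu>" using wballD(1)[OF assms(3)] by (simp add: measurable_cong_sets[OF assms(2) refl])
  show "AE x in \<mu>. norm (g x) \<le> norm (c * W x)"
    using order.trans[OF wballD(2)[OF assms(3)] abs_ge_self] sets_eq_imp_space_eq[OF assms(2)] by (intro AE_I2) simp
qed

lemma wfunctional_integral:
  assumes W: "integrable M W"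
  shows "wfunctional M W (\<lambda>g. \<integral>x. g x \<partial>M)"
proof -
  note int = wball_integrable[OF W refl]
  show ?thesis
    unfolding wfunctional_def
  proof (intro conjI allI impI)
    fix g h a b c d assume "g \<in> wball M W c" "h \<in> wball M W d"
    then show "(\<integral>x. a * g x + b * h x \<partial>M) = a * (\<integral>x. g x \<partial>M) + b * (\<integral>x. h x \<partial>M)"
      using int by simp
  next
    fix G :: "nat \<Rightarrow> 'a \<Rightarrow> real" and c assume G: "\<forall>n. G n \<in> wball M W c" "\<forall>x\<in>space M. (\<lambda>n. G n x) \<longlonglongrightarrow> 0"
    have "(\<lambda>n. \<integral>x. G n x \<partial>M) \<longlonglongrightarrow> (\<integral>x. 0 \<partial>M)"
      by (rule integral_dominated_convergence[where w = "\<lambda>x. c * W x"])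
         (use G W in \<open>auto simp: wball_def\<close>)
    then show "(\<lambda>n. \<integral>x. G n x \<partial>M) \<longlonglongrightarrow> 0" by simp
  qed
qed

lemma signed_measure_sum:
  assumes \<nu>: "signed_measure M \<nu>" and "A \<in> sets M" "B \<in> sets M" "A \<inter> B = {}"
  shows "\<nu> (A \<union> B) = \<nu> A + \<nu> B"
proof -
  let ?A = "binaryset A B"
  have "range ?A \<subseteq> sets M" "disjoint_family ?A"
    using assms by (auto simp: range_binaryset_eq disjoint_family_on_def binaryset_def)
  then have "(\<lambda>i. \<nu> (?A i)) sums \<nu> (\<Union>i. ?A i)" using \<nu> by (auto simp: signed_measure_def)
  moreover have "(\<lambda>i. \<nu> (?A i)) sums (\<nu> A + \<nu> B)"
    using binaryset_sums[of \<nu> A B] \<nu> by (simp add: signed_measure_def)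
  ultimately show ?thesis using sums_unique2 by (fastforce simp: UN_binaryset_eq)
qed

text \<open>\<open>measure_of\<close> has the intended values only if the set function is countably
  additive. Cutting a subset of a disjoint union along its pieces gives one inequality,
  superadditivity on disjoint sets the other.\<close>

lemma emeasure_upper_variation:
  assumes \<nu>: "signed_measure M \<nu>" and A: "A \<in> sets M"
  shows "emeasure (upper_variation M \<nu>) A = (SUP B\<in>{B \<in> sets M. B \<subseteq> A}. ennreal (\<nu> B))"
proof -
  define F where "F A = (SUP B\<in>{B \<in> sets M. B \<subseteq> A}. ennreal (\<nu> B))" for A
  have upper: "ennreal (\<nu> B) \<le> F A" if "B \<in> sets M" "B \<subseteq> A" for A B
    unfolding F_def by (rule SUP_upper) (use that in auto)
  have empty: "\<nu> {} = 0" using \<nu> by (simp add: signed_measure_def)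
  have super: "F C + F D \<le> F (C \<union> D)" if "C \<inter> D = {}" for C D
  proof -
    have "ennreal (\<nu> B) + ennreal (\<nu> B') \<le> F (C \<union> D)"
      if B: "B \<in> sets M" "B \<subseteq> C" and B': "B' \<in> sets M" "B' \<subseteq> D" for B B'
    proof -
      have "ennreal (\<nu> B) \<le> F (C \<union> D)" "ennreal (\<nu> B') \<le> F (C \<union> D)"
        using B B' by (auto intro!: upper)
      moreover have "ennreal (\<nu> (B \<union> B')) \<le> F (C \<union> D)" using B B' by (auto intro!: upper)
      moreover have "\<nu> (B \<union> B') = \<nu> B + \<nu> B'"
        by (rule signed_measure_sum[OF \<nu> B(1) B'(1)]) (use B B' \<open>C \<inter> D = {}\<close> in auto)
      \<comment> \<open>\<open>ennreal\<close> truncates negative values; if one of the two values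
        is negative, the other set alone is admissible.\<close>
      ultimately show ?thesis
        by (cases "\<nu> B \<ge> 0"; cases "\<nu> B' \<ge> 0") (auto simp: ennreal_plus[symmetric] ennreal_neg simp del: ennreal_plus)
    qed
    then have "F C + ennreal (\<nu> B') \<le> F (C \<union> D)" if "B' \<in> sets M" "B' \<subseteq> D" for B'
      unfolding F_def[of C] using that
      by (subst ennreal_SUP_add_left[symmetric]) (auto intro!: SUP_least)
    then show ?thesis
      unfolding F_def[of D] by (subst ennreal_SUP_add_right) (auto intro!: SUP_least)
  qed
  have "countably_additive (sets M) F"
  proof (rule countably_additiveI)
    fix A :: "nat \<Rightarrow> 'a set" assume A: "range A \<subseteq> sets M" "disjoint_family A"
    have "F (\<Union>i. A i) \<le> (\<Sum>i. F (A i))"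
      unfolding F_def[of "\<Union>i. A i"]
    proof (rule SUP_least)
      fix B assume "B \<in> {B \<in> sets M. B \<subseteq> (\<Union>i. A i)}"
      then have B: "B \<in> sets M" "B \<subseteq> (\<Union>i. A i)" by auto
      have "(\<lambda>i. \<nu> (B \<inter> A i)) sums \<nu> (\<Union>i. B \<inter> A i)"
      proof -
        have "range (\<lambda>i. B \<inter> A i) \<subseteq> sets M" using A B by auto
        moreover have "disjoint_family (\<lambda>i. B \<inter> A i)" using A(2) by (auto simp: disjoint_family_on_def)
        ultimately show ?thesis using \<nu> unfolding signed_measure_def by blast
      qed
      moreover have "(\<Union>i. B \<inter> A i) = B" using B(2) by auto
      ultimately have "(\<lambda>n. \<Sum>i<n. \<nu> (B \<inter> A i)) \<longlonglongrightarrow> \<nu> B" by (simp add: sums_def)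
      then have "(\<lambda>n. ennreal (\<Sum>i<n. \<nu> (B \<inter> A i))) \<longlonglongrightarrow> ennreal (\<nu> B)" by (intro tendsto_ennrealI)
      then show "ennreal (\<nu> B) \<le> (\<Sum>i. F (A i))"
      proof (rule LIMSEQ_le_const2, intro exI allI impI)
        fix n
        have "ennreal (\<Sum>i<n. \<nu> (B \<inter> A i)) \<le> ennreal (\<Sum>i<n. max 0 (\<nu> (B \<inter> A i)))"
          by (intro ennreal_leI sum_mono) simp
        also have "\<dots> = (\<Sum>i<n. ennreal (max 0 (\<nu> (B \<inter> A i))))" by (rule sum_ennreal[symmetric]) simp
        also have "\<dots> \<le> (\<Sum>i<n. F (A i))"
        proof (rule sum_mono)
          fix i
          have "ennreal (max 0 (\<nu> (B \<inter> A i))) = ennreal (\<nu> (B \<inter> A i))" by (simp add: max_def ennreal_neg)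
          also have "\<dots> \<le> F (A i)" using A B by (intro upper) auto
          finally show "ennreal (max 0 (\<nu> (B \<inter> A i))) \<le> F (A i)" .
        qed
        also have "\<dots> \<le> (\<Sum>i. F (A i))" by (rule sum_le_suminf) auto
        finally show "ennreal (\<Sum>i<n. \<nu> (B \<inter> A i)) \<le> (\<Sum>i. F (A i))" .
      qed
    qed
    moreover have "(\<Sum>i. F (A i)) \<le> F (\<Union>i. A i)"
      unfolding suminf_eq_SUP
    proof (rule SUP_least)
      fix n
      have "(\<Sum>i<n. F (A i)) \<le> F (\<Union>i<n. A i)"
      proof (induction n)
        case (Suc n)
        have "A i \<inter> A n = {}" if "i < n" for i
          by (rule disjoint_family_onD[OF A(2)]) (use that in auto)
        then have "F (\<Union>i<n. A i) + F (A n) \<le> F ((\<Union>i<n. A i) \<union> A n)"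
          by (intro super) auto
        moreover have "(\<Union>i<n. A i) \<union> A n = (\<Union>i<Suc n. A i)" by (auto simp: less_Suc_eq)
        moreover have "(\<Sum>i<Suc n. F (A i)) \<le> F (\<Union>i<n. A i) + F (A n)" unfolding sum.lessThan_Suc by (rule add_right_mono[OF Suc])
        ultimately show ?case by (metis order.trans)
      qed simp
      also have "\<dots> \<le> F (\<Union>i. A i)" unfolding F_def by (rule SUP_subset_mono) auto
      finally show "(\<Sum>i<n. F (A i)) \<le> F (\<Union>i. A i)" .
    qed
    ultimately show "(\<Sum>i. F (A i)) = F (\<Union>i. A i)" by simp
  qed
  moreover have "F {} = 0"
  proof -
    have "F {} \<le> 0" unfolding F_def by (rule SUP_least) (auto simp: empty)
    then show ?thesis by simp
  qed
  then have "positive (sets M) F" by (simp add: positive_def)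
  ultimately show ?thesis
    using emeasure_measure_of_sigma[of "space M" "sets M" F A] A
    by (simp add: upper_variation_def F_def[abs_def] sets.sigma_algebra_axioms)
qed

lemma sets_upper_variation [simp, measurable_cong]: "sets (upper_variation M \<nu>) = sets M"
  by (simp add: upper_variation_def sets.space_closed)

lemma space_upper_variation [simp]: "space (upper_variation M \<nu>) = space M"
  by (rule sets_eq_imp_space_eq) simp

definition functional_measure :: "'a measure \<Rightarrow> (('a \<Rightarrow> real) \<Rightarrow> real) \<Rightarrow> 'a set \<Rightarrow> real" where
  "functional_measure M L A = (if A \<in> sets M then L (indicator A) else 0)"

text \<open>A representation of Daniell type. Continuity of \<open>L\<close> gives countable
  additivity, and boundedness makes both variations finite measures. They live on complementary
  sets, so the bound on \<open>L\<close> controls the integral of \<open>W\<close> under each of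
  them, and both Bochner integrals are genuine.\<close>

lemma
  assumes W: "\<And>x. x \<in> space M \<Longrightarrow> 1 \<le> W x" and Wm: "W \<in> borel_measurable M" and L: "wfunctional M W L"
  shows signed_measure_functional: "signed_measure M (functional_measure M L)"
    and signed_integral_functional: "g \<in> wball M W c \<Longrightarrow> signed_integral M (functional_measure M L) g = L g"
    and integrable_upper_variation_functional: "g \<in> wball M W c \<Longrightarrow> integrable (upper_variation M (functional_measure M L)) g"
proof -
  define \<nu> where "\<nu> = functional_measure M L"
  define \<nu>' where "\<nu>' A = - \<nu> A" for A
  have ind: "(indicator A :: 'a \<Rightarrow> real) \<in> wball M W 1" if "A \<in> sets M" for A
    by (rule wball_bounded[OF W]) (use that in \<open>auto simp: indicator_def\<close>)
  have \<nu>A: "\<nu> A = L (indicator A)" if "A \<in> sets M" for A using that by (simp add: \<nu>_def functional_measure_def)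
  have zero: "L (\<lambda>_. 0) = 0" using wfunctional_scale[OF L ind[of "{}"], of 0] by simp
  show sm: "signed_measure M (functional_measure M L)"
    unfolding signed_measure_def \<nu>_def[symmetric]
  proof (intro conjI allI impI)
    have "(indicator {} :: 'a \<Rightarrow> real) = (\<lambda>_. 0)" by (simp add: fun_eq_iff)
    then show "\<nu> {} = 0" using zero by (simp add: \<nu>A)
    show "\<nu> A = 0" if "A \<notin> sets M" for A using that by (simp add: \<nu>_def functional_measure_def)
    fix A :: "nat \<Rightarrow> 'a set" assume A: "range A \<subseteq> sets M" "disjoint_family A"
    have UA: "(\<Union>i. A i) \<in> sets M" "(\<Union>i<n. A i) \<in> sets M" for n using A by auto
    have sum: "(\<Sum>i<n. \<nu> (A i)) = L (indicator (\<Union>i<n. A i))" for n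
    proof (induction n)
      case (Suc n)
      have "False" if "x \<in> A i" "x \<in> A n" "i < n" for x i
        using disjoint_family_onD[OF A(2), of i n] that by auto
      then have "(indicator (\<Union>i<Suc n. A i) :: 'a \<Rightarrow> real) = (\<lambda>x. indicator (\<Union>i<n. A i) x + indicator (A n) x)"
        by (auto simp: fun_eq_iff indicator_def less_Suc_eq)
      then show ?case
        using Suc wfunctional_add[OF L ind[OF UA(2)] ind, of "A n" n] A by (simp add: \<nu>A range_subsetD)
    qed (simp add: zero)
    have "(\<lambda>n. L (indicator (\<Union>i<n. A i)) - L (indicator (\<Union>i. A i))) \<longlonglongrightarrow> 0"
    proof (rule wfunctional_tendsto_diff[OF L ind[OF UA(2)] ind[OF UA(1)]])
      fix x
      show "(\<lambda>n. indicator (\<Union>i<n. A i) x - indicator (\<Union>i. A i) x :: real) \<longlonglongrightarrow> 0"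
        by (rule LIM_zero[OF LIMSEQ_indicator_UN])
    qed
    then show "(\<lambda>i. \<nu> (A i)) sums \<nu> (\<Union>i. A i)"
      unfolding sums_def sum \<nu>A[OF UA(1)] by (rule LIM_zero_cancel)
  qed
  then have sm': "signed_measure M \<nu>'"
    unfolding signed_measure_def \<nu>_def[symmetric] \<nu>'_def by (auto intro: sums_minus)
  define U where "U = upper_variation M \<nu>"
  define U' where "U' = upper_variation M \<nu>'"
  have [simp, measurable_cong]: "sets U = sets M" "sets U' = sets M" and [simp]: "space U = space M" "space U' = space M"
    by (auto simp: U_def U'_def)
  note cong = measurable_cong_sets[OF \<open>sets U = sets M\<close> refl] measurable_cong_sets[OF \<open>sets U' = sets M\<close> refl]
  have eU: "emeasure U A = (SUP B\<in>{B \<in> sets M. B \<subseteq> A}. ennreal (\<nu> B))" if "A \<in> sets M" for A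
    unfolding U_def by (rule emeasure_upper_variation[OF sm[folded \<nu>_def] that])
  have eU': "emeasure U' A = (SUP B\<in>{B \<in> sets M. B \<subseteq> A}. ennreal (\<nu>' B))" if "A \<in> sets M" for A
    unfolding U'_def by (rule emeasure_upper_variation[OF sm' that])
  obtain K where K: "K > 0" "\<And>g c. 0 \<le> c \<Longrightarrow> g \<in> wball M W c \<Longrightarrow> \<bar>L g\<bar> \<le> K * c"
    by (rule wfunctional_bounded[OF L]) (use W in \<open>auto intro: order.trans[OF zero_le_one]\<close>)
  have \<nu>K: "\<bar>\<nu> A\<bar> \<le> K" for A
    using K(1) K(2)[of 1 "indicator A"] ind by (auto simp: \<nu>_def functional_measure_def)
  have "emeasure U (space U) \<le> ennreal K"
    unfolding \<open>space U = space M\<close> eU[OF sets.top] by (rule SUP_least) (use \<nu>K abs_le_D1 in \<open>blast intro: ennreal_leI\<close>)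
  then interpret U: finite_measure U by (intro finite_measureI) (auto simp: top_unique)
  have "emeasure U' (space U') \<le> ennreal K"
    unfolding \<open>space U' = space M\<close> eU'[OF sets.top] \<nu>'_def by (rule SUP_least) (use \<nu>K abs_le_D2 in \<open>blast intro: ennreal_leI\<close>)
  then interpret U': finite_measure U' by (intro finite_measureI) (auto simp: top_unique)
  have lower: "\<nu> B \<le> measure U A" if "A \<in> sets M" "B \<in> sets M" "B \<subseteq> A" for A B
  proof -
    have "ennreal (\<nu> B) \<le> emeasure U A" unfolding eU[OF that(1)] by (rule SUP_upper) (use that in auto)
    then show ?thesis by (simp add: U.emeasure_eq_measure)
  qed
  have lower': "- \<nu> B \<le> measure U' A" if "A \<in> sets M" "B \<in> sets M" "B \<subseteq> A" for A B
  proof -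
    have "ennreal (\<nu>' B) \<le> emeasure U' A" unfolding eU'[OF that(1)] by (rule SUP_upper) (use that in auto)
    then show ?thesis by (simp add: U'.emeasure_eq_measure \<nu>'_def)
  qed
  have split: "\<nu> A = \<nu> B + \<nu> (A - B)" if "A \<in> sets M" "B \<in> sets M" "B \<subseteq> A" for A B
    using signed_measure_sum[OF sm[folded \<nu>_def] that(2), of "A - B"] that by (simp add: Un_absorb1)
  \<comment> \<open>For \<open>B\<close> inside \<open>A\<close>,
    \<open>- \<nu> B = \<nu> (A - B) - \<nu> A\<close> is at most
    \<open>measure U A - \<nu> A\<close>, and symmetrically for \<open>\<nu> B\<close>; taking
    suprema gives both inequalities.\<close>
  have jordan: "\<nu> A = measure U A - measure U' A" if A: "A \<in> sets M" for A
  proof (rule antisym)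
    have "emeasure U' A \<le> ennreal (measure U A - \<nu> A)"
      unfolding eU'[OF A]
    proof (rule SUP_least)
      fix B assume "B \<in> {B \<in> sets M. B \<subseteq> A}"
      then show "ennreal (\<nu>' B) \<le> ennreal (measure U A - \<nu> A)"
        using split[OF A, of B] lower[OF A, of "A - B"] A by (intro ennreal_leI) (auto simp: \<nu>'_def)
    qed
    then show "\<nu> A \<le> measure U A - measure U' A"
      using lower[OF A A] by (simp add: U'.emeasure_eq_measure)
    have "emeasure U A \<le> ennreal (measure U' A + \<nu> A)"
      unfolding eU[OF A]
    proof (rule SUP_least)
      fix B assume "B \<in> {B \<in> sets M. B \<subseteq> A}"
      then show "ennreal (\<nu> B) \<le> ennreal (measure U' A + \<nu> A)"
        using split[OF A, of B] lower'[OF A, of "A - B"] A by (intro ennreal_leI) auto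
    qed
    then show "measure U A - measure U' A \<le> \<nu> A"
      using lower'[OF A A] by (simp add: U.emeasure_eq_measure)
  qed
  \<comment> \<open>A Hahn set of the pair makes the variations mutually singular:
    \<open>\<nu>\<close> is nonnegative on subsets of \<open>Y\<close>, so \<open>U'\<close>
    vanishes on \<open>Y\<close>, and likewise \<open>U\<close> off \<open>Y\<close>.\<close>
  obtain Y where Y: "Y \<in> sets M" "\<And>X. X \<in> sets M \<Longrightarrow> X \<subseteq> Y \<Longrightarrow> emeasure U' X \<le> emeasure U X"
     "\<And>X. X \<in> sets M \<Longrightarrow> X \<inter> Y = {} \<Longrightarrow> emeasure U X \<le> emeasure U' X"
    using finite_unsigned_Hahn_decomposition[OF U.finite_measure_axioms U'.finite_measure_axioms] by auto
  have "emeasure U' Y \<le> 0"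
    unfolding eU'[OF Y(1)]
    by (rule SUP_least) (use Y(2) jordan in \<open>auto simp: \<nu>'_def U.emeasure_eq_measure U'.emeasure_eq_measure ennreal_neg\<close>)
  then have U'Y: "Y \<in> null_sets U'" using Y(1) by auto
  have "emeasure U (space M - Y) \<le> 0"
    unfolding eU[OF sets.compl_sets[OF Y(1)]]
  proof (rule SUP_least)
    fix B assume "B \<in> {B \<in> sets M. B \<subseteq> space M - Y}"
    then have B: "B \<in> sets M" "B \<inter> Y = {}" by auto
    then show "ennreal (\<nu> B) \<le> 0"
      using Y(3)[OF B] jordan[OF B(1)] by (auto simp: U.emeasure_eq_measure U'.emeasure_eq_measure intro!: ennreal_neg)
  qed
  then have UY: "space M - Y \<in> null_sets U" using Y(1) by auto
  have bnn: "g \<in> wball M W \<bar>b\<bar>" if "g \<in> borel_measurable M" "\<And>x. 0 \<le> g x" "\<forall>x\<in>space M. g x \<le> b" for g and b :: real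
    by (rule wball_bounded[OF W that(1)]) (use that(2,3) in force)+
  have bint: "integrable U g" "integrable U' g" if "g \<in> borel_measurable M" "\<And>x. 0 \<le> g x" "\<forall>x\<in>space M. g x \<le> b" for g and b :: real
    using that by (auto intro!: U.integrable_const_bound[where B = b] U'.integrable_const_bound[where B = b]
        simp: cong)
  \<comment> \<open>From indicators to bounded nonnegative functions by linearity and monotone
    limits; a common bound keeps the approximations in one ball because
    \<open>W \<ge> 1\<close>.\<close>
  have bdd: "L g = (\<integral>x. g x \<partial>U) - (\<integral>x. g x \<partial>U')" if "g \<in> borel_measurable M" "\<And>x. 0 \<le> g x" "\<forall>x\<in>space M. g x \<le> b" for g and b :: real
    using that
  proof (induction g arbitrary: b rule: borel_measurable_induct_real)
    case (set A)
    then show ?case using jordan[of A] by (simp add: \<nu>A)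
  next
    case (mult u a)
    show ?case
    proof (cases "a = 0")
      case False
      then have le: "\<forall>x\<in>space M. u x \<le> b / a" using mult by (simp add: field_simps)
      then have "L u = (\<integral>x. u x \<partial>U) - (\<integral>x. u x \<partial>U')" by (rule mult.IH)
      then show ?thesis
        using wfunctional_scale[OF L bnn[OF mult.hyps(2,3) le], of a] by (simp add: right_diff_distrib)
    qed (simp add: zero)
  next
    case (add u v)
    have u: "\<forall>x\<in>space M. u x \<le> b" and v: "\<forall>x\<in>space M. v x \<le> b"
      using add.hyps(2,4) add.prems by (auto intro: order.trans[rotated])
    show ?case
      using wfunctional_add[OF L bnn[OF add.hyps(3,4) v] bnn[OF add.hyps(1,2) u]] add.IH(1)[OF u] add.IH(2)[OF v]
        bint[OF add.hyps(3,4) v] bint[OF add.hyps(1,2) u] by simp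
  next
    case (seq G)
    have u: "g \<in> borel_measurable M" by (rule borel_measurable_LIMSEQ_real[OF seq.hyps(4,1)])
    have le: "G i x \<le> g x" if "x \<in> space M" for i x
      using incseq_le[of "\<lambda>i. G i x" "g x" i] seq.hyps(3,4) that by (auto simp: incseq_def le_fun_def)
    then have Gb: "\<forall>x\<in>space M. G i x \<le> b" for i using seq.prems by (meson order.trans)
    have 1: "(\<lambda>i. L (G i) - L g) \<longlonglongrightarrow> 0"
      by (rule wfunctional_tendsto_diff[OF L bnn[OF seq.hyps(1,2) Gb] bnn[OF u \<open>\<And>x. 0 \<le> g x\<close> seq.prems]])
         (rule LIM_zero[OF seq.hyps(4)])
    have "(\<lambda>i. \<integral>x. G i x \<partial>U) \<longlonglongrightarrow> (\<integral>x. g x \<partial>U)" "(\<lambda>i. \<integral>x. G i x \<partial>U') \<longlonglongrightarrow> (\<integral>x. g x \<partial>U')"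
      by (rule integral_dominated_convergence[where w = "\<lambda>_. b"],
          use u seq.hyps(1,2,4) Gb in \<open>auto simp: cong\<close>)+
    then have 2: "(\<lambda>i. L (G i)) \<longlonglongrightarrow> (\<integral>x. g x \<partial>U) - (\<integral>x. g x \<partial>U')"
      unfolding seq.IH[OF Gb] by (rule tendsto_diff)
    show ?case by (rule LIMSEQ_unique[OF LIM_zero_cancel[OF 1] 2])
  qed
  \<comment> \<open>\<open>W\<close> is cut at level \<open>n\<close> so that the identity for
    bounded functions applies. Restricted to \<open>Y\<close> or to its complement, the cut function
    sees only one of the variations, while \<open>L\<close> is bounded by \<open>K\<close>.\<close>
  define Wn where "Wn n x = max 0 (min (W x) (real n))" for n x
  have Wn: "Wn n \<in> borel_measurable M" "\<And>x. 0 \<le> Wn n x" "\<forall>x\<in>space M. Wn n x \<le> real n" for n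
    using Wm unfolding Wn_def by auto
  have Wn_le: "Wn n x \<le> W x" if "x \<in> space M" for x n
    using W[OF that] by (simp add: Wn_def)
  have ball: "(\<lambda>x. Wn n x * indicator B x) \<in> wball M W 1" if "B \<in> sets M" for n B
    by (rule wballI) (use Wn(1)[of n] Wn(2)[of n] Wn_le that W in \<open>auto simp: indicator_def intro: order.trans[OF zero_le_one]\<close>)
  have WnB: "\<bar>(\<integral>x. Wn n x * indicator B x \<partial>U) - (\<integral>x. Wn n x * indicator B x \<partial>U')\<bar> \<le> K" if B: "B \<in> sets M" for n B
  proof -
    have "L (\<lambda>x. Wn n x * indicator B x) = (\<integral>x. Wn n x * indicator B x \<partial>U) - (\<integral>x. Wn n x * indicator B x \<partial>U')"
      by (rule bdd[where b = "real n"]) (use Wn[of n] B in \<open>auto simp: indicator_def\<close>)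
    with K(2)[OF zero_le_one ball[OF B], of n] show ?thesis by simp
  qed
  \<comment> \<open>Fatou's lemma turns a uniform bound on the truncations into integrability of
    \<open>W\<close>.\<close>
  have int_bound: "integrable N W"
    if N: "sets N = sets M" "finite_measure N" and le: "\<And>n. (\<integral>x. Wn n x \<partial>N) \<le> K" for N
  proof (rule integrableI_nonneg)
    interpret finite_measure N by fact
    have sp: "space N = space M" using sets_eq_imp_space_eq[OF N(1)] .
    note [measurable_cong] = N(1)
    show "W \<in> borel_measurable N" using Wm by (simp add: measurable_cong_sets[OF N(1) refl])
    show "AE x in N. 0 \<le> W x" by (rule AE_I2) (use W in \<open>auto simp: sp intro: order.trans[OF zero_le_one]\<close>)
    have "ennreal (W x) = liminf (\<lambda>n. ennreal (Wn n x))" if x: "x \<in> space M" for x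
    proof -
      obtain n0 where "W x \<le> real n0" using real_arch_simple by blast
      then have "\<forall>\<^sub>F n in sequentially. Wn n x = W x"
        using W[OF x] by (intro eventually_sequentiallyI[of n0]) (auto simp: Wn_def)
      then have "(\<lambda>n. Wn n x) \<longlonglongrightarrow> W x" by (rule tendsto_eventually)
      then show ?thesis by (intro lim_imp_Liminf[symmetric] tendsto_ennrealI) simp
    qed
    then have "(\<integral>\<^sup>+x. ennreal (W x) \<partial>N) = (\<integral>\<^sup>+x. liminf (\<lambda>n. ennreal (Wn n x)) \<partial>N)"
      by (intro nn_integral_cong) (simp add: sp)
    also have "\<dots> \<le> liminf (\<lambda>n. \<integral>\<^sup>+x. ennreal (Wn n x) \<partial>N)"
      by (rule nn_integral_liminf) (use Wn(1) in \<open>simp add: measurable_cong_sets[OF N(1) refl]\<close>)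
    also have "\<dots> \<le> liminf (\<lambda>n. ennreal K)"
    proof (rule Liminf_mono, rule always_eventually, rule allI)
      fix n
      have "integrable N (Wn n)"
        by (rule integrable_const_bound[where B = "real n"])
           (use Wn[of n] in \<open>auto simp: sp measurable_cong_sets[OF N(1) refl]\<close>)
      then show "(\<integral>\<^sup>+x. ennreal (Wn n x) \<partial>N) \<le> ennreal K"
        using le[of n] Wn(2)[of n] by (subst nn_integral_eq_integral) (auto intro: ennreal_leI)
    qed
    also have "\<dots> < \<infinity>" by (simp add: Liminf_const)
    finally show "(\<integral>\<^sup>+x. ennreal (W x) \<partial>N) < \<infinity>" .
  qed
  have U_int: "integrable U W"
  proof (rule int_bound[OF _ U.finite_measure_axioms])
    fix n
    have "(\<integral>x. Wn n x * indicator Y x \<partial>U) = (\<integral>x. Wn n x \<partial>U)"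
    proof (rule integral_cong_AE)
      show "AE x in U. Wn n x * indicator Y x = Wn n x"
        using AE_not_in[OF UY] by (rule AE_mp) (auto intro!: AE_I2 simp: indicator_def)
    qed (use Wn(1)[of n] Y(1) in \<open>auto simp: cong\<close>)
    moreover have "(\<integral>x. Wn n x * indicator Y x \<partial>U') = 0"
      by (rule integral_eq_zero_AE) (use AE_not_in[OF U'Y] in \<open>auto simp: indicator_def elim: AE_mp\<close>)
    ultimately show "(\<integral>x. Wn n x \<partial>U) \<le> K" using WnB[OF Y(1), of n] by simp
  qed simp
  have U'_int: "integrable U' W"
  proof (rule int_bound[OF _ U'.finite_measure_axioms])
    fix n
    have "(\<integral>x. Wn n x * indicator (space M - Y) x \<partial>U') = (\<integral>x. Wn n x \<partial>U')"
    proof (rule integral_cong_AE)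
      show "AE x in U'. Wn n x * indicator (space M - Y) x = Wn n x"
        using AE_not_in[OF U'Y] by (rule AE_mp) (auto intro!: AE_I2 simp: indicator_def)
    qed (use Wn(1)[of n] Y(1) in \<open>auto simp: cong\<close>)
    moreover have "(\<integral>x. Wn n x * indicator (space M - Y) x \<partial>U) = 0"
      by (rule integral_eq_zero_AE) (use AE_not_in[OF UY] in \<open>auto simp: indicator_def elim: AE_mp\<close>)
    ultimately show "(\<integral>x. Wn n x \<partial>U') \<le> K" using WnB[OF sets.compl_sets[OF Y(1)], of n] by simp
  qed simp
  have int: "integrable U g" if "g \<in> wball M W c" for g c
    by (rule wball_integrable[OF U_int _ that]) simp
  \<comment> \<open>Both signs are truncated at level \<open>n\<close>; the differences stay in the
    ball of \<open>g\<close>, so that \<open>L\<close> and both integrals pass to the limit.\<close>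
  have eq: "L g = (\<integral>x. g x \<partial>U) - (\<integral>x. g x \<partial>U')" if g: "g \<in> wball M W c" for g c
  proof -
    note gm = wballD(1)[OF g]
    define p where "p n x = max 0 (min (g x) (real n))" for n x
    define q where "q n x = max 0 (min (- g x) (real n))" for n x
    have p: "p n \<in> borel_measurable M" "\<And>x. 0 \<le> p n x" "\<forall>x\<in>space M. p n x \<le> real n"
      and q: "q n \<in> borel_measurable M" "\<And>x. 0 \<le> q n x" "\<forall>x\<in>space M. q n x \<le> real n" for n
      using gm unfolding p_def q_def by auto
    define h where "h n x = p n x - q n x" for n x
    have hm: "h n \<in> borel_measurable M" for n
      unfolding h_def[abs_def] by (intro borel_measurable_diff p q)
    have h: "h n \<in> wball M W c" for n
      by (rule wball_truncate[OF g _ hm]) (auto simp: h_def p_def q_def)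
    have Lh: "L (h n) = (\<integral>x. h n x \<partial>U) - (\<integral>x. h n x \<partial>U')" for n
      using wfunctional_diff[OF L bnn[OF p] bnn[OF q], of n n] bdd[OF p, of n] bdd[OF q, of n] bint[OF p, of n] bint[OF q, of n]
      by (simp add: h_def[abs_def])
    have lim: "(\<lambda>n. h n x) \<longlonglongrightarrow> g x" for x
    proof -
      obtain n0 where "\<bar>g x\<bar> \<le> real n0" using real_arch_simple by blast
      then show ?thesis
        by (intro tendsto_eventually eventually_sequentiallyI[of n0]) (auto simp: h_def p_def q_def)
    qed
    have 1: "(\<lambda>n. L (h n) - L g) \<longlonglongrightarrow> 0"
      by (rule wfunctional_tendsto_diff[OF L h g]) (rule LIM_zero[OF lim])
    have "(\<lambda>n. \<integral>x. h n x \<partial>U) \<longlonglongrightarrow> (\<integral>x. g x \<partial>U)" "(\<lambda>n. \<integral>x. h n x \<partial>U') \<longlonglongrightarrow> (\<integral>x. g x \<partial>U')"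
      by (rule integral_dominated_convergence[where w = "\<lambda>x. c * W x"],
          use lim gm h U_int U'_int in \<open>auto simp: wball_def cong\<close>)+
    then have 2: "(\<lambda>n. L (h n)) \<longlonglongrightarrow> (\<integral>x. g x \<partial>U) - (\<integral>x. g x \<partial>U')"
      unfolding Lh by (rule tendsto_diff)
    show ?thesis by (rule LIMSEQ_unique[OF LIM_zero_cancel[OF 1] 2])
  qed
  show "signed_integral M (functional_measure M L) g = L g" if g: "g \<in> wball M W c"
    unfolding eq[OF g] signed_integral_def U_def U'_def \<nu>_def \<nu>'_def[abs_def] ..
  show "integrable (upper_variation M (functional_measure M L)) g" if g: "g \<in> wball M W c"
    using int[OF g] unfolding U_def \<nu>_def .
qed

section \<open>The weighted norm of a functional and differentiability in that norm\<close>

lemma weighted_norm_functional: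
  assumes W: "\<And>x. x \<in> space M \<Longrightarrow> 1 \<le> W x" and Wm: "W \<in> borel_measurable M" and L: "wfunctional M W L"
  shows "weighted_norm M W (functional_measure M L) = (SUP g\<in>wball M W 1. ennreal (L g))"
proof -
  have "{g \<in> borel_measurable M. \<forall>x\<in>space M. \<bar>g x\<bar> \<le> W x} = wball M W 1"
    by (auto simp: wball_def)
  then show ?thesis
    unfolding weighted_norm_def by (simp add: signed_integral_functional[OF W Wm L] cong: SUP_cong)
qed

lemma weighted_norm_functional_le:
  assumes W: "\<And>x. x \<in> space M \<Longrightarrow> 1 \<le> W x" and Wm: "W \<in> borel_measurable M" and L: "wfunctional M W L"
    and le: "\<And>g. g \<in> wball M W 1 \<Longrightarrow> L g \<le> c"
  shows "weighted_norm M W (functional_measure M L) \<le> ennreal c"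
proof -
  have "(SUP g\<in>wball M W 1. ennreal (L g)) \<le> ennreal c" by (rule SUP_least) (simp add: le ennreal_leI)
  then show ?thesis using weighted_norm_functional[OF W Wm L] by simp
qed

lemma functional_measure_weighted:
  assumes W: "\<And>x. x \<in> space M \<Longrightarrow> 1 \<le> W x" and Wm: "W \<in> borel_measurable M" and L: "wfunctional M W L"
  shows "functional_measure M L \<in> weighted_measures M W"
proof -
  obtain K where K: "K > 0" "\<And>g c. 0 \<le> c \<Longrightarrow> g \<in> wball M W c \<Longrightarrow> \<bar>L g\<bar> \<le> K * c"
    by (rule wfunctional_bounded[OF L]) (use W in \<open>auto intro: order.trans[OF zero_le_one]\<close>)
  have "weighted_norm M W (functional_measure M L) \<le> ennreal K"
  proof (rule weighted_norm_functional_le[OF W Wm L])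
    show "L g \<le> K" if "g \<in> wball M W 1" for g using K(2)[OF zero_le_one that] by simp
  qed
  then show ?thesis
    using signed_measure_functional[OF W Wm L] by (auto simp: weighted_measures_def intro: le_less_trans)
qed

text \<open>Whenever the norm of \<open>L i\<close> exceeds \<open>e\<close>, some
  \<open>G i\<close> in the unit ball has \<open>L i (G i) > e\<close>. Convergence along this one
  sequence of test functions therefore forces convergence in norm.\<close>

lemma weighted_norm_functional_tendsto:
  assumes W: "\<And>x. x \<in> space M \<Longrightarrow> 1 \<le> W x" and Wm: "W \<in> borel_measurable M"
    and L: "\<And>i::nat. wfunctional M W (L i)"
    and lim: "\<And>G. (\<And>i. G i \<in> wball M W 1) \<Longrightarrow> (\<lambda>i. L i (G i)) \<longlonglongrightarrow> 0"
  shows "(\<lambda>i. weighted_norm M W (functional_measure M (L i))) \<longlonglongrightarrow> 0"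
proof (rule order_tendstoI)
  fix a :: ennreal assume "0 < a"
  then obtain e' where "0 < e'" "e' < a" using dense by blast
  then obtain e where e: "0 < e" "ennreal e < a" by (cases e' rule: ennreal_cases) auto
  have zero: "(\<lambda>_. 0) \<in> wball M W 1"
    using W by (auto simp: wball_def intro: order.trans[OF zero_le_one])
  define G where "G i = (if \<exists>g\<in>wball M W 1. e < L i g then SOME g. g \<in> wball M W 1 \<and> e < L i g else (\<lambda>_. 0))" for i
  have G: "G i \<in> wball M W 1" and Ge: "(\<exists>g\<in>wball M W 1. e < L i g) \<Longrightarrow> e < L i (G i)" for i
    using someI_ex[of "\<lambda>g. g \<in> wball M W 1 \<and> e < L i g"] zero by (auto simp: G_def)
  have "\<forall>\<^sub>F i in sequentially. L i (G i) < e"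
    by (rule order_tendstoD(2)[OF lim[OF G] e(1)])
  then show "\<forall>\<^sub>F i in sequentially. weighted_norm M W (functional_measure M (L i)) < a"
  proof eventually_elim
    case (elim i)
    have "weighted_norm M W (functional_measure M (L i)) \<le> ennreal e"
    proof (rule weighted_norm_functional_le[OF W Wm L])
      show "L i g \<le> e" if "g \<in> wball M W 1" for g using Ge[of i] elim that by force
    qed
    then show ?case using e(2) by (rule le_less_trans)
  qed
qed simp

text \<open>\<open>W\<close> lies below a multiple of the last weight \<open>w k\<close>, hence of
  every weight, so a single norm is able to measure the functionals of all orders.\<close>

lemma smooth_family_Ck_on_measures:
  assumes D: "smooth_family k M w D" and ws: "weight_scale k M w"
    and W: "\<And>x. x \<in> space M \<Longrightarrow> 1 \<le> W x" and Wm: "W \<in> borel_measurable M"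
    and Wle: "\<And>x. x \<in> space M \<Longrightarrow> W x \<le> K * w k x"
    and f: "\<And>u. u \<in> {0..1} \<Longrightarrow> f u = functional_measure M (D 0 u)"
  shows "Ck_on_measures k {0..1} M W f"
proof -
  have Wl: "W x \<le> \<bar>K\<bar> * w l x" if "l \<le> k" "x \<in> space M" for l x
  proof -
    have "K * w k x \<le> \<bar>K\<bar> * w k x" using weight_scale_ge1[OF ws order.refl that(2)] by (intro mult_right_mono) auto
    also have "\<dots> \<le> \<bar>K\<bar> * w l x" using ws that by (intro mult_left_mono) (auto simp: weight_scale_def)
    finally show ?thesis using Wle[OF that(2)] by linarith
  qed
  have ball: "g \<in> wball M (w l) \<bar>K\<bar>" if "l \<le> k" "g \<in> wball M W 1" for g l
    by (rule wball_mono[OF that(2)]) (use Wl[OF that(1)] in simp)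
  have Dl: "wfunctional M W (D l u)" if "l \<le> k" "u \<in> {0..1}" for l u
    by (rule wfunctional_mono[OF fcontD(1), of M "w l" "D l" u _ "\<bar>K\<bar>"])
       (use D that W Wl[OF that(1)] in \<open>auto simp: smooth_family_def intro: order.trans[OF zero_le_one]\<close>)
  show ?thesis
    unfolding Ck_on_measures_def
  proof (intro exI[of _ "\<lambda>l u. functional_measure M (D l u)"] conjI ballI allI impI)
    show "functional_measure M (D 0 u) = f u" if "u \<in> {0..1}" for u using f[OF that] by simp
    show "functional_measure M (D l u) \<in> weighted_measures M W" if "l \<le> k" "u \<in> {0..1}" for l u
      by (rule functional_measure_weighted[OF W Wm Dl[OF that]])
  next
    fix l u assume l: "l < k" and u: "u \<in> {0..1::real}"
    show "((\<lambda>v. weighted_norm M W (\<lambda>A. (functional_measure M (D l v) A - functional_measure M (D l u) A) / (v - u) -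
        functional_measure M (D (Suc l) u) A)) \<longlongrightarrow> 0) (at u within {0..1})"
      unfolding tendsto_at_iff_sequentially comp_def
    proof (intro allI impI)
      fix X assume X: "\<forall>i. X i \<in> {0..1} - {u}" "X \<longlonglongrightarrow> u"
      let ?L = "\<lambda>i g. 1 * ((1 / (X i - u)) * D l (X i) g + (- 1 / (X i - u)) * D l u g) + - 1 * D (Suc l) u g"
      have "(\<lambda>i. weighted_norm M W (functional_measure M (?L i))) \<longlonglongrightarrow> 0"
      proof (rule weighted_norm_functional_tendsto[OF W Wm])
        show "wfunctional M W (?L i)" for i
          by (intro wfunctional_lincomb_functional Dl) (use X u l in auto)
        fix G :: "nat \<Rightarrow> 'a \<Rightarrow> real" assume G: "\<And>i. G i \<in> wball M W 1"
        have "(\<lambda>n. (D l (X n) (G n) - D l u (G n)) / (X n - u) - D (Suc l) u (G n)) \<longlonglongrightarrow> 0"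
          by (rule fderivD[of M "w (Suc l)", OF _ u _ X(2) ball[OF _ G]]) (use D X l in \<open>auto simp: smooth_family_def\<close>)
        then show "(\<lambda>i. ?L i (G i)) \<longlonglongrightarrow> 0" by (simp add: diff_divide_distrib)
      qed
      moreover have "functional_measure M (?L i) = (\<lambda>A. (functional_measure M (D l (X i)) A - functional_measure M (D l u) A) / (X i - u) -
         functional_measure M (D (Suc l) u) A)" for i
        by (auto simp: functional_measure_def fun_eq_iff diff_divide_distrib)
      ultimately show "(\<lambda>i. weighted_norm M W (\<lambda>A. (functional_measure M (D l (X i)) A - functional_measure M (D l u) A) / (X i - u) -
         functional_measure M (D (Suc l) u) A)) \<longlonglongrightarrow> 0" by simp
    qed
  next
    fix u assume u: "u \<in> {0..1::real}"
    show "((\<lambda>v. weighted_norm M W (\<lambda>A. functional_measure M (D k v) A - functional_measure M (D k u) A)) \<longlongrightarrow> 0) (at u within {0..1})"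
      unfolding tendsto_at_iff_sequentially comp_def
    proof (intro allI impI)
      fix X assume X: "\<forall>i. X i \<in> {0..1} - {u}" "X \<longlonglongrightarrow> u"
      let ?L = "\<lambda>i g. 1 * D k (X i) g + - 1 * D k u g"
      have "(\<lambda>i. weighted_norm M W (functional_measure M (?L i))) \<longlonglongrightarrow> 0"
      proof (rule weighted_norm_functional_tendsto[OF W Wm])
        show "wfunctional M W (?L i)" for i
          by (intro wfunctional_lincomb_functional Dl) (use X u in auto)
        fix G :: "nat \<Rightarrow> 'a \<Rightarrow> real" assume G: "\<And>i. G i \<in> wball M W 1"
        have "(\<lambda>n. D k (X n) (G n) - D k u (G n)) \<longlonglongrightarrow> 0"
          by (rule fcontD(2)[of M "w k", OF _ u _ X(2) ball[OF _ G]]) (use D X in \<open>auto simp: smooth_family_def\<close>)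
        then show "(\<lambda>i. ?L i (G i)) \<longlonglongrightarrow> 0" by simp
      qed
      moreover have "functional_measure M (?L i) = (\<lambda>A. functional_measure M (D k (X i)) A - functional_measure M (D k u) A)" for i
        by (auto simp: functional_measure_def fun_eq_iff)
      ultimately show "(\<lambda>i. weighted_norm M W (\<lambda>A. functional_measure M (D k (X i)) A - functional_measure M (D k u) A)) \<longlonglongrightarrow> 0" by simp
    qed
  qed
qed

text \<open>Positivity makes the upper variation of the negative set function the null measure, so
  the integral against the upper variation is \<open>L\<close> itself.\<close>

lemma ex_measure_of_functional:
  assumes W: "\<And>x. x \<in> space M \<Longrightarrow> 1 \<le> W x" and Wm: "W \<in> borel_measurable M" and L: "wfunctional M W L"
    and pos: "\<And>A. A \<in> sets M \<Longrightarrow> 0 \<le> L (indicator A)"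
  obtains N where "sets N = sets M" "\<And>A. A \<in> sets M \<Longrightarrow> emeasure N A = ennreal (L (indicator A))"
    "\<And>g c. g \<in> wball M W c \<Longrightarrow> integrable N g" "\<And>g c. g \<in> wball M W c \<Longrightarrow> (\<integral>x. g x \<partial>N) = L g"
proof -
  define \<nu> where "\<nu> = functional_measure M L"
  have sm: "signed_measure M \<nu>" unfolding \<nu>_def by (rule signed_measure_functional[OF W Wm L])
  then have sm': "signed_measure M (\<lambda>A. - \<nu> A)"
    unfolding signed_measure_def by (auto intro: sums_minus)
  have \<nu>0: "0 \<le> \<nu> A" for A using pos by (simp add: \<nu>_def functional_measure_def)
  define N where "N = upper_variation M \<nu>"
  define N' where "N' = upper_variation M (\<lambda>A. - \<nu> A)"
  have "emeasure N' (space M) \<le> 0"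
    unfolding N'_def emeasure_upper_variation[OF sm' sets.top]
    by (rule SUP_least) (use \<nu>0 in \<open>simp add: ennreal_neg\<close>)
  then have "space M \<in> null_sets N'" by (auto simp: N'_def)
  then have "AE x in N'. x \<notin> space M" by (rule AE_not_in)
  then have "AE x in N'. False" by (rule AE_mp) (auto simp: N'_def)
  then have N'0: "(\<integral>x. g x \<partial>N') = 0" for g :: "'a \<Rightarrow> real"
    by (intro integral_eq_zero_AE) (auto elim: AE_mp)
  show ?thesis
  proof (rule that[of N])
    show "sets N = sets M" by (simp add: N_def)
    show "integrable N g" "(\<integral>x. g x \<partial>N) = L g" if "g \<in> wball M W c" for g c
      using integrable_upper_variation_functional[OF W Wm L that] signed_integral_functional[OF W Wm L that] N'0[of g]
      unfolding N_def N'_def \<nu>_def signed_integral_def by auto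
    fix A assume A: "A \<in> sets M"
    have "emeasure N A = ennreal (\<nu> A)"
      unfolding N_def emeasure_upper_variation[OF sm A]
    proof (rule antisym)
      show "(SUP B\<in>{B \<in> sets M. B \<subseteq> A}. ennreal (\<nu> B)) \<le> ennreal (\<nu> A)"
      proof (rule SUP_least)
        fix B assume "B \<in> {B \<in> sets M. B \<subseteq> A}"
        then show "ennreal (\<nu> B) \<le> ennreal (\<nu> A)"
          using signed_measure_sum[OF sm, of B "A - B"] A \<nu>0[of "A - B"] by (intro ennreal_leI) (auto simp: Un_absorb1)
      qed
      show "ennreal (\<nu> A) \<le> (SUP B\<in>{B \<in> sets M. B \<subseteq> A}. ennreal (\<nu> B))"
        by (rule SUP_upper) (use A in auto)
    qed
    then show "emeasure N A = ennreal (L (indicator A))" using A by (simp add: \<nu>_def functional_measure_def)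
  qed
qed

section \<open>Higher derivatives of products and compositions\<close>

text \<open>Derivatives are carried as an explicit sequence and not as \<open>nderiv\<close>, so
  that the formulas of Leibniz's rule and of the chain rule can themselves serve as the
  derivatives.\<close>

definition dseq :: "nat \<Rightarrow> (nat \<Rightarrow> real \<Rightarrow> real) \<Rightarrow> bool" where
  "dseq n F \<longleftrightarrow> (\<forall>l<n. \<forall>u\<in>{0..1}. (F l has_real_derivative F (Suc l) u) (at u within {0..1})) \<and>
     (\<forall>l\<le>n. continuous_on {0..1} (F l))"

lemma dseqD:
  "dseq n F \<Longrightarrow> l < n \<Longrightarrow> u \<in> {0..1} \<Longrightarrow> (F l has_real_derivative F (Suc l) u) (at u within {0..1})"
  "dseq n F \<Longrightarrow> l \<le> n \<Longrightarrow> continuous_on {0..1} (F l)"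
  by (auto simp: dseq_def)

lemma nderiv_simps: "nderiv S f 0 = f" "nderiv S f (Suc l) u = vector_derivative (nderiv S f l) (at u within S)"
  by (simp_all add: nderiv_def)

lemma nderiv_has_derivative:
  assumes "Ck_on k S f" "l < k" "u \<in> S"
  shows "(nderiv S f l has_real_derivative nderiv S f (Suc l) u) (at u within S)"
proof -
  have "nderiv S f l differentiable (at u within S)"
    using assms by (auto simp: Ck_on_def differentiable_on_def)
  then show ?thesis
    by (simp add: nderiv_simps has_real_derivative_iff_has_vector_derivative vector_derivative_works)
qed

lemma nderiv_continuous:
  assumes "Ck_on k S f" "l \<le> k"
  shows "continuous_on S (nderiv S f l)"
  using assms by (cases "l = k") (auto simp: Ck_on_def intro: differentiable_imp_continuous_on)

lemma Ck_on_dseq: "Ck_on k {0..1} f \<Longrightarrow> dseq k (nderiv {0..1} f)"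
  unfolding dseq_def by (blast intro: nderiv_has_derivative nderiv_continuous)

definition leib :: "(nat \<Rightarrow> real \<Rightarrow> real) \<Rightarrow> (nat \<Rightarrow> real \<Rightarrow> real) \<Rightarrow> nat \<Rightarrow> real \<Rightarrow> real" where
  "leib a b l u = (\<Sum>i\<le>l. real (l choose i) * (a (l - i) u * b i u))"

lemma leib_has_derivative:
  assumes "\<And>j. j \<le> l \<Longrightarrow> (a j has_real_derivative a (Suc j) u) (at u within S)"
    and "\<And>j. j \<le> l \<Longrightarrow> (b j has_real_derivative b (Suc j) u) (at u within S)"
  shows "(leib a b l has_real_derivative leib a b (Suc l) u) (at u within S)"
proof -
  have "((\<lambda>u. \<Sum>i\<le>l. real (l choose i) * (a (l - i) u * b i u)) has_real_derivative
      (\<Sum>i\<le>l. real (l choose i) * (a (Suc (l - i)) u * b i u + a (l - i) u * b (Suc i) u))) (at u within S)"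
  proof (rule DERIV_sum)
    fix i assume "i \<in> {..l}"
    then have "((\<lambda>u. a (l - i) u * b i u) has_real_derivative
        (a (Suc (l - i)) u * b i u + b (Suc i) u * a (l - i) u)) (at u within S)"
      by (intro DERIV_mult assms) auto
    from DERIV_cmult[OF this, of "real (l choose i)"]
    show "((\<lambda>u. real (l choose i) * (a (l - i) u * b i u)) has_real_derivative
        real (l choose i) * (a (Suc (l - i)) u * b i u + a (l - i) u * b (Suc i) u)) (at u within S)"
      by (simp add: mult.commute)
  qed
  then show ?thesis
    unfolding binomial_sum_Suc[of l "\<lambda>j i. a j u * b i u"] leib_def[abs_def] .
qed

lemma leib_continuous:
  assumes "\<And>j. j \<le> l \<Longrightarrow> continuous_on S (a j)" "\<And>j. j \<le> l \<Longrightarrow> continuous_on S (b j)"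
  shows "continuous_on S (leib a b l)"
  unfolding leib_def[abs_def] by (intro continuous_intros assms) auto

lemma dseq_leib: "dseq n a \<Longrightarrow> dseq n b \<Longrightarrow> dseq n (leib a b)"
  unfolding dseq_def by (auto intro!: leib_has_derivative leib_continuous)

text \<open>With \<open>F s\<close> and \<open>z i\<close> the derivatives of orders \<open>s\<close> and \<open>i\<close>, \<open>chain_deriv F z l s\<close> is the \<open>l\<close>-th derivative of
  \<open>F s \<circ> z 0\<close>: Leibniz's rule applied to \<open>(F s \<circ> z 0)' = (F (s + 1) \<circ> z 0) z 1\<close>.\<close>

fun chain_deriv :: "(nat \<Rightarrow> real \<Rightarrow> real) \<Rightarrow> (nat \<Rightarrow> real \<Rightarrow> real) \<Rightarrow> nat \<Rightarrow> nat \<Rightarrow> real \<Rightarrow> real" where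
  "chain_deriv F z 0 s u = F s (z 0 u)"
| "chain_deriv F z (Suc l) s u = (\<Sum>i\<le>l. real (l choose i) * (chain_deriv F z (l - i) (Suc s) u * z (Suc i) u))"

declare chain_deriv.simps(2) [simp del]

lemma chain_deriv_Suc: "chain_deriv F z (Suc l) s = leib (\<lambda>j. chain_deriv F z j (Suc s)) (\<lambda>i. z (Suc i)) l"
  by (simp add: fun_eq_iff leib_def chain_deriv.simps(2))

text \<open>Strong induction on \<open>l\<close> for all \<open>s\<close> at once: order
  \<open>l\<close> at \<open>s\<close> is a Leibniz expression in lower orders at
  \<open>s + 1\<close>, and \<open>s + l\<close> bounds the number of derivatives of
  \<open>F\<close> in use.\<close>

lemma chain_deriv_has_derivative:
  assumes z: "dseq n z" and u: "u \<in> {0..1}"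
    and F: "\<And>s. s < n \<Longrightarrow> (F s has_real_derivative F (Suc s) (z 0 u)) (at (z 0 u))"
  shows "s + l < n \<Longrightarrow> (chain_deriv F z l s has_real_derivative chain_deriv F z (Suc l) s u) (at u within {0..1})"
proof (induction l arbitrary: s rule: less_induct)
  case (less l)
  show ?case
  proof (cases l)
    case 0
    have "((\<lambda>u. F s (z 0 u)) has_real_derivative F (Suc s) (z 0 u) * z (Suc 0) u) (at u within {0..1})"
      by (rule DERIV_chain2[OF F dseqD(1)[OF z _ u]]) (use less.prems 0 in auto)
    moreover have "chain_deriv F z 0 s = (\<lambda>u. F s (z 0 u))" by (simp add: fun_eq_iff)
    ultimately show ?thesis by (simp add: 0 chain_deriv_Suc leib_def)
  next
    case (Suc l')
    show ?thesis
      unfolding Suc chain_deriv_Suc[of _ _ "Suc l'"] unfolding chain_deriv_Suc[of _ _ l' s]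
      by (intro leib_has_derivative less.IH dseqD(1)[OF z _ u]) (use less.prems Suc in auto)
  qed
qed

lemma chain_deriv_continuous:
  assumes z: "dseq n z" and F: "\<And>s. s \<le> n \<Longrightarrow> continuous_on (z 0 ` {0..1}) (F s)"
  shows "s + l \<le> n \<Longrightarrow> continuous_on {0..1} (chain_deriv F z l s)"
proof (induction l arbitrary: s rule: less_induct)
  case (less l)
  show ?case
  proof (cases l)
    case 0
    have "continuous_on {0..1} (\<lambda>u. F s (z 0 u))"
      by (rule continuous_on_compose2[OF F dseqD(2)[OF z]]) (use less.prems 0 in auto)
    moreover have "chain_deriv F z 0 s = (\<lambda>u. F s (z 0 u))" by (simp add: fun_eq_iff)
    ultimately show ?thesis by (simp add: 0)
  next
    case (Suc l')
    show ?thesis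
      unfolding Suc chain_deriv_Suc
      by (intro leib_continuous less.IH dseqD(2)[OF z]) (use less.prems Suc in auto)
  qed
qed

lemma chain_deriv_dseq:
  assumes "dseq n z"
    and "\<And>s u. s < n \<Longrightarrow> u \<in> {0..1} \<Longrightarrow> (F s has_real_derivative F (Suc s) (z 0 u)) (at (z 0 u))"
    and "\<And>s. s \<le> n \<Longrightarrow> continuous_on (z 0 ` {0..1}) (F s)"
  shows "dseq n (\<lambda>l. chain_deriv F z l 0)"
  unfolding dseq_def
proof (intro conjI allI impI ballI)
  show "(chain_deriv F z l 0 has_real_derivative chain_deriv F z (Suc l) 0 u) (at u within {0..1})"
    if "l < n" "u \<in> {0..1}" for l u
    by (rule chain_deriv_has_derivative[where n = n, OF assms(1) that(2)]) (use that in \<open>auto intro!: assms(2)\<close>)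
  show "continuous_on {0..1} (chain_deriv F z l 0)" if "l \<le> n" for l
    by (rule chain_deriv_continuous[OF assms(1,3)]) (use that in auto)
qed

text \<open>The factor \<open>(B + \<bar>z\<bar>) ^ r\<close> comes with the \<open>r\<close>-th derivative of \<open>F\<close>, which is what the moment
  conditions on the derivatives of the noise density allow for.\<close>

lemma chain_deriv_bound:
  assumes A: "0 \<le> A"
  shows "\<exists>C\<ge>0. \<forall>F z s u B. 0 \<le> B \<longrightarrow> (\<forall>i\<in>{1..l}. \<bar>z i u\<bar> \<le> A * (B + \<bar>z 0 u\<bar>)) \<longrightarrow>
     \<bar>chain_deriv F z l s u\<bar> \<le> C * (\<Sum>r\<le>l. \<bar>F (s + r) (z 0 u)\<bar> * (B + \<bar>z 0 u\<bar>) ^ r)"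
proof (induction l rule: less_induct)
  case (less l)
  show ?case
  proof (cases l)
    case 0
    then show ?thesis by (intro exI[of _ 1]) simp
  next
    case (Suc n)
    define Q where "Q j c \<longleftrightarrow> 0 \<le> c \<and> (\<forall>F z s u B. 0 \<le> B \<longrightarrow> (\<forall>i\<in>{1..j}. \<bar>z i u\<bar> \<le> A * (B + \<bar>z 0 u\<bar>)) \<longrightarrow>
       \<bar>chain_deriv F z j s u\<bar> \<le> c * (\<Sum>r\<le>j. \<bar>F (s + r) (z 0 u)\<bar> * (B + \<bar>z 0 u\<bar>) ^ r))" for j c
    have "\<exists>c. Q j c" if "j \<in> {..n}" for j
      using less.IH[of j] that unfolding Q_def Suc by simp
    then obtain C where Q: "\<And>j. j \<in> {..n} \<Longrightarrow> Q j (C j)"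
      using bchoice[of "{..n}" Q] by blast
    then have C: "\<And>j. j \<le> n \<Longrightarrow> 0 \<le> C j" by (simp add: Q_def)
    have bd: "\<bar>chain_deriv F z j s u\<bar> \<le> C j * (\<Sum>r\<le>j. \<bar>F (s + r) (z 0 u)\<bar> * (B + \<bar>z 0 u\<bar>) ^ r)"
      if "j \<le> n" "0 \<le> B" "\<forall>i\<in>{1..j}. \<bar>z i u\<bar> \<le> A * (B + \<bar>z 0 u\<bar>)" for j F z s u B
      using Q[of j] that unfolding Q_def by simp
    define K where "K = (\<Sum>i\<le>n. real (n choose i) * (C (n - i) * A))"
    show ?thesis
    proof (intro exI[of _ K] conjI allI impI)
      show "0 \<le> K" unfolding K_def using A C by (intro sum_nonneg mult_nonneg_nonneg) auto
      fix F z :: "nat \<Rightarrow> real \<Rightarrow> real" and s u and B :: real assume B: "(0::real) \<le> B" and z: "\<forall>i\<in>{1..l}. \<bar>z i u\<bar> \<le> A * (B + \<bar>z 0 u\<bar>)"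
      let ?b = "B + \<bar>z 0 u\<bar>"
      let ?S = "\<Sum>r\<le>l. \<bar>F (s + r) (z 0 u)\<bar> * ?b ^ r"
      have b: "0 \<le> ?b" using B by simp
      have "\<bar>chain_deriv F z l s u\<bar> \<le> (\<Sum>i\<le>n. \<bar>real (n choose i) * (chain_deriv F z (n - i) (Suc s) u * z (Suc i) u)\<bar>)"
        unfolding Suc chain_deriv.simps(2) by (rule sum_abs)
      also have "\<dots> \<le> (\<Sum>i\<le>n. real (n choose i) * (C (n - i) * A) * ?S)"
      proof (rule sum_mono)
        fix i assume i: "i \<in> {..n}"
        have "\<bar>chain_deriv F z (n - i) (Suc s) u\<bar> * \<bar>z (Suc i) u\<bar> \<le>
            (C (n - i) * (\<Sum>r\<le>n - i. \<bar>F (Suc s + r) (z 0 u)\<bar> * ?b ^ r)) * (A * ?b)"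
          by (intro mult_mono bd B) (use i z Suc b C in \<open>auto intro!: mult_nonneg_nonneg sum_nonneg\<close>)
        \<comment> \<open>The factor \<open>z (Suc i)\<close> supplies one more power of
          \<open>B + |z 0 u|\<close>, which matches the additional derivative on
          \<open>F\<close>.\<close>
        also have "\<dots> = (C (n - i) * A) * (\<Sum>r\<le>n - i. \<bar>F (s + Suc r) (z 0 u)\<bar> * ?b ^ Suc r)"
          by (simp add: sum_distrib_left sum_distrib_right mult_ac)
        also have "(\<Sum>r\<le>n - i. \<bar>F (s + Suc r) (z 0 u)\<bar> * ?b ^ Suc r) \<le> (\<Sum>r\<le>n. \<bar>F (s + Suc r) (z 0 u)\<bar> * ?b ^ Suc r)"
          by (rule sum_mono2) (use b in auto)
        also have "\<dots> \<le> ?S"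
          unfolding Suc by (subst sum.atMost_Suc_shift) simp
        finally have "\<bar>chain_deriv F z (n - i) (Suc s) u\<bar> * \<bar>z (Suc i) u\<bar> \<le> (C (n - i) * A) * ?S"
          using A C i by (simp add: mult_left_mono)
        then show "\<bar>real (n choose i) * (chain_deriv F z (n - i) (Suc s) u * z (Suc i) u)\<bar> \<le> real (n choose i) * (C (n - i) * A) * ?S"
          by (simp add: abs_mult mult_left_mono mult.assoc)
      qed
      also have "\<dots> = K * ?S" by (simp add: K_def sum_distrib_right)
      finally show "\<bar>chain_deriv F z l s u\<bar> \<le> K * ?S" .
    qed
  qed
qed

text \<open>Dominated convergence with varying bounds of constant integral. As in Scheffe's lemma,
  equal integrals make the positive and negative parts of \<open>G n - H\<close> have the same
  integral, and the negative part is dominated by \<open>H\<close>. What \<open>|a n|\<close> has in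
  excess of \<open>H\<close> is at most the positive part.\<close>

lemma tendsto_nn_integral_varying_bound:
  fixes a :: "nat \<Rightarrow> 'a \<Rightarrow> real" and G :: "nat \<Rightarrow> 'a \<Rightarrow> real"
  assumes [measurable]: "\<And>n. a n \<in> borel_measurable M" "\<And>n. G n \<in> borel_measurable M" "H \<in> borel_measurable M"
    and aG: "\<And>n x. x \<in> space M \<Longrightarrow> \<bar>a n x\<bar> \<le> G n x"
    and lim: "\<And>x. x \<in> space M \<Longrightarrow> (\<lambda>n. a n x) \<longlonglongrightarrow> 0" "\<And>x. x \<in> space M \<Longrightarrow> (\<lambda>n. G n x) \<longlonglongrightarrow> H x"
    and int: "\<And>n. (\<integral>\<^sup>+x. ennreal (G n x) \<partial>M) = c" "(\<integral>\<^sup>+x. ennreal (H x) \<partial>M) = c" "c < \<infinity>"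
  shows "(\<lambda>n. \<integral>x. \<bar>a n x\<bar> \<partial>M) \<longlonglongrightarrow> 0"
proof -
  have G0: "0 \<le> G n x" if "x \<in> space M" for n x using aG[OF that, of n] by linarith
  have H0: "0 \<le> H x" if "x \<in> space M" for x
    by (rule LIMSEQ_le_const[OF lim(2)[OF that]]) (use G0[OF that] in auto)
  have Gi: "integrable M (G n)" for n
    by (rule integrableI_nonneg) (use G0 int in \<open>auto intro!: AE_I2\<close>)
  have Hi: "integrable M H"
    by (rule integrableI_nonneg) (use H0 int in \<open>auto intro!: AE_I2\<close>)
  have IG: "(\<integral>x. G n x \<partial>M) = (\<integral>x. H x \<partial>M)" for n
    using int G0 H0 by (simp add: integral_eq_nn_integral AE_I2)
  have "(\<lambda>n. \<integral>x. max 0 (H x - G n x) \<partial>M) \<longlonglongrightarrow> (\<integral>x. 0 \<partial>M)"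
  proof (rule integral_dominated_convergence[where w = H])
    show "AE x in M. (\<lambda>n. max 0 (H x - G n x)) \<longlonglongrightarrow> 0"
    proof (rule AE_I2)
      fix x assume "x \<in> space M"
      then have "(\<lambda>n. max 0 (H x - G n x)) \<longlonglongrightarrow> max 0 (H x - H x)"
        by (intro tendsto_intros lim)
      then show "(\<lambda>n. max 0 (H x - G n x)) \<longlonglongrightarrow> 0" by simp
    qed
    show "AE x in M. norm (max 0 (H x - G n x)) \<le> H x" for n
      by (rule AE_I2) (use G0 H0 in auto)
  qed (use Hi in auto)
  then have 1: "(\<lambda>n. \<integral>x. max 0 (H x - G n x) \<partial>M) \<longlonglongrightarrow> 0" by simp
  have maxi: "integrable M (\<lambda>x. max 0 (H x - G n x))" for n
    by (intro integrable_max Bochner_Integration.integrable_diff Hi Gi) simp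
  have "(\<integral>x. max 0 (G n x - H x) \<partial>M) = (\<integral>x. max 0 (H x - G n x) \<partial>M)" for n
  proof -
    have "(\<integral>x. max 0 (G n x - H x) \<partial>M) = (\<integral>x. max 0 (H x - G n x) + (G n x - H x) \<partial>M)"
      by (rule Bochner_Integration.integral_cong) auto
    also have "\<dots> = (\<integral>x. max 0 (H x - G n x) \<partial>M)"
      using maxi Gi Hi IG by simp
    finally show ?thesis .
  qed
  with 1 have 2: "(\<lambda>n. \<integral>x. max 0 (G n x - H x) \<partial>M) \<longlonglongrightarrow> 0" by simp
  have "(\<lambda>n. \<integral>x. min \<bar>a n x\<bar> (H x) \<partial>M) \<longlonglongrightarrow> (\<integral>x. 0 \<partial>M)"
  proof (rule integral_dominated_convergence[where w = H])
    show "AE x in M. (\<lambda>n. min \<bar>a n x\<bar> (H x)) \<longlonglongrightarrow> 0"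
    proof (rule AE_I2)
      fix x assume x: "x \<in> space M"
      then have "(\<lambda>n. min \<bar>a n x\<bar> (H x)) \<longlonglongrightarrow> min \<bar>0\<bar> (H x)"
        by (intro tendsto_intros lim)
      then show "(\<lambda>n. min \<bar>a n x\<bar> (H x)) \<longlonglongrightarrow> 0" using H0[OF x] by simp
    qed
    show "AE x in M. norm (min \<bar>a n x\<bar> (H x)) \<le> H x" for n
      by (rule AE_I2) (use H0 in auto)
  qed (use Hi in auto)
  then have 3: "(\<lambda>n. \<integral>x. min \<bar>a n x\<bar> (H x) \<partial>M) \<longlonglongrightarrow> 0" by simp
  have ai: "integrable M (a n)" for n
    by (rule Bochner_Integration.integrable_bound[OF Gi[of n]]) (use aG in \<open>auto intro!: AE_I2 intro: order.trans[OF _ abs_ge_self]\<close>)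
  have le: "(\<integral>x. \<bar>a n x\<bar> \<partial>M) \<le> (\<integral>x. min \<bar>a n x\<bar> (H x) \<partial>M) + (\<integral>x. max 0 (G n x - H x) \<partial>M)" for n
  proof -
    have "(\<integral>x. \<bar>a n x\<bar> \<partial>M) \<le> (\<integral>x. min \<bar>a n x\<bar> (H x) + max 0 (G n x - H x) \<partial>M)"
    proof (rule integral_mono)
      show "integrable M (\<lambda>x. min \<bar>a n x\<bar> (H x) + max 0 (G n x - H x))"
        using ai Gi Hi by (intro Bochner_Integration.integrable_add integrable_min integrable_max) auto
      show "\<bar>a n x\<bar> \<le> min \<bar>a n x\<bar> (H x) + max 0 (G n x - H x)" if "x \<in> space M" for x
        using aG[OF that, of n] by (simp add: min_def max_def)
    qed (use ai in simp)
    also have "\<dots> = (\<integral>x. min \<bar>a n x\<bar> (H x) \<partial>M) + (\<integral>x. max 0 (G n x - H x) \<partial>M)"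
      using ai Gi Hi by (intro Bochner_Integration.integral_add integrable_min integrable_max) auto
    finally show ?thesis .
  qed
  show ?thesis
    by (rule tendsto_sandwich[OF _ _ tendsto_const]) (use le tendsto_add[OF 3 2] in auto)
qed

section \<open>The transition density of the autoregression\<close>

lemma continuous_on_unit_bounded:
  fixes g :: "real \<Rightarrow> real"
  assumes "continuous_on {0..1} g"
  shows "\<exists>B. \<forall>u\<in>{0..1}. \<bar>g u\<bar> \<le> B"
proof -
  have "bounded (g ` {0..1})"
    by (intro compact_imp_bounded compact_continuous_image assms compact_Icc)
  then show ?thesis by (auto simp: bounded_iff)
qed

lemma DERIV_const_divide_power:
  fixes t :: real
  assumes "t \<noteq> 0"
  shows "((\<lambda>t. c / t ^ Suc s) has_real_derivative - (real (Suc s) * c) / t ^ Suc (Suc s)) (at t)"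
proof -
  have "((\<lambda>t. c / t ^ Suc s) has_real_derivative
      (0 * t ^ Suc s - c * (real (Suc s) * t ^ (Suc s - Suc 0))) / (t ^ Suc s * t ^ Suc s)) (at t)"
    by (rule DERIV_divide[OF DERIV_const DERIV_pow]) (use assms in simp)
  moreover have "(0 * t ^ Suc s - c * (real (Suc s) * t ^ (Suc s - Suc 0))) / (t ^ Suc s * t ^ Suc s) = - (real (Suc s) * c) / t ^ Suc (Suc s)"
    using assms by (simp add: divide_simps)
  ultimately show ?thesis by simp
qed

text \<open>Of the coefficients only a common bound \<open>\<beta>\<close> on their sums is kept:
  coordinates bounded by \<open>B\<close> give a value bounded by
  \<open>\<beta> * B + \<beta>0\<close>, a contraction of the maximum norm up to a constant.\<close>

locale ar_kernel =
  fixes p k :: nat and m :: "real \<Rightarrow> (nat \<Rightarrow> real) \<Rightarrow> real" and \<sigma> f :: "real \<Rightarrow> real"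
    and \<beta> \<beta>0 q' C1 C2 d0 :: real
  assumes p: "1 \<le> p" and k: "1 \<le> k"
    and m_meas: "\<And>u. u \<in> {0..1} \<Longrightarrow> m u \<in> borel_measurable (Rp p)"
    and \<sigma>C: "Ck_on k {0..1} \<sigma>" and \<sigma>_pos: "\<And>u. u \<in> {0..1} \<Longrightarrow> 0 < \<sigma> u"
    and mC: "\<And>y. y \<in> space (Rp p) \<Longrightarrow> Ck_on k {0..1} (\<lambda>u. m u y)"
    and \<beta>: "0 \<le> \<beta>" "\<beta> < 1" and cpos: "0 < \<beta>0" "0 < q'" "0 < C1" "0 < C2"
    and m_growth: "\<And>u y B. u \<in> {0..1} \<Longrightarrow> y \<in> space (Rp p) \<Longrightarrow> \<forall>i\<in>{1..p}. \<bar>y i\<bar> \<le> B \<Longrightarrow> \<bar>m u y\<bar> \<le> \<beta> * B + \<beta>0"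
    and m_deriv_growth: "\<And>l u y. l \<in> {1..k} \<Longrightarrow> u \<in> {0..1} \<Longrightarrow> y \<in> space (Rp p) \<Longrightarrow>
       \<bar>nderiv {0..1} (\<lambda>u. m u y) l u\<bar> \<le> C1 * (\<Sum>i=1..p. \<bar>y i\<bar>) powr q' + C2"
    and d0: "0 < d0 - q' * real k"
    and fC: "Ck_on k UNIV f" and f_pos: "\<And>y. 0 < f y"
    and f_int: "\<And>s. s \<le> k \<Longrightarrow> integrable lborel (\<lambda>y. \<bar>y\<bar> powr (d0 + (1 - q') * real s) * \<bar>nderiv UNIV f s y\<bar>)"
    and f_mass: "(\<integral>\<^sup>+y. ennreal (f y) \<partial>lborel) = 1"
begin

definition mm :: "nat \<Rightarrow> real \<Rightarrow> (nat \<Rightarrow> real) \<Rightarrow> real" where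
  "mm l u x = nderiv {0..1} (\<lambda>u. m u (rev_vec p x)) l u"

abbreviation F :: "nat \<Rightarrow> real \<Rightarrow> real" where "F \<equiv> nderiv UNIV f"

text \<open>The functions passed to \<open>chain_deriv\<close> are the successive derivatives of
  \<open>1 / t\<close>, so \<open>tau l\<close> is the \<open>l\<close>-th derivative of
  \<open>1 / \<sigma>\<close>.\<close>

definition tau :: "nat \<Rightarrow> real \<Rightarrow> real" where
  "tau l = chain_deriv (\<lambda>s t. (- 1) ^ s * fact s / t ^ Suc s) (nderiv {0..1} \<sigma>) l 0"

text \<open>\<open>zz x y 0 u\<close> is the argument \<open>(y - m(u, x)) / \<sigma>(u)\<close> of the noise density, and \<open>rho 0 x y u\<close> is the
  transition density; the other indices are the derivatives with respect to \<open>u\<close>.\<close>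

definition zz :: "(nat \<Rightarrow> real) \<Rightarrow> real \<Rightarrow> nat \<Rightarrow> real \<Rightarrow> real" where
  "zz x y = leib tau (\<lambda>i u. if i = 0 then y - mm 0 u x else - mm i u x)"

definition rho :: "nat \<Rightarrow> (nat \<Rightarrow> real) \<Rightarrow> real \<Rightarrow> real \<Rightarrow> real" where
  "rho l x y = leib tau (\<lambda>i. chain_deriv F (zz x y) i 0) l"

definition sz :: "(nat \<Rightarrow> real) \<Rightarrow> real" where
  "sz x = 1 + (\<Sum>i=1..p. \<bar>x i\<bar>)"

lemma sz_ge1: "1 \<le> sz x"
  by (simp add: sz_def sum_nonneg)

lemma rev_vec_space: "rev_vec p x \<in> space (Rp p)"
  by (simp add: rev_vec_def space_PiM)

lemma sum_rev_vec: "(\<Sum>i=1..p. \<bar>rev_vec p x i\<bar>) = (\<Sum>i=1..p. \<bar>x i\<bar>)"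
  by (rule sum.reindex_bij_witness[where i = "\<lambda>i. p + 1 - i" and j = "\<lambda>i. p + 1 - i"])
     (auto simp: rev_vec_def)

lemma mm_dseq: "dseq k (\<lambda>l u. mm l u x)"
  unfolding mm_def by (rule Ck_on_dseq[OF mC[OF rev_vec_space]])

lemma mm_0: "mm 0 u x = m u (rev_vec p x)"
  by (simp add: mm_def nderiv_simps)

lemma tau_dseq: "dseq k tau"
  unfolding tau_def
proof (rule chain_deriv_dseq[OF Ck_on_dseq[OF \<sigma>C]])
  fix s u assume u: "u \<in> {0..1::real}"
  show "((\<lambda>t. (- 1) ^ s * fact s / t ^ Suc s) has_real_derivative
      (- 1) ^ Suc s * fact (Suc s) / (nderiv {0..1} \<sigma> 0 u) ^ Suc (Suc s)) (at (nderiv {0..1} \<sigma> 0 u))"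
    using DERIV_const_divide_power[of "\<sigma> u" "(- 1) ^ s * fact s" s] \<sigma>_pos[OF u] unfolding nderiv_simps
    by (simp add: mult_ac)
next
  fix s
  show "continuous_on (nderiv {0..1} \<sigma> 0 ` {0..1}) (\<lambda>t. (- 1) ^ s * fact s / t ^ Suc s)"
    by (intro continuous_intros) (use \<sigma>_pos in \<open>force simp: nderiv_simps\<close>)
qed

lemma tau_0: "tau 0 u = 1 / \<sigma> u"
  by (simp add: tau_def nderiv_simps)

lemma tau_0_pos: "u \<in> {0..1} \<Longrightarrow> 0 < tau 0 u"
  using \<sigma>_pos by (simp add: tau_0)

lemma zz_dseq: "dseq k (zz x y)"
  unfolding zz_def
proof (rule dseq_leib[OF tau_dseq])
  show "dseq k (\<lambda>i u. if i = 0 then y - mm 0 u x else - mm i u x)"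
    unfolding dseq_def
  proof (intro conjI allI impI ballI)
    fix l u assume "l < k" "u \<in> {0..1::real}"
    then have "((\<lambda>u. mm l u x) has_real_derivative mm (Suc l) u x) (at u within {0..1})"
      using dseqD(1)[OF mm_dseq] by blast
    then show "((\<lambda>u. if l = 0 then y - mm 0 u x else - mm l u x) has_real_derivative
       (if Suc l = 0 then y - mm 0 u x else - mm (Suc l) u x)) (at u within {0..1})"
      by (cases "l = 0") (auto intro!: derivative_eq_intros)
  next
    fix l assume "l \<le> k"
    then have "continuous_on {0..1} (\<lambda>u. mm l u x)" using dseqD(2)[OF mm_dseq] by blast
    then show "continuous_on {0..1} (\<lambda>u. if l = 0 then y - mm 0 u x else - mm l u x)"
      by (cases "l = 0") (auto intro!: continuous_intros)
  qed
qed

lemma zz_0: "zz x y 0 u = tau 0 u * (y - mm 0 u x)"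
  by (simp add: zz_def leib_def)

lemma F_deriv: "s < k \<Longrightarrow> (F s has_real_derivative F (Suc s) z) (at z)"
  using nderiv_has_derivative[OF fC, of s z] by simp

lemma F_continuous: "s \<le> k \<Longrightarrow> continuous_on UNIV (F s)"
  by (rule nderiv_continuous[OF fC])

lemma F_measurable: "s \<le> k \<Longrightarrow> F s \<in> borel_measurable borel"
  by (rule borel_measurable_continuous_onI[OF F_continuous])

lemma rho_dseq: "dseq k (\<lambda>l. rho l x y)"
  unfolding rho_def
  by (intro dseq_leib[OF tau_dseq, unfolded eta_contract_eq] chain_deriv_dseq[OF zz_dseq] F_deriv)
     (auto intro: continuous_on_subset[OF F_continuous])

lemma rho_0: "rho 0 x y u = 1 / \<sigma> u * f ((y - m u (rev_vec p x)) / \<sigma> u)"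
  by (simp add: rho_def leib_def zz_0 tau_0 mm_0 nderiv_simps)

section \<open>Domination of the derivatives of the transition density\<close>

definition dl :: "nat \<Rightarrow> real" where "dl l = d0 - q' * real l"

lemma dl_mono: "l \<le> l' \<Longrightarrow> dl l' \<le> dl l"
  using cpos by (simp add: dl_def)

lemma dl_pos: "l \<le> k \<Longrightarrow> 0 < dl l"
  using dl_mono[of l k] d0 by (simp add: dl_def)

text \<open>The moment conditions on \<open>f\<close> and its derivatives, collected into one
  integrable function of the standardized noise that serves all orders at once.\<close>

definition Phi :: "real \<Rightarrow> real" where
  "Phi z = (\<Sum>r\<le>k. \<bar>F r z\<bar> * (1 + \<bar>z\<bar>) powr (d0 + (1 - q') * real r))"

text \<open>\<open>Phi\<close> in the variable \<open>y\<close>, with the Jacobian of the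
  substitution, so that its integral is the same for all \<open>x\<close> and \<open>u\<close>. This
  constancy takes the place of a common dominating function.\<close>

definition H :: "(nat \<Rightarrow> real) \<Rightarrow> real \<Rightarrow> real \<Rightarrow> real" where
  "H x u y = tau 0 u * Phi (tau 0 u * (y - mm 0 u x))"

lemma Phi_nonneg: "0 \<le> Phi z"
  by (simp add: Phi_def sum_nonneg)

lemma Phi_continuous: "continuous_on UNIV Phi"
  unfolding Phi_def[abs_def] by (intro continuous_intros F_continuous) auto

lemma H_nonneg: "u \<in> {0..1} \<Longrightarrow> 0 \<le> H x u y"
  using tau_0_pos[of u] Phi_nonneg by (simp add: H_def)

lemma ex_tau_bound: "\<exists>T\<ge>1. (\<forall>l\<le>k. \<forall>u\<in>{0..1}. \<bar>tau l u\<bar> \<le> T) \<and> (\<forall>u\<in>{0..1}. \<sigma> u \<le> T)"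
proof -
  have "\<exists>B. \<forall>u\<in>{0..1}. \<bar>tau l u\<bar> \<le> B" if "l \<le> k" for l
    by (rule continuous_on_unit_bounded[OF dseqD(2)[OF tau_dseq that]])
  then obtain B where B: "\<And>l u. l \<le> k \<Longrightarrow> u \<in> {0..1} \<Longrightarrow> \<bar>tau l u\<bar> \<le> B l" by metis
  obtain S where S: "\<And>u. u \<in> {0..1} \<Longrightarrow> \<bar>\<sigma> u\<bar> \<le> S"
    using continuous_on_unit_bounded[OF nderiv_continuous[OF \<sigma>C, of 0]] by (auto simp: nderiv_simps simp del: atLeastAtMost_iff)
  define T where "T = 1 + \<bar>S\<bar> + (\<Sum>l\<le>k. \<bar>B l\<bar>)"
  have B0: "0 \<le> (\<Sum>l\<le>k. \<bar>B l\<bar>)" by (rule sum_nonneg) simp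
  have "\<bar>tau l u\<bar> \<le> T" if "l \<le> k" "u \<in> {0..1}" for l u
  proof -
    have "\<bar>B l\<bar> \<le> (\<Sum>l\<le>k. \<bar>B l\<bar>)" by (rule member_le_sum) (use that in auto)
    then show ?thesis using B[OF that] by (simp add: T_def)
  qed
  moreover have "\<sigma> u \<le> T" if "u \<in> {0..1}" for u
    using S[OF that] B0 abs_ge_self[of S] abs_ge_self[of "\<sigma> u"] unfolding T_def by linarith
  moreover have "1 \<le> T" using B0 by (simp add: T_def)
  ultimately show ?thesis by blast
qed

lemma sz_powr_ge1: "1 \<le> sz x powr q'"
  using sz_ge1 cpos by (simp add: ge_one_powr_ge_zero)

text \<open>The observation is eliminated through
  \<open>y - mm 0 u x = \<sigma> u * zz x y 0 u\<close>, and the derivatives of \<open>m\<close>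
  contribute \<open>sz x powr q'\<close>. The result has the shape that
  \<open>chain_deriv_bound\<close> asks for, with \<open>B = sz x powr q'\<close>.\<close>

lemma zz_bound: "\<exists>A\<ge>0. \<forall>x y. \<forall>u\<in>{0..1}. \<forall>i\<in>{1..k}. \<bar>zz x y i u\<bar> \<le> A * (sz x powr q' + \<bar>zz x y 0 u\<bar>)"
proof -
  obtain T where T: "T \<ge> 1" "\<And>l u. l \<le> k \<Longrightarrow> u \<in> {0..1} \<Longrightarrow> \<bar>tau l u\<bar> \<le> T" "\<And>u. u \<in> {0..1} \<Longrightarrow> \<sigma> u \<le> T"
    using ex_tau_bound by blast
  show ?thesis
  proof (intro exI[of _ "2 ^ k * (T * (T + C1 + C2))"] conjI allI ballI)
    show "0 \<le> 2 ^ k * (T * (T + C1 + C2))" using T cpos by simp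
    fix x y u i assume u: "u \<in> {0..1::real}" and i: "i \<in> {1..k}"
    let ?b = "sz x powr q' + \<bar>zz x y 0 u\<bar>"
    let ?e = "\<lambda>i. if i = 0 then y - mm 0 u x else - mm i u x"
    have e: "\<bar>?e j\<bar> \<le> (T + C1 + C2) * ?b" if "j \<le> i" for j
    proof (cases "j = 0")
      case True
      have "\<bar>?e j\<bar> = \<sigma> u * \<bar>zz x y 0 u\<bar>"
        using \<sigma>_pos[OF u] True by (simp add: zz_0 tau_0 abs_mult)
      also have "\<dots> \<le> (T + C1 + C2) * ?b"
        by (rule mult_mono) (use T(3)[OF u] T(1) cpos sz_powr_ge1[of x] in auto)
      finally show ?thesis .
    next
      case False
      have "\<bar>?e j\<bar> \<le> C1 * (\<Sum>i=1..p. \<bar>rev_vec p x i\<bar>) powr q' + C2"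
        using m_deriv_growth[OF _ u rev_vec_space, of j x] False that i by (simp add: mm_def)
      also have "\<dots> \<le> C1 * sz x powr q' + C2 * sz x powr q'"
      proof (rule add_mono)
        show "C1 * (\<Sum>i=1..p. \<bar>rev_vec p x i\<bar>) powr q' \<le> C1 * sz x powr q'"
          unfolding sum_rev_vec using cpos by (intro mult_left_mono powr_mono2) (auto simp: sz_def sum_nonneg)
        show "C2 \<le> C2 * sz x powr q'" using sz_powr_ge1[of x] cpos by simp
      qed
      also have "\<dots> = (C1 + C2) * sz x powr q'" by (simp add: algebra_simps)
      also have "\<dots> \<le> (T + C1 + C2) * ?b"
        by (rule mult_mono) (use T(1) cpos in auto)
      finally show ?thesis .
    qed
    have b0: "0 \<le> (T + C1 + C2) * ?b" using T cpos by (intro mult_nonneg_nonneg) auto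
    have "\<bar>zz x y i u\<bar> \<le> (\<Sum>j\<le>i. \<bar>real (i choose j) * (tau (i - j) u * ?e j)\<bar>)"
      unfolding zz_def leib_def by (rule sum_abs)
    also have "\<dots> \<le> (\<Sum>j\<le>i. real (i choose j) * (T * ((T + C1 + C2) * ?b)))"
    proof (rule sum_mono)
      fix j assume "j \<in> {..i}"
      then have "\<bar>tau (i - j) u\<bar> * \<bar>?e j\<bar> \<le> T * ((T + C1 + C2) * ?b)"
        by (intro mult_mono T(2) u e) (use i T in auto)
      then show "\<bar>real (i choose j) * (tau (i - j) u * ?e j)\<bar> \<le> real (i choose j) * (T * ((T + C1 + C2) * ?b))"
        unfolding abs_mult by (simp only: abs_of_nat) (rule mult_left_mono, auto)
    qed
    also have "\<dots> = 2 ^ i * (T * ((T + C1 + C2) * ?b))"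
      unfolding sum_distrib_right[symmetric] of_nat_sum[symmetric] choose_row_sum by simp
    also have "\<dots> \<le> 2 ^ k * (T * ((T + C1 + C2) * ?b))"
      using i T(1) b0 by (intro mult_right_mono power_increasing) auto
    finally show "\<bar>zz x y i u\<bar> \<le> 2 ^ k * (T * (T + C1 + C2)) * ?b" by (simp add: mult.assoc)
  qed
qed

text \<open>At most \<open>i\<close> factors \<open>sz x powr q'\<close> arise, one per derivative,
  and \<open>B + |z| \<le> B * (1 + |z|)\<close> separates the state from the noise
  variable.\<close>

lemma rho_bound:
  "\<exists>C\<ge>0. \<forall>x y. \<forall>u\<in>{0..1}. \<forall>i\<le>k. \<bar>rho i x y u\<bar> \<le>
     C * sz x powr (q' * real i) * tau 0 u * (\<Sum>r\<le>i. \<bar>F r (zz x y 0 u)\<bar> * (1 + \<bar>zz x y 0 u\<bar>) ^ r)"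
proof -
  obtain T where T: "T \<ge> 1" "\<And>l u. l \<le> k \<Longrightarrow> u \<in> {0..1} \<Longrightarrow> \<bar>tau l u\<bar> \<le> T" "\<And>u. u \<in> {0..1} \<Longrightarrow> \<sigma> u \<le> T"
    using ex_tau_bound by blast
  obtain A where A: "A \<ge> 0" "\<And>x y u i. u \<in> {0..1} \<Longrightarrow> i \<in> {1..k} \<Longrightarrow> \<bar>zz x y i u\<bar> \<le> A * (sz x powr q' + \<bar>zz x y 0 u\<bar>)"
    using zz_bound by blast
  define Q where "Q l C \<longleftrightarrow> 0 \<le> C \<and> (\<forall>F z s u B. 0 \<le> B \<longrightarrow> (\<forall>i\<in>{1..l}. \<bar>z i u\<bar> \<le> A * (B + \<bar>z 0 u\<bar>)) \<longrightarrow>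
     \<bar>chain_deriv F z l s u\<bar> \<le> C * (\<Sum>r\<le>l. \<bar>F (s + r) (z 0 u)\<bar> * (B + \<bar>z 0 u\<bar>) ^ r))" for l C
  have "\<forall>l. \<exists>C. Q l C"
    using chain_deriv_bound[OF A(1)] unfolding Q_def by simp
  then obtain c where Q: "\<And>l. Q l (c l)" using choice[of Q] by blast
  then have c: "\<And>l. 0 \<le> c l" by (simp add: Q_def)
  have bd: "\<bar>chain_deriv F z l s u\<bar> \<le> c l * (\<Sum>r\<le>l. \<bar>F (s + r) (z 0 u)\<bar> * (B + \<bar>z 0 u\<bar>) ^ r)"
    if "0 \<le> B" "\<forall>i\<in>{1..l}. \<bar>z i u\<bar> \<le> A * (B + \<bar>z 0 u\<bar>)" for l F z s u B
    using Q[of l] that unfolding Q_def by simp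
  define K where "K = (\<Sum>l\<le>k. c l)"
  have K: "c l \<le> K" if "l \<le> k" for l
    unfolding K_def using c that by (intro member_le_sum) auto
  have K0: "0 \<le> K" unfolding K_def using c by (intro sum_nonneg) auto
  show ?thesis
  proof (intro exI[of _ "2 ^ k * (T * K) * T"] conjI allI ballI impI)
    show "0 \<le> 2 ^ k * (T * K) * T" using T(1) K0 by simp
    fix x y u i assume u: "u \<in> {0..1::real}" and i: "i \<le> k"
    let ?z = "zz x y 0 u" and ?B = "sz x powr q'"
    define S where "S = (\<Sum>r\<le>i. \<bar>F r ?z\<bar> * (1 + \<bar>?z\<bar>) ^ r)"
    have S0: "0 \<le> S" by (simp add: S_def sum_nonneg)
    have Bi: "?B ^ i = sz x powr (q' * real i)"
      using sz_ge1[of x] by (simp add: powr_powr[symmetric] powr_realpow)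
    have ch: "\<bar>chain_deriv F (zz x y) j 0 u\<bar> \<le> K * (?B ^ i * S)" if j: "j \<le> i" for j
    proof -
      have "\<bar>chain_deriv F (zz x y) j 0 u\<bar> \<le> c j * (\<Sum>r\<le>j. \<bar>F (0 + r) ?z\<bar> * (?B + \<bar>?z\<bar>) ^ r)"
        by (rule bd) (use A(2)[OF u] i j in auto)
      also have "(\<Sum>r\<le>j. \<bar>F (0 + r) ?z\<bar> * (?B + \<bar>?z\<bar>) ^ r) \<le> (\<Sum>r\<le>j. ?B ^ i * (\<bar>F r ?z\<bar> * (1 + \<bar>?z\<bar>) ^ r))"
      proof (rule sum_mono)
        fix r assume r: "r \<in> {..j}"
        have "1 * \<bar>?z\<bar> \<le> ?B * \<bar>?z\<bar>" by (rule mult_right_mono[OF sz_powr_ge1]) simp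
        then have "(?B + \<bar>?z\<bar>) ^ r \<le> (?B * (1 + \<bar>?z\<bar>)) ^ r"
          by (intro power_mono) (auto simp: algebra_simps)
        also have "\<dots> \<le> ?B ^ i * (1 + \<bar>?z\<bar>) ^ r"
          unfolding power_mult_distrib using sz_powr_ge1[of x] r j by (intro mult_right_mono power_increasing) auto
        finally show "\<bar>F (0 + r) ?z\<bar> * (?B + \<bar>?z\<bar>) ^ r \<le> ?B ^ i * (\<bar>F r ?z\<bar> * (1 + \<bar>?z\<bar>) ^ r)"
          using mult_left_mono[of "(?B + \<bar>?z\<bar>) ^ r" "?B ^ i * (1 + \<bar>?z\<bar>) ^ r" "\<bar>F r ?z\<bar>"] by (simp add: mult_ac)
      qed
      also have "\<dots> = ?B ^ i * (\<Sum>r\<le>j. \<bar>F r ?z\<bar> * (1 + \<bar>?z\<bar>) ^ r)" by (simp add: sum_distrib_left)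
      also have "\<dots> \<le> ?B ^ i * S"
        unfolding S_def by (intro mult_left_mono sum_mono2) (use j in auto)
      finally have "\<bar>chain_deriv F (zz x y) j 0 u\<bar> \<le> c j * (?B ^ i * S)" using c by (simp add: mult_left_mono)
      also have "\<dots> \<le> K * (?B ^ i * S)" by (rule mult_right_mono) (use K[of j] j i S0 in auto)
      finally show ?thesis .
    qed
    have "\<bar>rho i x y u\<bar> \<le> (\<Sum>j\<le>i. \<bar>real (i choose j) * (tau (i - j) u * chain_deriv F (zz x y) j 0 u)\<bar>)"
      unfolding rho_def leib_def by (rule sum_abs)
    also have "\<dots> \<le> (\<Sum>j\<le>i. real (i choose j) * (T * (K * (?B ^ i * S))))"
    proof (rule sum_mono)
      fix j assume "j \<in> {..i}"
      then have "\<bar>tau (i - j) u\<bar> * \<bar>chain_deriv F (zz x y) j 0 u\<bar> \<le> T * (K * (?B ^ i * S))"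
        by (intro mult_mono T(2) u ch) (use i T(1) K0 S0 in auto)
      then show "\<bar>real (i choose j) * (tau (i - j) u * chain_deriv F (zz x y) j 0 u)\<bar> \<le> real (i choose j) * (T * (K * (?B ^ i * S)))"
        unfolding abs_mult by (simp only: abs_of_nat) (rule mult_left_mono, auto)
    qed
    also have "\<dots> = 2 ^ i * (T * (K * (?B ^ i * S)))"
      unfolding sum_distrib_right[symmetric] of_nat_sum[symmetric] choose_row_sum by simp
    also have "\<dots> \<le> 2 ^ k * (T * (K * (?B ^ i * S)))"
      using i T(1) K0 S0 by (intro mult_right_mono power_increasing) auto
    \<comment> \<open>A factor that is at least 1 is inserted, so that the bound carries the
      Jacobian \<open>tau 0 u\<close> contained in \<open>H\<close>.\<close>
    also have "\<dots> * 1 \<le> \<dots> * (T * tau 0 u)"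
    proof (rule mult_left_mono)
      show "1 \<le> T * tau 0 u" using T(3)[OF u] \<sigma>_pos[OF u] by (simp add: tau_0 field_simps)
    qed (use T(1) K0 S0 in auto)
    finally show "\<bar>rho i x y u\<bar> \<le> 2 ^ k * (T * K) * T * sz x powr (q' * real i) * tau 0 u * (\<Sum>r\<le>i. \<bar>F r ?z\<bar> * (1 + \<bar>?z\<bar>) ^ r)"
      unfolding Bi[symmetric] S_def[symmetric] by (simp add: mult_ac)
  qed
qed

lemma y_bound: "\<exists>D\<ge>1. \<forall>x y N. \<forall>u\<in>{0..1}. sz x \<le> N \<longrightarrow> 2 * (N + \<bar>y\<bar>) \<le> D * (N * (1 + \<bar>zz x y 0 u\<bar>))"
proof -
  obtain T where T: "T \<ge> 1" "\<And>u. u \<in> {0..1} \<Longrightarrow> \<sigma> u \<le> T"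
    using ex_tau_bound by blast
  show ?thesis
  proof (intro exI[of _ "2 * (2 + \<beta>0 + T)"] conjI allI ballI impI)
    show "1 \<le> 2 * (2 + \<beta>0 + T)" using T cpos by simp
    fix x y N u assume u: "u \<in> {0..1::real}" and N: "sz x \<le> N"
    let ?z = "zz x y 0 u"
    have N1: "1 \<le> N" using sz_ge1[of x] N by simp
    have "\<bar>mm 0 u x\<bar> \<le> \<beta> * sz x + \<beta>0"
      unfolding mm_0
    proof (rule m_growth[OF u rev_vec_space], rule ballI)
      fix i assume "i \<in> {1..p}"
      then have "\<bar>rev_vec p x i\<bar> \<le> (\<Sum>i=1..p. \<bar>rev_vec p x i\<bar>)" by (intro member_le_sum) auto
      then show "\<bar>rev_vec p x i\<bar> \<le> sz x" unfolding sum_rev_vec sz_def by simp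
    qed
    also have "\<dots> \<le> 1 * N + \<beta>0 * N"
      by (intro add_mono mult_mono) (use \<beta> N N1 cpos sz_ge1[of x] in \<open>auto simp: mult_le_cancel_left1\<close>)
    finally have mb: "\<bar>mm 0 u x\<bar> \<le> (1 + \<beta>0) * N" by (simp add: algebra_simps)
    have "y = mm 0 u x + \<sigma> u * ?z" using \<sigma>_pos[OF u] by (simp add: zz_0 tau_0)
    then have "\<bar>y\<bar> \<le> \<bar>mm 0 u x\<bar> + \<bar>\<sigma> u * ?z\<bar>" by linarith
    also have "\<bar>\<sigma> u * ?z\<bar> \<le> T * (N * \<bar>?z\<bar>)"
      unfolding abs_mult by (intro mult_mono) (use T(2)[OF u] \<sigma>_pos[OF u] T(1) N1 in \<open>auto simp: mult_le_cancel_right1\<close>)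
    finally have "\<bar>y\<bar> \<le> (1 + \<beta>0) * N + T * (N * \<bar>?z\<bar>)" using mb by linarith
    moreover have "(1 + \<beta>0) * N * 1 \<le> (1 + \<beta>0) * N * (1 + \<bar>?z\<bar>)" "T * (N * \<bar>?z\<bar>) \<le> T * (N * (1 + \<bar>?z\<bar>))" "N * 1 \<le> N * (1 + \<bar>?z\<bar>)"
      using cpos N1 T by (intro mult_left_mono; simp)+
    ultimately show "2 * (N + \<bar>y\<bar>) \<le> 2 * (2 + \<beta>0 + T) * (N * (1 + \<bar>?z\<bar>))" by (simp add: algebra_simps)
  qed
qed

text \<open>The exponents balance exactly: the new weight gives \<open>N\<close> to the power
  \<open>dl (l + i)\<close>, the derivatives give \<open>q' * i\<close> more, and the sum is
  \<open>dl l\<close>. The noise variable is left with the exponent \<open>dl (l + i) + r\<close>,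
  which for \<open>r \<le> i\<close> does not exceed the exponent \<open>d0 + (1 - q') * r\<close>
  that occurs in \<open>Phi\<close>.\<close>

lemma kernel_bound:
  "\<exists>C>0. \<forall>l i x y N N'. \<forall>u\<in>{0..1}. l + i \<le> k \<longrightarrow> sz x \<le> N \<longrightarrow> 0 \<le> N' \<longrightarrow> N' \<le> 2 * (N + \<bar>y\<bar>) \<longrightarrow>
     N' powr dl (l + i) * \<bar>rho i x y u\<bar> \<le> C * N powr dl l * H x u y"
proof -
  obtain C where C: "C \<ge> 0" "\<And>x y u i. u \<in> {0..1} \<Longrightarrow> i \<le> k \<Longrightarrow> \<bar>rho i x y u\<bar> \<le>
     C * sz x powr (q' * real i) * tau 0 u * (\<Sum>r\<le>i. \<bar>F r (zz x y 0 u)\<bar> * (1 + \<bar>zz x y 0 u\<bar>) ^ r)"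
    using rho_bound by blast
  obtain D where D: "D \<ge> 1" "\<And>x y N u. u \<in> {0..1} \<Longrightarrow> sz x \<le> N \<Longrightarrow> 2 * (N + \<bar>y\<bar>) \<le> D * (N * (1 + \<bar>zz x y 0 u\<bar>))"
    using y_bound by blast
  show ?thesis
  proof (intro exI[of _ "D powr d0 * (C + 1)"] conjI allI ballI impI)
    show "0 < D powr d0 * (C + 1)" using C D by simp
    fix l i x y N N' u assume u: "u \<in> {0..1::real}" and li: "l + i \<le> k" and N: "sz x \<le> N" and N': "0 \<le> N'" "N' \<le> 2 * (N + \<bar>y\<bar>)"
    let ?d = "dl (l + i)"
    define z where "z = zz x y 0 u"
    have N1: "1 \<le> N" using sz_ge1[of x] N by simp
    have d: "0 < ?d" "?d \<le> d0" using dl_pos[OF li] dl_mono[of 0 "l + i"] by (auto simp: dl_def)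
    have "N' powr ?d \<le> (D * (N * (1 + \<bar>z\<bar>))) powr ?d"
      using N' D(2)[OF u N, of y] d by (intro powr_mono2) (auto simp: z_def)
    also have "\<dots> = D powr ?d * (N powr ?d * (1 + \<bar>z\<bar>) powr ?d)"
      using D N1 by (simp add: powr_mult)
    also have "\<dots> \<le> D powr d0 * (N powr ?d * (1 + \<bar>z\<bar>) powr ?d)"
      by (intro mult_right_mono powr_mono) (use D d in auto)
    finally have N'd: "N' powr ?d \<le> D powr d0 * (N powr ?d * (1 + \<bar>z\<bar>) powr ?d)" .
    have "sz x powr (q' * real i) \<le> N powr (q' * real i)"
      using N sz_ge1[of x] cpos by (intro powr_mono2) auto
    then have "C * sz x powr (q' * real i) \<le> (C + 1) * N powr (q' * real i)"
      using C(1) by (intro mult_mono) auto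
    then have "C * sz x powr (q' * real i) * (tau 0 u * (\<Sum>r\<le>i. \<bar>F r z\<bar> * (1 + \<bar>z\<bar>) ^ r)) \<le>
       (C + 1) * N powr (q' * real i) * (tau 0 u * (\<Sum>r\<le>i. \<bar>F r z\<bar> * (1 + \<bar>z\<bar>) ^ r))"
      by (rule mult_right_mono) (use tau_0_pos[OF u] in \<open>auto intro!: mult_nonneg_nonneg sum_nonneg\<close>)
    then have "\<bar>rho i x y u\<bar> \<le> (C + 1) * N powr (q' * real i) * tau 0 u * (\<Sum>r\<le>i. \<bar>F r z\<bar> * (1 + \<bar>z\<bar>) ^ r)"
      using C(2)[OF u, of i x y] li unfolding z_def[symmetric] by (simp add: mult.assoc)
    then have "N' powr ?d * \<bar>rho i x y u\<bar> \<le> (D powr d0 * (N powr ?d * (1 + \<bar>z\<bar>) powr ?d)) *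
        ((C + 1) * N powr (q' * real i) * tau 0 u * (\<Sum>r\<le>i. \<bar>F r z\<bar> * (1 + \<bar>z\<bar>) ^ r))"
      by (intro mult_mono N'd) auto
    also have "\<dots> = (D powr d0 * (C + 1)) * (N powr ?d * N powr (q' * real i)) * (tau 0 u * ((1 + \<bar>z\<bar>) powr ?d * (\<Sum>r\<le>i. \<bar>F r z\<bar> * (1 + \<bar>z\<bar>) ^ r)))"
      by (simp add: mult_ac)
    also have "N powr ?d * N powr (q' * real i) = N powr dl l"
      by (simp add: powr_add[symmetric] dl_def algebra_simps)
    also have "(D powr d0 * (C + 1)) * N powr dl l * (tau 0 u * ((1 + \<bar>z\<bar>) powr ?d * (\<Sum>r\<le>i. \<bar>F r z\<bar> * (1 + \<bar>z\<bar>) ^ r))) \<le>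
        (D powr d0 * (C + 1)) * N powr dl l * (tau 0 u * Phi z)"
    proof (intro mult_left_mono)
      have "(1 + \<bar>z\<bar>) powr ?d * (\<Sum>r\<le>i. \<bar>F r z\<bar> * (1 + \<bar>z\<bar>) ^ r) = (\<Sum>r\<le>i. \<bar>F r z\<bar> * (1 + \<bar>z\<bar>) powr (?d + real r))"
        by (simp add: sum_distrib_left powr_add powr_realpow mult_ac)
      also have "\<dots> \<le> (\<Sum>r\<le>i. \<bar>F r z\<bar> * (1 + \<bar>z\<bar>) powr (d0 + (1 - q') * real r))"
      proof (intro sum_mono mult_left_mono powr_mono)
        fix r assume "r \<in> {..i}"
        then have "dl (l + i) \<le> dl r" by (intro dl_mono) auto
        then show "?d + real r \<le> d0 + (1 - q') * real r" by (simp add: dl_def algebra_simps)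
      qed auto
      also have "\<dots> \<le> Phi z" unfolding Phi_def by (rule sum_mono2) (use li in auto)
      finally show "(1 + \<bar>z\<bar>) powr ?d * (\<Sum>r\<le>i. \<bar>F r z\<bar> * (1 + \<bar>z\<bar>) ^ r) \<le> Phi z" .
    qed (use tau_0_pos[OF u] C in auto)
    finally show "N' powr dl (l + i) * \<bar>rho i x y u\<bar> \<le> D powr d0 * (C + 1) * N powr dl l * H x u y"
      by (simp add: H_def z_def zz_0)
  qed
qed

section \<open>Measurability of the derivatives and integrals of the dominating functions\<close>

lemma rev_vec_measurable: "rev_vec p \<in> measurable (Rp p) (Rp p)"
  unfolding rev_vec_def[abs_def]
  by (rule measurable_restrict) (rule measurable_component_singleton, auto)

text \<open>Each derivative is a pointwise limit of difference quotients of the preceding one, so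
  measurability goes up order by order.\<close>

lemma mm_measurable: "l \<le> k \<Longrightarrow> u \<in> {0..1} \<Longrightarrow> (\<lambda>x. mm l u x) \<in> borel_measurable (Rp p)"
proof (induction l arbitrary: u)
  case 0
  then show ?case
    unfolding mm_0 by (intro measurable_compose[OF rev_vec_measurable m_meas])
next
  case (Suc l)
  obtain U :: "nat \<Rightarrow> real" where U: "\<And>n. U n \<in> {0..1} - {u}" "U \<longlonglongrightarrow> u"
    by (rule ex_sequence_tendsto[OF Suc.prems(2)]) (rule that)
  show ?case
  proof (rule borel_measurable_LIMSEQ_real)
    show "(\<lambda>n. (mm l (U n) x - mm l u x) / (U n - u)) \<longlonglongrightarrow> mm (Suc l) u x" for x
    proof -
      have "((\<lambda>u. mm l u x) has_real_derivative mm (Suc l) u x) (at u within {0..1})"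
        using dseqD(1)[OF mm_dseq] Suc.prems by (simp add: Suc_le_eq)
      then have "((\<lambda>v. (mm l v x - mm l u x) / (v - u)) \<longlongrightarrow> mm (Suc l) u x) (at u within {0..1})"
        by (simp add: has_field_derivative_iff)
      then show ?thesis using U unfolding tendsto_at_iff_sequentially comp_def by blast
    qed
    show "(\<lambda>x. (mm l (U n) x - mm l u x) / (U n - u)) \<in> borel_measurable (Rp p)" for n
      using U(1)[of n] Suc.prems by (intro borel_measurable_divide borel_measurable_diff Suc.IH) auto
  qed
qed

lemma zz_measurable: "l \<le> k \<Longrightarrow> u \<in> {0..1} \<Longrightarrow> (\<lambda>(x, y). zz x y l u) \<in> borel_measurable (Rp p \<Otimes>\<^sub>M borel)"
  unfolding zz_def leib_def case_prod_beta
proof (intro borel_measurable_sum borel_measurable_times borel_measurable_const)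
  fix i assume i: "l \<le> k" "u \<in> {0..1}" "i \<in> {..l}"
  have "(\<lambda>z. mm j u (fst z)) \<in> borel_measurable (Rp p \<Otimes>\<^sub>M borel)" if "j \<le> k" for j
    by (rule measurable_compose[OF measurable_fst mm_measurable[OF that i(2)]])
  from this[of i] this[of 0]
  have "(\<lambda>z. mm i u (fst z)) \<in> borel_measurable (Rp p \<Otimes>\<^sub>M borel)"
    and "(\<lambda>z. mm 0 u (fst z)) \<in> borel_measurable (Rp p \<Otimes>\<^sub>M borel)"
    using i by auto
  then show "(\<lambda>z. if i = 0 then snd z - mm 0 u (fst z) else - mm i u (fst z)) \<in> borel_measurable (Rp p \<Otimes>\<^sub>M borel)"
    by (cases "i = 0") auto
qed

lemma chain_measurable:
  "s + l \<le> k \<Longrightarrow> u \<in> {0..1} \<Longrightarrow> (\<lambda>(x, y). chain_deriv F (zz x y) l s u) \<in> borel_measurable (Rp p \<Otimes>\<^sub>M borel)"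
proof (induction l arbitrary: s rule: less_induct)
  case (less l)
  show ?case
  proof (cases l)
    case 0
    then show ?thesis
      using measurable_compose[OF zz_measurable[of 0 u] F_measurable[of s]] less.prems
      by (simp add: case_prod_beta)
  next
    case (Suc n)
    show ?thesis
      unfolding Suc chain_deriv.simps(2) case_prod_beta
    proof (intro borel_measurable_sum borel_measurable_times borel_measurable_const)
      fix i assume i: "i \<in> {..n}"
      show "(\<lambda>z. chain_deriv F (zz (fst z) (snd z)) (n - i) (Suc s) u) \<in> borel_measurable (Rp p \<Otimes>\<^sub>M borel)"
        using less.IH[of "n - i" "Suc s"] less.prems Suc i by (simp add: case_prod_beta)
      show "(\<lambda>z. zz (fst z) (snd z) (Suc i) u) \<in> borel_measurable (Rp p \<Otimes>\<^sub>M borel)"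
        using zz_measurable[of "Suc i" u] less.prems Suc i by (simp add: case_prod_beta)
    qed
  qed
qed

lemma rho_measurable: "i \<le> k \<Longrightarrow> u \<in> {0..1} \<Longrightarrow> (\<lambda>(x, y). rho i x y u) \<in> borel_measurable (Rp p \<Otimes>\<^sub>M borel)"
  unfolding rho_def leib_def case_prod_beta
  by (intro borel_measurable_sum borel_measurable_times borel_measurable_const)
     (use chain_measurable[of 0 _ u] in \<open>simp add: case_prod_beta\<close>)

text \<open>On \<open>[-1, 1]\<close> the factor \<open>1 + |z|\<close> is at most 2 and
  \<open>F r\<close> is integrable by continuity; elsewhere \<open>1 + |z| \<le> 2 * |z|\<close>,
  and the moment condition applies.\<close>

lemma Phi_integrable: "integrable lborel Phi"
  unfolding Phi_def[abs_def]
proof (rule Bochner_Integration.integrable_sum)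
  fix r assume r: "r \<in> {..k}"
  define e where "e = d0 + (1 - q') * real r"
  have e: "0 < e" using dl_pos[of r] r by (simp add: e_def dl_def algebra_simps)
  have [measurable]: "F r \<in> borel_measurable borel" using F_measurable r by simp
  have "integrable lborel (\<lambda>y. indicator {-1..1} y *\<^sub>R F r y)"
    by (rule borel_integrable_compact) (use F_continuous[of r] r in \<open>auto intro: continuous_on_subset\<close>)
  from integrable_abs[OF this] f_int[of r] r
  have int: "integrable lborel (\<lambda>y. 2 powr e * (\<bar>y\<bar> powr e * \<bar>F r y\<bar> + \<bar>indicator {-1..1} y *\<^sub>R F r y\<bar>))"
    by (intro integrable_mult_right Bochner_Integration.integrable_add) (auto simp: e_def)
  show "integrable lborel (\<lambda>z. \<bar>F r z\<bar> * (1 + \<bar>z\<bar>) powr (d0 + (1 - q') * real r))"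
    unfolding e_def[symmetric]
  proof (rule Bochner_Integration.integrable_bound[OF int])
    show "(\<lambda>z. \<bar>F r z\<bar> * (1 + \<bar>z\<bar>) powr e) \<in> borel_measurable lborel"
      using r by measurable
    show "AE z in lborel. norm (\<bar>F r z\<bar> * (1 + \<bar>z\<bar>) powr e) \<le> norm (2 powr e * (\<bar>z\<bar> powr e * \<bar>F r z\<bar> + \<bar>indicator {-1..1} z *\<^sub>R F r z\<bar>))"
    proof (rule AE_I2)
      fix z :: real
      have "(1 + \<bar>z\<bar>) powr e * \<bar>F r z\<bar> \<le> 2 powr e * (\<bar>z\<bar> powr e * \<bar>F r z\<bar> + \<bar>indicator {-1..1} z *\<^sub>R F r z\<bar>)"
      proof (cases "\<bar>z\<bar> \<le> 1")
        case True
        have "(1 + \<bar>z\<bar>) powr e \<le> 2 powr e" using True e by (intro powr_mono2) auto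
        then have "(1 + \<bar>z\<bar>) powr e * \<bar>F r z\<bar> \<le> 2 powr e * \<bar>F r z\<bar>" by (rule mult_right_mono) simp
        moreover have "\<bar>indicator {-1..1} z *\<^sub>R F r z\<bar> = \<bar>F r z\<bar>" using True by (auto simp: indicator_def abs_le_iff)
        moreover have "0 \<le> 2 powr e * (\<bar>z\<bar> powr e * \<bar>F r z\<bar>)" by simp
        ultimately show ?thesis by (simp only: distrib_left)
      next
        case False
        have "(1 + \<bar>z\<bar>) powr e \<le> (2 * \<bar>z\<bar>) powr e" using False e by (intro powr_mono2) auto
        then have "(1 + \<bar>z\<bar>) powr e * \<bar>F r z\<bar> \<le> (2 * \<bar>z\<bar>) powr e * \<bar>F r z\<bar>" by (rule mult_right_mono) simp
        also have "\<dots> \<le> 2 powr e * (\<bar>z\<bar> powr e * \<bar>F r z\<bar> + \<bar>indicator {-1..1} z *\<^sub>R F r z\<bar>)"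
          by (simp add: powr_mult algebra_simps)
        finally show ?thesis .
      qed
      then show "norm (\<bar>F r z\<bar> * (1 + \<bar>z\<bar>) powr e) \<le> norm (2 powr e * (\<bar>z\<bar> powr e * \<bar>F r z\<bar> + \<bar>indicator {-1..1} z *\<^sub>R F r z\<bar>))"
        by (simp add: mult.commute abs_mult)
    qed
  qed
qed

definition cPhi :: real where "cPhi = (\<integral>z. Phi z \<partial>lborel)"

lemma cPhi_nonneg: "0 \<le> cPhi"
  unfolding cPhi_def by (rule Bochner_Integration.integral_nonneg) (rule Phi_nonneg)

lemma Phi_measurable [measurable]: "Phi \<in> borel_measurable borel"
  by (rule borel_measurable_continuous_onI[OF Phi_continuous])

lemma nn_integral_H:
  assumes u: "u \<in> {0..1}"
  shows "(\<integral>\<^sup>+y. ennreal (H x u y) \<partial>lborel) = ennreal cPhi"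
proof -
  have t: "0 < tau 0 u" by (rule tau_0_pos[OF u])
  have "(\<integral>\<^sup>+z. ennreal (Phi z) \<partial>lborel) = \<bar>tau 0 u\<bar> * (\<integral>\<^sup>+y. ennreal (Phi (- tau 0 u * mm 0 u x + tau 0 u * y)) \<partial>lborel)"
    by (rule nn_integral_real_affine) (use t in auto)
  also have "\<dots> = (\<integral>\<^sup>+y. ennreal (H x u y) \<partial>lborel)"
    using t by (simp add: H_def nn_integral_cmult[symmetric] ennreal_mult' algebra_simps)
  finally show ?thesis
    unfolding cPhi_def using nn_integral_eq_integral[OF Phi_integrable] Phi_nonneg by simp
qed

lemma H_measurable: "H x u \<in> borel_measurable borel"
  unfolding H_def[abs_def] by measurable

lemma
  assumes u: "u \<in> {0..1}"
  shows H_integrable: "integrable lborel (H x u)" and integral_H: "(\<integral>y. H x u y \<partial>lborel) = cPhi"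
proof -
  show *: "integrable lborel (H x u)"
    by (rule integrableI_nonneg) (use H_measurable H_nonneg[OF u] nn_integral_H[OF u] in auto)
  have "ennreal (\<integral>y. H x u y \<partial>lborel) = ennreal cPhi"
    using nn_integral_eq_integral[OF *] H_nonneg[OF u] nn_integral_H[OF u] by simp
  then show "(\<integral>y. H x u y \<partial>lborel) = cPhi"
    using cPhi_nonneg Bochner_Integration.integral_nonneg[of lborel "H x u"] H_nonneg[OF u] by (simp add: ennreal_inj)
qed

lemma H_continuous: "continuous_on {0..1} (\<lambda>u. H x u y)"
proof -
  have t: "continuous_on {0..1} (tau 0)" by (rule dseqD(2)[OF tau_dseq]) simp
  have m: "continuous_on {0..1} (\<lambda>u. mm 0 u x)" using dseqD(2)[OF mm_dseq, of 0 x] by simp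
  have "continuous_on {0..1} (\<lambda>u. Phi (tau 0 u * (y - mm 0 u x)))"
    by (rule continuous_on_compose2[OF Phi_continuous]) (auto intro!: continuous_intros t m)
  with t show ?thesis unfolding H_def by (intro continuous_intros)
qed

text \<open>The average of \<open>H x w y\<close> over \<open>w\<close> between \<open>u\<close> and \<open>v\<close> dominates the difference quotients.\<close>

definition way :: "real \<Rightarrow> real \<Rightarrow> real \<Rightarrow> real" where
  "way u v \<theta> = u + max 0 (min 1 \<theta>) * (v - u)"

definition Hbar :: "(nat \<Rightarrow> real) \<Rightarrow> real \<Rightarrow> real \<Rightarrow> real \<Rightarrow> real" where
  "Hbar x u v y = (\<integral>\<theta>. indicator {0..1} \<theta> * H x (way u v \<theta>) y \<partial>lborel)"

lemma way_in:
  assumes "u \<in> {0..1}" "v \<in> {0..1}" shows "way u v \<theta> \<in> {0..1}"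
proof -
  define t where "t = max 0 (min 1 \<theta>)"
  have t: "0 \<le> t" "t \<le> 1" by (auto simp: t_def)
  have "way u v \<theta> = (1 - t) * u + t * v" by (simp add: way_def t_def[symmetric] algebra_simps)
  moreover have "0 \<le> (1 - t) * u + t * v" using t assms by simp
  moreover have "(1 - t) * u + t * v \<le> (1 - t) * 1 + t * 1"
    using t assms by (intro add_mono mult_left_mono) auto
  ultimately show ?thesis by simp
qed

lemma way_continuous: "continuous_on UNIV (way u v)"
  unfolding way_def[abs_def] by (intro continuous_intros)

lemma H_way_measurable:
  assumes uv: "u \<in> {0..1}" "v \<in> {0..1}"
  shows "(\<lambda>(\<theta>, y). H x (way u v \<theta>) y) \<in> borel_measurable (borel \<Otimes>\<^sub>M borel)"
proof -
  have t: "continuous_on UNIV (\<lambda>z. tau 0 (way u v (fst z)))"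
    by (rule continuous_on_compose2[OF dseqD(2)[OF tau_dseq]])
       (auto intro!: continuous_on_compose2[OF way_continuous] continuous_intros way_in[OF uv, simplified])
  have m: "continuous_on UNIV (\<lambda>z. mm 0 (way u v (fst z)) x)"
    by (rule continuous_on_compose2[OF dseqD(2)[OF mm_dseq, of 0 x]])
       (auto intro!: continuous_on_compose2[OF way_continuous] continuous_intros way_in[OF uv, simplified])
  have "continuous_on UNIV (\<lambda>z. Phi (tau 0 (way u v (fst z)) * (snd z - mm 0 (way u v (fst z)) x)))"
    by (rule continuous_on_compose2[OF Phi_continuous]) (auto intro!: continuous_intros t m)
  then have "continuous_on UNIV (\<lambda>z. H x (way u v (fst z)) (snd z))"
    unfolding H_def by (intro continuous_intros t)
  then have "(\<lambda>z. H x (way u v (fst z)) (snd z)) \<in> borel_measurable borel"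
    by (rule borel_measurable_continuous_onI)
  then show ?thesis by (simp add: borel_prod case_prod_beta)
qed

lemma H_way_bounded:
  shows "\<exists>B. \<forall>u\<in>{0..1}. \<bar>H x u y\<bar> \<le> B"
  by (rule continuous_on_unit_bounded[OF H_continuous])

lemma H_way_integrable:
  assumes uv: "u \<in> {0..1}" "v \<in> {0..1}"
  shows "integrable lborel (\<lambda>\<theta>. indicator {0..1} \<theta> * H x (way u v \<theta>) y)"
proof -
  have "continuous_on {0..1} (\<lambda>\<theta>. H x (way u v \<theta>) y)"
    by (rule continuous_on_compose2[OF H_continuous continuous_on_subset[OF way_continuous]])
       (use way_in[OF uv] in auto)
  from borel_integrable_compact[OF compact_Icc this] show ?thesis by simp
qed

lemma Hbar_nonneg: "u \<in> {0..1} \<Longrightarrow> v \<in> {0..1} \<Longrightarrow> 0 \<le> Hbar x u v y"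
  unfolding Hbar_def by (rule Bochner_Integration.integral_nonneg, rule mult_nonneg_nonneg[OF _ H_nonneg[OF way_in]]) simp_all

lemma Hbar_measurable:
  assumes uv: "u \<in> {0..1}" "v \<in> {0..1}"
  shows "Hbar x u v \<in> borel_measurable borel"
proof -
  have [measurable]: "(\<lambda>(\<theta>, y). H x (way u v \<theta>) y) \<in> borel_measurable (borel \<Otimes>\<^sub>M borel)"
    by (rule H_way_measurable[OF uv])
  have "(\<lambda>y. \<integral>\<theta>. indicator {0..1} \<theta> * H x (way u v \<theta>) y \<partial>lborel) \<in> borel_measurable borel"
    by measurable
  then show ?thesis by (simp add: Hbar_def[abs_def])
qed

text \<open>An average of functions with integral \<open>cPhi\<close> has that integral again, by
  exchanging the two integrations. Equality is what \<open>tendsto_nn_integral_varying_bound\<close>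
  demands of varying bounds.\<close>

lemma nn_integral_Hbar:
  assumes uv: "u \<in> {0..1}" "v \<in> {0..1}"
  shows "(\<integral>\<^sup>+y. ennreal (Hbar x u v y) \<partial>lborel) = ennreal cPhi"
proof -
  have [measurable]: "(\<lambda>(\<theta>, y). H x (way u v \<theta>) y) \<in> borel_measurable (borel \<Otimes>\<^sub>M borel)"
    by (rule H_way_measurable[OF uv])
  have "(\<integral>\<^sup>+y. ennreal (Hbar x u v y) \<partial>lborel) = (\<integral>\<^sup>+y. \<integral>\<^sup>+\<theta>. ennreal (indicator {0..1} \<theta> * H x (way u v \<theta>) y) \<partial>lborel \<partial>lborel)"
    unfolding Hbar_def using H_way_integrable[OF uv] H_nonneg[OF way_in[OF uv]]
    by (intro nn_integral_cong nn_integral_eq_integral[symmetric]) auto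
  also have "\<dots> = (\<integral>\<^sup>+\<theta>. \<integral>\<^sup>+y. ennreal (indicator {0..1} \<theta> * H x (way u v \<theta>) y) \<partial>lborel \<partial>lborel)"
    by (rule lborel_pair.Fubini') measurable
  also have "\<dots> = (\<integral>\<^sup>+(\<theta>::real). indicator {0..1} \<theta> * ennreal cPhi \<partial>lborel)"
  proof (rule nn_integral_cong)
    fix \<theta> :: real
    have "(\<integral>\<^sup>+y. ennreal (indicator {0..1} \<theta> * H x (way u v \<theta>) y) \<partial>lborel) = (\<integral>\<^sup>+y. indicator {0..1} \<theta> * ennreal (H x (way u v \<theta>) y) \<partial>lborel)"
      by (rule nn_integral_cong) (auto simp: indicator_def)
    also have "\<dots> = indicator {0..1} \<theta> * ennreal cPhi"
      using H_measurable[of x "way u v \<theta>"] by (subst nn_integral_cmult) (auto simp: nn_integral_H[OF way_in[OF uv]])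
    finally show "(\<integral>\<^sup>+y. ennreal (indicator {0..1} \<theta> * H x (way u v \<theta>) y) \<partial>lborel) = indicator {0..1} \<theta> * ennreal cPhi" .
  qed
  also have "\<dots> = ennreal cPhi" by (simp add: nn_integral_multc)
  finally show ?thesis .
qed

lemma
  assumes uv: "u \<in> {0..1}" "v \<in> {0..1}"
  shows Hbar_integrable: "integrable lborel (Hbar x u v)" and integral_Hbar: "(\<integral>y. Hbar x u v y \<partial>lborel) = cPhi"
proof -
  show *: "integrable lborel (Hbar x u v)"
    by (rule integrableI_nonneg) (use Hbar_measurable[OF uv] Hbar_nonneg[OF uv] nn_integral_Hbar[OF uv] in auto)
  have "ennreal (\<integral>y. Hbar x u v y \<partial>lborel) = ennreal cPhi"
    using nn_integral_eq_integral[OF *] Hbar_nonneg[OF uv] nn_integral_Hbar[OF uv] by simp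
  then show "(\<integral>y. Hbar x u v y \<partial>lborel) = cPhi"
    using cPhi_nonneg Bochner_Integration.integral_nonneg[of lborel "Hbar x u v"] Hbar_nonneg[OF uv] by (simp add: ennreal_inj)
qed

lemma Hbar_tendsto:
  assumes u: "u \<in> {0..1}" and U: "\<And>n. U n \<in> {0..1}" "U \<longlonglongrightarrow> u"
  shows "(\<lambda>n. Hbar x u (U n) y) \<longlonglongrightarrow> H x u y"
proof -
  obtain B where B: "\<And>u. u \<in> {0..1} \<Longrightarrow> \<bar>H x u y\<bar> \<le> B" using H_way_bounded by blast
  have "(\<lambda>n. \<integral>\<theta>. indicator {0..1} \<theta> * H x (way u (U n) \<theta>) y \<partial>lborel) \<longlonglongrightarrow> (\<integral>(\<theta>::real). indicator {0..1} \<theta> * H x u y \<partial>lborel)"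
  proof (rule integral_dominated_convergence[where w = "\<lambda>\<theta>. indicator {0..1} \<theta> * B"])
    show "integrable lborel (\<lambda>\<theta>::real. indicator {0..1} \<theta> * B)" by simp
    show "(\<lambda>\<theta>. indicator {0..1} \<theta> * H x (way u (U n) \<theta>) y) \<in> borel_measurable lborel" for n
      using borel_measurable_integrable[OF H_way_integrable[OF u U(1)]] .
    show "AE \<theta> in lborel. norm (indicator {0..1} \<theta> * H x (way u (U n) \<theta>) y) \<le> indicator {0..1} \<theta> * B" for n
      by (rule AE_I2) (use B[OF way_in[OF u U(1)]] in \<open>auto simp: indicator_def\<close>)
    show "AE \<theta> in lborel. (\<lambda>n. indicator {0..1} \<theta> * H x (way u (U n) \<theta>) y) \<longlonglongrightarrow> indicator {0..1} \<theta> * H x u y"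
    proof (rule AE_I2)
      fix \<theta> :: real
      have "(\<lambda>n. way u (U n) \<theta>) \<longlonglongrightarrow> u + max 0 (min 1 \<theta>) * (u - u)"
        unfolding way_def by (intro tendsto_intros U)
      then have "(\<lambda>n. way u (U n) \<theta>) \<longlonglongrightarrow> u" by simp
      then have "(\<lambda>n. H x (way u (U n) \<theta>) y) \<longlonglongrightarrow> H x u y"
        by (intro continuous_on_tendsto_compose[OF H_continuous] u always_eventually allI way_in U)
      then show "(\<lambda>n. indicator {0..1} \<theta> * H x (way u (U n) \<theta>) y) \<longlonglongrightarrow> indicator {0..1} \<theta> * H x u y"
        by (rule tendsto_mult_left)
    qed
  qed simp
  then show ?thesis by (simp add: Hbar_def)
qed

text \<open>Fundamental theorem of calculus along the segment from \<open>u\<close> to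
  \<open>v\<close>. Averaging the bound over the segment keeps its integral in \<open>y\<close>
  equal to \<open>cPhi\<close>, for which a supremum over the segment offers no control.\<close>

lemma rho_increment:
  assumes i: "i < k" and u: "u \<in> {0..1}" and v: "v \<in> {0..1}" and c: "0 \<le> c"
    and bound: "\<And>w. w \<in> {0..1} \<Longrightarrow> c * \<bar>rho (Suc i) x y w\<bar> \<le> K * H x w y"
  shows "c * \<bar>rho i x y v - rho i x y u\<bar> \<le> \<bar>v - u\<bar> * K * Hbar x u v y"
proof -
  \<comment> \<open>\<open>way\<close> clamps \<open>\<theta>\<close> to the unit interval, so it is
    affine only there.\<close>
  have wayeq: "way u v \<theta> = u + \<theta> * (v - u)" if "\<theta> \<in> {0..1}" for \<theta>
    using that by (simp add: way_def)
  have deriv: "((\<lambda>\<theta>. rho i x y (way u v \<theta>)) has_vector_derivative rho (Suc i) x y (way u v \<theta>) * (v - u)) (at \<theta> within {0..1})"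
    if \<theta>: "0 \<le> \<theta>" "\<theta> \<le> 1" for \<theta>
  proof -
    have "((\<lambda>\<theta>. u + \<theta> * (v - u)) has_real_derivative (v - u)) (at \<theta> within {0..1})"
      by (auto intro!: derivative_eq_intros)
    then have 1: "(way u v has_real_derivative (v - u)) (at \<theta> within {0..1})"
      by (rule has_field_derivative_transform_within[OF _ zero_less_one]) (use \<theta> wayeq in auto)
    have "(rho i x y has_real_derivative rho (Suc i) x y (way u v \<theta>)) (at (way u v \<theta>) within {0..1})"
      using dseqD(1)[OF rho_dseq i way_in[OF u v]] by simp
    then have "(rho i x y has_real_derivative rho (Suc i) x y (way u v \<theta>)) (at (way u v \<theta>) within way u v ` {0..1})"
      by (rule DERIV_subset) (use way_in[OF u v] in auto)
    from DERIV_image_chain[OF this 1] show ?thesis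
      by (simp add: has_real_derivative_iff_has_vector_derivative o_def)
  qed
  have rc: "continuous_on {0..1} (rho (Suc i) x y)"
    using dseqD(2)[OF rho_dseq, of "Suc i"] i by simp
  have cont: "continuous_on {0..1} (\<lambda>\<theta>. rho (Suc i) x y (way u v \<theta>) * (v - u))"
    by (intro continuous_intros continuous_on_compose2[OF rc continuous_on_subset[OF way_continuous]])
       (use way_in[OF u v] in auto)
  have "(\<integral>\<theta>. indicator {0..1} \<theta> *\<^sub>R (rho (Suc i) x y (way u v \<theta>) * (v - u)) \<partial>lborel) = rho i x y (way u v 1) - rho i x y (way u v 0)"
    by (rule integral_FTC_Icc[OF _ deriv cont]) auto
  then have eq: "c * (rho i x y v - rho i x y u) = (\<integral>\<theta>. c * (indicator {0..1} \<theta> *\<^sub>R (rho (Suc i) x y (way u v \<theta>) * (v - u))) \<partial>lborel)"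
    by (simp add: way_def)
  have "\<bar>c * (rho i x y v - rho i x y u)\<bar> \<le> (\<integral>\<theta>. \<bar>v - u\<bar> * K * (indicator {0..1} \<theta> * H x (way u v \<theta>) y) \<partial>lborel)"
    unfolding eq
  proof (rule order.trans[OF integral_abs_bound], rule integral_mono)
    show "integrable lborel (\<lambda>\<theta>. \<bar>c * (indicator {0..1} \<theta> *\<^sub>R (rho (Suc i) x y (way u v \<theta>) * (v - u)))\<bar>)"
      by (intro integrable_abs integrable_mult_right borel_integrable_compact[OF compact_Icc cont])
    show "integrable lborel (\<lambda>\<theta>. \<bar>v - u\<bar> * K * (indicator {0..1} \<theta> * H x (way u v \<theta>) y))"
      by (intro integrable_mult_right H_way_integrable u v)
    fix \<theta> :: real
    show "\<bar>c * (indicator {0..1} \<theta> *\<^sub>R (rho (Suc i) x y (way u v \<theta>) * (v - u)))\<bar> \<le> \<bar>v - u\<bar> * K * (indicator {0..1} \<theta> * H x (way u v \<theta>) y)"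
      using mult_left_mono[OF bound[OF way_in[OF u v, of \<theta>]], of "\<bar>v - u\<bar>"] c
      by (auto simp: indicator_def abs_mult mult_ac)
  qed
  also have "\<dots> = \<bar>v - u\<bar> * K * Hbar x u v y" by (simp add: Hbar_def)
  finally show ?thesis using c by (simp add: abs_mult)
qed

end

section \<open>Kernels on lifted state spaces\<close>

context ar_kernel
begin

definition wt :: "('a \<Rightarrow> real) \<Rightarrow> nat \<Rightarrow> 'a \<Rightarrow> real" where
  "wt N l a = N a powr dl l"

lemma weight_scale_wt:
  assumes "N \<in> borel_measurable M" "\<And>x. x \<in> space M \<Longrightarrow> 1 \<le> N x"
  shows "weight_scale k M (wt N)"
  unfolding weight_scale_def wt_def[abs_def]
  using assms by (auto intro!: ge_one_powr_ge_zero powr_mono dl_mono less_imp_le[OF dl_pos])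

end

text \<open>One transition from a structure \<open>a\<close> to a structure
  \<open>\<psi> a y\<close>, in which only the current state \<open>\<pi> a\<close> influences the
  new value \<open>y\<close>. The chain itself and the growing blocks are instances. The factor 2 in
  the size condition leaves room for counting the last state of a block twice.\<close>

locale ar_lift = ar_kernel +
  fixes MA :: "'a measure" and MB :: "'b measure" and \<pi> :: "'a \<Rightarrow> nat \<Rightarrow> real" and \<psi> :: "'a \<Rightarrow> real \<Rightarrow> 'b"
    and NA :: "'a \<Rightarrow> real" and NB :: "'b \<Rightarrow> real"
  assumes \<pi>_meas: "\<pi> \<in> measurable MA (Rp p)"
    and \<psi>_meas: "(\<lambda>(a, y). \<psi> a y) \<in> measurable (MA \<Otimes>\<^sub>M borel) MB"
    and NA_meas: "NA \<in> borel_measurable MA" and NB_meas: "NB \<in> borel_measurable MB"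
    and NA_ge: "\<And>a. a \<in> space MA \<Longrightarrow> sz (\<pi> a) \<le> NA a"
    and NB_ge1: "\<And>b. b \<in> space MB \<Longrightarrow> 1 \<le> NB b"
    and NB_le: "\<And>a y. a \<in> space MA \<Longrightarrow> NB (\<psi> a y) \<le> 2 * (NA a + \<bar>y\<bar>)"
begin

definition Top :: "nat \<Rightarrow> real \<Rightarrow> ('b \<Rightarrow> real) \<Rightarrow> 'a \<Rightarrow> real" where
  "Top i u g a = (\<integral>y. g (\<psi> a y) * rho i (\<pi> a) y u \<partial>lborel)"

lemma NA_ge1: "a \<in> space MA \<Longrightarrow> 1 \<le> NA a"
  using NA_ge sz_ge1 order.trans by blast

lemma weight_scale_A: "weight_scale k MA (wt NA)"
  by (rule weight_scale_wt[OF NA_meas NA_ge1])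

lemma weight_scale_B: "weight_scale k MB (wt NB)"
  by (rule weight_scale_wt[OF NB_meas NB_ge1])

lemma \<psi>_space: "a \<in> space MA \<Longrightarrow> \<psi> a y \<in> space MB"
  using measurable_space[OF \<psi>_meas, of "(a, y)"] by (simp add: space_pair_measure)

lemma \<psi>_meas1: "a \<in> space MA \<Longrightarrow> \<psi> a \<in> measurable borel MB"
  using measurable_compose[OF measurable_Pair1' \<psi>_meas] by simp

lemma \<pi>_space: "a \<in> space MA \<Longrightarrow> \<pi> a \<in> space (Rp p)"
  by (rule measurable_space[OF \<pi>_meas])

lemma rho_meas1: "a \<in> space MA \<Longrightarrow> i \<le> k \<Longrightarrow> u \<in> {0..1} \<Longrightarrow> (\<lambda>y. rho i (\<pi> a) y u) \<in> borel_measurable borel"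
  using measurable_compose[OF measurable_Pair1'[OF \<pi>_space] rho_measurable] by simp

lemma integrand_measurable:
  assumes "g \<in> borel_measurable MB" "i \<le> k" "u \<in> {0..1}"
  shows "(\<lambda>(a, y). g (\<psi> a y) * rho i (\<pi> a) y u) \<in> borel_measurable (MA \<Otimes>\<^sub>M borel)"
proof -
  have "(\<lambda>z. g (\<psi> (fst z) (snd z))) \<in> borel_measurable (MA \<Otimes>\<^sub>M borel)"
    using measurable_compose[OF \<psi>_meas assms(1)] by (simp add: case_prod_beta)
  moreover have "(\<lambda>z. rho i (\<pi> (fst z)) (snd z) u) \<in> borel_measurable (MA \<Otimes>\<^sub>M borel)"
  proof -
    have "(\<lambda>z. (\<pi> (fst z), snd z)) \<in> measurable (MA \<Otimes>\<^sub>M borel) (Rp p \<Otimes>\<^sub>M borel)"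
      by (intro measurable_Pair measurable_compose[OF measurable_fst \<pi>_meas] measurable_snd)
    from measurable_compose[OF this rho_measurable[OF assms(2,3)]] show ?thesis by (simp add: case_prod_beta)
  qed
  ultimately show ?thesis by (simp add: case_prod_beta)
qed

lemma integrand_measurable1:
  assumes "g \<in> borel_measurable MB" "i \<le> k" "u \<in> {0..1}" "a \<in> space MA"
  shows "(\<lambda>y. g (\<psi> a y) * rho i (\<pi> a) y u) \<in> borel_measurable borel"
  by (intro borel_measurable_times measurable_compose[OF \<psi>_meas1 assms(1)] rho_meas1 assms)

lemma Top_measurable:
  assumes "g \<in> borel_measurable MB" "i \<le> k" "u \<in> {0..1}"
  shows "Top i u g \<in> borel_measurable MA"
proof -
  have "(\<lambda>(a, y). g (\<psi> a y) * rho i (\<pi> a) y u) \<in> borel_measurable (MA \<Otimes>\<^sub>M lborel)"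
    using integrand_measurable[OF assms] by (simp cong: measurable_cong_sets)
  from lborel.borel_measurable_lebesgue_integral[OF this] show ?thesis
    by (simp add: Top_def[abs_def])
qed

text \<open>The constant of \<open>kernel_bound\<close>; no part of the lift enters, so it is common
  to all block lengths.\<close>

definition Kc :: real where
  "Kc = (SOME C. C > 0 \<and> (\<forall>l i x y N N'. \<forall>u\<in>{0..1}. l + i \<le> k \<longrightarrow> sz x \<le> N \<longrightarrow> 0 \<le> N' \<longrightarrow> N' \<le> 2 * (N + \<bar>y\<bar>) \<longrightarrow>
     N' powr dl (l + i) * \<bar>rho i x y u\<bar> \<le> C * N powr dl l * H x u y))"

lemma Kc: "0 < Kc"
  "u \<in> {0..1} \<Longrightarrow> l + i \<le> k \<Longrightarrow> sz x \<le> N \<Longrightarrow> 0 \<le> N' \<Longrightarrow> N' \<le> 2 * (N + \<bar>y\<bar>) \<Longrightarrow>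
     N' powr dl (l + i) * \<bar>rho i x y u\<bar> \<le> Kc * N powr dl l * H x u y"
proof -
  note * = someI_ex[OF kernel_bound, folded Kc_def]
  show "0 < Kc" using * by blast
  show "u \<in> {0..1} \<Longrightarrow> l + i \<le> k \<Longrightarrow> sz x \<le> N \<Longrightarrow> 0 \<le> N' \<Longrightarrow> N' \<le> 2 * (N + \<bar>y\<bar>) \<Longrightarrow>
     N' powr dl (l + i) * \<bar>rho i x y u\<bar> \<le> Kc * N powr dl l * H x u y"
    using conjunct2[OF *] by blast
qed

lemma weighted_rho_bound:
  assumes "a \<in> space MA" "u \<in> {0..1}" "l + i \<le> k"
  shows "wt NB (l + i) (\<psi> a y) * \<bar>rho i (\<pi> a) y u\<bar> \<le> Kc * wt NA l a * H (\<pi> a) u y"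
  unfolding wt_def
  by (rule Kc(2)[OF assms(2,3) NA_ge[OF assms(1)] _ NB_le[OF assms(1)]])
     (use NB_ge1[OF \<psi>_space[OF assms(1)], of y] in simp)

lemma weighted_rho_increment:
  assumes a: "a \<in> space MA" and u: "u \<in> {0..1}" and v: "v \<in> {0..1}" and li: "l + i < k"
  shows "wt NB (Suc (l + i)) (\<psi> a y) * \<bar>rho i (\<pi> a) y v - rho i (\<pi> a) y u\<bar> \<le> \<bar>v - u\<bar> * (Kc * wt NA l a) * Hbar (\<pi> a) u v y"
proof (rule rho_increment[OF _ u v])
  show "wt NB (Suc (l + i)) (\<psi> a y) * \<bar>rho (Suc i) (\<pi> a) y w\<bar> \<le> Kc * wt NA l a * H (\<pi> a) w y" if "w \<in> {0..1}" for w
    using weighted_rho_bound[OF a that, of l "Suc i"] li by simp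
qed (use li in \<open>auto simp: wt_def\<close>)

lemma g_bound:
  assumes "g \<in> wball MB (wt NB j) c" "a \<in> space MA"
  shows "\<bar>g (\<psi> a y) * r\<bar> \<le> c * (wt NB j (\<psi> a y) * \<bar>r\<bar>)"
  using mult_right_mono[OF wballD(2)[OF assms(1) \<psi>_space[OF assms(2)], of y], of "\<bar>r\<bar>"] by (simp add: abs_mult mult_ac)

lemma integrand_bound:
  assumes "g \<in> wball MB (wt NB (l + i)) c" "0 \<le> c" "a \<in> space MA" "u \<in> {0..1}" "l + i \<le> k"
  shows "\<bar>g (\<psi> a y) * rho i (\<pi> a) y u\<bar> \<le> c * (Kc * wt NA l a) * H (\<pi> a) u y"
  using order.trans[OF g_bound[OF assms(1,3)] mult_left_mono[OF weighted_rho_bound[OF assms(3-5)] assms(2)]]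
  by (simp add: mult_ac)

lemma integrand_integrable:
  assumes "g \<in> wball MB (wt NB (l + i)) c" "0 \<le> c" "a \<in> space MA" "u \<in> {0..1}" "l + i \<le> k"
  shows "integrable lborel (\<lambda>y. g (\<psi> a y) * rho i (\<pi> a) y u)"
proof (rule Bochner_Integration.integrable_bound[OF integrable_mult_right[OF H_integrable[OF assms(4)], of "c * (Kc * wt NA l a)"]])
  show "(\<lambda>y. g (\<psi> a y) * rho i (\<pi> a) y u) \<in> borel_measurable lborel"
    using integrand_measurable1[OF wballD(1)[OF assms(1)] _ assms(4,3)] assms(5) by simp
  show "AE y in lborel. norm (g (\<psi> a y) * rho i (\<pi> a) y u) \<le> norm (c * (Kc * wt NA l a) * H (\<pi> a) u y)"
    by (rule AE_I2) (use order.trans[OF integrand_bound[OF assms] abs_ge_self] in simp)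
qed

lemma Top_bound:
  assumes "g \<in> wball MB (wt NB (l + i)) c" "0 \<le> c" "u \<in> {0..1}" "l + i \<le> k"
  shows "Top i u g \<in> wball MA (wt NA l) ((Kc * cPhi) * c)"
proof (rule wballI)
  show "Top i u g \<in> borel_measurable MA"
    by (rule Top_measurable[OF wballD(1)[OF assms(1)]]) (use assms in auto)
  fix a assume a: "a \<in> space MA"
  have "\<bar>Top i u g a\<bar> \<le> (\<integral>y. c * (Kc * wt NA l a) * H (\<pi> a) u y \<partial>lborel)"
    unfolding Top_def
    by (rule order.trans[OF integral_abs_bound integral_mono])
       (auto intro!: integrable_abs integrand_integrable[OF assms(1,2) a assms(3,4)] integrand_bound[OF assms(1,2) a assms(3,4)]
          integrable_mult_right H_integrable assms simp del: abs_mult)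
  then show "\<bar>Top i u g a\<bar> \<le> Kc * cPhi * c * wt NA l a"
    by (simp add: integral_H[OF assms(3)] mult_ac)
qed

lemma Top_functional:
  assumes i: "i \<le> k" and u: "u \<in> {0..1}" and a: "a \<in> space MA"
  shows "wfunctional MB (wt NB i) (\<lambda>g. Top i u g a)"
proof -
  have i': "0 + i \<le> k" using i by simp
  note nn = weight_scale_wball_nn[OF weight_scale_B i]
  have int: "integrable lborel (\<lambda>y. g (\<psi> a y) * rho i (\<pi> a) y u)" if "g \<in> wball MB (wt NB i) c" for g c
    using integrand_integrable[OF _ abs_ge_zero a u i'] nn[OF that] by simp
  show ?thesis
    unfolding wfunctional_def Top_def
  proof (intro conjI allI impI)
    fix g h a' b c d assume gh: "g \<in> wball MB (wt NB i) c" "h \<in> wball MB (wt NB i) d"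
    show "(\<integral>y. (a' * g (\<psi> a y) + b * h (\<psi> a y)) * rho i (\<pi> a) y u \<partial>lborel) =
       a' * (\<integral>y. g (\<psi> a y) * rho i (\<pi> a) y u \<partial>lborel) + b * (\<integral>y. h (\<psi> a y) * rho i (\<pi> a) y u \<partial>lborel)"
      using int[OF gh(1)] int[OF gh(2)] by (simp add: distrib_right mult.assoc)
  next
    fix G :: "nat \<Rightarrow> 'b \<Rightarrow> real" and c
    assume G: "\<forall>n. G n \<in> wball MB (wt NB i) c" "\<forall>x\<in>space MB. (\<lambda>n. G n x) \<longlonglongrightarrow> 0"
    have "(\<lambda>n. \<integral>y. G n (\<psi> a y) * rho i (\<pi> a) y u \<partial>lborel) \<longlonglongrightarrow> (\<integral>(y::real). 0 \<partial>lborel)"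
    proof (rule integral_dominated_convergence[where w = "\<lambda>y. \<bar>c\<bar> * (Kc * wt NA 0 a) * H (\<pi> a) u y"])
      show "integrable lborel (\<lambda>y. \<bar>c\<bar> * (Kc * wt NA 0 a) * H (\<pi> a) u y)"
        by (intro integrable_mult_right H_integrable u)
      show "(\<lambda>y. G n (\<psi> a y) * rho i (\<pi> a) y u) \<in> borel_measurable lborel" for n
        using borel_measurable_integrable[OF int] G by blast
      show "AE y in lborel. norm (G n (\<psi> a y) * rho i (\<pi> a) y u) \<le> \<bar>c\<bar> * (Kc * wt NA 0 a) * H (\<pi> a) u y" for n
        by (rule AE_I2) (use integrand_bound[OF _ abs_ge_zero a u i'] nn[of "G n" c] G in simp)
      show "AE y in lborel. (\<lambda>n. G n (\<psi> a y) * rho i (\<pi> a) y u) \<longlonglongrightarrow> 0"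
        by (rule AE_I2) (use G \<psi>_space[OF a] tendsto_mult_left_zero in blast)
    qed simp
    then show "(\<lambda>n. \<integral>y. G n (\<psi> a y) * rho i (\<pi> a) y u \<partial>lborel) \<longlonglongrightarrow> 0" by simp
  qed
qed

text \<open>Uniformity over a ball of test functions amounts to convergence in weighted
  \<open>L^1\<close> of the densities. Their difference is bounded by a multiple of \<open>H\<close>
  at the moving parameter plus \<open>H\<close> at \<open>u\<close>, a bound of constant
  integral.\<close>

lemma Top_fcont:
  assumes i: "i \<le> k" and a: "a \<in> space MA"
  shows "fcont MB (wt NB i) (\<lambda>u g. Top i u g a)"
  unfolding fcont_def
proof (intro conjI ballI allI impI)
  show "wfunctional MB (wt NB i) (\<lambda>g. Top i u g a)" if "u \<in> {0..1}" for u
    by (rule Top_functional[OF i that a])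
  fix u :: real and U :: "nat \<Rightarrow> real" and G :: "nat \<Rightarrow> 'b \<Rightarrow> real" and c'
  assume u: "u \<in> {0..1}" and "\<forall>n. U n \<in> {0..1}" and lim: "U \<longlonglongrightarrow> u" and G': "\<forall>n. G n \<in> wball MB (wt NB i) c'"
  then have U: "U n \<in> {0..1}" for n by auto
  define c where "c = \<bar>c'\<bar>"
  have c: "c \<ge> 0" by (simp add: c_def)
  have G: "G n \<in> wball MB (wt NB (0 + i)) c" for n
    unfolding c_def using weight_scale_wball_nn[OF weight_scale_B i G'[rule_format]] by simp
  have i': "0 + i \<le> k" using i by simp
  define K where "K = Kc * wt NA 0 a"
  have K0: "0 \<le> K" using Kc(1) by (simp add: K_def wt_def)
  \<comment> \<open>The weight is multiplied into the increment, so that the test functions enter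
    only through the radius of their ball.\<close>
  define d where "d n y = wt NB (0 + i) (\<psi> a y) * (rho i (\<pi> a) y (U n) - rho i (\<pi> a) y u)" for n y
  have wm: "(\<lambda>y. wt NB (0 + i) (\<psi> a y)) \<in> borel_measurable borel"
    unfolding wt_def using measurable_compose[OF \<psi>_meas1[OF a] NB_meas] by measurable
  have dm: "d n \<in> borel_measurable borel" for n
    unfolding d_def[abs_def] by (intro borel_measurable_times borel_measurable_diff wm rho_meas1 a i u U)
  have dle: "\<bar>d n y\<bar> \<le> K * (H (\<pi> a) (U n) y + H (\<pi> a) u y)" for n y
  proof -
    have "\<bar>d n y\<bar> \<le> wt NB (0 + i) (\<psi> a y) * (\<bar>rho i (\<pi> a) y (U n)\<bar> + \<bar>rho i (\<pi> a) y u\<bar>)"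
      unfolding d_def abs_mult by (intro mult_mono) (auto simp: wt_def)
    also have "\<dots> \<le> K * H (\<pi> a) (U n) y + K * H (\<pi> a) u y"
      using weighted_rho_bound[OF a U i', of y n] weighted_rho_bound[OF a u i', of y] by (simp add: K_def distrib_left)
    finally show ?thesis by (simp add: distrib_left)
  qed
  have "(\<lambda>n. \<integral>y. \<bar>d n y\<bar> \<partial>lborel) \<longlonglongrightarrow> 0"
  proof (rule tendsto_nn_integral_varying_bound)
    show "d n \<in> borel_measurable lborel" for n using dm by simp
    show "(\<lambda>y. K * (H (\<pi> a) (U n) y + H (\<pi> a) u y)) \<in> borel_measurable lborel" for n
      using H_measurable by simp
    show "(\<lambda>y. K * (H (\<pi> a) u y + H (\<pi> a) u y)) \<in> borel_measurable lborel"
      using H_measurable by simp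
    show "\<bar>d n y\<bar> \<le> K * (H (\<pi> a) (U n) y + H (\<pi> a) u y)" for n y by (rule dle)
    show "(\<lambda>n. d n y) \<longlonglongrightarrow> 0" for y
    proof -
      have "(\<lambda>n. rho i (\<pi> a) y (U n)) \<longlonglongrightarrow> rho i (\<pi> a) y u"
        by (rule continuous_on_tendsto_compose[OF dseqD(2)[OF rho_dseq i] lim u]) (use U in simp)
      then have "(\<lambda>n. rho i (\<pi> a) y (U n) - rho i (\<pi> a) y u) \<longlonglongrightarrow> 0" by (rule LIM_zero)
      then show ?thesis unfolding d_def by (rule tendsto_mult_right_zero)
    qed
    show "(\<lambda>n. K * (H (\<pi> a) (U n) y + H (\<pi> a) u y)) \<longlonglongrightarrow> K * (H (\<pi> a) u y + H (\<pi> a) u y)" for y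
    proof -
      have "(\<lambda>n. H (\<pi> a) (U n) y) \<longlonglongrightarrow> H (\<pi> a) u y"
        by (rule continuous_on_tendsto_compose[OF H_continuous lim u]) (use U in simp)
      then show ?thesis by (intro tendsto_intros)
    qed
    have "(\<integral>\<^sup>+y. ennreal (K * (H (\<pi> a) w y + H (\<pi> a) u y)) \<partial>lborel) = ennreal (K * (2 * cPhi))" if w: "w \<in> {0..1}" for w
    proof -
      have "integrable lborel (\<lambda>y. K * (H (\<pi> a) w y + H (\<pi> a) u y))"
        by (intro integrable_mult_right Bochner_Integration.integrable_add H_integrable u w)
      then show ?thesis
        by (subst nn_integral_eq_integral) (use K0 H_nonneg[OF u] H_nonneg[OF w] in \<open>auto simp: H_integrable u[simplified] w[simplified] integral_H\<close>)
    qed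
    from this[OF U] this[OF u] show "(\<integral>\<^sup>+y. ennreal (K * (H (\<pi> a) (U n) y + H (\<pi> a) u y)) \<partial>lborel) = ennreal (K * (2 * cPhi))"
      "(\<integral>\<^sup>+y. ennreal (K * (H (\<pi> a) u y + H (\<pi> a) u y)) \<partial>lborel) = ennreal (K * (2 * cPhi))" for n by auto
  qed simp
  then have lim0: "(\<lambda>n. c * (\<integral>y. \<bar>d n y\<bar> \<partial>lborel)) \<longlonglongrightarrow> 0" by (rule tendsto_mult_right_zero)
  have dint: "integrable lborel (d n)" for n
  proof (rule Bochner_Integration.integrable_bound)
    show "integrable lborel (\<lambda>y. K * (H (\<pi> a) (U n) y + H (\<pi> a) u y))"
      by (intro integrable_mult_right Bochner_Integration.integrable_add H_integrable u U)
    show "AE y in lborel. norm (d n y) \<le> norm (K * (H (\<pi> a) (U n) y + H (\<pi> a) u y))"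
      by (rule AE_I2) (use order.trans[OF dle abs_ge_self] in simp)
  qed (use dm in simp)
  show "(\<lambda>n. Top i (U n) (G n) a - Top i u (G n) a) \<longlonglongrightarrow> 0"
  proof (rule Lim_null_comparison[OF always_eventually lim0], rule allI)
    fix n
    note int = integrand_integrable[OF G c a _ i']
    have eq': "Top i (U n) (G n) a - Top i u (G n) a = (\<integral>y. G n (\<psi> a y) * (rho i (\<pi> a) y (U n) - rho i (\<pi> a) y u) \<partial>lborel)"
      unfolding Top_def using int[OF U] int[OF u] by (simp add: right_diff_distrib)
    show "norm (Top i (U n) (G n) a - Top i u (G n) a) \<le> c * (\<integral>y. \<bar>d n y\<bar> \<partial>lborel)"
      unfolding eq' real_norm_def integral_mult_right_zero[symmetric]
    proof (rule order.trans[OF integral_abs_bound integral_mono])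
      show "integrable lborel (\<lambda>y. \<bar>G n (\<psi> a y) * (rho i (\<pi> a) y (U n) - rho i (\<pi> a) y u)\<bar>)"
        using int[OF U] int[OF u] by (intro integrable_abs) (simp add: right_diff_distrib)
      show "integrable lborel (\<lambda>y. c * \<bar>d n y\<bar>)" using dint by simp
      show "\<bar>G n (\<psi> a y) * (rho i (\<pi> a) y (U n) - rho i (\<pi> a) y u)\<bar> \<le> c * \<bar>d n y\<bar>" for y
        using g_bound[OF G a] by (simp add: d_def abs_mult wt_def)
    qed
  qed
qed

lemma Top_lipschitz:
  assumes g: "g \<in> wball MB (wt NB (Suc (l + i))) c" and c: "0 \<le> c" and u: "u \<in> {0..1}" and v: "v \<in> {0..1}" and li: "l + i < k"
  shows "(\<lambda>x. Top i v g x - Top i u g x) \<in> wball MA (wt NA l) ((Kc * cPhi) * c * \<bar>v - u\<bar>)"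
proof (rule wballI)
  have g0: "g \<in> wball MB (wt NB (l + i)) c"
    by (rule weight_scale_wball[OF weight_scale_B _ _ c g]) (use li in auto)
  show "(\<lambda>x. Top i v g x - Top i u g x) \<in> borel_measurable MA"
    using Top_measurable[OF wballD(1)[OF g]] u v li by simp
  fix a assume a: "a \<in> space MA"
  have li': "l + i \<le> k" using li by simp
  note int = integrand_integrable[OF g0 c a _ li']
  have eq': "Top i v g a - Top i u g a = (\<integral>y. g (\<psi> a y) * (rho i (\<pi> a) y v - rho i (\<pi> a) y u) \<partial>lborel)"
    unfolding Top_def using int[OF v] int[OF u] by (simp add: right_diff_distrib)
  have "\<bar>Top i v g a - Top i u g a\<bar> \<le> (\<integral>y. c * \<bar>v - u\<bar> * (Kc * wt NA l a) * Hbar (\<pi> a) u v y \<partial>lborel)"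
    unfolding eq'
  proof (rule order.trans[OF integral_abs_bound integral_mono])
    show "integrable lborel (\<lambda>y. \<bar>g (\<psi> a y) * (rho i (\<pi> a) y v - rho i (\<pi> a) y u)\<bar>)"
      using int[OF v] int[OF u] by (intro integrable_abs) (simp add: right_diff_distrib)
    show "integrable lborel (\<lambda>y. c * \<bar>v - u\<bar> * (Kc * wt NA l a) * Hbar (\<pi> a) u v y)"
      by (intro integrable_mult_right Hbar_integrable u v)
    show "\<bar>g (\<psi> a y) * (rho i (\<pi> a) y v - rho i (\<pi> a) y u)\<bar> \<le> c * \<bar>v - u\<bar> * (Kc * wt NA l a) * Hbar (\<pi> a) u v y" for y
      using order.trans[OF g_bound[OF g a] mult_left_mono[OF weighted_rho_increment[OF a u v li] c]] by (simp add: mult_ac)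
  qed
  also have "\<dots> = Kc * cPhi * c * \<bar>v - u\<bar> * wt NA l a" by (simp add: integral_Hbar[OF u v])
  finally show "\<bar>Top i v g a - Top i u g a\<bar> \<le> Kc * cPhi * c * \<bar>v - u\<bar> * wt NA l a" .
qed

text \<open>As for continuity, with the difference quotient bounded through the path average
  \<open>Hbar\<close> and the derivative through \<open>H\<close>. Both have integral
  \<open>cPhi\<close>, and the average tends to \<open>H\<close> at \<open>u\<close>.\<close>

lemma Top_fderiv:
  assumes i: "i < k" and a: "a \<in> space MA"
  shows "fderiv MB (wt NB (Suc i)) (\<lambda>u g. Top i u g a) (\<lambda>u g. Top (Suc i) u g a)"
  unfolding fderiv_def
proof (intro ballI allI impI)
  fix u :: real and U :: "nat \<Rightarrow> real" and G :: "nat \<Rightarrow> 'b \<Rightarrow> real" and c'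
  assume u: "u \<in> {0..1}" and U': "\<forall>n. U n \<in> {0..1} - {u}" and lim: "U \<longlonglongrightarrow> u" and G': "\<forall>n. G n \<in> wball MB (wt NB (Suc i)) c'"
  have U: "U n \<in> {0..1}" and Une: "U n - u \<noteq> 0" for n using U' by auto
  define c where "c = \<bar>c'\<bar>"
  have c: "c \<ge> 0" by (simp add: c_def)
  have G: "G n \<in> wball MB (wt NB (0 + Suc i)) c" for n
    unfolding c_def using weight_scale_wball_nn[OF weight_scale_B _ G'[rule_format]] i by simp
  have G0: "G n \<in> wball MB (wt NB (0 + i)) c" for n
    by (rule weight_scale_wball[OF weight_scale_B _ _ c G]) (use i in auto)
  have i': "0 + i \<le> k" "0 + Suc i \<le> k" "0 + i < k" using i by auto
  define K where "K = Kc * wt NA 0 a"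
  have K0: "0 \<le> K" using Kc(1) by (simp add: K_def wt_def)
  define q where "q n y = (rho i (\<pi> a) y (U n) - rho i (\<pi> a) y u) / (U n - u) - rho (Suc i) (\<pi> a) y u" for n y
  define d where "d n y = wt NB (0 + Suc i) (\<psi> a y) * q n y" for n y
  have wm: "(\<lambda>y. wt NB (0 + Suc i) (\<psi> a y)) \<in> borel_measurable borel"
    unfolding wt_def using measurable_compose[OF \<psi>_meas1[OF a] NB_meas] by measurable
  have dm: "d n \<in> borel_measurable borel" for n
    unfolding d_def[abs_def] q_def
    by (intro borel_measurable_times borel_measurable_diff borel_measurable_divide wm rho_meas1 a u U) (use i in auto)
  have dle: "\<bar>d n y\<bar> \<le> K * (Hbar (\<pi> a) u (U n) y + H (\<pi> a) u y)" for n y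
  proof -
    have 1: "wt NB (0 + Suc i) (\<psi> a y) * (\<bar>rho i (\<pi> a) y (U n) - rho i (\<pi> a) y u\<bar> / \<bar>U n - u\<bar>) \<le> K * Hbar (\<pi> a) u (U n) y"
      using weighted_rho_increment[OF a u U i'(3), of y n] Une[of n] by (simp add: K_def field_simps)
    have "\<bar>q n y\<bar> \<le> \<bar>rho i (\<pi> a) y (U n) - rho i (\<pi> a) y u\<bar> / \<bar>U n - u\<bar> + \<bar>rho (Suc i) (\<pi> a) y u\<bar>"
      unfolding q_def abs_divide[symmetric] by (rule abs_triangle_ineq4)
    then have "\<bar>d n y\<bar> \<le> wt NB (0 + Suc i) (\<psi> a y) * (\<bar>rho i (\<pi> a) y (U n) - rho i (\<pi> a) y u\<bar> / \<bar>U n - u\<bar> + \<bar>rho (Suc i) (\<pi> a) y u\<bar>)"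
      unfolding d_def abs_mult by (intro mult_mono) (auto simp: wt_def)
    then show ?thesis
      using 1 weighted_rho_bound[OF a u i'(2), of y] by (simp add: K_def distrib_left)
  qed
  have "(\<lambda>n. \<integral>y. \<bar>d n y\<bar> \<partial>lborel) \<longlonglongrightarrow> 0"
  proof (rule tendsto_nn_integral_varying_bound)
    show "d n \<in> borel_measurable lborel" for n using dm by simp
    show "(\<lambda>y. K * (Hbar (\<pi> a) u (U n) y + H (\<pi> a) u y)) \<in> borel_measurable lborel" for n
      using H_measurable Hbar_measurable[OF u U] by simp
    show "(\<lambda>y. K * (H (\<pi> a) u y + H (\<pi> a) u y)) \<in> borel_measurable lborel"
      using H_measurable by simp
    show "\<bar>d n y\<bar> \<le> K * (Hbar (\<pi> a) u (U n) y + H (\<pi> a) u y)" for n y by (rule dle)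
    show "(\<lambda>n. d n y) \<longlonglongrightarrow> 0" for y
    proof -
      have "(rho i (\<pi> a) y has_real_derivative rho (Suc i) (\<pi> a) y u) (at u within {0..1})"
        using dseqD(1)[OF rho_dseq i u] by simp
      then have "((\<lambda>v. (rho i (\<pi> a) y v - rho i (\<pi> a) y u) / (v - u)) \<longlongrightarrow> rho (Suc i) (\<pi> a) y u) (at u within {0..1})"
        by (simp add: has_field_derivative_iff)
      then have "(\<lambda>n. (rho i (\<pi> a) y (U n) - rho i (\<pi> a) y u) / (U n - u)) \<longlonglongrightarrow> rho (Suc i) (\<pi> a) y u"
        using U' lim unfolding tendsto_at_iff_sequentially comp_def by blast
      then have "(\<lambda>n. q n y) \<longlonglongrightarrow> 0" unfolding q_def by (rule LIM_zero)
      then show ?thesis unfolding d_def by (rule tendsto_mult_right_zero)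
    qed
    show "(\<lambda>n. K * (Hbar (\<pi> a) u (U n) y + H (\<pi> a) u y)) \<longlonglongrightarrow> K * (H (\<pi> a) u y + H (\<pi> a) u y)" for y
      by (intro tendsto_intros Hbar_tendsto u U lim)
    show "(\<integral>\<^sup>+y. ennreal (K * (Hbar (\<pi> a) u (U n) y + H (\<pi> a) u y)) \<partial>lborel) = ennreal (K * (2 * cPhi))" for n
    proof -
      have "integrable lborel (\<lambda>y. K * (Hbar (\<pi> a) u (U n) y + H (\<pi> a) u y))"
        by (intro integrable_mult_right Bochner_Integration.integrable_add H_integrable Hbar_integrable u U)
      then show ?thesis
        by (subst nn_integral_eq_integral) (use K0 H_nonneg[OF u] Hbar_nonneg[OF u U] in \<open>auto simp: H_integrable[OF u] Hbar_integrable[OF u U] integral_H[OF u] integral_Hbar[OF u U]\<close>)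
    qed
    show "(\<integral>\<^sup>+y. ennreal (K * (H (\<pi> a) u y + H (\<pi> a) u y)) \<partial>lborel) = ennreal (K * (2 * cPhi))"
    proof -
      have "integrable lborel (\<lambda>y. K * (H (\<pi> a) u y + H (\<pi> a) u y))"
        by (intro integrable_mult_right Bochner_Integration.integrable_add H_integrable u)
      then show ?thesis
        by (subst nn_integral_eq_integral) (use K0 H_nonneg[OF u] in \<open>auto simp: H_integrable[OF u] integral_H[OF u]\<close>)
    qed
  qed simp
  then have lim0: "(\<lambda>n. c * (\<integral>y. \<bar>d n y\<bar> \<partial>lborel)) \<longlonglongrightarrow> 0" by (rule tendsto_mult_right_zero)
  have dint: "integrable lborel (d n)" for n
  proof (rule Bochner_Integration.integrable_bound)
    show "integrable lborel (\<lambda>y. K * (Hbar (\<pi> a) u (U n) y + H (\<pi> a) u y))"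
      by (intro integrable_mult_right Bochner_Integration.integrable_add H_integrable Hbar_integrable u U)
    show "AE y in lborel. norm (d n y) \<le> norm (K * (Hbar (\<pi> a) u (U n) y + H (\<pi> a) u y))"
      by (rule AE_I2) (use order.trans[OF dle abs_ge_self] in simp)
  qed (use dm in simp)
  show "(\<lambda>n. (Top i (U n) (G n) a - Top i u (G n) a) / (U n - u) - Top (Suc i) u (G n) a) \<longlonglongrightarrow> 0"
  proof (rule Lim_null_comparison[OF always_eventually lim0], rule allI)
    fix n
    note int = integrand_integrable[OF G0 c a _ i'(1)] and int' = integrand_integrable[OF G c a _ i'(2)]
    have eq: "G n (\<psi> a y) * q n y = (G n (\<psi> a y) * rho i (\<pi> a) y (U n) - G n (\<psi> a y) * rho i (\<pi> a) y u) / (U n - u) - G n (\<psi> a y) * rho (Suc i) (\<pi> a) y u" for y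
      by (simp add: q_def right_diff_distrib)
    have qint: "integrable lborel (\<lambda>y. G n (\<psi> a y) * q n y)"
      unfolding eq by (intro Bochner_Integration.integrable_diff integrable_divide int int' u U)
    have eq': "(Top i (U n) (G n) a - Top i u (G n) a) / (U n - u) - Top (Suc i) u (G n) a = (\<integral>y. G n (\<psi> a y) * q n y \<partial>lborel)"
      unfolding Top_def eq using int[OF U] int[OF u] int'[OF u] by simp
    show "norm ((Top i (U n) (G n) a - Top i u (G n) a) / (U n - u) - Top (Suc i) u (G n) a) \<le> c * (\<integral>y. \<bar>d n y\<bar> \<partial>lborel)"
      unfolding eq' real_norm_def integral_mult_right_zero[symmetric]
    proof (rule order.trans[OF integral_abs_bound integral_mono])
      show "integrable lborel (\<lambda>y. \<bar>G n (\<psi> a y) * q n y\<bar>)" using qint by (rule integrable_abs)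
      show "integrable lborel (\<lambda>y. c * \<bar>d n y\<bar>)" using dint by simp
      show "\<bar>G n (\<psi> a y) * q n y\<bar> \<le> c * \<bar>d n y\<bar>" for y
        using g_bound[OF G a] by (simp add: d_def abs_mult wt_def)
    qed
  qed
qed

text \<open>The constants in \<open>kernel_op\<close> have to be positive; \<open>Phi\<close> is at
  least the density \<open>f\<close>, whose integral is 1.\<close>

lemma cPhi_pos: "0 < cPhi"
proof -
  have "f z \<le> Phi z" for z
  proof -
    have "f z * 1 \<le> \<bar>F 0 z\<bar> * (1 + \<bar>z\<bar>) powr (d0 + (1 - q') * real 0)"
      using f_pos[of z] dl_pos[of 0] by (intro mult_mono ge_one_powr_ge_zero) (auto simp: nderiv_simps dl_def)
    also have "\<dots> \<le> Phi z" unfolding Phi_def by (rule member_le_sum) auto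
    finally show ?thesis by simp
  qed
  then have "(\<integral>\<^sup>+z. ennreal (f z) \<partial>lborel) \<le> (\<integral>\<^sup>+z. ennreal (Phi z) \<partial>lborel)"
    by (intro nn_integral_mono ennreal_leI)
  also have "\<dots> = ennreal cPhi"
    unfolding cPhi_def using nn_integral_eq_integral[OF Phi_integrable] Phi_nonneg by simp
  finally show ?thesis unfolding f_mass by (cases "0 < cPhi") (auto simp: ennreal_neg)
qed

lemma kernel_op_Top: "kernel_op k MA (wt NA) MB (wt NB) Top"
  unfolding kernel_op_def
proof (intro conjI allI impI ballI)
  show "\<exists>C>0. \<forall>u\<in>{0..1}. \<forall>c\<ge>0. \<forall>g\<in>wball MB (wt NB (l + i)) c. Top i u g \<in> wball MA (wt NA l) (C * c)" if "l + i \<le> k" for l i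
    using Top_bound[OF _ _ _ that] Kc(1) cPhi_pos by (intro exI[of _ "Kc * cPhi"]) auto
  show "\<exists>C>0. \<forall>u\<in>{0..1}. \<forall>v\<in>{0..1}. \<forall>c\<ge>0. \<forall>g\<in>wball MB (wt NB (Suc (l + i))) c.
        (\<lambda>x. Top i v g x - Top i u g x) \<in> wball MA (wt NA l) (C * c * \<bar>v - u\<bar>)" if "l + i < k" for l i
    using Top_lipschitz[OF _ _ _ _ that] Kc(1) cPhi_pos by (intro exI[of _ "Kc * cPhi"]) auto
qed (auto intro: Top_fcont Top_fderiv)

end

section \<open>Ergodicity of the autoregression\<close>

definition shift :: "nat \<Rightarrow> (nat \<Rightarrow> real) \<Rightarrow> real \<Rightarrow> nat \<Rightarrow> real" where
  "shift p x y = (\<lambda>i\<in>{1..p}. if i = p then y else x (i + 1))"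

lemma shift_space: "shift p x y \<in> space (Rp p)"
  by (simp add: shift_def space_PiM)

lemma shift_measurable: "(\<lambda>(x, y). shift p x y) \<in> measurable (Rp p \<Otimes>\<^sub>M borel) (Rp p)"
  unfolding shift_def[abs_def] case_prod_beta
proof (rule measurable_restrict)
  fix i assume i: "i \<in> {1..p}"
  show "(\<lambda>z. if i = p then snd z else fst z (i + 1)) \<in> borel_measurable (Rp p \<Otimes>\<^sub>M borel)"
  proof (cases "i = p")
    case False
    then have "(\<lambda>x. x (i + 1)) \<in> borel_measurable (Rp p)"
      using i by (intro measurable_component_singleton) auto
    then show ?thesis using False measurable_compose[OF measurable_fst] by simp
  qed simp
qed

text \<open>If the additive terms are small against \<open>m\<close>, raising \<open>\<beta>\<close>
  to the midpoint \<open>\<beta>'\<close> of \<open>\<beta>\<close> and 1 absorbs them. Otherwise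
  \<open>m\<close> is at most a multiple of \<open>1 + s\<close>, and everything goes into the noise
  term. The case split keeps the first factor below 1 also for \<open>d > 1\<close>, where powers
  are not subadditive.\<close>

lemma powr_affine_contraction:
  fixes \<beta> b T d :: real
  assumes \<beta>: "0 \<le> \<beta>" "\<beta> < 1" and b: "0 \<le> b" and T: "0 \<le> T" and d: "0 < d"
  shows "\<exists>\<kappa> K. 0 < \<kappa> \<and> \<kappa> < 1 \<and> 0 \<le> K \<and> (\<forall>m\<ge>0. \<forall>s\<ge>0.
    (1 + \<beta> * m + b + T * s) powr d \<le> \<kappa> * (1 + m) powr d + K * (1 + s) powr d)"
proof -
  define \<beta>' where "\<beta>' = (1 + \<beta>) / 2"
  have \<beta>': "\<beta> < \<beta>'" "\<beta>' < 1" "0 < \<beta>'" using \<beta> by (auto simp: \<beta>'_def)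
  define E where "E = (1 + b + T) * (1 + 1 / (\<beta>' - \<beta>))"
  have E: "0 \<le> E" using b T \<beta>' by (auto simp: E_def intro!: mult_nonneg_nonneg add_nonneg_nonneg)
  show ?thesis
  proof (intro exI conjI allI impI)
    show "0 < \<beta>' powr d" "\<beta>' powr d < 1" "0 \<le> E powr d"
      using \<beta>' d powr_less_mono2[of d \<beta>' 1] by auto
    fix m s :: real assume ms: "0 \<le> m" "0 \<le> s"
    show "(1 + \<beta> * m + b + T * s) powr d \<le> \<beta>' powr d * (1 + m) powr d + E powr d * (1 + s) powr d"
    proof (cases "1 + b + T * s \<le> (\<beta>' - \<beta>) * m")
      case True
      then have "1 + \<beta> * m + b + T * s \<le> \<beta>' * (1 + m)" using \<beta>' by (simp add: algebra_simps)
      then have "(1 + \<beta> * m + b + T * s) powr d \<le> (\<beta>' * (1 + m)) powr d"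
        using ms b T \<beta> d by (intro powr_mono2) auto
      also have "\<dots> = \<beta>' powr d * (1 + m) powr d" using \<beta>' ms by (simp add: powr_mult)
      finally show ?thesis using powr_ge_zero[of E d] powr_ge_zero[of "1 + s" d] by (simp add: add_increasing2)
    next
      case False
      have le: "1 + b + T * s \<le> (1 + b + T) * (1 + s)"
        using ms b T by (simp add: algebra_simps)
      have "m \<le> (1 + b + T * s) / (\<beta>' - \<beta>)" using False \<beta>' by (simp add: field_simps)
      also have "\<dots> \<le> (1 + b + T) * (1 + s) / (\<beta>' - \<beta>)" using le \<beta>' by (intro divide_right_mono) auto
      finally have m: "m \<le> (1 + b + T) * (1 + s) / (\<beta>' - \<beta>)" .
      have "\<beta> * m \<le> 1 * m" using \<beta> ms by (intro mult_right_mono) auto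
      then have "1 + \<beta> * m + b + T * s \<le> (1 + b + T) * (1 + s) + (1 + b + T) * (1 + s) / (\<beta>' - \<beta>)"
        using le m by linarith
      also have "\<dots> = E * (1 + s)" by (simp add: E_def algebra_simps)
      finally have "(1 + \<beta> * m + b + T * s) powr d \<le> (E * (1 + s)) powr d"
        using ms b T \<beta> d by (intro powr_mono2) auto
      also have "\<dots> = E powr d * (1 + s) powr d" using E ms by (simp add: powr_mult)
      finally show ?thesis by (simp add: add_increasing)
    qed
  qed
qed

context ar_kernel
begin

lemma sz_measurable: "sz \<in> borel_measurable (Rp p)"
  unfolding sz_def[abs_def]
  by (intro borel_measurable_add borel_measurable_sum borel_measurable_const borel_measurable_abs measurable_component_singleton)

lemma sz_shift: "sz (shift p x y) \<le> sz x + \<bar>y\<bar>"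
proof -
  have "(\<Sum>i=1..p. \<bar>shift p x y i\<bar>) = (\<Sum>i\<in>{1..p} - {p}. \<bar>shift p x y i\<bar>) + \<bar>shift p x y p\<bar>"
    using p by (subst sum.remove[of _ p]) auto
  also have "(\<Sum>i\<in>{1..p} - {p}. \<bar>shift p x y i\<bar>) = (\<Sum>i\<in>{2..p}. \<bar>x i\<bar>)"
    by (rule sum.reindex_bij_witness[where i = "\<lambda>i. i - 1" and j = "\<lambda>i. i + 1"]) (auto simp: shift_def)
  also have "\<dots> \<le> (\<Sum>i\<in>{1..p}. \<bar>x i\<bar>)" by (rule sum_mono2) auto
  also have "\<bar>shift p x y p\<bar> = \<bar>y\<bar>" using p by (simp add: shift_def)
  finally show ?thesis by (simp add: sz_def)
qed

end

sublocale ar_kernel \<subseteq> st: ar_lift p k m \<sigma> f \<beta> \<beta>0 q' C1 C2 d0 "Rp p" "Rp p" "\<lambda>x. x" "shift p" sz sz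
proof
  show "sz (shift p a y) \<le> 2 * (sz a + \<bar>y\<bar>)" for a y
    using sz_shift[of a y] sz_ge1[of a] by simp
qed (use shift_measurable sz_measurable sz_ge1 in auto)

context ar_kernel
begin

abbreviation P where "P \<equiv> st.Top"
abbreviation iter where "iter \<equiv> kernel_iter (P 0)"
abbreviation Wp where "Wp l \<equiv> wball (Rp p) (wt sz l)"

lemma rho_0_nonneg: "u \<in> {0..1} \<Longrightarrow> 0 \<le> rho 0 x y u"
  using \<sigma>_pos f_pos by (simp add: rho_0 less_imp_le)

lemma f_measurable: "f \<in> borel_measurable borel"
  using F_measurable[of 0] by (simp add: nderiv_simps)

lemma nn_integral_rho_0:
  assumes u: "u \<in> {0..1}"
  shows "(\<integral>\<^sup>+y. ennreal (rho 0 x y u) \<partial>lborel) = 1"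
proof -
  note [measurable] = f_measurable
  have t: "0 < tau 0 u" by (rule tau_0_pos[OF u])
  have "(\<integral>\<^sup>+z. ennreal (f z) \<partial>lborel) = \<bar>tau 0 u\<bar> * (\<integral>\<^sup>+y. ennreal (f (- tau 0 u * mm 0 u x + tau 0 u * y)) \<partial>lborel)"
    by (rule nn_integral_real_affine) (use t in auto)
  also have "\<dots> = (\<integral>\<^sup>+y. ennreal (tau 0 u * f (- tau 0 u * mm 0 u x + tau 0 u * y)) \<partial>lborel)"
    using t by (simp add: nn_integral_cmult[symmetric] ennreal_mult')
  also have "\<dots> = (\<integral>\<^sup>+y. ennreal (rho 0 x y u) \<partial>lborel)"
    by (simp add: rho_0 mm_0 tau_0 diff_divide_distrib)
  finally show ?thesis using f_mass by simp
qed

lemma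
  assumes u: "u \<in> {0..1}" and x: "x \<in> space (Rp p)"
  shows rho_0_integrable: "integrable lborel (\<lambda>y. rho 0 x y u)" and integral_rho_0: "(\<integral>y. rho 0 x y u \<partial>lborel) = 1"
proof -
  show *: "integrable lborel (\<lambda>y. rho 0 x y u)"
    by (rule integrableI_nonneg) (use st.rho_meas1[OF x _ u] rho_0_nonneg[OF u] nn_integral_rho_0[OF u] in auto)
  have "ennreal (\<integral>y. rho 0 x y u \<partial>lborel) = 1"
    using nn_integral_eq_integral[OF *] rho_0_nonneg[OF u] nn_integral_rho_0[OF u] by simp
  then show "(\<integral>y. rho 0 x y u \<partial>lborel) = 1" by simp
qed

lemma P_one: "u \<in> {0..1} \<Longrightarrow> x \<in> space (Rp p) \<Longrightarrow> P 0 u (\<lambda>_. 1) x = 1"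
  by (simp add: st.Top_def integral_rho_0)

lemma P_nonneg:
  assumes "u \<in> {0..1}" "\<And>x. x \<in> space (Rp p) \<Longrightarrow> 0 \<le> g x"
  shows "0 \<le> P 0 u g x"
  unfolding st.Top_def
  by (intro Bochner_Integration.integral_nonneg mult_nonneg_nonneg rho_0_nonneg assms shift_space)

text \<open>The minorizing kernel: the new coordinate is uniform on the unit interval. After \<open>p\<close> steps
  the starting point is forgotten.\<close>

definition J :: "((nat \<Rightarrow> real) \<Rightarrow> real) \<Rightarrow> (nat \<Rightarrow> real) \<Rightarrow> real" where
  "J g x = (\<integral>y. indicator {0..1} y * g (shift p x y) \<partial>lborel)"

lemma J_integrand:
  assumes g: "g \<in> Wp 0 c" and c: "0 \<le> c" and y: "y \<in> {0..1}"
  shows "\<bar>g (shift p x y)\<bar> \<le> c * 2 powr d0 * wt sz 0 x"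
proof -
  have "\<bar>g (shift p x y)\<bar> \<le> c * wt sz 0 (shift p x y)" by (rule wballD(2)[OF g shift_space])
  also have "wt sz 0 (shift p x y) \<le> (2 * sz x) powr dl 0"
    unfolding wt_def using sz_shift[of x y] y sz_ge1[of x] sz_ge1[of "shift p x y"] dl_pos[of 0] by (intro powr_mono2) auto
  also have "\<dots> = 2 powr d0 * wt sz 0 x" using sz_ge1[of x] by (simp add: powr_mult wt_def dl_def)
  finally show ?thesis using c by (simp add: mult_left_mono mult.assoc)
qed

lemma J_integrable:
  assumes g: "g \<in> Wp 0 c" and x: "x \<in> space (Rp p)"
  shows "integrable lborel (\<lambda>y. indicator {0..1} y * g (shift p x y))"
proof (rule Bochner_Integration.integrable_bound)
  have g': "g \<in> Wp 0 \<bar>c\<bar>"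
    by (rule weight_scale_wball_nn[OF st.weight_scale_A le0 g])
  show "integrable lborel (\<lambda>y::real. indicator {0..1} y * (\<bar>c\<bar> * 2 powr d0 * wt sz 0 x))" by simp
  show "AE y in lborel. norm (indicator {0..1} y * g (shift p x y)) \<le> norm (indicator {0..1} y * (\<bar>c\<bar> * 2 powr d0 * wt sz 0 x))"
    by (rule AE_I2) (use J_integrand[OF g', of _ x] in \<open>auto simp: indicator_def intro: order.trans[OF _ abs_ge_self]\<close>)
  show "(\<lambda>y. indicator {0..1} y * g (shift p x y)) \<in> borel_measurable lborel"
    using measurable_compose[OF st.\<psi>_meas1[OF x] wballD(1)[OF g]] by simp
qed

lemma J_wball:
  assumes g: "g \<in> Wp 0 c"
  shows "J g \<in> Wp 0 (\<bar>c\<bar> * 2 powr d0)"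
proof (rule wballI)
  have g': "g \<in> Wp 0 \<bar>c\<bar>"
    by (rule weight_scale_wball_nn[OF st.weight_scale_A le0 g])
  have "(\<lambda>(x, y). g (shift p x y)) \<in> borel_measurable (Rp p \<Otimes>\<^sub>M borel)"
    using measurable_compose[OF shift_measurable wballD(1)[OF g]] by (simp add: case_prod_beta)
  then have "(\<lambda>(x, y). indicator {0..1} y * g (shift p x y)) \<in> borel_measurable (Rp p \<Otimes>\<^sub>M lborel)"
    by (simp add: case_prod_beta cong: measurable_cong_sets)
  from lborel.borel_measurable_lebesgue_integral[OF this] show "J g \<in> borel_measurable (Rp p)"
    by (simp add: J_def[abs_def])
  fix x assume x: "x \<in> space (Rp p)"
  have "\<bar>J g x\<bar> \<le> (\<integral>(y::real). indicator {0..1} y * (\<bar>c\<bar> * 2 powr d0 * wt sz 0 x) \<partial>lborel)"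
    unfolding J_def
  proof (rule order.trans[OF integral_abs_bound integral_mono])
    show "\<bar>indicator {0..1} y * g (shift p x y)\<bar> \<le> indicator {0..1} y * (\<bar>c\<bar> * 2 powr d0 * wt sz 0 x)" for y
      using J_integrand[OF g', of y x] by (auto simp: indicator_def)
  qed (use J_integrable[OF g x] in auto)
  then show "\<bar>J g x\<bar> \<le> \<bar>c\<bar> * 2 powr d0 * wt sz 0 x" by simp
qed

lemma J_functional:
  assumes x: "x \<in> space (Rp p)"
  shows "wfunctional (Rp p) (wt sz 0) (\<lambda>g. J g x)"
  unfolding wfunctional_def J_def
proof (intro conjI allI impI)
  fix g h a b c d assume gh: "g \<in> Wp 0 c" "h \<in> Wp 0 d"
  show "(\<integral>y. indicator {0..1} y * (a * g (shift p x y) + b * h (shift p x y)) \<partial>lborel) =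
     a * (\<integral>y. indicator {0..1} y * g (shift p x y) \<partial>lborel) + b * (\<integral>y. indicator {0..1} y * h (shift p x y) \<partial>lborel)"
    using J_integrable[OF gh(1) x] J_integrable[OF gh(2) x] by (simp add: distrib_left mult.left_commute)
next
  fix G :: "nat \<Rightarrow> (nat \<Rightarrow> real) \<Rightarrow> real" and c
  assume G: "\<forall>n. G n \<in> Wp 0 c" "\<forall>x\<in>space (Rp p). (\<lambda>n. G n x) \<longlonglongrightarrow> 0"
  have G': "G n \<in> Wp 0 \<bar>c\<bar>" for n
    by (rule weight_scale_wball_nn[OF st.weight_scale_A le0]) (use G in blast)
  have "(\<lambda>n. \<integral>y. indicator {0..1} y * G n (shift p x y) \<partial>lborel) \<longlonglongrightarrow> (\<integral>(y::real). 0 \<partial>lborel)"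
  proof (rule integral_dominated_convergence[where w = "\<lambda>y. indicator {0..1} y * (\<bar>c\<bar> * 2 powr d0 * wt sz 0 x)"])
    show "(\<lambda>y. indicator {0..1} y * G n (shift p x y)) \<in> borel_measurable lborel" for n
      using borel_measurable_integrable[OF J_integrable[OF G' x]] .
    show "AE y in lborel. norm (indicator {0..1} y * G n (shift p x y)) \<le> indicator {0..1} y * (\<bar>c\<bar> * 2 powr d0 * wt sz 0 x)" for n
      by (rule AE_I2) (use J_integrand[OF G', where x = x] in \<open>auto simp: indicator_def\<close>)
    show "AE y in lborel. (\<lambda>n. indicator {0..1} y * G n (shift p x y)) \<longlonglongrightarrow> 0"
      by (rule AE_I2, rule tendsto_mult_right_zero) (use G shift_space in blast)
  qed simp_all
  then show "(\<lambda>n. \<integral>y. indicator {0..1} y * G n (shift p x y) \<partial>lborel) \<longlonglongrightarrow> 0" by simp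
qed

sublocale Jm: markov_ops "Rp p" "wt sz 0" "\<lambda>_. J"
proof
  show "1 \<le> wt sz 0 x" for x using sz_ge1[of x] dl_pos[of 0] by (simp add: wt_def ge_one_powr_ge_zero)
  show "J (\<lambda>_. 1) x = 1" for x by (simp add: J_def)
  show "wfunctional (Rp p) (wt sz 0) (\<lambda>g. J g x)" if "x \<in> space (Rp p)" for x by (rule J_functional[OF that])
  show "\<exists>C. J g \<in> Wp 0 C" if "g \<in> Wp 0 c" for g c using J_wball[OF that] by blast
qed

lemma J_iter_nonneg:
  assumes "\<And>x. x \<in> space (Rp p) \<Longrightarrow> 0 \<le> g x" "x \<in> space (Rp p)"
  shows "0 \<le> kernel_iter (\<lambda>_. J) us g x"
  using assms(2)
proof (induction us arbitrary: x)
  case (Cons u us)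
  then show ?case
    using shift_space by (auto simp: J_def intro!: Bochner_Integration.integral_nonneg)
qed (use assms(1) in simp)

text \<open>Each step discards the oldest coordinate, so only coordinates beyond the number of steps
  can still matter; after \<open>p\<close> steps there are none.\<close>

lemma J_iter_cong:
  assumes "x \<in> space (Rp p)" "x' \<in> space (Rp p)" "\<forall>i\<in>{1..p}. length us < i \<longrightarrow> x i = x' i"
  shows "kernel_iter (\<lambda>_. J) us g x = kernel_iter (\<lambda>_. J) us g x'"
  using assms
proof (induction us arbitrary: x x')
  case Nil
  then have "x = x'" by (intro PiE_ext[of x "{1..p}" "\<lambda>_. UNIV" x']) (auto simp: space_PiM)
  then show ?case by simp
next
  case (Cons u us)
  have "kernel_iter (\<lambda>_. J) us g (shift p x y) = kernel_iter (\<lambda>_. J) us g (shift p x' y)" for y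
    by (rule Cons.IH[OF shift_space shift_space]) (use Cons.prems in \<open>auto simp: shift_def\<close>)
  then show ?case unfolding kernel_iter_simps J_def[of _ x] J_def[of _ x'] by simp
qed

lemma f_lower_bound: "\<exists>c>0. \<forall>z. \<bar>z\<bar> \<le> r \<longrightarrow> c \<le> f z"
proof (cases "0 \<le> r")
  case True
  have "continuous_on {-r..r} f"
    using continuous_on_subset[OF F_continuous[of 0]] by (simp add: nderiv_simps)
  then obtain z0 where "z0 \<in> {-r..r}" "\<forall>z\<in>{-r..r}. f z0 \<le> f z"
    using continuous_attains_inf[of "{-r..r}" f] True by auto
  then show ?thesis using f_pos[of z0] by (intro exI[of _ "f z0"]) (auto simp: abs_le_iff)
qed (auto intro: exI[of _ 1])

lemma mm_0_bound:
  assumes "u \<in> {0..1}" "\<forall>i\<in>{1..p}. \<bar>x i\<bar> \<le> B"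
  shows "\<bar>mm 0 u x\<bar> \<le> \<beta> * B + \<beta>0"
  unfolding mm_0
proof (rule m_growth[OF assms(1) rev_vec_space], rule ballI)
  fix i assume "i \<in> {1..p}"
  then have "p + 1 - i \<in> {1..p}" "rev_vec p x i = x (p + 1 - i)" by (auto simp: rev_vec_def)
  then show "\<bar>rev_vec p x i\<bar> \<le> B" using assms(2) by simp
qed

text \<open>For states in a box the argument of the noise density stays in a compact interval, on
  which the positive continuous \<open>f\<close> has a positive lower bound; the Jacobian is at
  least \<open>1 / T\<close>.\<close>

lemma rho_0_lower_bound:
  assumes R: "1 \<le> R"
  shows "\<exists>\<eta>>0. \<forall>u\<in>{0..1}. \<forall>x y. (\<forall>i\<in>{1..p}. \<bar>x i\<bar> \<le> R) \<longrightarrow> y \<in> {0..1} \<longrightarrow> \<eta> \<le> rho 0 x y u"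
proof -
  obtain T where T: "T \<ge> 1" "\<And>l u. l \<le> k \<Longrightarrow> u \<in> {0..1} \<Longrightarrow> \<bar>tau l u\<bar> \<le> T" "\<And>u. u \<in> {0..1} \<Longrightarrow> \<sigma> u \<le> T"
    using ex_tau_bound by blast
  obtain c where c: "c > 0" "\<And>z. \<bar>z\<bar> \<le> T * (1 + (\<beta> * R + \<beta>0)) \<Longrightarrow> c \<le> f z"
    using f_lower_bound by blast
  show ?thesis
  proof (intro exI[of _ "1 / T * c"] conjI ballI allI impI)
    show "0 < 1 / T * c" using T c by simp
    fix u x y assume u: "u \<in> {0..1::real}" and x: "\<forall>i\<in>{1..p}. \<bar>x i\<bar> \<le> R" and y: "y \<in> {0..1::real}"
    have "\<bar>y - mm 0 u x\<bar> \<le> 1 + (\<beta> * R + \<beta>0)" using mm_0_bound[OF u x] y by auto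
    then have "\<bar>tau 0 u * (y - mm 0 u x)\<bar> \<le> T * (1 + (\<beta> * R + \<beta>0))"
      unfolding abs_mult using T(1) T(2)[of 0 u] u by (intro mult_mono) auto
    then have "c \<le> f (tau 0 u * (y - mm 0 u x))" by (rule c(2))
    moreover have "1 / T \<le> tau 0 u" using T(1) T(3)[OF u] \<sigma>_pos[OF u] by (simp add: tau_0 field_simps)
    ultimately have "1 / T * c \<le> tau 0 u * f (tau 0 u * (y - mm 0 u x))"
      using T(1) c(1) tau_0_pos[OF u] by (intro mult_mono) auto
    then show "1 / T * c \<le> rho 0 x y u" by (simp add: rho_0 tau_0 mm_0)
  qed
qed

lemma P_wball:
  assumes u: "u \<in> {0..1}" and l: "l \<le> k" and g: "g \<in> Wp l c"
  shows "P 0 u g \<in> Wp l ((st.Kc * cPhi) * \<bar>c\<bar>)"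
  using st.Top_bound[of g l 0 "\<bar>c\<bar>" u] weight_scale_wball_nn[OF st.weight_scale_A l g] u l by simp

sublocale Pm: markov_ops "Rp p" "wt sz 0" "P 0"
proof
  show "\<exists>C. P 0 u g \<in> Wp 0 C" if "u \<in> {0..1}" "g \<in> Wp 0 c" for u g c
    using P_wball[OF that(1) le0 that(2)] by blast
qed (use Jm.V_ge1 st.Top_functional[OF le0] P_one in auto)

lemma P_iter_nonneg:
  assumes "set us \<subseteq> {0..1}" "\<And>x. x \<in> space (Rp p) \<Longrightarrow> 0 \<le> g x" "x \<in> space (Rp p)"
  shows "0 \<le> iter us g x"
  using assms(1,3)
proof (induction us arbitrary: x)
  case (Cons u us)
  then show ?case using P_nonneg[of u "iter us g" x] by simp
qed (use assms(2) in simp)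

text \<open>New coordinates of the minorizing kernel lie in \<open>[0, 1]\<close>, inside the box
  because \<open>R \<ge> 1\<close>. Its paths never leave the box, so the same lower bound
  \<open>\<eta>\<close> applies at every step.\<close>

lemma iter_minorization:
  assumes R: "1 \<le> R" and \<eta>: "0 < \<eta>"
    and low: "\<And>u x y. u \<in> {0..1} \<Longrightarrow> \<forall>i\<in>{1..p}. \<bar>x i\<bar> \<le> R \<Longrightarrow> y \<in> {0..1} \<Longrightarrow> \<eta> \<le> rho 0 x y u"
    and g: "g \<in> Wp 0 c" "\<And>x. x \<in> space (Rp p) \<Longrightarrow> 0 \<le> g x"
  shows "set us \<subseteq> {0..1} \<Longrightarrow> x \<in> space (Rp p) \<Longrightarrow> \<forall>i\<in>{1..p}. \<bar>x i\<bar> \<le> R \<Longrightarrow>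
     \<eta> ^ length us * kernel_iter (\<lambda>_. J) us g x \<le> iter us g x"
proof (induction us arbitrary: x)
  case (Cons u us)
  then have u: "u \<in> {0..1}" and us: "set us \<subseteq> {0..1}" by auto
  define h where "h = iter us g"
  define j where "j = kernel_iter (\<lambda>_. J) us g"
  obtain C where C: "h \<in> Wp 0 C" unfolding h_def using Pm.iter_ex_wball[OF g(1) us] by blast
  obtain D where D: "j \<in> Wp 0 D" unfolding j_def using Jm.iter_ex_wball[OF g(1) us] by blast
  have j0: "0 \<le> j z" if "z \<in> space (Rp p)" for z unfolding j_def by (rule J_iter_nonneg[OF g(2) that])
  have h0: "0 \<le> h z" if "z \<in> space (Rp p)" for z
    unfolding h_def by (rule P_iter_nonneg[OF us g(2) that])
  have "\<eta> * \<eta> ^ length us * J j x = (\<integral>y. \<eta> * \<eta> ^ length us * (indicator {0..1} y * j (shift p x y)) \<partial>lborel)"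
    by (simp add: J_def)
  also have "\<dots> \<le> (\<integral>y. h (shift p x y) * rho 0 x y u \<partial>lborel)"
  proof (rule integral_mono)
    show "integrable lborel (\<lambda>y. \<eta> * \<eta> ^ length us * (indicator {0..1} y * j (shift p x y)))"
      by (intro integrable_mult_right J_integrable[OF D Cons.prems(2)])
    show "integrable lborel (\<lambda>y. h (shift p x y) * rho 0 x y u)"
      using st.integrand_integrable[of h 0 0 "\<bar>C\<bar>" x u] weight_scale_wball_nn[OF st.weight_scale_A le0 C] u Cons.prems by simp
    fix y :: real
    show "\<eta> * \<eta> ^ length us * (indicator {0..1} y * j (shift p x y)) \<le> h (shift p x y) * rho 0 x y u"
    proof (cases "y \<in> {0..1}")
      case True
      have "\<eta> ^ length us * j (shift p x y) \<le> h (shift p x y)"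
        unfolding h_def j_def
        by (rule Cons.IH[OF us shift_space]) (use Cons.prems True R in \<open>auto simp: shift_def\<close>)
      from mult_mono[OF this low[OF u Cons.prems(3) True] h0[OF shift_space]] \<eta> True
      show ?thesis by (simp add: mult_ac)
    qed (use h0[OF shift_space] rho_0_nonneg[OF u] in simp)
  qed
  finally show ?case by (simp add: st.Top_def[of 0 u "iter us g" x] h_def j_def)
qed simp

section \<open>The Lyapunov function and the drift condition\<close>

lemma one_plus_le_sz: "i \<in> {1..p} \<Longrightarrow> 1 + \<bar>x i\<bar> \<le> sz x"
  unfolding sz_def using member_le_sum[of i "{1..p}" "\<lambda>i. \<bar>x i\<bar>"] by simp

text \<open>A maximum and not a sum, since the growth bound on \<open>m\<close> controls the new
  value by the largest coordinate. It is comparable with \<open>wt sz l\<close>, for which a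
  one-step drift can fail.\<close>

definition lyap :: "real \<Rightarrow> nat \<Rightarrow> (nat \<Rightarrow> real) \<Rightarrow> real" where
  "lyap \<gamma> l x = Max ((\<lambda>i. \<gamma> ^ (p - i) * (1 + \<bar>x i\<bar>) powr dl l) ` {1..p})"

lemma lyap_upper: "i \<in> {1..p} \<Longrightarrow> \<gamma> ^ (p - i) * (1 + \<bar>x i\<bar>) powr dl l \<le> lyap \<gamma> l x"
  unfolding lyap_def by (intro Max_ge) auto

lemma lyap_le_iff: "lyap \<gamma> l x \<le> B \<longleftrightarrow> (\<forall>i\<in>{1..p}. \<gamma> ^ (p - i) * (1 + \<bar>x i\<bar>) powr dl l \<le> B)"
  unfolding lyap_def using p by (subst Max_le_iff) auto

lemma lyap_measurable: "lyap \<gamma> l \<in> borel_measurable (Rp p)"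
  unfolding lyap_def[abs_def]
proof (rule borel_measurable_Max)
  fix i assume "i \<in> {1..p}"
  then have [measurable]: "(\<lambda>x. x i) \<in> borel_measurable (Rp p)" by (rule measurable_component_singleton)
  show "(\<lambda>x. \<gamma> ^ (p - i) * (1 + \<bar>x i\<bar>) powr dl l) \<in> borel_measurable (Rp p)" by measurable
qed simp

lemma lyap_ge1: "l \<le> k \<Longrightarrow> 1 \<le> lyap \<gamma> l x"
  using order.trans[OF _ lyap_upper[of p \<gamma> x l]] p dl_pos[of l] by (simp add: ge_one_powr_ge_zero)

lemma coord_le_lyap:
  assumes \<gamma>: "0 < \<gamma>" "\<gamma> \<le> 1" and i: "i \<in> {1..p}"
  shows "\<gamma> ^ p * (1 + \<bar>x i\<bar>) powr dl l \<le> lyap \<gamma> l x"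
proof -
  have "\<gamma> ^ p * (1 + \<bar>x i\<bar>) powr dl l \<le> \<gamma> ^ (p - i) * (1 + \<bar>x i\<bar>) powr dl l"
    using \<gamma> by (intro mult_right_mono power_decreasing) auto
  then show ?thesis using lyap_upper[OF i, of \<gamma> x l] by linarith
qed

lemma lyap_le_wt:
  assumes \<gamma>: "0 < \<gamma>" "\<gamma> \<le> 1" and l: "l \<le> k"
  shows "lyap \<gamma> l x \<le> 1 * wt sz l x"
  unfolding lyap_le_iff
proof
  fix i assume i: "i \<in> {1..p}"
  have "\<gamma> ^ (p - i) * (1 + \<bar>x i\<bar>) powr dl l \<le> 1 * sz x powr dl l"
    using \<gamma> one_plus_le_sz[OF i, of x] dl_pos[OF l] by (intro mult_mono power_le_one powr_mono2) auto
  then show "\<gamma> ^ (p - i) * (1 + \<bar>x i\<bar>) powr dl l \<le> 1 * wt sz l x" by (simp add: wt_def)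
qed

lemma ex_max_coord: "\<exists>i\<in>{1..p}. \<forall>j\<in>{1..p}. \<bar>x j\<bar> \<le> \<bar>x i :: real\<bar>"
proof -
  have "Max ((\<lambda>i. \<bar>x i\<bar>) ` {1..p}) \<in> (\<lambda>i. \<bar>x i\<bar>) ` {1..p}" using p by (intro Max_in) auto
  then obtain i where i: "i \<in> {1..p}" "Max ((\<lambda>i. \<bar>x i\<bar>) ` {1..p}) = \<bar>x i\<bar>" by auto
  have "\<bar>x j\<bar> \<le> \<bar>x i\<bar>" if "j \<in> {1..p}" for j
    unfolding i(2)[symmetric] using that by (intro Max_ge) auto
  with i(1) show ?thesis by blast
qed

lemma wt_le_lyap:
  assumes \<gamma>: "0 < \<gamma>" "\<gamma> \<le> 1" and l: "l \<le> k"
  shows "wt sz l x \<le> (real p powr dl l / \<gamma> ^ p) * lyap \<gamma> l x"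
proof -
  obtain i where i: "i \<in> {1..p}" "\<And>j. j \<in> {1..p} \<Longrightarrow> \<bar>x j\<bar> \<le> \<bar>x i\<bar>" using ex_max_coord by blast
  have "(\<Sum>j=1..p. \<bar>x j\<bar>) \<le> (\<Sum>j=1..p. \<bar>x i\<bar>)" by (rule sum_mono) (rule i(2))
  then have "sz x \<le> 1 + real p * \<bar>x i\<bar>" by (simp add: sz_def)
  also have "\<dots> \<le> real p * (1 + \<bar>x i\<bar>)" using p by (simp add: algebra_simps)
  finally have "wt sz l x \<le> (real p * (1 + \<bar>x i\<bar>)) powr dl l"
    unfolding wt_def using sz_ge1[of x] dl_pos[OF l] by (intro powr_mono2) auto
  also have "\<dots> = real p powr dl l / \<gamma> ^ p * (\<gamma> ^ p * (1 + \<bar>x i\<bar>) powr dl l)" using \<gamma> by (simp add: powr_mult)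
  also have "\<dots> \<le> real p powr dl l / \<gamma> ^ p * lyap \<gamma> l x"
    using \<gamma> coord_le_lyap[OF \<gamma> i(1)] by (intro mult_left_mono) auto
  finally show ?thesis .
qed

text \<open>Powers of \<open>\<gamma>\<close> discount the older coordinates, so that moving every coordinate one place down
  already gains a factor \<open>\<gamma>\<close>.\<close>

lemma lyap_shift:
  assumes l: "l \<le> k"
  shows "\<exists>\<gamma> K. 0 < \<gamma> \<and> \<gamma> < 1 \<and> 0 \<le> K \<and> (\<forall>u\<in>{0..1}. \<forall>x y.
     lyap \<gamma> l (shift p x y) \<le> \<gamma> * lyap \<gamma> l x + K * (1 + \<bar>zz x y 0 u\<bar>) powr dl l)"
proof -
  obtain T where T: "T \<ge> 1" "\<And>u. u \<in> {0..1} \<Longrightarrow> \<sigma> u \<le> T"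
    using ex_tau_bound by blast
  obtain \<kappa> K where \<kappa>: "0 < \<kappa>" "\<kappa> < 1" "0 \<le> K" and bd: "\<And>m s. m \<ge> 0 \<Longrightarrow> s \<ge> 0 \<Longrightarrow>
    (1 + \<beta> * m + \<beta>0 + T * s) powr dl l \<le> \<kappa> * (1 + m) powr dl l + K * (1 + s) powr dl l"
    using powr_affine_contraction[OF \<beta>, of \<beta>0 T "dl l"] cpos T(1) dl_pos[OF l] by auto
  \<comment> \<open>With \<open>\<gamma> ^ Suc p = \<kappa>\<close>, the contraction
    \<open>\<kappa>\<close> of the new coordinate pays for a discount of \<open>\<gamma> ^ p\<close>
    on the largest old one and still leaves a factor \<open>\<gamma>\<close>.\<close>
  define \<gamma> where "\<gamma> = \<kappa> powr (1 / real (Suc p))"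
  have \<gamma>: "0 < \<gamma>" "\<gamma> < 1" using \<kappa> powr_less_mono2[of "1 / real (Suc p)" \<kappa> 1] by (auto simp: \<gamma>_def)
  have \<gamma>p: "\<gamma> ^ Suc p = \<kappa>"
    using \<kappa> \<gamma> by (simp add: \<gamma>_def powr_realpow[symmetric] powr_powr del: power_Suc)
  show ?thesis
  proof (rule exI[of _ \<gamma>], intro exI[of _ K] conjI ballI allI \<gamma> \<kappa>)
    fix u x y assume u: "u \<in> {0..1::real}"
    let ?e = "K * (1 + \<bar>zz x y 0 u\<bar>) powr dl l"
    have e0: "0 \<le> ?e" using \<kappa> by simp
    show "lyap \<gamma> l (shift p x y) \<le> \<gamma> * lyap \<gamma> l x + ?e"
      unfolding lyap_le_iff[of \<gamma> l "shift p x y"]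
    proof
      fix i assume i: "i \<in> {1..p}"
      show "\<gamma> ^ (p - i) * (1 + \<bar>shift p x y i\<bar>) powr dl l \<le> \<gamma> * lyap \<gamma> l x + ?e"
      proof (cases "i = p")
        case False
        then have "i + 1 \<in> {1..p}" "p - i = Suc (p - (i + 1))" "shift p x y i = x (i + 1)" using i by (auto simp: shift_def)
        then have "\<gamma> ^ (p - i) * (1 + \<bar>shift p x y i\<bar>) powr dl l \<le> \<gamma> * lyap \<gamma> l x"
          using mult_left_mono[OF lyap_upper[of "i + 1" \<gamma> x l], of \<gamma>] \<gamma> by (simp add: mult.assoc)
        then show ?thesis using e0 by linarith
      next
        case True
        obtain j where j: "j \<in> {1..p}" "\<And>i. i \<in> {1..p} \<Longrightarrow> \<bar>x i\<bar> \<le> \<bar>x j\<bar>" using ex_max_coord by blast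
        have "y = mm 0 u x + \<sigma> u * zz x y 0 u" using \<sigma>_pos[OF u] by (simp add: zz_0 tau_0)
        then have "\<bar>y\<bar> \<le> \<bar>mm 0 u x\<bar> + \<bar>\<sigma> u * zz x y 0 u\<bar>" by linarith
        also have "\<bar>mm 0 u x\<bar> \<le> \<beta> * \<bar>x j\<bar> + \<beta>0" by (rule mm_0_bound[OF u]) (use j in auto)
        also have "\<bar>\<sigma> u * zz x y 0 u\<bar> \<le> T * \<bar>zz x y 0 u\<bar>"
          unfolding abs_mult using T(2)[OF u] \<sigma>_pos[OF u] by (intro mult_right_mono) auto
        finally have "1 + \<bar>y\<bar> \<le> 1 + \<beta> * \<bar>x j\<bar> + \<beta>0 + T * \<bar>zz x y 0 u\<bar>" by simp
        then have "(1 + \<bar>y\<bar>) powr dl l \<le> (1 + \<beta> * \<bar>x j\<bar> + \<beta>0 + T * \<bar>zz x y 0 u\<bar>) powr dl l"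
          using dl_pos[OF l] by (intro powr_mono2) auto
        also have "\<dots> \<le> \<kappa> * (1 + \<bar>x j\<bar>) powr dl l + ?e" by (rule bd) auto
        also have "\<kappa> * (1 + \<bar>x j\<bar>) powr dl l = \<gamma> * (\<gamma> ^ p * (1 + \<bar>x j\<bar>) powr dl l)" by (simp add: \<gamma>p[symmetric])
        also have "\<dots> \<le> \<gamma> * lyap \<gamma> l x"
          using \<gamma> coord_le_lyap[OF \<gamma>(1) _ j(1), of x l] by (intro mult_left_mono) auto
        finally show ?thesis using True i by (simp add: shift_def)
      qed
    qed
  qed
qed

text \<open>The noise term of \<open>lyap_shift\<close>, multiplied by the density, lies below a
  multiple of \<open>H\<close>, whose integral depends on neither \<open>x\<close> nor
  \<open>u\<close>; so the drift constants are uniform.\<close>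

lemma P_lyap:
  assumes l: "l \<le> k" and u: "u \<in> {0..1}" and x: "x \<in> space (Rp p)" and \<gamma>: "0 < \<gamma>" "\<gamma> < 1" and K: "0 \<le> K"
    and sh: "\<And>y. lyap \<gamma> l (shift p x y) \<le> \<gamma> * lyap \<gamma> l x + K * (1 + \<bar>zz x y 0 u\<bar>) powr dl l"
  shows "P 0 u (lyap \<gamma> l) x \<le> \<gamma> * lyap \<gamma> l x + K * cPhi"
proof -
  have V: "lyap \<gamma> l \<in> wball (Rp p) (wt sz (l + 0)) 1"
    using lyap_measurable lyap_le_wt[OF \<gamma>(1) less_imp_le[OF \<gamma>(2)] l] order.trans[OF zero_le_one lyap_ge1[OF l]]
    by (intro wballI) auto
  have "P 0 u (lyap \<gamma> l) x \<le> (\<integral>y. \<gamma> * lyap \<gamma> l x * rho 0 x y u + K * H x u y \<partial>lborel)"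
    unfolding st.Top_def
  proof (rule integral_mono)
    show "integrable lborel (\<lambda>y. lyap \<gamma> l (shift p x y) * rho 0 x y u)"
      by (rule st.integrand_integrable[OF V _ x u]) (use l in auto)
    show "integrable lborel (\<lambda>y. \<gamma> * lyap \<gamma> l x * rho 0 x y u + K * H x u y)"
      by (intro Bochner_Integration.integrable_add integrable_mult_right rho_0_integrable H_integrable u x)
    fix y
    let ?z = "zz x y 0 u"
    have "(1 + \<bar>?z\<bar>) powr dl l * f ?z \<le> (1 + \<bar>?z\<bar>) powr (d0 + (1 - q') * real 0) * \<bar>F 0 ?z\<bar>"
      using dl_mono[of 0 l] f_pos[of ?z] by (intro mult_mono powr_mono) (auto simp: nderiv_simps dl_def)
    also have "\<dots> \<le> Phi ?z"
      unfolding Phi_def using member_le_sum[of 0 "{..k}" "\<lambda>r. \<bar>F r ?z\<bar> * (1 + \<bar>?z\<bar>) powr (d0 + (1 - q') * real r)"]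
      by (simp add: mult.commute)
    finally have "tau 0 u * ((1 + \<bar>?z\<bar>) powr dl l * f ?z) \<le> H x u y"
      unfolding H_def zz_0 using tau_0_pos[OF u] by (intro mult_left_mono) auto
    then have "(1 + \<bar>?z\<bar>) powr dl l * rho 0 x y u \<le> H x u y"
      by (simp add: rho_0 zz_0 tau_0 mm_0 mult_ac)
    then have "K * ((1 + \<bar>?z\<bar>) powr dl l * rho 0 x y u) \<le> K * H x u y" by (rule mult_left_mono[OF _ K])
    moreover have "lyap \<gamma> l (shift p x y) * rho 0 x y u \<le> (\<gamma> * lyap \<gamma> l x + K * (1 + \<bar>?z\<bar>) powr dl l) * rho 0 x y u"
      by (rule mult_right_mono[OF sh rho_0_nonneg[OF u]])
    ultimately show "lyap \<gamma> l (shift p x y) * rho 0 x y u \<le> \<gamma> * lyap \<gamma> l x * rho 0 x y u + K * H x u y"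
      by (simp add: distrib_right mult.assoc)
  qed
  also have "\<dots> = \<gamma> * lyap \<gamma> l x + K * cPhi"
    using rho_0_integrable[OF u x] H_integrable[OF u, of x] integral_rho_0[OF u x] integral_H[OF u, of x] by simp
  finally show ?thesis .
qed

text \<open>\<open>s * \<phi> + g\<close> and \<open>s * \<phi> - g\<close> are nonnegative and
  hence bounded below by the minorizing kernel. After \<open>p\<close> steps that kernel has the
  same value from both starting points, so on adding the bounds the terms of \<open>g\<close>
  cancel, while those of \<open>\<phi> \<ge> 1\<close> give the gain
  \<open>2 * s * \<eta> ^ p\<close>.\<close>

lemma P_minorization:
  assumes l: "l \<le> k" and \<gamma>: "0 < \<gamma>" "\<gamma> < 1"
  shows "\<exists>\<eta>>0. \<forall>us x y g \<phi> c d s. set us \<subseteq> {0..1} \<longrightarrow> length us = p \<longrightarrow> x \<in> space (Rp p) \<longrightarrow> y \<in> space (Rp p) \<longrightarrow>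
       lyap \<gamma> l x \<le> R \<longrightarrow> lyap \<gamma> l y \<le> R \<longrightarrow> g \<in> wball (Rp p) (lyap \<gamma> l) c \<longrightarrow> \<phi> \<in> wball (Rp p) (lyap \<gamma> l) d \<longrightarrow> 0 \<le> s \<longrightarrow>
       (\<forall>z\<in>space (Rp p). 1 \<le> \<phi> z) \<longrightarrow> (\<forall>z\<in>space (Rp p). \<bar>g z\<bar> \<le> s * \<phi> z) \<longrightarrow>
       \<bar>iter us g x - iter us g y\<bar> \<le> s * (iter us \<phi> x + iter us \<phi> y - 2 * \<eta>)"
proof -
  \<comment> \<open>Side of a box containing the level set; at least 1, as the minorizing kernel
    requires.\<close>
  define R' where "R' = max 1 ((\<bar>R\<bar> / \<gamma> ^ p) powr (1 / dl l))"
  have coord: "\<forall>i\<in>{1..p}. \<bar>x i\<bar> \<le> R'" if "lyap \<gamma> l x \<le> R" for x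
  proof
    fix i assume i: "i \<in> {1..p}"
    have "\<gamma> ^ p * (1 + \<bar>x i\<bar>) powr dl l \<le> \<bar>R\<bar>"
      using coord_le_lyap[OF \<gamma>(1) _ i, of x l] \<gamma>(2) that by linarith
    then have "(1 + \<bar>x i\<bar>) powr dl l \<le> \<bar>R\<bar> / \<gamma> ^ p" using \<gamma> by (simp add: field_simps)
    then have "((1 + \<bar>x i\<bar>) powr dl l) powr (1 / dl l) \<le> (\<bar>R\<bar> / \<gamma> ^ p) powr (1 / dl l)"
      using dl_pos[OF l] by (intro powr_mono2) auto
    then have "1 + \<bar>x i\<bar> \<le> (\<bar>R\<bar> / \<gamma> ^ p) powr (1 / dl l)" using dl_pos[OF l] by (simp add: powr_powr)
    then show "\<bar>x i\<bar> \<le> R'" by (simp add: R'_def)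
  qed
  obtain \<eta> where \<eta>: "0 < \<eta>" "\<And>u x y. u \<in> {0..1} \<Longrightarrow> \<forall>i\<in>{1..p}. \<bar>x i\<bar> \<le> R' \<Longrightarrow> y \<in> {0..1} \<Longrightarrow> \<eta> \<le> rho 0 x y u"
    using rho_0_lower_bound[of R'] by (auto simp: R'_def)
  have to0: "g \<in> Wp 0 \<bar>c\<bar>" if g: "g \<in> wball (Rp p) (lyap \<gamma> l) c" for g c
  proof (rule wball_mono[OF g])
    fix x
    have "c * lyap \<gamma> l x \<le> \<bar>c\<bar> * lyap \<gamma> l x" using lyap_ge1[OF l, of \<gamma> x] by (intro mult_right_mono) auto
    also have "\<dots> \<le> \<bar>c\<bar> * wt sz l x" using lyap_le_wt[OF \<gamma>(1) _ l, of x] \<gamma> by (intro mult_left_mono) auto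
    also have "wt sz l x \<le> wt sz 0 x" unfolding wt_def using sz_ge1[of x] dl_mono[of 0 l] by (intro powr_mono) auto
    finally show "c * lyap \<gamma> l x \<le> \<bar>c\<bar> * wt sz 0 x" by (simp add: mult_left_mono)
  qed
  show ?thesis
  proof (rule exI[of _ "\<eta> ^ p"], intro conjI allI impI)
    show "0 < \<eta> ^ p" using \<eta> by simp
    fix us :: "real list" and x y g \<phi> c d s
    assume us: "set us \<subseteq> {0..1}" and len: "length us = p" and x: "x \<in> space (Rp p)" and y: "y \<in> space (Rp p)"
      and xR: "lyap \<gamma> l x \<le> R" and yR: "lyap \<gamma> l y \<le> R" and g: "g \<in> wball (Rp p) (lyap \<gamma> l) c"
      and \<phi>: "\<phi> \<in> wball (Rp p) (lyap \<gamma> l) d" and s: "0 \<le> s" and \<phi>1: "\<forall>z\<in>space (Rp p). 1 \<le> \<phi> z"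
      and le: "\<forall>z\<in>space (Rp p). \<bar>g z\<bar> \<le> s * \<phi> z"
    note g0 = to0[OF g] and \<phi>0 = to0[OF \<phi>]
    let ?P = "iter us" and ?J = "kernel_iter (\<lambda>_. J) us"
    have low: "\<eta> ^ p * (s * ?J \<phi> x + t * ?J g x) \<le> s * ?P \<phi> z + t * ?P g z"
      if t: "t = 1 \<or> t = -1" and z: "z \<in> space (Rp p)" "lyap \<gamma> l z \<le> R" for t z
    proof -
      have h: "(\<lambda>z. s * \<phi> z + t * g z) \<in> Wp 0 (\<bar>s\<bar> * \<bar>d\<bar> + \<bar>t\<bar> * \<bar>c\<bar>)"
        by (rule wball_lincomb[OF \<phi>0 g0])
      have "\<eta> ^ length us * ?J (\<lambda>z. s * \<phi> z + t * g z) z \<le> ?P (\<lambda>z. s * \<phi> z + t * g z) z"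
      proof (rule iter_minorization[OF _ \<eta> h _ us z(1) coord[OF z(2)]])
        show "1 \<le> R'" by (simp add: R'_def)
        show "0 \<le> s * \<phi> z + t * g z" if "z \<in> space (Rp p)" for z
          using le that t by (auto simp: abs_le_iff)
      qed
      moreover have "?J (\<lambda>z. s * \<phi> z + t * g z) z = ?J (\<lambda>z. s * \<phi> z + t * g z) x"
        by (rule J_iter_cong[OF z(1) x]) (simp add: len)
      ultimately show ?thesis
        using Jm.iter_lincomb[OF us \<phi>0 g0 x, of s t] Pm.iter_lincomb[OF us \<phi>0 g0 z(1), of s t] by (simp add: len)
    qed
    have "0 \<le> ?J (\<lambda>z. \<phi> z - 1) x" by (rule J_iter_nonneg[OF _ x]) (use \<phi>1 in auto)
    then have J1: "1 \<le> ?J \<phi> x" using Jm.iter_diff_const[OF us \<phi>0 x, of 1] by simp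
    have "\<eta> ^ p * (2 * s * 1) \<le> \<eta> ^ p * (2 * s * ?J \<phi> x)"
      using J1 s \<eta> by (intro mult_left_mono) auto
    then show "\<bar>?P g x - ?P g y\<bar> \<le> s * (?P \<phi> x + ?P \<phi> y - 2 * \<eta> ^ p)"
      using low[of 1 x] low[of "-1" x] low[of 1 y] low[of "-1" y] x y xR yR
      by (auto simp: abs_le_iff algebra_simps)
  qed
qed

text \<open>For each order of the scale Harris's argument runs with its own Lyapunov function and
  rate, and the result is transferred to the weight by comparability.\<close>

lemma P_stable_contracting:
  assumes l: "l \<le> k"
  shows "\<exists>C>0. \<forall>us c g. set us \<subseteq> {0..1} \<longrightarrow> 0 \<le> c \<longrightarrow> g \<in> Wp l c \<longrightarrow> iter us g \<in> Wp l (C * c)"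
    and "\<exists>C>0. \<exists>\<rho>. 0 \<le> \<rho> \<and> \<rho> < 1 \<and> (\<forall>us c g x y. set us \<subseteq> {0..1} \<longrightarrow> 0 \<le> c \<longrightarrow>
       g \<in> Wp l c \<longrightarrow> x \<in> space (Rp p) \<longrightarrow> y \<in> space (Rp p) \<longrightarrow>
       \<bar>iter us g x - iter us g y\<bar> \<le> C * c * \<rho> ^ length us * (wt sz l x + wt sz l y))"
proof -
  obtain \<gamma> K where \<gamma>: "0 < \<gamma>" "\<gamma> < 1" and K: "0 \<le> K" and sh: "\<And>u x y. u \<in> {0..1} \<Longrightarrow>
     lyap \<gamma> l (shift p x y) \<le> \<gamma> * lyap \<gamma> l x + K * (1 + \<bar>zz x y 0 u\<bar>) powr dl l"
    using lyap_shift[OF l] by blast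
  define V where "V = lyap \<gamma> l"
  define B where "B = real p powr dl l / \<gamma> ^ p"
  have VA: "V x \<le> 1 * wt sz l x" for x unfolding V_def by (rule lyap_le_wt[OF \<gamma>(1) _ l]) (use \<gamma> in simp)
  have VB: "wt sz l x \<le> B * V x" for x unfolding V_def B_def by (rule wt_le_lyap[OF \<gamma>(1) _ l]) (use \<gamma> in simp)
  have B: "0 < B" using \<gamma> p by (simp add: B_def)
  have V1: "1 \<le> V x" for x unfolding V_def by (rule lyap_ge1[OF l])
  have V0: "0 \<le> V x" for x using V1[of x] by simp
  have to: "g \<in> Wp l \<bar>c\<bar>" if g: "g \<in> wball (Rp p) V c" for g c
  proof (rule wball_mono[OF g])
    fix x
    have "c * V x \<le> \<bar>c\<bar> * V x" using V0 by (intro mult_right_mono) auto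
    also have "\<dots> \<le> \<bar>c\<bar> * wt sz l x" using VA by (intro mult_left_mono) auto
    finally show "c * V x \<le> \<bar>c\<bar> * wt sz l x" .
  qed
  interpret harris_ops "Rp p" V "P 0" \<gamma> "K * cPhi" p
  proof
    show "1 \<le> V x" for x by (rule V1)
    show "wfunctional (Rp p) V (\<lambda>g. P 0 u g x)" if "u \<in> {0..1}" "x \<in> space (Rp p)" for u x
    proof (rule wfunctional_mono[OF st.Top_functional[OF le0 that]])
      show "0 \<le> V x" for x by (rule V0)
      show "V x \<le> 1 * wt sz 0 x" for x
        using VA[of x] powr_mono[OF dl_mono[of 0 l] sz_ge1[of x]] by (simp add: wt_def)
    qed
    show "\<exists>C. P 0 u g \<in> wball (Rp p) V C" if u: "u \<in> {0..1}" and g: "g \<in> wball (Rp p) V c" for u g c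
    proof -
      have "P 0 u g \<in> wball (Rp p) V (st.Kc * cPhi * \<bar>\<bar>c\<bar>\<bar> * B)"
      proof (rule wball_mono[OF P_wball[OF u l to[OF g]]])
        fix x
        show "st.Kc * cPhi * \<bar>\<bar>c\<bar>\<bar> * wt sz l x \<le> st.Kc * cPhi * \<bar>\<bar>c\<bar>\<bar> * B * V x"
          using mult_left_mono[OF VB[of x], of "st.Kc * cPhi * \<bar>\<bar>c\<bar>\<bar>"] st.Kc(1) cPhi_nonneg by (simp add: mult.assoc)
      qed
      then show ?thesis by blast
    qed
    show "P 0 u (\<lambda>_. 1) x = 1" if "u \<in> {0..1}" "x \<in> space (Rp p)" for u x by (rule P_one[OF that])
    show "0 \<le> P 0 u g x" if "u \<in> {0..1}" "\<And>x. x \<in> space (Rp p) \<Longrightarrow> 0 \<le> g x" for u g x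
      by (rule P_nonneg[OF that])
    show "V \<in> borel_measurable (Rp p)" unfolding V_def by (rule lyap_measurable)
    show "P 0 u V x \<le> \<gamma> * V x + K * cPhi" if "u \<in> {0..1}" "x \<in> space (Rp p)" for u x
      unfolding V_def by (rule P_lyap[OF l that \<gamma> K sh[OF that(1)]])
    show "0 \<le> \<gamma>" "\<gamma> < 1" "0 \<le> K * cPhi" "1 \<le> p" using \<gamma> K cPhi_nonneg p by auto
    show "\<exists>\<eta>>0. \<forall>us x y g \<phi> c d s. set us \<subseteq> {0..1} \<longrightarrow> length us = p \<longrightarrow> x \<in> space (Rp p) \<longrightarrow> y \<in> space (Rp p) \<longrightarrow>
       V x \<le> R \<longrightarrow> V y \<le> R \<longrightarrow> g \<in> wball (Rp p) V c \<longrightarrow> \<phi> \<in> wball (Rp p) V d \<longrightarrow> 0 \<le> s \<longrightarrow> (\<forall>z\<in>space (Rp p). 1 \<le> \<phi> z) \<longrightarrow>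
       (\<forall>z\<in>space (Rp p). \<bar>g z\<bar> \<le> s * \<phi> z) \<longrightarrow>
       \<bar>iter us g x - iter us g y\<bar> \<le> s * (iter us \<phi> x + iter us \<phi> y - 2 * \<eta>)" for R
      unfolding V_def by (rule P_minorization[OF l \<gamma>])
  qed
  note eqw = equivalent_weight[of 1 "wt sz l" B, OF zero_less_one VA B VB]
  show "\<exists>C>0. \<forall>us c g. set us \<subseteq> {0..1} \<longrightarrow> 0 \<le> c \<longrightarrow> g \<in> Wp l c \<longrightarrow> iter us g \<in> Wp l (C * c)"
    by (rule eqw(1))
  show "\<exists>C>0. \<exists>\<rho>. 0 \<le> \<rho> \<and> \<rho> < 1 \<and> (\<forall>us c g x y. set us \<subseteq> {0..1} \<longrightarrow> 0 \<le> c \<longrightarrow>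
       g \<in> Wp l c \<longrightarrow> x \<in> space (Rp p) \<longrightarrow> y \<in> space (Rp p) \<longrightarrow>
       \<bar>iter us g x - iter us g y\<bar> \<le> C * c * \<rho> ^ length us * (wt sz l x + wt sz l y))"
    by (rule eqw(2))
qed

definition zero_vec :: "nat \<Rightarrow> real" where "zero_vec = (\<lambda>i\<in>{1..p}. 0)"

sublocale erg: ergodic_kernels k "Rp p" "wt sz" P zero_vec
proof
  show "zero_vec \<in> space (Rp p)" by (simp add: zero_vec_def space_PiM)
qed ((rule st.weight_scale_A st.kernel_op_Top P_one P_stable_contracting; assumption)+)

end

section \<open>Laws driven by the kernels\<close>

context ar_lift
begin

text \<open>A relation between two laws and not a formula for the second, so that it can be verified
  for a bind with \<open>Q u\<close>, for blocks and for the actual process, and then exploited in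
  the same way.\<close>

definition step_law :: "real \<Rightarrow> 'a measure \<Rightarrow> 'b measure \<Rightarrow> bool" where
  "step_law u \<mu> \<nu> \<longleftrightarrow> sets \<mu> = sets MA \<and> sets \<nu> = sets MB \<and> (\<forall>G\<in>borel_measurable MB.
     (\<integral>\<^sup>+b. G b \<partial>\<nu>) = (\<integral>\<^sup>+a. \<integral>\<^sup>+y. G (\<psi> a y) * ennreal (rho 0 (\<pi> a) y u) \<partial>lborel \<partial>\<mu>))"

text \<open>Finiteness of the integral of \<open>Top 0 u g\<close> turns the defining identity of
  extended integrals into one of Bochner integrals. Applied to the weight itself, it carries the
  moment from \<open>\<mu>\<close> to \<open>\<nu>\<close>.\<close>

lemma step_law_nonneg:
  assumes u: "u \<in> {0..1}" and st: "step_law u \<mu> \<nu>" and int: "integrable \<mu> (wt NA 0)"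
    and g: "g \<in> wball MB (wt NB 0) c" and nn: "\<And>b. b \<in> space MB \<Longrightarrow> 0 \<le> g b"
  shows "integrable \<nu> g" "(\<integral>b. g b \<partial>\<nu>) = (\<integral>a. Top 0 u g a \<partial>\<mu>)"
proof -
  have s\<mu>: "sets \<mu> = sets MA" and s\<nu>: "sets \<nu> = sets MB" using st by (auto simp: step_law_def)
  note sp\<mu> = sets_eq_imp_space_eq[OF s\<mu>] and sp\<nu> = sets_eq_imp_space_eq[OF s\<nu>]
  have g': "g \<in> wball MB (wt NB (0 + 0)) \<bar>c\<bar>"
    using weight_scale_wball_nn[OF weight_scale_B le0 g] by simp
  have gi: "integrable lborel (\<lambda>y. g (\<psi> a y) * rho 0 (\<pi> a) y u)" if "a \<in> space MA" for a
    by (rule integrand_integrable[OF g' _ that u]) auto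
  have T: "Top 0 u g \<in> wball MA (wt NA 0) (Kc * cPhi * \<bar>c\<bar>)"
    by (rule Top_bound[OF g' _ u]) auto
  note Ti = wball_integrable[OF int s\<mu> T]
  have T0: "0 \<le> Top 0 u g a" if "a \<in> space MA" for a
    unfolding Top_def by (intro Bochner_Integration.integral_nonneg mult_nonneg_nonneg rho_0_nonneg u nn \<psi>_space that)
  have "(\<lambda>b. ennreal (g b)) \<in> borel_measurable MB" using wballD(1)[OF g] by simp
  then have "(\<integral>\<^sup>+b. ennreal (g b) \<partial>\<nu>) = (\<integral>\<^sup>+a. \<integral>\<^sup>+y. ennreal (g (\<psi> a y)) * ennreal (rho 0 (\<pi> a) y u) \<partial>lborel \<partial>\<mu>)"
    using st unfolding step_law_def by blast
  also have "\<dots> = (\<integral>\<^sup>+a. ennreal (Top 0 u g a) \<partial>\<mu>)"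
  proof (rule nn_integral_cong)
    fix a assume "a \<in> space \<mu>"
    then have a: "a \<in> space MA" by (simp add: sp\<mu>)
    have "(\<integral>\<^sup>+y. ennreal (g (\<psi> a y)) * ennreal (rho 0 (\<pi> a) y u) \<partial>lborel) = (\<integral>\<^sup>+y. ennreal (g (\<psi> a y) * rho 0 (\<pi> a) y u) \<partial>lborel)"
      by (rule nn_integral_cong) (simp add: ennreal_mult nn \<psi>_space[OF a] rho_0_nonneg[OF u])
    also have "\<dots> = ennreal (Top 0 u g a)"
      unfolding Top_def by (rule nn_integral_eq_integral[OF gi[OF a]]) (simp add: nn \<psi>_space[OF a] rho_0_nonneg[OF u])
    finally show "(\<integral>\<^sup>+y. ennreal (g (\<psi> a y)) * ennreal (rho 0 (\<pi> a) y u) \<partial>lborel) = ennreal (Top 0 u g a)" .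
  qed
  also have "\<dots> = ennreal (\<integral>a. Top 0 u g a \<partial>\<mu>)"
    by (rule nn_integral_eq_integral[OF Ti]) (use T0 in \<open>auto simp: sp\<mu>\<close>)
  finally have eq: "(\<integral>\<^sup>+b. ennreal (g b) \<partial>\<nu>) = ennreal (\<integral>a. Top 0 u g a \<partial>\<mu>)" .
  show gint: "integrable \<nu> g"
    by (rule integrableI_nonneg)
       (use wballD(1)[OF g] nn eq in \<open>auto simp: measurable_cong_sets[OF s\<nu> refl] sp\<nu>\<close>)
  have "AE b in \<nu>. 0 \<le> g b" by (rule AE_I2) (simp add: nn sp\<nu>)
  then have "ennreal (\<integral>b. g b \<partial>\<nu>) = ennreal (\<integral>a. Top 0 u g a \<partial>\<mu>)"
    using nn_integral_eq_integral[OF gint] eq by simp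
  moreover have "0 \<le> (\<integral>b. g b \<partial>\<nu>)" "0 \<le> (\<integral>a. Top 0 u g a \<partial>\<mu>)"
    by (intro Bochner_Integration.integral_nonneg_AE AE_I2; simp add: sp\<nu> sp\<mu> nn T0)+
  ultimately show "(\<integral>b. g b \<partial>\<nu>) = (\<integral>a. Top 0 u g a \<partial>\<mu>)" by simp
qed

lemma wt_wball: "wt NB 0 \<in> wball MB (wt NB 0) 1"
  using NB_meas by (intro wballI) (auto simp: wt_def[abs_def])

lemma step_law_moment:
  assumes "u \<in> {0..1}" "step_law u \<mu> \<nu>" "integrable \<mu> (wt NA 0)"
  shows "integrable \<nu> (wt NB 0)"
  by (rule step_law_nonneg(1)[OF assms wt_wball]) (simp add: wt_def)

lemma step_law_integral:
  assumes u: "u \<in> {0..1}" and st: "step_law u \<mu> \<nu>" and int: "integrable \<mu> (wt NA 0)"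
    and g: "g \<in> wball MB (wt NB 0) c"
  shows "(\<integral>b. g b \<partial>\<nu>) = (\<integral>a. Top 0 u g a \<partial>\<mu>)"
proof -
  have s\<mu>: "sets \<mu> = sets MA" and s\<nu>: "sets \<nu> = sets MB" using st by (auto simp: step_law_def)
  have gp: "(\<lambda>b. max 0 (g b)) \<in> wball MB (wt NB 0) c" "(\<lambda>b. max 0 (- g b)) \<in> wball MB (wt NB 0) c"
    using wballD(1)[OF g] by (intro wball_truncate[OF g]; auto)+
  note p = step_law_nonneg[OF u st int gp(1)] and q = step_law_nonneg[OF u st int gp(2)]
  have T: "Top 0 u h \<in> wball MA (wt NA 0) (Kc * cPhi * \<bar>c\<bar>)" if "h \<in> wball MB (wt NB 0) c" for h
    using Top_bound[of h 0 0 "\<bar>c\<bar>" u] weight_scale_wball_nn[OF weight_scale_B le0 that] u by simp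
  have "(\<integral>b. g b \<partial>\<nu>) = (\<integral>b. max 0 (g b) - max 0 (- g b) \<partial>\<nu>)" by (rule Bochner_Integration.integral_cong) auto
  also have "\<dots> = (\<integral>a. Top 0 u (\<lambda>b. max 0 (g b)) a - Top 0 u (\<lambda>b. max 0 (- g b)) a \<partial>\<mu>)"
    using p q wball_integrable[OF int s\<mu> T[OF gp(1)]] wball_integrable[OF int s\<mu> T[OF gp(2)]] by simp
  also have "\<dots> = (\<integral>a. Top 0 u g a \<partial>\<mu>)"
  proof (rule Bochner_Integration.integral_cong[OF refl])
    fix a assume "a \<in> space \<mu>"
    then have a: "a \<in> space MA" using sets_eq_imp_space_eq[OF s\<mu>] by simp
    have "Top 0 u (\<lambda>b. max 0 (g b) - max 0 (- g b)) a = Top 0 u (\<lambda>b. max 0 (g b)) a - Top 0 u (\<lambda>b. max 0 (- g b)) a"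
      by (rule wfunctional_diff[OF Top_functional[OF le0 u a] gp])
    moreover have "(\<lambda>b. max 0 (g b) - max 0 (- g b)) = g" by auto
    ultimately show "Top 0 u (\<lambda>b. max 0 (g b)) a - Top 0 u (\<lambda>b. max 0 (- g b)) a = Top 0 u g a" by simp
  qed
  finally show ?thesis .
qed

end

section \<open>The transition kernels as image measures\<close>

context ar_kernel
begin

abbreviation R where "R \<equiv> R_kernel p m \<sigma> f"
abbreviation Q where "Q \<equiv> Q_kernel p m \<sigma> f"

lemma R_eq: "R u x = density lborel (\<lambda>y. ennreal (rho 0 x y u))"
  by (simp add: R_kernel_def rho_0)

lemma sets_R [simp, measurable_cong]: "sets (R u x) = sets borel"
  by (simp add: R_eq)

lemma space_R [simp]: "space (R u x) = UNIV"
  by (simp add: R_eq)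

lemma rho_0_measurable:
  assumes u: "u \<in> {0..1}" shows "(\<lambda>y. rho 0 x y u) \<in> borel_measurable borel"
proof -
  note [measurable] = f_measurable
  show ?thesis unfolding rho_0 by measurable
qed

lemma ennreal_rho_0_measurable:
  "u \<in> {0..1} \<Longrightarrow> (\<lambda>y. ennreal (rho 0 x y u)) \<in> borel_measurable lborel"
  using rho_0_measurable by simp

lemma prob_space_R:
  assumes u: "u \<in> {0..1}" shows "prob_space (R u x)"
  by (rule prob_spaceI) (simp add: R_eq emeasure_density[OF ennreal_rho_0_measurable[OF u]] nn_integral_rho_0[OF u])

lemma nn_integral_R:
  assumes u: "u \<in> {0..1}" and "G \<in> borel_measurable borel"
  shows "(\<integral>\<^sup>+y. G y \<partial>R u x) = (\<integral>\<^sup>+y. G y * ennreal (rho 0 x y u) \<partial>lborel)"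
  unfolding R_eq using assms rho_0_measurable[OF u] by (subst nn_integral_density) (auto simp: mult.commute)

lemma R_measurable:
  assumes u: "u \<in> {0..1}"
  shows "R u \<in> measurable (Rp p) (subprob_algebra borel)"
proof (rule measurable_subprob_algebra)
  show "subprob_space (R u x)" for x
    using prob_space_R[OF u] by (rule prob_space_imp_subprob_space)
  fix A :: "real set" assume A: "A \<in> sets borel"
  have "(\<lambda>(x, y). ennreal (rho 0 x y u) * indicator A y) \<in> borel_measurable (Rp p \<Otimes>\<^sub>M lborel)"
    using rho_measurable[OF le0 u] A by (simp add: case_prod_beta cong: measurable_cong_sets)
  from lborel.borel_measurable_nn_integral[OF this]
  show "(\<lambda>x. emeasure (R u x) A) \<in> borel_measurable (Rp p)"
    using A by (simp add: R_eq emeasure_density[OF ennreal_rho_0_measurable[OF u]])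
qed simp

lemma emeasure_shift_box:
  assumes x: "x \<in> space (Rp p)" and A: "\<And>i. i \<in> {1..p} \<Longrightarrow> A i \<in> sets borel"
  shows "emeasure (distr (R u x) (Rp p) (shift p x)) (Pi\<^sub>E {1..p} A) =
    (if \<forall>i\<in>{1..p} - {p}. x (i + 1) \<in> A i then emeasure (R u x) (A p) else 0)"
proof -
  have box: "Pi\<^sub>E {1..p} A \<in> sets (Rp p)" by (rule sets_PiM_I_finite) (use A in auto)
  have sm: "shift p x \<in> measurable (R u x) (Rp p)" using st.\<psi>_meas1[OF x] by simp
  have "shift p x y \<in> Pi\<^sub>E {1..p} A \<longleftrightarrow> y \<in> A p \<and> (\<forall>i\<in>{1..p} - {p}. x (i + 1) \<in> A i)" for y
    using p unfolding shift_def PiE_iff by (auto split: if_splits)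
  then have vim: "shift p x -` Pi\<^sub>E {1..p} A \<inter> space (R u x) = (if \<forall>i\<in>{1..p} - {p}. x (i + 1) \<in> A i then A p else {})"
    by auto
  show ?thesis unfolding emeasure_distr[OF sm box] vim by simp
qed

text \<open>All factors of the product but the last are point masses, so it is the image of the law
  of the new observation under \<open>shift\<close>; agreement on boxes suffices.\<close>

lemma Q_eq:
  assumes u: "u \<in> {0..1}" and x: "x \<in> space (Rp p)"
  shows "Q u x = distr (R u x) (Rp p) (shift p x)"
proof -
  let ?M = "\<lambda>i. if i = p then R u x else return borel (x (i + 1))"
  interpret pr: prob_space "?M i" for i
    using prob_space_R[OF u] by (auto intro: prob_space_return)
  interpret product_sigma_finite ?M
    by (simp add: product_sigma_finite_def pr.sigma_finite_measure_axioms)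
  have sets: "sets (\<Pi>\<^sub>M i\<in>{1..p}. ?M i) = sets (Rp p)"
    by (rule sets_PiM_cong) auto
  have "distr (R u x) (Rp p) (shift p x) = (\<Pi>\<^sub>M i\<in>{1..p}. ?M i)"
  proof (rule PiM_eqI)
    show "finite {1..p}" by simp
    show "sets (distr (R u x) (Rp p) (shift p x)) = sets (\<Pi>\<^sub>M i\<in>{1..p}. ?M i)" using sets by simp
    fix A assume A: "\<And>i. i \<in> {1..p} \<Longrightarrow> A i \<in> sets (?M i)"
    have A': "A i \<in> sets borel" if "i \<in> {1..p}" for i using A[OF that] by (auto split: if_splits)
    have "(\<Prod>i\<in>{1..p}. emeasure (?M i) (A i)) = emeasure (R u x) (A p) * (\<Prod>i\<in>{1..p} - {p}. emeasure (?M i) (A i))"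
      using p by (subst prod.remove[of _ p]) auto
    also have "(\<Prod>i\<in>{1..p} - {p}. emeasure (?M i) (A i)) = (\<Prod>i\<in>{1..p} - {p}. indicator (A i) (x (i + 1)))"
      using A' by (intro prod.cong) auto
    also have "\<dots> = (if \<forall>i\<in>{1..p} - {p}. x (i + 1) \<in> A i then 1 else 0)"
      by (auto simp: indicator_def prod_zero_iff intro!: prod.neutral)
    finally show "emeasure (distr (R u x) (Rp p) (shift p x)) (Pi\<^sub>E {1..p} A) = (\<Prod>i\<in>{1..p}. emeasure (?M i) (A i))"
      by (simp only: emeasure_shift_box[OF x A']) simp
  qed
  then show ?thesis by (simp add: Q_kernel_def)
qed

lemma Q_measurable:
  assumes u: "u \<in> {0..1}"
  shows "Q u \<in> measurable (Rp p) (subprob_algebra (Rp p))"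
proof -
  have "(\<lambda>x. distr (R u x) (Rp p) (shift p x)) \<in> measurable (Rp p) (subprob_algebra (Rp p))"
    by (rule measurable_distr2[OF shift_measurable R_measurable[OF u]])
  then show ?thesis by (subst measurable_cong[OF Q_eq[OF u]])
qed

lemma nn_integral_Q:
  assumes u: "u \<in> {0..1}" and x: "x \<in> space (Rp p)" and G: "G \<in> borel_measurable (Rp p)"
  shows "(\<integral>\<^sup>+z. G z \<partial>Q u x) = (\<integral>\<^sup>+y. G (shift p x y) * ennreal (rho 0 x y u) \<partial>lborel)"
proof -
  have sm: "shift p x \<in> measurable borel (Rp p)" by (rule st.\<psi>_meas1[OF x])
  then have "shift p x \<in> measurable (R u x) (Rp p)" by simp
  then have "(\<integral>\<^sup>+z. G z \<partial>Q u x) = (\<integral>\<^sup>+y. G (shift p x y) \<partial>R u x)"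
    unfolding Q_eq[OF u x] using G by (subst nn_integral_distr) auto
  also have "\<dots> = (\<integral>\<^sup>+y. G (shift p x y) * ennreal (rho 0 x y u) \<partial>lborel)"
    by (rule nn_integral_R[OF u measurable_compose[OF sm G]])
  finally show ?thesis .
qed

lemma step_law_bind:
  assumes u: "u \<in> {0..1}" and \<mu>: "sets \<mu> = sets (Rp p)"
  shows "st.step_law u \<mu> (\<mu> \<bind> Q u)"
proof -
  have ne: "space \<mu> \<noteq> {}" using sets_eq_imp_space_eq[OF \<mu>] shift_space[of p] by auto
  have Qm: "Q u \<in> measurable \<mu> (subprob_algebra (Rp p))"
    using Q_measurable[OF u] by (simp add: measurable_cong_sets[OF \<mu> refl])
  show ?thesis
    unfolding st.step_law_def
  proof (intro conjI ballI \<mu>)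
    show "sets (\<mu> \<bind> Q u) = sets (Rp p)" by (rule sets_bind) (use sets_kernel[OF Qm] ne in auto)
    fix G :: "(nat \<Rightarrow> real) \<Rightarrow> ennreal" assume G: "G \<in> borel_measurable (Rp p)"
    have "(\<integral>\<^sup>+z. G z \<partial>(\<mu> \<bind> Q u)) = (\<integral>\<^sup>+x. \<integral>\<^sup>+z. G z \<partial>Q u x \<partial>\<mu>)"
      by (rule nn_integral_bind[OF G Qm])
    also have "\<dots> = (\<integral>\<^sup>+x. \<integral>\<^sup>+y. G (shift p x y) * ennreal (rho 0 x y u) \<partial>lborel \<partial>\<mu>)"
      by (rule nn_integral_cong) (simp add: nn_integral_Q[OF u _ G] sets_eq_imp_space_eq[OF \<mu>])
    finally show "(\<integral>\<^sup>+z. G z \<partial>(\<mu> \<bind> Q u)) = (\<integral>\<^sup>+x. \<integral>\<^sup>+y. G (shift p x y) * ennreal (rho 0 x y u) \<partial>lborel \<partial>\<mu>)" .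
  qed
qed

section \<open>Existence and uniqueness of the invariant probability\<close>

lemma stat_indicator_bounds:
  assumes u: "u \<in> {0..1}" and A: "A \<in> sets (Rp p)"
  shows "0 \<le> erg.stat u (indicator A)"
proof -
  have ind: "(indicator A :: _ \<Rightarrow> real) \<in> Wp 0 1"
    by (rule wball_bounded[OF Jm.V_ge1]) (use A in \<open>auto simp: indicator_def\<close>)
  show ?thesis
  proof (rule LIMSEQ_le_const[OF erg.iter_tendsto_stat[OF u ind erg.x0]], intro exI allI impI)
    show "0 \<le> iter (replicate N u) (indicator A) zero_vec" for N
      by (rule P_iter_nonneg[OF _ _ erg.x0]) (use u in \<open>auto simp: set_replicate_conv_if\<close>)
  qed
qed

text \<open>The stationary functional is nonnegative on indicators and hence given by a measure; its
  invariance as a functional, tested on indicators, is invariance of the measure.\<close>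

lemma ex_stat_measure:
  assumes u: "u \<in> {0..1}"
  obtains N where "invariant_prob (Rp p) (Q u) N" "\<And>A. A \<in> sets (Rp p) \<Longrightarrow> emeasure N A = ennreal (erg.stat u (indicator A))"
    "\<And>g c. g \<in> Wp 0 c \<Longrightarrow> integrable N g"
    "\<And>g c. g \<in> Wp 0 c \<Longrightarrow> (\<integral>x. g x \<partial>N) = erg.stat u g"
proof -
  have Wm: "wt sz 0 \<in> borel_measurable (Rp p)" using st.weight_scale_A by (simp add: weight_scale_def)
  note L = fcontD(1)[OF erg.stat_fcont u]
  obtain N where N: "sets N = sets (Rp p)" "\<And>A. A \<in> sets (Rp p) \<Longrightarrow> emeasure N A = ennreal (erg.stat u (indicator A))"
    "\<And>g c. g \<in> Wp 0 c \<Longrightarrow> integrable N g"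
    "\<And>g c. g \<in> Wp 0 c \<Longrightarrow> (\<integral>x. g x \<partial>N) = erg.stat u g"
    by (rule ex_measure_of_functional[OF Jm.V_ge1 Wm L stat_indicator_bounds[OF u]], assumption, assumption) (rule that)
  note sp = sets_eq_imp_space_eq[OF N(1)]
  have ind: "(indicator A :: _ \<Rightarrow> real) \<in> Wp 0 1" if "A \<in> sets (Rp p)" for A
    by (rule wball_bounded[OF Jm.V_ge1]) (use that in \<open>auto simp: indicator_def\<close>)
  have "erg.stat u (indicator (space (Rp p))) = erg.stat u (\<lambda>_. 1)"
    by (rule wfunctional_cong[OF L ind[OF sets.top] erg.const_wball[OF le0]]) simp
  then have "emeasure N (space N) = 1"
    using N(2)[OF sets.top] erg.stat_const[OF u, of 1] by (simp add: sp)
  then have pN: "prob_space N" by (rule prob_spaceI)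
  have st: "st.step_law u N (N \<bind> Q u)" by (rule step_law_bind[OF u N(1)])
  have intW: "integrable N (wt sz 0)" by (rule N(3)[OF st.wt_wball])
  have "N \<bind> Q u = N"
  proof (rule measure_eqI)
    show s: "sets (N \<bind> Q u) = sets N" using st unfolding st.step_law_def N(1) by blast
    fix A assume "A \<in> sets (N \<bind> Q u)"
    then have A: "A \<in> sets (Rp p)" using s N(1) by simp
    have int: "integrable (N \<bind> Q u) (indicator A :: _ \<Rightarrow> real)"
      by (rule st.step_law_nonneg(1)[OF u st intW ind[OF A]]) simp
    have "(\<integral>x. indicator A x \<partial>(N \<bind> Q u)) = (\<integral>x. P 0 u (indicator A) x \<partial>N)"
      by (rule st.step_law_integral[OF u st intW ind[OF A]])
    also have "\<dots> = erg.stat u (P 0 u (indicator A))" by (rule N(4)[OF P_wball[OF u le0 ind[OF A]]])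
    also have "\<dots> = erg.stat u (indicator A)" by (rule erg.stat_invariant[OF u ind[OF A]])
    finally have "(\<integral>x. indicator A x \<partial>(N \<bind> Q u)) = erg.stat u (indicator A)" .
    moreover have "emeasure (N \<bind> Q u) A = ennreal (\<integral>x. indicator A x \<partial>(N \<bind> Q u))"
    proof -
      have "A \<in> sets (N \<bind> Q u)" using A s N(1) by blast
      then have "emeasure (N \<bind> Q u) A = (\<integral>\<^sup>+x. indicator A x \<partial>(N \<bind> Q u))" by (rule nn_integral_indicator[symmetric])
      also have "\<dots> = (\<integral>\<^sup>+x. ennreal (indicator A x) \<partial>(N \<bind> Q u))"
        by (rule nn_integral_cong) (rule ennreal_indicator[symmetric])
      also have "\<dots> = ennreal (\<integral>x. indicator A x \<partial>(N \<bind> Q u))"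
        by (rule nn_integral_eq_integral[OF int]) simp
      finally show ?thesis .
    qed
    ultimately show "emeasure (N \<bind> Q u) A = emeasure N A" by (simp add: N(2)[OF A])
  qed
  with pN N(1) have "invariant_prob (Rp p) (Q u) N" by (simp add: invariant_prob_def)
  then show ?thesis using that N by blast
qed

text \<open>No moment of \<open>\<mu>\<close> is known beforehand, so the argument stays with
  bounded functions: the iterates of an indicator all have integral \<open>\<mu> A\<close>, lie
  between 0 and 1, and converge pointwise to the constant
  \<open>erg.stat u (indicator A)\<close>.\<close>

lemma invariant_prob_unique:
  assumes u: "u \<in> {0..1}" and inv: "invariant_prob (Rp p) (Q u) \<mu>" and A: "A \<in> sets (Rp p)"
  shows "emeasure \<mu> A = ennreal (erg.stat u (indicator A))"
proof -
  interpret prob_space \<mu> using inv by (simp add: invariant_prob_def)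
  have s\<mu>: "sets \<mu> = sets (Rp p)" and b: "\<mu> \<bind> Q u = \<mu>" using inv by (auto simp: invariant_prob_def)
  note sp = sets_eq_imp_space_eq[OF s\<mu>]
  have st: "st.step_law u \<mu> \<mu>" using step_law_bind[OF u s\<mu>] by (simp add: b)
  have ind: "(indicator A :: _ \<Rightarrow> real) \<in> Wp 0 1"
    by (rule wball_bounded[OF Jm.V_ge1]) (use A in \<open>auto simp: indicator_def\<close>)
  have rep: "set (replicate n u) \<subseteq> {0..1}" for n using u by (auto simp: set_replicate_conv_if)
  define h where "h n = iter (replicate n u) (indicator A)" for n
  have hb: "\<exists>C. h n \<in> Wp 0 C" for n unfolding h_def by (rule Pm.iter_ex_wball[OF ind rep])
  have h0: "0 \<le> h n x" if "x \<in> space (Rp p)" for n x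
    unfolding h_def by (rule P_iter_nonneg[OF rep _ that]) simp
  have h1: "h n x \<le> 1" if x: "x \<in> space (Rp p)" for n x
  proof -
    have "0 \<le> iter (replicate n u) (\<lambda>x. 1 * 1 + (-1) * indicator A x) x"
      by (rule P_iter_nonneg[OF rep _ x]) (simp add: indicator_def)
    also have "\<dots> = 1 * iter (replicate n u) (\<lambda>_. 1) x + (-1) * h n x"
      unfolding h_def by (rule Pm.iter_lincomb[OF rep Pm.const_wball_V ind x])
    finally show ?thesis using Pm.iter_const[OF rep[of n] x, of 1] by simp
  qed
  have hm: "h n \<in> borel_measurable (Rp p)" for n using hb wballD(1) by blast
  have inv_h: "(\<integral>\<^sup>+x. ennreal (h n x) \<partial>\<mu>) = emeasure \<mu> A" for n
  proof (induction n)
    case 0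
    then show ?case using A by (simp add: h_def ennreal_indicator s\<mu>)
  next
    case (Suc n)
    obtain C where C: "h n \<in> Wp 0 C" using hb by blast
    have "(\<integral>\<^sup>+x. ennreal (h n x) \<partial>\<mu>) = (\<integral>\<^sup>+x. \<integral>\<^sup>+y. ennreal (h n (shift p x y)) * ennreal (rho 0 x y u) \<partial>lborel \<partial>\<mu>)"
      using st hm[of n] unfolding st.step_law_def by auto
    also have "\<dots> = (\<integral>\<^sup>+x. ennreal (h (Suc n) x) \<partial>\<mu>)"
    proof (rule nn_integral_cong)
      fix x assume "x \<in> space \<mu>"
      then have x: "x \<in> space (Rp p)" by (simp add: sp)
      have "(\<integral>\<^sup>+y. ennreal (h n (shift p x y)) * ennreal (rho 0 x y u) \<partial>lborel) = (\<integral>\<^sup>+y. ennreal (h n (shift p x y) * rho 0 x y u) \<partial>lborel)"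
        by (rule nn_integral_cong, rule ennreal_mult[symmetric], rule h0[OF shift_space], rule rho_0_nonneg[OF u])
      also have "\<dots> = ennreal (\<integral>y. h n (shift p x y) * rho 0 x y u \<partial>lborel)"
      proof (rule nn_integral_eq_integral)
        show "integrable lborel (\<lambda>y. h n (shift p x y) * rho 0 x y u)"
          using st.integrand_integrable[of "h n" 0 0 "\<bar>C\<bar>" x u] weight_scale_wball_nn[OF st.weight_scale_A le0 C] u x by simp
        show "AE y in lborel. 0 \<le> h n (shift p x y) * rho 0 x y u"
          by (rule AE_I2) (rule mult_nonneg_nonneg[OF h0[OF shift_space] rho_0_nonneg[OF u]])
      qed
      also have "\<dots> = ennreal (h (Suc n) x)" by (simp add: h_def st.Top_def[of 0 u "iter (replicate n u) (indicator A)" x])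
      finally show "(\<integral>\<^sup>+y. ennreal (h n (shift p x y)) * ennreal (rho 0 x y u) \<partial>lborel) = ennreal (h (Suc n) x)" .
    qed
    finally show ?case using Suc by simp
  qed
  have "(\<lambda>n. \<integral>\<^sup>+x. ennreal (h n x) \<partial>\<mu>) \<longlonglongrightarrow> (\<integral>\<^sup>+x. ennreal (erg.stat u (indicator A)) \<partial>\<mu>)"
  proof (rule nn_integral_dominated_convergence[where w = "\<lambda>_. 1"])
    show "(\<lambda>x. ennreal (h n x)) \<in> borel_measurable \<mu>" for n using hm by (simp add: measurable_cong_sets[OF s\<mu> refl])
    show "AE x in \<mu>. ennreal (h n x) \<le> 1" for n by (rule AE_I2) (simp add: h1 sp)
    show "AE x in \<mu>. (\<lambda>n. ennreal (h n x)) \<longlonglongrightarrow> ennreal (erg.stat u (indicator A))"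
      unfolding h_def by (intro AE_I2 tendsto_ennrealI erg.iter_tendsto_stat[OF u ind]) (simp add: sp)
  qed (auto simp: emeasure_space_1)
  then show ?thesis by (simp add: inv_h LIMSEQ_const_iff emeasure_space_1)
qed

text \<open>Existence together with uniqueness gives the definite description in
  \<open>inv_law\<close> its meaning; its integrals are then values of the stationary
  functional.\<close>

lemma
  assumes u: "u \<in> {0..1}"
  shows inv_law_invariant: "invariant_prob (Rp p) (Q u) (inv_law (Rp p) (Q u))"
    and inv_law_unique: "invariant_prob (Rp p) (Q u) \<mu> \<Longrightarrow> \<mu> = inv_law (Rp p) (Q u)"
    and inv_law_integrable: "g \<in> Wp 0 c \<Longrightarrow> integrable (inv_law (Rp p) (Q u)) g"
    and inv_law_integral: "g \<in> Wp 0 c \<Longrightarrow> (\<integral>x. g x \<partial>inv_law (Rp p) (Q u)) = erg.stat u g"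
proof -
  obtain N where N: "invariant_prob (Rp p) (Q u) N" "\<And>A. A \<in> sets (Rp p) \<Longrightarrow> emeasure N A = ennreal (erg.stat u (indicator A))"
    "\<And>g c. g \<in> Wp 0 c \<Longrightarrow> integrable N g"
    "\<And>g c. g \<in> Wp 0 c \<Longrightarrow> (\<integral>x. g x \<partial>N) = erg.stat u g"
    by (rule ex_stat_measure[OF u]) (rule that)
  have unique: "\<mu> = N" if inv: "invariant_prob (Rp p) (Q u) \<mu>" for \<mu>
  proof (rule measure_eqI)
    have s: "sets \<mu> = sets (Rp p)" "sets N = sets (Rp p)" using inv N(1) unfolding invariant_prob_def by blast+
    then show "sets \<mu> = sets N" by simp
    show "emeasure \<mu> A = emeasure N A" if "A \<in> sets \<mu>" for A
      using invariant_prob_unique[OF u inv, of A] N(2)[of A] that s by simp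
  qed
  have eq: "inv_law (Rp p) (Q u) = N" unfolding inv_law_def by (rule the_equality, rule N(1), rule unique)
  show "invariant_prob (Rp p) (Q u) (inv_law (Rp p) (Q u))" "invariant_prob (Rp p) (Q u) \<mu> \<Longrightarrow> \<mu> = inv_law (Rp p) (Q u)"
    "g \<in> Wp 0 c \<Longrightarrow> integrable (inv_law (Rp p) (Q u)) g"
    "g \<in> Wp 0 c \<Longrightarrow> (\<integral>x. g x \<partial>inv_law (Rp p) (Q u)) = erg.stat u g"
    unfolding eq by (fact N(1), erule unique, erule N(3), erule N(4))
qed

end

section \<open>Laws of blocks\<close>

text \<open>Carries the derivatives of the stationary functional from states to blocks of length
  one, on which the weights agree under the embedding.\<close>

lemma smooth_family_pullback:
  assumes D: "smooth_family k M w D" and e: "e \<in> measurable M M'"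
    and w: "\<And>l x. l \<le> k \<Longrightarrow> x \<in> space M \<Longrightarrow> w' l (e x) = w l x"
  shows "smooth_family k M' w' (\<lambda>l u g. D l u (\<lambda>x. g (e x)))"
proof -
  have ball: "(\<lambda>x. g (e x)) \<in> wball M (w l) c" if "l \<le> k" "g \<in> wball M' (w' l) c" for l g c
    using measurable_compose[OF e wballD(1)[OF that(2)]] wballD(2)[OF that(2) measurable_space[OF e]] w[OF that(1)]
    by (intro wballI) auto
  have Dc: "fcont M (w l) (D l)" if "l \<le> k" for l using D that by (simp add: smooth_family_def)
  have Dd: "fderiv M (w (Suc l)) (D l) (D (Suc l))" if "l < k" for l using D that by (simp add: smooth_family_def)
  have "fcont M' (w' l) (\<lambda>u g. D l u (\<lambda>x. g (e x)))" if l: "l \<le> k" for l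
    unfolding fcont_def
  proof (intro conjI ballI allI impI)
    fix u :: real assume u: "u \<in> {0..1}"
    note Du = fcontD(1)[OF Dc[OF l] u]
    show "wfunctional M' (w' l) (\<lambda>g. D l u (\<lambda>x. g (e x)))"
      unfolding wfunctional_def
    proof (intro conjI allI impI)
      show "D l u (\<lambda>x. a * g (e x) + b * h (e x)) = a * D l u (\<lambda>x. g (e x)) + b * D l u (\<lambda>x. h (e x))"
        if "g \<in> wball M' (w' l) c" "h \<in> wball M' (w' l) d" for g h a b c d
        by (rule wfunctional_lincomb[OF Du ball[OF l that(1)] ball[OF l that(2)]])
      show "(\<lambda>n. D l u (\<lambda>x. G n (e x))) \<longlonglongrightarrow> 0"
        if "\<forall>n. G n \<in> wball M' (w' l) c" "\<forall>x\<in>space M'. (\<lambda>n. G n x) \<longlonglongrightarrow> 0" for G c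
        by (rule wfunctional_tendsto[OF Du ball[OF l]]) (use that measurable_space[OF e] in auto)
    qed
  next
    fix u :: real and U :: "nat \<Rightarrow> real" and G :: "nat \<Rightarrow> 'b \<Rightarrow> real" and c
    assume *: "u \<in> {0..1}" "\<forall>n. U n \<in> {0..1}" "U \<longlonglongrightarrow> u" "\<forall>n. G n \<in> wball M' (w' l) c"
    show "(\<lambda>n. D l (U n) (\<lambda>x. G n (e x)) - D l u (\<lambda>x. G n (e x))) \<longlonglongrightarrow> 0"
      by (rule fcontD(2)[OF Dc[OF l] *(1) _ *(3) ball[OF l]]) (use * in auto)
  qed
  moreover have "fderiv M' (w' (Suc l)) (\<lambda>u g. D l u (\<lambda>x. g (e x))) (\<lambda>u g. D (Suc l) u (\<lambda>x. g (e x)))" if l: "l < k" for l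
    unfolding fderiv_def
  proof (intro ballI allI impI)
    fix u :: real and U :: "nat \<Rightarrow> real" and G :: "nat \<Rightarrow> 'b \<Rightarrow> real" and c
    assume *: "u \<in> {0..1}" "\<forall>n. U n \<in> {0..1} - {u}" "U \<longlonglongrightarrow> u" "\<forall>n. G n \<in> wball M' (w' (Suc l)) c"
    show "(\<lambda>n. (D l (U n) (\<lambda>x. G n (e x)) - D l u (\<lambda>x. G n (e x))) / (U n - u) - D (Suc l) u (\<lambda>x. G n (e x))) \<longlonglongrightarrow> 0"
      by (rule fderivD[OF Dd[OF l] *(1) _ *(3) ball]) (use * l in auto)
  qed
  ultimately show ?thesis by (simp add: smooth_family_def)
qed

definition emb :: "(nat \<Rightarrow> real) \<Rightarrow> nat \<Rightarrow> nat \<Rightarrow> real" where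
  "emb x = (\<lambda>_. undefined)(1 := x)"

definition snoc :: "nat \<Rightarrow> nat \<Rightarrow> (nat \<Rightarrow> nat \<Rightarrow> real) \<Rightarrow> real \<Rightarrow> nat \<Rightarrow> nat \<Rightarrow> real" where
  "snoc p j z y = z(Suc j := shift p (z j) y)"

lemma upd_measurable:
  "(\<lambda>(z, x). z(Suc j := x)) \<in> measurable (Rpj p j \<Otimes>\<^sub>M Rp p) (Rpj p (Suc j))"
proof -
  have "{1..Suc j} = insert (Suc j) {1..j}" by auto
  then show ?thesis using measurable_add_dim[of "Suc j" "{1..j}" "\<lambda>_. Rp p"] by simp
qed

lemma emb_measurable: "emb \<in> measurable (Rp p) (Rpj p 1)"
proof -
  have "(\<lambda>_. undefined) \<in> space (Rpj p 0)" by (simp add: space_PiM)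
  then have "Pair (\<lambda>_. undefined) \<in> measurable (Rp p) (Rpj p 0 \<Otimes>\<^sub>M Rp p)" by (rule measurable_Pair1')
  from measurable_compose[OF this upd_measurable] show ?thesis by (simp add: emb_def[abs_def])
qed

lemma snoc_measurable:
  assumes j: "1 \<le> j"
  shows "(\<lambda>(z, y). snoc p j z y) \<in> measurable (Rpj p j \<Otimes>\<^sub>M borel) (Rpj p (Suc j))"
proof -
  have c: "(\<lambda>z. z j) \<in> measurable (Rpj p j) (Rp p)" using j by (intro measurable_component_singleton) auto
  have "(\<lambda>w. (fst w j, snd w)) \<in> measurable (Rpj p j \<Otimes>\<^sub>M borel) (Rp p \<Otimes>\<^sub>M borel)"
    by (intro measurable_Pair measurable_compose[OF measurable_fst c] measurable_snd)
  from measurable_compose[OF this shift_measurable]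
  have "(\<lambda>w. (fst w, shift p (fst w j) (snd w))) \<in> measurable (Rpj p j \<Otimes>\<^sub>M borel) (Rpj p j \<Otimes>\<^sub>M Rp p)"
    by (intro measurable_Pair measurable_fst) simp
  from measurable_compose[OF this upd_measurable] show ?thesis by (simp add: snoc_def case_prod_beta)
qed

context ar_kernel
begin

definition szj :: "nat \<Rightarrow> (nat \<Rightarrow> nat \<Rightarrow> real) \<Rightarrow> real" where
  "szj j z = (\<Sum>i=1..j. sz (z i))"

abbreviation Wb where "Wb j l \<equiv> wball (Rpj p (Suc j)) (wt (szj (Suc j)) l)"

lemma szj_measurable: "szj j \<in> borel_measurable (Rpj p j)"
  unfolding szj_def[abs_def]
proof (rule borel_measurable_sum)
  fix i assume "i \<in> {1..j}"
  then have "(\<lambda>z. z i) \<in> measurable (Rpj p j) (Rp p)" by (rule measurable_component_singleton)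
  then show "(\<lambda>z. sz (z i)) \<in> borel_measurable (Rpj p j)" by (rule measurable_compose[OF _ sz_measurable])
qed

lemma sz_le_szj: "i \<in> {1..j} \<Longrightarrow> sz (z i) \<le> szj j z"
  unfolding szj_def by (rule member_le_sum) (use sz_ge1 in \<open>auto intro: order.trans[OF zero_le_one]\<close>)

lemma szj_snoc: "1 \<le> j \<Longrightarrow> szj (Suc j) (snoc p j z y) \<le> 2 * (szj j z + \<bar>y\<bar>)"
proof -
  assume j: "1 \<le> j"
  have "(\<Sum>i=1..j. sz (snoc p j z y i)) = (\<Sum>i=1..j. sz (z i))" by (rule sum.cong) (auto simp: snoc_def)
  then have "szj (Suc j) (snoc p j z y) = (\<Sum>i=1..j. sz (z i)) + sz (shift p (z j) y)"
    unfolding szj_def by (simp add: snoc_def)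
  also have "\<dots> \<le> szj j z + (sz (z j) + \<bar>y\<bar>)" using sz_shift[of "z j" y] by (simp add: szj_def)
  also have "\<dots> \<le> 2 * (szj j z + \<bar>y\<bar>)" using sz_le_szj[of j j z] j by simp
  finally show ?thesis .
qed

end

text \<open>The reading map picks the last state of a block of length \<open>j + 1\<close>, which
  governs the next observation; the size of a block is the sum of the sizes of its states.\<close>

sublocale ar_kernel \<subseteq> bl: ar_lift p k m \<sigma> f \<beta> \<beta>0 q' C1 C2 d0 "Rpj p (Suc j)" "Rpj p (Suc (Suc j))" "\<lambda>z. z (Suc j)"
    "snoc p (Suc j)" "szj (Suc j)" "szj (Suc (Suc j))" for j
proof
  show "(\<lambda>z. z (Suc j)) \<in> measurable (Rpj p (Suc j)) (Rp p)" by (intro measurable_component_singleton) auto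
  show "(\<lambda>(a, y). snoc p (Suc j) a y) \<in> measurable (Rpj p (Suc j) \<Otimes>\<^sub>M borel) (Rpj p (Suc (Suc j)))"
    by (rule snoc_measurable) simp
  show "szj (Suc (Suc j)) (snoc p (Suc j) a y) \<le> 2 * (szj (Suc j) a + \<bar>y\<bar>)" for a y by (rule szj_snoc) simp
  show "sz (a (Suc j)) \<le> szj (Suc j) a" for a by (rule sz_le_szj) simp
  show "1 \<le> szj (Suc (Suc j)) b" for b using order.trans[OF sz_ge1 sz_le_szj[of 1 "Suc (Suc j)" b]] by simp
qed (rule szj_measurable)+

context ar_kernel
begin

text \<open>\<open>blk j\<close> belongs to blocks of \<open>j + 1\<close> states, so that the
  recursion starts with a single state. Every further state means composition with one kernel,
  differentiated by Leibniz's formula.\<close>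

primrec blk :: "nat \<Rightarrow> nat \<Rightarrow> real \<Rightarrow> ((nat \<Rightarrow> nat \<Rightarrow> real) \<Rightarrow> real) \<Rightarrow> real" where
  "blk 0 = (\<lambda>l u g. erg.stat_deriv l u (\<lambda>x. g (emb x)))"
| "blk (Suc j) = (\<lambda>l u g. \<Sum>i\<le>l. real (l choose i) * blk j (l - i) u (bl.Top j i u g))"

lemma blk_smooth: "smooth_family k (Rpj p (Suc j)) (wt (szj (Suc j))) (blk j)"
proof (induction j)
  case 0
  have "smooth_family k (Rpj p 1) (wt (szj 1)) (\<lambda>l u g. erg.stat_deriv l u (\<lambda>x. g (emb x)))"
    by (rule smooth_family_pullback[OF erg.stat_deriv_smooth emb_measurable]) (simp add: wt_def szj_def emb_def)
  then show ?case by simp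
next
  case (Suc j)
  show ?case
    unfolding blk.simps by (rule smooth_family_kernel[OF bl.kernel_op_Top bl.weight_scale_B Suc])
qed

text \<open>Given the first \<open>j + 1\<close> states, the next one is drawn from
  \<open>Q u\<close> at the last of them, and \<open>Q u\<close> is the law of the shifted state
  with the new observation put in.\<close>

lemma chain_law_step:
  assumes u: "u \<in> {0..1}" and s: "sets (chain_law (Rp p) \<mu> (Q u) (Suc j)) = sets (Rpj p (Suc j))"
  shows "bl.step_law j u (chain_law (Rp p) \<mu> (Q u) (Suc j)) (chain_law (Rp p) \<mu> (Q u) (Suc (Suc j)))"
proof -
  let ?c = "chain_law (Rp p) \<mu> (Q u) (Suc j)"
  define K where "K z = distr (Q u (z (Suc j))) (Rpj p (Suc (Suc j))) (\<lambda>x. z(Suc (Suc j) := x))" for z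
  have c: "chain_law (Rp p) \<mu> (Q u) (Suc (Suc j)) = ?c \<bind> K"
    unfolding chain_law.simps(2)[of _ _ _ "Suc j"] K_def[abs_def] by (simp del: chain_law.simps)
  have comp: "(\<lambda>z. z (Suc j)) \<in> measurable (Rpj p (Suc j)) (Rp p)" by (intro measurable_component_singleton) auto
  have "K \<in> measurable (Rpj p (Suc j)) (subprob_algebra (Rpj p (Suc (Suc j))))"
    unfolding K_def by (rule measurable_distr2[OF upd_measurable measurable_compose[OF comp Q_measurable[OF u]]])
  then have Km: "K \<in> measurable ?c (subprob_algebra (Rpj p (Suc (Suc j))))"
    unfolding measurable_cong_sets[OF s refl] .
  have sp: "space ?c = space (Rpj p (Suc j))" by (rule sets_eq_imp_space_eq[OF s])
  have "(\<lambda>i\<in>{1..Suc j}. zero_vec) \<in> space (Rpj p (Suc j))" by (simp add: space_PiM zero_vec_def)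
  then have ne: "space ?c \<noteq> {}" unfolding sp by blast
  show ?thesis
    unfolding bl.step_law_def c
  proof (intro conjI ballI s)
    show "sets (?c \<bind> K) = sets (Rpj p (Suc (Suc j)))"
      by (rule sets_bind[OF sets_kernel[OF Km] ne])
    fix G :: "_ \<Rightarrow> ennreal" assume G: "G \<in> borel_measurable (Rpj p (Suc (Suc j)))"
    have "(\<integral>\<^sup>+z. G z \<partial>(?c \<bind> K)) = (\<integral>\<^sup>+z. \<integral>\<^sup>+w. G w \<partial>K z \<partial>?c)"
      by (rule nn_integral_bind[OF G Km])
    also have "\<dots> = (\<integral>\<^sup>+z. \<integral>\<^sup>+y. G (snoc p (Suc j) z y) * ennreal (rho 0 (z (Suc j)) y u) \<partial>lborel \<partial>?c)"
    proof (rule nn_integral_cong)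
      fix z assume "z \<in> space ?c"
      then have z: "z \<in> space (Rpj p (Suc j))" by (simp only: sp)
      have zj: "z (Suc j) \<in> space (Rp p)" by (rule measurable_space[OF comp z])
      have um: "(\<lambda>x. z(Suc (Suc j) := x)) \<in> measurable (Rp p) (Rpj p (Suc (Suc j)))"
        using measurable_compose[OF measurable_Pair1'[OF z] upd_measurable] by simp
      have "sets (Q u (z (Suc j))) = sets (Rp p)" by (rule sets_kernel[OF Q_measurable[OF u] zj])
      then have "(\<lambda>x. z(Suc (Suc j) := x)) \<in> measurable (Q u (z (Suc j))) (Rpj p (Suc (Suc j)))"
        using um measurable_cong_sets by blast
      then have "(\<integral>\<^sup>+w. G w \<partial>K z) = (\<integral>\<^sup>+x. G (z(Suc (Suc j) := x)) \<partial>Q u (z (Suc j)))"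
        unfolding K_def by (rule nn_integral_distr) (use G in simp)
      also have "\<dots> = (\<integral>\<^sup>+y. G (snoc p (Suc j) z y) * ennreal (rho 0 (z (Suc j)) y u) \<partial>lborel)"
        unfolding snoc_def by (rule nn_integral_Q[OF u zj measurable_compose[OF um G]])
      finally show "(\<integral>\<^sup>+w. G w \<partial>K z) = (\<integral>\<^sup>+y. G (snoc p (Suc j) z y) * ennreal (rho 0 (z (Suc j)) y u) \<partial>lborel)" .
    qed
    finally show "(\<integral>\<^sup>+z. G z \<partial>(?c \<bind> K)) = (\<integral>\<^sup>+z. \<integral>\<^sup>+y. G (snoc p (Suc j) z y) * ennreal (rho 0 (z (Suc j)) y u) \<partial>lborel \<partial>?c)" .
  qed
qed

text \<open>The recursion starts from a point mass on the empty block, so the first bind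
  collapses.\<close>

lemma chain_law_1:
  assumes \<mu>: "prob_space \<mu>" "sets \<mu> = sets (Rp p)"
  shows "chain_law (Rp p) \<mu> K (Suc 0) = distr \<mu> (Rpj p 1) emb"
proof -
  have sp: "(\<lambda>_. undefined) \<in> space (Rpj p 0)" by (simp add: space_PiM)
  have "(\<lambda>z. distr \<mu> (Rpj p 1) (\<lambda>y. z(1 := y))) \<in> measurable (Rpj p 0) (subprob_algebra (Rpj p 1))"
  proof (rule measurable_distr2[where M = "Rp p"])
    show "(\<lambda>(z, y). z(1 := y)) \<in> measurable (Rpj p 0 \<Otimes>\<^sub>M Rp p) (Rpj p 1)"
      using upd_measurable[of 0 p] by simp
    show "(\<lambda>z. \<mu>) \<in> measurable (Rpj p 0) (subprob_algebra (Rp p))"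
      using prob_space_imp_subprob_space[OF \<mu>(1)] \<mu>(2) by (intro measurable_const) (simp add: space_subprob_algebra)
  qed
  from bind_return[OF this sp] show ?thesis by (simp add: emb_def[abs_def])
qed

lemma
  assumes u: "u \<in> {0..1}"
  shows stat_law_sets: "sets (stat_law p m \<sigma> f u (Suc j)) = sets (Rpj p (Suc j))"
    and stat_law_integrable: "integrable (stat_law p m \<sigma> f u (Suc j)) (wt (szj (Suc j)) 0)"
    and stat_law_integral: "g \<in> Wb j 0 c \<Longrightarrow>
       (\<integral>z. g z \<partial>stat_law p m \<sigma> f u (Suc j)) = blk j 0 u g"
proof -
  have inv: "prob_space (inv_law (Rp p) (Q u))" "sets (inv_law (Rp p) (Q u)) = sets (Rp p)"
    using inv_law_invariant[OF u] unfolding invariant_prob_def by blast+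
  have "sets (stat_law p m \<sigma> f u (Suc j)) = sets (Rpj p (Suc j)) \<and> integrable (stat_law p m \<sigma> f u (Suc j)) (wt (szj (Suc j)) 0) \<and>
    (\<forall>g c. g \<in> Wb j 0 c \<longrightarrow> (\<integral>z. g z \<partial>stat_law p m \<sigma> f u (Suc j)) = blk j 0 u g)"
  proof (induction j)
    case 0
    have c1: "stat_law p m \<sigma> f u (Suc 0) = distr (inv_law (Rp p) (Q u)) (Rpj p 1) emb"
      unfolding stat_law_def by (rule chain_law_1[OF inv])
    have em: "emb \<in> measurable (inv_law (Rp p) (Q u)) (Rpj p 1)"
      using emb_measurable measurable_cong_sets[OF inv(2) refl] by blast
    have w: "(\<lambda>x. wt (szj 1) 0 (emb x)) = wt sz 0" by (simp add: fun_eq_iff wt_def szj_def emb_def)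
    have wm: "wt (szj 1) 0 \<in> borel_measurable (Rpj p 1)"
      unfolding wt_def[abs_def] using szj_measurable[of 1] by measurable
    show ?case
    proof (intro conjI allI impI)
      show "sets (stat_law p m \<sigma> f u (Suc 0)) = sets (Rpj p (Suc 0))" by (simp add: c1)
      show "integrable (stat_law p m \<sigma> f u (Suc 0)) (wt (szj (Suc 0)) 0)"
        using integrable_distr_eq[OF em wm] inv_law_integrable[OF u st.wt_wball] w unfolding c1 by simp
      fix g c assume g: "g \<in> wball (Rpj p (Suc 0)) (wt (szj (Suc 0)) 0) c"
      have "(\<lambda>x. g (emb x)) \<in> Wp 0 c"
      proof (rule wballI)
        show "(\<lambda>x. g (emb x)) \<in> borel_measurable (Rp p)"
          using measurable_compose[OF emb_measurable] wballD(1)[OF g] by simp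
        fix x assume x: "x \<in> space (Rp p)"
        have "emb x \<in> space (Rpj p (Suc 0))" using measurable_space[OF emb_measurable x] by simp
        from wballD(2)[OF g this] show "\<bar>g (emb x)\<bar> \<le> c * wt sz 0 x" using fun_cong[OF w, of x] by simp
      qed
      then have "(\<integral>x. g (emb x) \<partial>inv_law (Rp p) (Q u)) = erg.stat u (\<lambda>x. g (emb x))" by (rule inv_law_integral[OF u])
      then show "(\<integral>z. g z \<partial>stat_law p m \<sigma> f u (Suc 0)) = blk 0 0 u g"
        unfolding c1 using integral_distr[OF em, of g] wballD(1)[OF g] by simp
    qed
  next
    case (Suc j)
    have st: "bl.step_law j u (stat_law p m \<sigma> f u (Suc j)) (stat_law p m \<sigma> f u (Suc (Suc j)))"
      unfolding stat_law_def by (rule chain_law_step[OF u]) (use Suc in \<open>simp add: stat_law_def\<close>)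
    have int: "integrable (stat_law p m \<sigma> f u (Suc j)) (wt (szj (Suc j)) 0)" using Suc by blast
    show ?case
    proof (intro conjI allI impI)
      show "sets (stat_law p m \<sigma> f u (Suc (Suc j))) = sets (Rpj p (Suc (Suc j)))" using st unfolding bl.step_law_def by blast
      show "integrable (stat_law p m \<sigma> f u (Suc (Suc j))) (wt (szj (Suc (Suc j))) 0)"
        by (rule bl.step_law_moment[OF u st int])
      fix g c assume g: "g \<in> Wb (Suc j) 0 c"
      have g': "g \<in> Wb (Suc j) (0 + 0) \<bar>c\<bar>"
        using weight_scale_wball_nn[OF bl.weight_scale_B le0 g] by simp
      have T: "bl.Top j 0 u g \<in> Wb j 0 (bl.Kc * cPhi * \<bar>c\<bar>)"
        by (rule bl.Top_bound[OF g' _ u]) auto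
      have "(\<integral>z. g z \<partial>stat_law p m \<sigma> f u (Suc (Suc j))) = (\<integral>z. bl.Top j 0 u g z \<partial>stat_law p m \<sigma> f u (Suc j))"
        by (rule bl.step_law_integral[OF u st int g])
      also have "\<dots> = blk j 0 u (bl.Top j 0 u g)" using Suc T by blast
      finally show "(\<integral>z. g z \<partial>stat_law p m \<sigma> f u (Suc (Suc j))) = blk (Suc j) 0 u g" by simp
    qed
  qed
  then show "sets (stat_law p m \<sigma> f u (Suc j)) = sets (Rpj p (Suc j))"
    "integrable (stat_law p m \<sigma> f u (Suc j)) (wt (szj (Suc j)) 0)"
    "g \<in> Wb j 0 c \<Longrightarrow> (\<integral>z. g z \<partial>stat_law p m \<sigma> f u (Suc j)) = blk j 0 u g"
    by blast+
qed

end

section \<open>Local stationarity of the laws\<close>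

context ar_kernel
begin

text \<open>What is used of the laws of the states at times 0 to \<open>n\<close>: a start in
  equilibrium at parameter 0, and the parameter \<open>(t + 1) / n\<close> for the transition into
  time \<open>t + 1\<close>.\<close>

definition chain_laws :: "nat \<Rightarrow> (nat \<Rightarrow> (nat \<Rightarrow> real) measure) \<Rightarrow> bool" where
  "chain_laws n \<nu> \<longleftrightarrow> \<nu> 0 = inv_law (Rp p) (Q 0) \<and>
     (\<forall>t<n. st.step_law (real (Suc t) / real n) (\<nu> t) (\<nu> (Suc t)))"

lemma unit_frac: "1 \<le> n \<Longrightarrow> t \<le> n \<Longrightarrow> real t / real n \<in> {0..1}"
  by (simp add: divide_simps)

lemma chain_laws_integral:
  assumes n: "1 \<le> n" and ch: "chain_laws n \<nu>" and t: "t \<le> n"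
  shows "sets (\<nu> t) = sets (Rp p) \<and> integrable (\<nu> t) (wt sz 0) \<and> (\<exists>us. set us \<subseteq> {0..1} \<and>
     (\<forall>g c. g \<in> Wp 0 c \<longrightarrow> (\<integral>x. g x \<partial>\<nu> t) = erg.stat 0 (iter us g)))"
  using t
proof (induction t)
  case 0
  have z: "(0::real) \<in> {0..1}" by simp
  have \<nu>0: "\<nu> 0 = inv_law (Rp p) (Q 0)" using ch by (simp add: chain_laws_def)
  show ?case
    unfolding \<nu>0
  proof (intro conjI exI[of _ "[]"])
    show "sets (inv_law (Rp p) (Q 0)) = sets (Rp p)" using inv_law_invariant[OF z] unfolding invariant_prob_def by blast
    show "integrable (inv_law (Rp p) (Q 0)) (wt sz 0)" by (rule inv_law_integrable[OF z st.wt_wball])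
  qed (use inv_law_integral[OF z] in auto)
next
  case (Suc t)
  note IH = Suc.IH[OF Suc_leD[OF Suc.prems]]
  obtain us where us: "set us \<subseteq> {0..1}"
    and eq: "\<And>g c. g \<in> Wp 0 c \<Longrightarrow> (\<integral>x. g x \<partial>\<nu> t) = erg.stat 0 (iter us g)" using IH by blast
  have int: "integrable (\<nu> t) (wt sz 0)" using IH by blast
  let ?v = "real (Suc t) / real n"
  have v: "?v \<in> {0..1}" by (rule unit_frac[OF n Suc.prems])
  have st: "st.step_law ?v (\<nu> t) (\<nu> (Suc t))" using ch Suc.prems by (simp add: chain_laws_def)
  show ?case
  proof (intro conjI exI[of _ "us @ [?v]"] allI impI)
    show "sets (\<nu> (Suc t)) = sets (Rp p)" using st unfolding st.step_law_def by blast
    show "integrable (\<nu> (Suc t)) (wt sz 0)" by (rule st.step_law_moment[OF v st int])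
    show "set (us @ [?v]) \<subseteq> {0..1}" using us v by simp
    fix g c assume g: "g \<in> Wp 0 c"
    have "(\<integral>x. g x \<partial>\<nu> (Suc t)) = (\<integral>x. P 0 ?v g x \<partial>\<nu> t)" by (rule st.step_law_integral[OF v st int g])
    also have "\<dots> = erg.stat 0 (iter us (P 0 ?v g))" by (rule eq[OF P_wball[OF v le0 g]])
    finally show "(\<integral>x. g x \<partial>\<nu> (Suc t)) = erg.stat 0 (iter (us @ [?v]) g)"
      by simp
  qed
qed

text \<open>Stability of products with arbitrary parameters bounds the moment uniformly in
  \<open>n\<close> and \<open>t\<close>.\<close>

lemma chain_laws_moment:
  obtains C where "C > 0" "\<And>n \<nu> t. 1 \<le> n \<Longrightarrow> chain_laws n \<nu> \<Longrightarrow> t \<le> n \<Longrightarrow> (\<integral>x. wt sz 0 x \<partial>\<nu> t) \<le> C"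
proof -
  obtain A where A: "A > 0" "\<And>us c g. set us \<subseteq> {0..1} \<Longrightarrow> 0 \<le> c \<Longrightarrow> g \<in> Wp 0 c \<Longrightarrow>
      iter us g \<in> Wp 0 (A * c)"
    by (rule erg.iter_wball[OF le0]) (rule that)
  obtain B where B: "B > 0" "\<And>u c g. u \<in> {0..1} \<Longrightarrow> 0 \<le> c \<Longrightarrow> g \<in> Wp 0 c \<Longrightarrow> \<bar>erg.stat u g\<bar> \<le> B * c"
    by (rule erg.stat_bounded[OF le0]) (rule that)
  show ?thesis
  proof (rule that[of "B * A"])
    show "B * A > 0" using A B by simp
    fix n \<nu> t assume n: "1 \<le> n" "chain_laws n \<nu>" "t \<le> n"
    obtain us where us: "set us \<subseteq> {0..1}"
      and eq: "\<And>g c. g \<in> Wp 0 c \<Longrightarrow> (\<integral>x. g x \<partial>\<nu> t) = erg.stat 0 (iter us g)"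
      using chain_laws_integral[OF n] by blast
    have "(\<integral>x. wt sz 0 x \<partial>\<nu> t) = erg.stat 0 (iter us (wt sz 0))" by (rule eq[OF st.wt_wball])
    also have "\<dots> \<le> B * (A * 1)"
      using B(2)[OF _ _ A(2)[OF us zero_le_one st.wt_wball], of 0] A(1) by simp
    finally show "(\<integral>x. wt sz 0 x \<partial>\<nu> t) \<le> B * A" by simp
  qed
qed

text \<open>The term \<open>1 / n\<close> comes from the movement of the parameter along the array,
  the term \<open>|u - t / n|\<close> from the Lipschitz continuity of the stationary functional.
  Test functions have weight 1, for which that Lipschitz bound holds.\<close>

lemma chain_laws_stat:
  obtains C where "C > 0" "\<And>n \<nu> t u c g. 1 \<le> n \<Longrightarrow> chain_laws n \<nu> \<Longrightarrow> t \<le> n \<Longrightarrow> u \<in> {0..1} \<Longrightarrow> 0 \<le> c \<Longrightarrow>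
     g \<in> Wp 1 c \<Longrightarrow>
     \<bar>(\<integral>x. g x \<partial>\<nu> t) - erg.stat u g\<bar> \<le> C * c * (\<bar>u - real t / real n\<bar> + 1 / real n)"
proof -
  obtain A \<rho> where A: "A > 0" "0 \<le> \<rho>" "\<rho> < 1"
    "\<And>us c g x. set us \<subseteq> {0..1} \<Longrightarrow> 0 \<le> c \<Longrightarrow> g \<in> Wp 1 c \<Longrightarrow> x \<in> space (Rp p) \<Longrightarrow>
      (\<lambda>y. iter us g y - iter us g x) \<in> Wp 1 (A * c * \<rho> ^ length us * wt sz 1 x)"
    by (rule erg.iter_coupling[OF k]) (rule that)
  obtain L where L: "L > 0" "\<And>u v c g. u \<in> {0..1} \<Longrightarrow> v \<in> {0..1} \<Longrightarrow> 0 \<le> c \<Longrightarrow> g \<in> Wp 1 c \<Longrightarrow>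
     \<bar>erg.stat v g - erg.stat u g\<bar> \<le> L * c * \<bar>v - u\<bar>"
    by (rule erg.stat_lipschitz[OF k]) (rule that)
  define K where "K = L * A * wt sz 1 zero_vec"
  have w1: "1 \<le> wt sz 1 zero_vec" by (rule erg.w_ge1[OF k erg.x0])
  have K: "K > 0" using L A w1 by (simp add: K_def)
  \<comment> \<open>Solves the error recursion: the new error \<open>K * \<rho>\<close> together
    with the damped earlier ones \<open>B * \<rho>\<close> must not exceed \<open>B\<close>.\<close>
  define B where "B = K / (1 - \<rho>)"
  have B: "B > 0" "K * \<rho> + B * \<rho> \<le> B"
  proof -
    show "B > 0" using K A(3) by (simp add: B_def)
    have "K * \<rho> \<le> K" using K A(3) by simp
    also have "K = B * (1 - \<rho>)" using A(3) by (simp add: B_def)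
    finally show "K * \<rho> + B * \<rho> \<le> B" by (simp add: algebra_simps)
  qed
  \<comment> \<open>Constants have the same stationary value at all parameters, so the function may
    be centred at \<open>zero_vec\<close>; the coupling estimate then supplies the factor
    \<open>\<rho> ^ length us\<close>.\<close>
  have lip: "\<bar>erg.stat v (iter us g) - erg.stat u (iter us g)\<bar> \<le> K * c * \<rho> ^ length us * \<bar>v - u\<bar>"
    if u: "u \<in> {0..1}" and v: "v \<in> {0..1}" and us: "set us \<subseteq> {0..1}" and c: "0 \<le> c" and g: "g \<in> Wp 1 c" for u v us c g
  proof -
    let ?h = "iter us g"
    obtain d where h: "?h \<in> Wp 0 d" using erg.iter_wball_0[OF k g us] by blast
    have e: "erg.stat s (\<lambda>y. ?h y - ?h zero_vec) = erg.stat s ?h - ?h zero_vec" if s: "s \<in> {0..1}" for s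
      using wfunctional_diff[OF fcontD(1)[OF erg.stat_fcont s] h erg.const_wball[OF le0, of "?h zero_vec"]] erg.stat_const[OF s] by simp
    have "0 \<le> A * c * \<rho> ^ length us * wt sz 1 zero_vec" using A c w1 by simp
    from L(2)[OF u v this A(4)[OF us c g erg.x0]] show ?thesis by (simp add: e[OF u] e[OF v] K_def mult_ac)
  qed
  \<comment> \<open>\<open>us\<close> lists the transitions still to come and is arbitrary in the
    induction: the step moves the latest kernel from the law to the front of the list. The result is
    wanted for the empty list.\<close>
  have main: "\<bar>(\<integral>x. iter us g x \<partial>\<nu> t) - erg.stat (real t / real n) (iter us g)\<bar> \<le> B * c * \<rho> ^ length us / real n"
    if n: "1 \<le> n" and ch: "chain_laws n \<nu>" and c: "0 \<le> c" and g: "g \<in> Wp 1 c" and t: "t \<le> n" and us: "set us \<subseteq> {0..1}"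
    for n \<nu> c g t us
    using t us
  proof (induction t arbitrary: us)
    case 0
    have z: "(0::real) \<in> {0..1}" by simp
    obtain d where h: "iter us g \<in> Wp 0 d" using erg.iter_wball_0[OF k g 0(2)] by blast
    have "\<nu> 0 = inv_law (Rp p) (Q 0)" using ch by (simp add: chain_laws_def)
    then have "(\<integral>x. iter us g x \<partial>\<nu> 0) = erg.stat 0 (iter us g)"
      using inv_law_integral[OF z h] by simp
    then show ?case using B(1) c A by simp
  next
    case (Suc t)
    let ?v = "real (Suc t) / real n" and ?u = "real t / real n" and ?h = "iter us g"
    have v: "?v \<in> {0..1}" and u: "?u \<in> {0..1}" using Suc.prems(1) by (intro unit_frac[OF n]; simp)+
    have st: "st.step_law ?v (\<nu> t) (\<nu> (Suc t))" using ch Suc.prems by (simp add: chain_laws_def)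
    have int: "integrable (\<nu> t) (wt sz 0)" using chain_laws_integral[OF n ch, of t] Suc.prems by simp
    obtain d where h: "?h \<in> Wp 0 d" using erg.iter_wball_0[OF k g Suc.prems(2)] by blast
    have vus: "set (?v # us) \<subseteq> {0..1}" using v Suc.prems(2) by simp
    have Ph: "P 0 ?v ?h = iter (?v # us) g" by simp
    have i: "(\<integral>x. ?h x \<partial>\<nu> (Suc t)) = (\<integral>x. P 0 ?v ?h x \<partial>\<nu> t)" by (rule st.step_law_integral[OF v st int h])
    have s: "erg.stat ?v ?h = erg.stat ?v (P 0 ?v ?h)" by (rule erg.stat_invariant[OF v h, symmetric])
    have "\<bar>?v - ?u\<bar> = 1 / real n" using n by (simp add: field_simps)
    then have 1: "\<bar>erg.stat ?v (P 0 ?v ?h) - erg.stat ?u (P 0 ?v ?h)\<bar> \<le> K * c * \<rho> ^ Suc (length us) * (1 / real n)"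
      using lip[OF u v vus c g] unfolding Ph by simp
    have 2: "\<bar>(\<integral>x. P 0 ?v ?h x \<partial>\<nu> t) - erg.stat ?u (P 0 ?v ?h)\<bar> \<le> B * c * \<rho> ^ Suc (length us) / real n"
      using Suc.IH[OF _ vus] Suc.prems(1) unfolding Ph by simp
    have "\<bar>(\<integral>x. ?h x \<partial>\<nu> (Suc t)) - erg.stat ?v ?h\<bar> \<le> (K * c * \<rho> ^ Suc (length us) + B * c * \<rho> ^ Suc (length us)) / real n"
      using 1 2 unfolding i s by (simp add: add_divide_distrib)
    also have "\<dots> = (K * \<rho> + B * \<rho>) * (c * \<rho> ^ length us / real n)" by (simp add: algebra_simps add_divide_distrib)
    also have "\<dots> \<le> B * (c * \<rho> ^ length us / real n)" by (rule mult_right_mono[OF B(2)]) (use c A in simp)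
    finally show ?case by simp
  qed
  show ?thesis
  proof (rule that[of "B + L"])
    show "B + L > 0" using B L by simp
    fix n \<nu> t and u c :: real and g :: "(nat \<Rightarrow> real) \<Rightarrow> real"
    assume *: "1 \<le> n" "chain_laws n \<nu>" "t \<le> n" "u \<in> {0..1}" "0 \<le> (c::real)" "g \<in> Wp 1 c"
    have tn: "real t / real n \<in> {0..1}" by (rule unit_frac[OF *(1,3)])
    have 1: "\<bar>(\<integral>x. g x \<partial>\<nu> t) - erg.stat (real t / real n) g\<bar> \<le> B * c / real n"
      using main[OF *(1,2,5,6,3), of "[]"] by simp
    have 2: "\<bar>erg.stat (real t / real n) g - erg.stat u g\<bar> \<le> L * c * \<bar>u - real t / real n\<bar>"
      using L(2)[OF *(4) tn *(5,6)] by (simp add: abs_minus_commute)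
    have "0 \<le> B * c * \<bar>u - real t / real n\<bar>" "0 \<le> L * c / real n" using B L *(5) by simp_all
    then show "\<bar>(\<integral>x. g x \<partial>\<nu> t) - erg.stat u g\<bar> \<le> (B + L) * c * (\<bar>u - real t / real n\<bar> + 1 / real n)"
      using 1 2 by (simp add: algebra_simps)
  qed
qed

text \<open>\<open>\<theta> j\<close> stands for the law of the \<open>j + 1\<close> states from
  time \<open>t\<close> on, so its extension uses the parameter of time
  \<open>t + j + 1\<close>.\<close>

definition block_laws :: "nat \<Rightarrow> nat \<Rightarrow> (nat \<Rightarrow> real) measure \<Rightarrow> (nat \<Rightarrow> (nat \<Rightarrow> nat \<Rightarrow> real) measure) \<Rightarrow> bool" where
  "block_laws n t \<mu> \<theta> \<longleftrightarrow> \<theta> 0 = distr \<mu> (Rpj p 1) emb \<and>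
     (\<forall>j. t + Suc j \<le> n \<longrightarrow> bl.step_law j (real (t + Suc j) / real n) (\<theta> j) (\<theta> (Suc j)))"

lemma emb_wball:
  assumes g: "g \<in> wball (Rpj p 1) (wt (szj 1) l) c"
  shows "(\<lambda>x. g (emb x)) \<in> Wp l c"
proof (rule wballI)
  show "(\<lambda>x. g (emb x)) \<in> borel_measurable (Rp p)"
    by (rule measurable_compose[OF emb_measurable wballD(1)[OF g]])
  fix x assume x: "x \<in> space (Rp p)"
  have "wt (szj 1) l (emb x) = wt sz l x" by (simp add: wt_def szj_def emb_def)
  then show "\<bar>g (emb x)\<bar> \<le> c * wt sz l x" using wballD(2)[OF g measurable_space[OF emb_measurable x]] by simp
qed

lemma szj_wball: "wt (szj (Suc j)) 0 \<in> Wb j 0 1"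
  using szj_measurable[of "Suc j"] by (intro wballI) (auto simp: wt_def[abs_def])

text \<open>Induction on the block length. The new kernel has its own parameter instead of
  \<open>u\<close>; exchanging it produces an error of weight 0 for test functions of weight 1, so a
  moment bound uniform in \<open>n\<close> and \<open>t\<close> is carried along in the
  induction.\<close>

lemma block_laws_stat:
  "\<exists>C>0. \<forall>n \<nu> t \<theta>. 1 \<le> n \<longrightarrow> chain_laws n \<nu> \<longrightarrow> block_laws n t (\<nu> t) \<theta> \<longrightarrow> t + j \<le> n \<longrightarrow>
     sets (\<theta> j) = sets (Rpj p (Suc j)) \<and> integrable (\<theta> j) (wt (szj (Suc j)) 0) \<and> (\<integral>z. wt (szj (Suc j)) 0 z \<partial>\<theta> j) \<le> C \<and>
     (\<forall>u c g. u \<in> {0..1} \<longrightarrow> 0 \<le> c \<longrightarrow> g \<in> Wb j 1 c \<longrightarrow>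
        \<bar>(\<integral>z. g z \<partial>\<theta> j) - blk j 0 u g\<bar> \<le> C * c * (\<bar>u - real t / real n\<bar> + 1 / real n))"
proof (induction j)
  case 0
  obtain A where A: "A > 0" "\<And>n \<nu> t. 1 \<le> n \<Longrightarrow> chain_laws n \<nu> \<Longrightarrow> t \<le> n \<Longrightarrow> (\<integral>x. wt sz 0 x \<partial>\<nu> t) \<le> A"
    by (rule chain_laws_moment) (rule that)
  obtain B where B: "B > 0" "\<And>n \<nu> t u c g. 1 \<le> n \<Longrightarrow> chain_laws n \<nu> \<Longrightarrow> t \<le> n \<Longrightarrow> u \<in> {0..1} \<Longrightarrow> 0 \<le> c \<Longrightarrow>
     g \<in> Wp 1 c \<Longrightarrow>
     \<bar>(\<integral>x. g x \<partial>\<nu> t) - erg.stat u g\<bar> \<le> B * c * (\<bar>u - real t / real n\<bar> + 1 / real n)"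
    by (rule chain_laws_stat) (rule that)
  show ?case
    unfolding One_nat_def[symmetric]
  proof (intro exI[of _ "A + B"] conjI allI impI)
    show "0 < A + B" using A B by simp
    fix n t and \<nu> :: "nat \<Rightarrow> (nat \<Rightarrow> real) measure" and \<theta> :: "nat \<Rightarrow> (nat \<Rightarrow> nat \<Rightarrow> real) measure"
    assume n: "1 \<le> n" and ch: "chain_laws n \<nu>" and bl: "block_laws n t (\<nu> t) \<theta>" and t: "t + 0 \<le> n"
    have t': "t \<le> n" using t by simp
    have s: "sets (\<nu> t) = sets (Rp p)" and int: "integrable (\<nu> t) (wt sz 0)" using chain_laws_integral[OF n ch t'] by blast+
    have em: "emb \<in> measurable (\<nu> t) (Rpj p 1)"
      using emb_measurable measurable_cong_sets[OF s refl] by blast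
    have \<theta>0: "\<theta> 0 = distr (\<nu> t) (Rpj p 1) emb" using bl by (simp add: block_laws_def)
    have w: "(\<lambda>x. wt (szj 1) 0 (emb x)) = wt sz 0" by (simp add: fun_eq_iff wt_def szj_def emb_def)
    have wm: "wt (szj 1) 0 \<in> borel_measurable (Rpj p 1)"
      using wballD(1)[OF szj_wball[of 0]] by simp
    show "sets (\<theta> 0) = sets (Rpj p 1)" by (simp add: \<theta>0)
    show "integrable (\<theta> 0) (wt (szj 1) 0)" using integrable_distr_eq[OF em wm] int unfolding \<theta>0 w by simp
    have "(\<integral>z. wt (szj 1) 0 z \<partial>\<theta> 0) = (\<integral>x. wt sz 0 x \<partial>\<nu> t)" unfolding \<theta>0 using integral_distr[OF em wm] w by simp
    then show "(\<integral>z. wt (szj 1) 0 z \<partial>\<theta> 0) \<le> A + B" using A(2)[OF n ch t'] B(1) by simp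
    fix u c :: real and g
    assume u: "u \<in> {0..1}" and c: "0 \<le> c" and g: "g \<in> wball (Rpj p 1) (wt (szj 1) 1) c"
    have "(\<integral>z. g z \<partial>\<theta> 0) = (\<integral>x. g (emb x) \<partial>\<nu> t)" unfolding \<theta>0 by (rule integral_distr[OF em wballD(1)[OF g]])
    then have "\<bar>(\<integral>z. g z \<partial>\<theta> 0) - blk 0 0 u g\<bar> \<le> B * c * (\<bar>u - real t / real n\<bar> + 1 / real n)"
      using B(2)[OF n ch t' u c emb_wball[OF g]] by simp
    also have "\<dots> \<le> (A + B) * c * (\<bar>u - real t / real n\<bar> + 1 / real n)"
      using A(1) c by (intro mult_right_mono) auto
    finally show "\<bar>(\<integral>z. g z \<partial>\<theta> 0) - blk 0 0 u g\<bar> \<le> (A + B) * c * (\<bar>u - real t / real n\<bar> + 1 / real n)" .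
  qed
next
  case (Suc j)
  then obtain C where C: "C > 0" and IH: "\<And>n \<nu> t \<theta>. 1 \<le> n \<Longrightarrow> chain_laws n \<nu> \<Longrightarrow> block_laws n t (\<nu> t) \<theta> \<Longrightarrow> t + j \<le> n \<Longrightarrow>
     sets (\<theta> j) = sets (Rpj p (Suc j)) \<and> integrable (\<theta> j) (wt (szj (Suc j)) 0) \<and> (\<integral>z. wt (szj (Suc j)) 0 z \<partial>\<theta> j) \<le> C \<and>
     (\<forall>u c g. u \<in> {0..1} \<longrightarrow> 0 \<le> c \<longrightarrow> g \<in> Wb j 1 c \<longrightarrow>
        \<bar>(\<integral>z. g z \<partial>\<theta> j) - blk j 0 u g\<bar> \<le> C * c * (\<bar>u - real t / real n\<bar> + 1 / real n))"
    by blast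
  define K where "K = bl.Kc * cPhi"
  have K: "K > 0" using bl.Kc(1) st.cPhi_pos by (simp add: K_def)
  \<comment> \<open>The first summand is the induction hypothesis applied to \<open>Top\<close> of
    the test function, the second the cost of exchanging the parameter of the new kernel.\<close>
  define B where "B = C * K + real (j + 2) * K * C"
  have B: "B > 0" using C K by (simp add: B_def add_pos_pos)
  show ?case
  proof (intro exI[of _ "K * C + B"] conjI allI impI)
    show "0 < K * C + B" using C K B by (simp add: add_pos_pos)
    fix n t and \<nu> :: "nat \<Rightarrow> (nat \<Rightarrow> real) measure" and \<theta> :: "nat \<Rightarrow> (nat \<Rightarrow> nat \<Rightarrow> real) measure"
    assume n: "1 \<le> n" and ch: "chain_laws n \<nu>" and bl: "block_laws n t (\<nu> t) \<theta>" and t: "t + Suc j \<le> n"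
    let ?v = "real (t + Suc j) / real n"
    have t': "t + j \<le> n" using t by simp
    have s: "sets (\<theta> j) = sets (Rpj p (Suc j))" and int: "integrable (\<theta> j) (wt (szj (Suc j)) 0)"
      and mom: "(\<integral>z. wt (szj (Suc j)) 0 z \<partial>\<theta> j) \<le> C" and
      approx: "\<And>u c g. u \<in> {0..1} \<Longrightarrow> 0 \<le> c \<Longrightarrow> g \<in> Wb j 1 c \<Longrightarrow>
        \<bar>(\<integral>z. g z \<partial>\<theta> j) - blk j 0 u g\<bar> \<le> C * c * (\<bar>u - real t / real n\<bar> + 1 / real n)" using IH[OF n ch bl t'] by blast+
    have v: "?v \<in> {0..1}" by (rule unit_frac[OF n t])
    have st: "bl.step_law j ?v (\<theta> j) (\<theta> (Suc j))" using bl t unfolding block_laws_def by blast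
    have bd: "(\<integral>z. h z \<partial>\<theta> j) \<le> d * C" "- (d * C) \<le> (\<integral>z. h z \<partial>\<theta> j)" if h: "h \<in> Wb j 0 d" and d: "0 \<le> d" for h d
    proof -
      have hi: "integrable (\<theta> j) h" by (rule wball_integrable[OF int s h])
      have "\<bar>\<integral>z. h z \<partial>\<theta> j\<bar> \<le> (\<integral>z. \<bar>h z\<bar> \<partial>\<theta> j)" by (rule integral_abs_bound)
      also have "\<dots> \<le> (\<integral>z. d * wt (szj (Suc j)) 0 z \<partial>\<theta> j)"
        by (rule integral_mono) (use hi int wballD(2)[OF h] sets_eq_imp_space_eq[OF s] in auto)
      also have "\<dots> \<le> d * C" using mult_left_mono[OF mom d] by simp
      finally show "(\<integral>z. h z \<partial>\<theta> j) \<le> d * C" "- (d * C) \<le> (\<integral>z. h z \<partial>\<theta> j)" by simp_all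
    qed
    show "sets (\<theta> (Suc j)) = sets (Rpj p (Suc (Suc j)))" using st unfolding bl.step_law_def by blast
    show "integrable (\<theta> (Suc j)) (wt (szj (Suc (Suc j))) 0)" by (rule bl.step_law_moment[OF v st int])
    have T0: "bl.Top j 0 w g \<in> Wb j 0 (K * d)"
      if "g \<in> Wb (Suc j) 0 d" "0 \<le> d" "w \<in> {0..1}" for w g d
      unfolding K_def by (rule bl.Top_bound[where l = 0 and i = 0]) (use that in auto)
    have "(\<integral>z. wt (szj (Suc (Suc j))) 0 z \<partial>\<theta> (Suc j)) = (\<integral>z. bl.Top j 0 ?v (wt (szj (Suc (Suc j))) 0) z \<partial>\<theta> j)"
      by (rule bl.step_law_integral[OF v st int szj_wball])
    also have "\<dots> \<le> K * 1 * C" by (rule bd(1)[OF T0[OF szj_wball _ v]]) (use K in auto)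
    finally show "(\<integral>z. wt (szj (Suc (Suc j))) 0 z \<partial>\<theta> (Suc j)) \<le> K * C + B" using B by simp
    fix u c :: real and g
    assume u: "u \<in> {0..1}" and c: "0 \<le> c" and g: "g \<in> Wb (Suc j) 1 c"
    define e where "e = \<bar>u - real t / real n\<bar> + 1 / real n"
    have e: "0 \<le> e" by (simp add: e_def)
    have g1: "g \<in> Wb (Suc j) (Suc (0 + 0)) c" using g by simp
    have g0: "g \<in> Wb (Suc j) 0 c"
      by (rule weight_scale_wball[OF bl.weight_scale_B _ _ c g]) (use k in auto)
    have D: "(\<lambda>z. bl.Top j 0 ?v g z - bl.Top j 0 u g z) \<in> Wb j 0 (K * c * \<bar>?v - u\<bar>)"
      unfolding K_def by (rule bl.Top_lipschitz[OF g1 c u v]) (use k in simp)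
    have T1: "bl.Top j 0 u g \<in> Wb j 1 (K * c)"
      unfolding K_def by (rule bl.Top_bound[where l = 1 and i = 0]) (use g c u k in auto)
    have "real (Suc j) / real n \<le> real (Suc j) * e"
    proof -
      have "1 / real n \<le> e" by (simp add: e_def)
      from mult_left_mono[OF this, of "real (Suc j)"] show ?thesis by simp
    qed
    moreover have "?v = real t / real n + real (Suc j) / real n" by (simp add: add_divide_distrib)
    moreover have "\<bar>u - real t / real n\<bar> \<le> e" by (simp add: e_def)
    moreover have "0 \<le> real (Suc j) / real n" by simp
    \<comment> \<open>The parameter of the new step exceeds \<open>t / n\<close> by
      \<open>(j + 1) / n\<close>, which is at most \<open>j + 1\<close> times
      \<open>e\<close>.\<close>
    ultimately have "\<bar>?v - u\<bar> \<le> e + real (Suc j) * e" unfolding abs_le_iff by linarith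
    then have "\<bar>?v - u\<bar> \<le> real (j + 2) * e" by (simp add: algebra_simps)
    then have dv: "K * c * \<bar>?v - u\<bar> * C \<le> K * c * (real (j + 2) * e) * C"
      using K C c by (intro mult_right_mono mult_left_mono) auto
    have "(\<integral>z. g z \<partial>\<theta> (Suc j)) = (\<integral>z. bl.Top j 0 ?v g z \<partial>\<theta> j)" by (rule bl.step_law_integral[OF v st int g0])
    moreover have "(\<integral>z. bl.Top j 0 ?v g z - bl.Top j 0 u g z \<partial>\<theta> j) = (\<integral>z. bl.Top j 0 ?v g z \<partial>\<theta> j) - (\<integral>z. bl.Top j 0 u g z \<partial>\<theta> j)"
      by (rule Bochner_Integration.integral_diff; rule wball_integrable[OF int s T0[OF g0 c]]) (use u v in auto)
    moreover have "\<bar>\<integral>z. bl.Top j 0 ?v g z - bl.Top j 0 u g z \<partial>\<theta> j\<bar> \<le> K * c * \<bar>?v - u\<bar> * C"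
      using bd[OF D] K c by simp
    moreover have "\<bar>(\<integral>z. bl.Top j 0 u g z \<partial>\<theta> j) - blk j 0 u (bl.Top j 0 u g)\<bar> \<le> C * (K * c) * e"
      unfolding e_def by (rule approx[OF u _ T1]) (use K c in simp)
    moreover have "blk (Suc j) 0 u g = blk j 0 u (bl.Top j 0 u g)" by simp
    ultimately have "\<bar>(\<integral>z. g z \<partial>\<theta> (Suc j)) - blk (Suc j) 0 u g\<bar> \<le> C * (K * c) * e + K * c * (real (j + 2) * e) * C"
      using dv by linarith
    also have "\<dots> = B * c * e" by (simp add: B_def algebra_simps)
    also have "\<dots> \<le> (K * C + B) * c * e" using K C c e by (intro mult_right_mono) auto
    finally show "\<bar>(\<integral>z. g z \<partial>\<theta> (Suc j)) - blk (Suc j) 0 u g\<bar> \<le> (K * C + B) * c * (\<bar>u - real t / real n\<bar> + 1 / real n)"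
      by (simp add: e_def)
  qed
qed

end

section \<open>Laws of the process\<close>

context ar_lift
begin

text \<open>\<open>X\<close> is a function of the past and hence independent of the new noise, so
  their joint law is a product. Substituting \<open>y\<close> for the affine image of the noise
  turns \<open>f\<close> into the transition density.\<close>

lemma step_law_process:
  fixes M :: "'w measure"
  assumes M: "prob_space M" and u: "u \<in> {0..1}" and N: "space N = space M" "sets N \<subseteq> sets M"
    and X: "X \<in> measurable N MA" and e: "distributed M lborel e (\<lambda>y. ennreal (f y))"
    and ind: "prob_space.indep_set M (sets (vimage_algebra (space M) e borel)) (sets N)"
    and Z: "\<And>\<omega>. \<omega> \<in> space M \<Longrightarrow> Z \<omega> = \<psi> (X \<omega>) (m u (rev_vec p (\<pi> (X \<omega>))) + \<sigma> u * e \<omega>)"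
  shows "step_law u (distr M MA X) (distr M MB Z)"
proof -
  interpret prob_space M by (rule M)
  have XM: "X \<in> measurable M MA" using X N by (auto simp: measurable_def)
  have eM: "e \<in> borel_measurable M" using distributed_measurable[OF e] by simp
  have fm: "f \<in> borel_measurable borel" by (rule f_measurable)
  have \<sigma>: "0 < \<sigma> u" by (rule \<sigma>_pos[OF u])
  interpret E: prob_space "distr M borel e" by (rule prob_space_distr[OF eM])
  interpret X: prob_space "distr M MA X" by (rule prob_space_distr[OF XM])
  have XE: "(\<lambda>\<omega>. (X \<omega>, e \<omega>)) \<in> measurable M (MA \<Otimes>\<^sub>M borel)" using XM eM by measurable
  have J: "distr M MA X \<Otimes>\<^sub>M distr M borel e = distr M (MA \<Otimes>\<^sub>M borel) (\<lambda>\<omega>. (X \<omega>, e \<omega>))"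
  proof (rule pair_measure_eqI)
    show "sets (distr M MA X \<Otimes>\<^sub>M distr M borel e) = sets (distr M (MA \<Otimes>\<^sub>M borel) (\<lambda>\<omega>. (X \<omega>, e \<omega>)))"
      by (simp cong: sets_pair_measure_cong)
    fix A B assume "A \<in> sets (distr M MA X)" "B \<in> sets (distr M borel e)"
    then have AB: "A \<in> sets MA" "B \<in> sets borel" by auto
    have eB: "e -` B \<inter> space M \<in> sets (vimage_algebra (space M) e borel)" by (rule in_vimage_algebra[OF AB(2)])
    have XA: "X -` A \<inter> space M \<in> sets N" using measurable_sets[OF X AB(1)] N(1) by simp
    have vim: "(\<lambda>\<omega>. (X \<omega>, e \<omega>)) -` (A \<times> B) \<inter> space M = (e -` B \<inter> space M) \<inter> (X -` A \<inter> space M)" by auto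
    show "emeasure (distr M MA X) A * emeasure (distr M borel e) B = emeasure (distr M (MA \<Otimes>\<^sub>M borel) (\<lambda>\<omega>. (X \<omega>, e \<omega>))) (A \<times> B)"
      unfolding emeasure_distr[OF XM AB(1)] emeasure_distr[OF eM AB(2)] emeasure_distr[OF XE pair_measureI[OF AB]] vim
      by (simp add: emeasure_eq_measure indep_setD[OF ind eB XA] ennreal_mult'' mult.commute)
  qed unfold_locales
  have de: "distr M borel e = density lborel (\<lambda>y. ennreal (f y))"
    using distributed_distr_eq_density[OF e] by (simp cong: distr_cong)
  let ?Y = "\<lambda>a z. m u (rev_vec p (\<pi> a)) + \<sigma> u * z"
  have mX: "(\<lambda>a. m u (rev_vec p (\<pi> a))) \<in> borel_measurable MA"
    using measurable_compose[OF \<pi>_meas mm_measurable[OF le0 u]] by (simp add: mm_0)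
  have "(\<lambda>w. (fst w, ?Y (fst w) (snd w))) \<in> measurable (MA \<Otimes>\<^sub>M borel) (MA \<Otimes>\<^sub>M borel)"
    using measurable_compose[OF measurable_fst mX] by measurable
  from measurable_compose[OF this \<psi>_meas]
  have \<psi>Y: "(\<lambda>w. \<psi> (fst w) (?Y (fst w) (snd w))) \<in> measurable (MA \<Otimes>\<^sub>M borel) MB" by simp
  have "(\<lambda>\<omega>. \<psi> (X \<omega>) (?Y (X \<omega>) (e \<omega>))) \<in> measurable M MB" using measurable_compose[OF XE \<psi>Y] by simp
  then have ZM: "Z \<in> measurable M MB" by (subst measurable_cong[OF Z])
  show ?thesis
    unfolding step_law_def
  proof (intro conjI ballI)
    fix G :: "'b \<Rightarrow> ennreal" assume G: "G \<in> borel_measurable MB"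
    note GY = measurable_compose[OF \<psi>Y G]
    have "(\<integral>\<^sup>+b. G b \<partial>distr M MB Z) = (\<integral>\<^sup>+\<omega>. G (Z \<omega>) \<partial>M)" by (rule nn_integral_distr[OF ZM]) (use G in simp)
    also have "\<dots> = (\<integral>\<^sup>+\<omega>. G (\<psi> (X \<omega>) (?Y (X \<omega>) (e \<omega>))) \<partial>M)" by (rule nn_integral_cong) (simp add: Z)
    also have "\<dots> = (\<integral>\<^sup>+w. G (\<psi> (fst w) (?Y (fst w) (snd w))) \<partial>distr M (MA \<Otimes>\<^sub>M borel) (\<lambda>\<omega>. (X \<omega>, e \<omega>)))"
      by (subst nn_integral_distr[OF XE]) (use GY in simp_all)
    also have "\<dots> = (\<integral>\<^sup>+a. \<integral>\<^sup>+z. G (\<psi> a (?Y a z)) \<partial>distr M borel e \<partial>distr M MA X)"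
    proof -
      have "(\<lambda>w. G (\<psi> (fst w) (?Y (fst w) (snd w)))) \<in> borel_measurable (distr M MA X \<Otimes>\<^sub>M distr M borel e)"
        using GY by (simp cong: measurable_cong_sets)
      from E.nn_integral_fst[OF this] show ?thesis unfolding J by simp
    qed
    also have "\<dots> = (\<integral>\<^sup>+a. \<integral>\<^sup>+y. G (\<psi> a y) * ennreal (rho 0 (\<pi> a) y u) \<partial>lborel \<partial>distr M MA X)"
    proof (rule nn_integral_cong)
      fix a assume "a \<in> space (distr M MA X)"
      then have a: "a \<in> space MA" by simp
      note [measurable] = measurable_compose[OF \<psi>_meas1[OF a] G] fm
      let ?c = "m u (rev_vec p (\<pi> a))"
      have "(\<integral>\<^sup>+z. G (\<psi> a (?Y a z)) \<partial>distr M borel e) = (\<integral>\<^sup>+z. ennreal (f z) * G (\<psi> a (?Y a z)) \<partial>lborel)"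
        unfolding de by (rule nn_integral_density) measurable
      also have "\<dots> = \<bar>1 / \<sigma> u\<bar> * (\<integral>\<^sup>+y. ennreal (f (- ?c / \<sigma> u + 1 / \<sigma> u * y)) * G (\<psi> a (?Y a (- ?c / \<sigma> u + 1 / \<sigma> u * y))) \<partial>lborel)"
        by (rule nn_integral_real_affine) (use \<sigma> in auto)
      also have "\<dots> = (\<integral>\<^sup>+y. ennreal (1 / \<sigma> u) * (ennreal (f (- ?c / \<sigma> u + 1 / \<sigma> u * y)) * G (\<psi> a (?Y a (- ?c / \<sigma> u + 1 / \<sigma> u * y)))) \<partial>lborel)"
        using \<sigma> by (simp add: nn_integral_cmult)
      also have "\<dots> = (\<integral>\<^sup>+y. G (\<psi> a y) * ennreal (rho 0 (\<pi> a) y u) \<partial>lborel)"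
      proof (rule nn_integral_cong)
        fix y
        have 1: "?Y a (- ?c / \<sigma> u + 1 / \<sigma> u * y) = y" using \<sigma> by (simp add: field_simps)
        have 2: "- ?c / \<sigma> u + 1 / \<sigma> u * y = (y - ?c) / \<sigma> u" by (simp add: diff_divide_distrib)
        have "rho 0 (\<pi> a) y u = 1 / \<sigma> u * f ((y - ?c) / \<sigma> u)" by (simp add: rho_0)
        then have "ennreal (rho 0 (\<pi> a) y u) = ennreal (1 / \<sigma> u) * ennreal (f ((y - ?c) / \<sigma> u))"
          using \<sigma> by (simp add: ennreal_mult'[symmetric])
        then show "ennreal (1 / \<sigma> u) * (ennreal (f (- ?c / \<sigma> u + 1 / \<sigma> u * y)) * G (\<psi> a (?Y a (- ?c / \<sigma> u + 1 / \<sigma> u * y)))) =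
            G (\<psi> a y) * ennreal (rho 0 (\<pi> a) y u)"
          unfolding 1 unfolding 2 by (simp add: mult_ac)
      qed
      finally show "(\<integral>\<^sup>+z. G (\<psi> a (?Y a z)) \<partial>distr M borel e) = (\<integral>\<^sup>+y. G (\<psi> a y) * ennreal (rho 0 (\<pi> a) y u) \<partial>lborel)" .
    qed
    finally show "(\<integral>\<^sup>+b. G b \<partial>distr M MB Z) = (\<integral>\<^sup>+a. \<integral>\<^sup>+y. G (\<psi> a y) * ennreal (rho 0 (\<pi> a) y u) \<partial>lborel \<partial>distr M MA X)" .
  qed simp_all
qed

end

section \<open>States, blocks and the past of the process\<close>

lemma state_shift:
  assumes "1 \<le> p" shows "state p Y t \<omega> = shift p (state p Y (t - 1) \<omega>) (Y t \<omega>)"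
proof
  fix i
  show "state p Y t \<omega> i = shift p (state p Y (t - 1) \<omega>) (Y t \<omega>) i"
  proof (cases "i \<in> {1..p} \<and> i \<noteq> p")
    case True
    then have "i + 1 \<in> {1..p}" by auto
    then show ?thesis using True by (simp add: state_def shift_def algebra_simps)
  qed (auto simp: state_def shift_def)
qed

lemma rev_vec_state: "rev_vec p (state p Y (t - 1) \<omega>) = (\<lambda>i\<in>{1..p}. Y (t - int i) \<omega>)"
  by (auto simp: rev_vec_def state_def fun_eq_iff of_nat_diff intro!: arg_cong[of _ _ "\<lambda>s. Y s \<omega>"])

lemma space_past_algebra [simp]: "space (past_algebra M Y t) = space M"
  by (simp add: past_algebra_def)

lemma past_algebra_measurable: "s < t \<Longrightarrow> Y s \<in> borel_measurable (past_algebra M Y t)"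
proof -
  assume s: "s < t"
  have "past_path Y t \<in> measurable (past_algebra M Y t) (\<Pi>\<^sub>M s\<in>{..<t}. borel)"
    unfolding past_algebra_def by (rule measurable_vimage_algebra1) (simp add: past_path_def space_PiM)
  from measurable_compose[OF this measurable_component_singleton, of s] s
  show ?thesis by (simp add: past_path_def)
qed

lemma sets_past_algebra:
  assumes "\<And>s. s < t \<Longrightarrow> Y s \<in> borel_measurable M"
  shows "sets (past_algebra M Y t) \<subseteq> sets M"
proof -
  have "past_path Y t \<in> measurable M (\<Pi>\<^sub>M s\<in>{..<t}. borel)"
    unfolding past_path_def[abs_def] by (rule measurable_restrict) (use assms in auto)
  from measurable_sets[OF this] show ?thesis unfolding past_algebra_def by (intro sets_image_in_sets') auto
qed

lemma state_measurable:
  assumes "\<And>s. s \<le> t \<Longrightarrow> Y s \<in> borel_measurable M"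
  shows "state p Y t \<in> measurable M (Rp p)"
  unfolding state_def[abs_def] by (rule measurable_restrict) (use assms in auto)

definition block :: "nat \<Rightarrow> (int \<Rightarrow> 'w \<Rightarrow> real) \<Rightarrow> int \<Rightarrow> nat \<Rightarrow> 'w \<Rightarrow> nat \<Rightarrow> nat \<Rightarrow> real" where
  "block p Y t j \<omega> = (\<lambda>i\<in>{1..j}. state p Y (t + int i - 1) \<omega>)"

lemma block_measurable:
  assumes "\<And>s. s < t + int j \<Longrightarrow> Y s \<in> borel_measurable M"
  shows "block p Y t j \<in> measurable M (Rpj p j)"
  unfolding block_def[abs_def]
proof (rule measurable_restrict)
  fix i assume "i \<in> {1..j}"
  then show "state p Y (t + int i - 1) \<in> measurable M (Rp p)" by (intro state_measurable assms) auto
qed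

lemma block_1: "block p Y t (Suc 0) \<omega> = emb (state p Y t \<omega>)"
  by (auto simp: block_def emb_def fun_eq_iff)

lemma block_Suc:
  assumes "1 \<le> p"
  shows "block p Y t (Suc (Suc j)) \<omega> = snoc p (Suc j) (block p Y t (Suc j) \<omega>) (Y (t + int (Suc j)) \<omega>)"
proof -
  have "block p Y t (Suc j) \<omega> (Suc j) = state p Y (t + int (Suc j) - 1) \<omega>" by (simp add: block_def)
  then have "snoc p (Suc j) (block p Y t (Suc j) \<omega>) (Y (t + int (Suc j)) \<omega>) =
      (block p Y t (Suc j) \<omega>)(Suc (Suc j) := state p Y (t + int (Suc j)) \<omega>)"
    unfolding snoc_def using state_shift[OF assms, of Y "t + int (Suc j)" \<omega>] by simp
  also have "\<dots> = block p Y t (Suc (Suc j)) \<omega>"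
    by (auto simp: block_def fun_eq_iff le_Suc_eq algebra_simps)
  finally show ?thesis by simp
qed

context ar_kernel
begin

text \<open>Stationarity gives the states at times -1 and 0 the same law, and the Markov property at
  time 0 exhibits the second law as the first followed by \<open>Q 0\<close>. The common law is
  therefore invariant, and uniqueness identifies it.\<close>

lemma initial_law:
  fixes M :: "'w measure" and Y :: "int \<Rightarrow> 'w \<Rightarrow> real"
  assumes M: "prob_space M" and Y: "\<And>t. t \<le> 0 \<Longrightarrow> Y t \<in> borel_measurable M"
    and stat: "stationary_upto_0 M Y" and markov: "markov_upto_0 M p (R 0) Y"
  shows "distr M (Rp p) (state p Y 0) = inv_law (Rp p) (Q 0)"
proof (rule inv_law_unique)
  interpret prob_space M by (rule M)
  have z: "(0::real) \<in> {0..1}" by simp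
  then show "0 \<in> {0..1::real}" .
  have X0: "state p Y 0 \<in> measurable M (Rp p)" and X1: "state p Y (- 1) \<in> measurable M (Rp p)"
    by (rule state_measurable, rule Y, simp)+
  let ?\<mu> = "distr M (Rp p) (state p Y 0)"
  interpret \<mu>: prob_space ?\<mu> by (rule prob_space_distr[OF X0])
  have same: "distr M (Rp p) (state p Y (- 1)) = ?\<mu>"
  proof -
    let ?S = "\<Pi>\<^sub>M s\<in>{..0::int}. borel :: real measure"
    \<comment> \<open>Both states are read off the path and off its shift by one and the same
      coordinate map, so equality of the path laws transfers to them.\<close>
    define r :: "(int \<Rightarrow> real) \<Rightarrow> nat \<Rightarrow> real" where "r w = (\<lambda>i\<in>{1..p}. w (int i - int p))" for w
    have r: "r \<in> measurable ?S (Rp p)"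
      unfolding r_def[abs_def]
    proof (rule measurable_restrict)
      fix i assume "i \<in> {1..p}"
      then show "(\<lambda>w. w (int i - int p)) \<in> borel_measurable ?S" by (intro measurable_component_singleton) auto
    qed
    have Yh: "(\<lambda>\<omega>. \<lambda>s\<in>{..0}. Y (s - h) \<omega>) \<in> measurable M ?S" if "0 \<le> h" for h
      by (rule measurable_restrict) (use Y that in auto)
    have rY: "r (\<lambda>s\<in>{..0}. Y (s - h) \<omega>) = state p Y (- h) \<omega>" for h \<omega>
      by (auto simp: r_def state_def fun_eq_iff algebra_simps)
    have d: "distr (distr M ?S (\<lambda>\<omega>. \<lambda>s\<in>{..0}. Y (s - h) \<omega>)) (Rp p) r = distr M (Rp p) (state p Y (- h))" if "0 \<le> h" for h
      by (subst distr_distr[OF r Yh[OF that]]) (simp add: comp_def rY)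
    have "distr M ?S (\<lambda>\<omega>. \<lambda>s\<in>{..0}. Y (s - 1) \<omega>) = distr M ?S (\<lambda>\<omega>. \<lambda>s\<in>{..0}. Y (s - 0) \<omega>)"
      using stat unfolding stationary_upto_0_def by simp
    then show ?thesis using d[of 1] d[of 0] by simp
  qed
  have Qm: "Q 0 \<in> measurable ?\<mu> (subprob_algebra (Rp p))" using Q_measurable[OF z] by (simp cong: measurable_cong_sets)
  show "invariant_prob (Rp p) (Q 0) ?\<mu>"
    unfolding invariant_prob_def
  proof (intro conjI)
    show "?\<mu> \<bind> Q 0 = ?\<mu>"
    proof (rule sym, rule measure_eqI_PiM_finite)
      show "sets (?\<mu> \<bind> Q 0) = sets (Rp p)" by (rule sets_bind) (use sets_kernel[OF Qm] \<mu>.not_empty in auto)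
      show "range (\<lambda>_::nat. space (Rp p)) \<subseteq> prod_algebra {1..p} (\<lambda>_. borel)"
        by (auto simp: space_PiM intro!: prod_algebraI_finite)
      show "emeasure ?\<mu> (space (Rp p)) \<noteq> \<infinity>" for i :: nat by (rule \<mu>.emeasure_finite[folded infinity_ennreal_def])
      fix A :: "nat \<Rightarrow> real set" assume A: "\<And>i. i \<in> {1..p} \<Longrightarrow> A i \<in> sets borel"
      have box: "Pi\<^sub>E {1..p} A \<in> sets (Rp p)" by (rule sets_PiM_I_finite) (use A in auto)
      have Ap: "A p \<in> sets borel" using A p by simp
      let ?B = "{\<omega>\<in>space M. \<forall>i\<in>{1..p} - {p}. state p Y (- 1) \<omega> (i + 1) \<in> A i}" and ?C = "{\<omega>\<in>space M. Y 0 \<omega> \<in> A p}"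
      let ?F = "past_algebra M Y 0"
      have subalg: "subalgebra M ?F"
        unfolding subalgebra_def using sets_past_algebra[of 0 Y M] Y by auto
      interpret F: finite_measure_subalgebra M ?F by unfold_locales (rule subalg)
      have B: "?B \<in> sets ?F"
      proof -
        have "{\<omega>\<in>space ?F. \<forall>i\<in>{1..p} - {p}. state p Y (- 1) \<omega> (i + 1) \<in> A i} \<in> sets ?F"
        proof (rule sets.sets_Collect_finite_All)
          fix i assume i: "i \<in> {1..p} - {p}"
          have "state p Y (- 1) \<in> measurable ?F (Rp p)" by (rule state_measurable) (simp add: past_algebra_measurable)
          moreover have "(\<lambda>x. x (i + 1)) \<in> borel_measurable (Rp p)" using i by (intro measurable_component_singleton) auto
          ultimately have "(\<lambda>\<omega>. state p Y (- 1) \<omega> (i + 1)) \<in> borel_measurable ?F" by (rule measurable_compose)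
          from measurable_sets[OF this A[of i]] i show "{\<omega> \<in> space ?F. state p Y (- 1) \<omega> (i + 1) \<in> A i} \<in> sets ?F"
            by (simp add: vimage_def Int_def conj_commute)
        qed simp
        then show ?thesis by simp
      qed
      have BM: "?B \<in> sets M" using B subalg by (auto simp: subalgebra_def)
      have CM: "?C \<in> sets M" using measurable_sets[OF Y[OF order.refl] Ap] by (simp add: vimage_def Int_def conj_commute)
      have fin: "integrable M (indicator ?C :: _ \<Rightarrow> real)" using CM by (simp add: less_top[symmetric])
      have Rm: "(\<lambda>\<omega>. measure (R 0 (state p Y (- 1) \<omega>)) (A p)) \<in> borel_measurable M"
        using measurable_compose[OF X1 measurable_compose[OF R_measurable[OF z] measurable_measure_subprob_algebra[OF Ap]]] by simp
      have AE: "AE \<omega> in M. real_cond_exp M ?F (indicator ?C) \<omega> = measure (R 0 (state p Y (- 1) \<omega>)) (A p)"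
        using markov[unfolded markov_upto_0_def, rule_format, OF order.refl Ap] by simp
      \<comment> \<open>A box for the state at time 0 splits into a condition on \<open>Y 0\<close>
        and conditions on the older values, which are coordinates of the state at time -1.\<close>
      have vim: "state p Y 0 -` Pi\<^sub>E {1..p} A \<inter> space M = ?B \<inter> ?C"
      proof -
        have "state p Y 0 \<omega> \<in> Pi\<^sub>E {1..p} A \<longleftrightarrow> Y 0 \<omega> \<in> A p \<and> (\<forall>i\<in>{1..p} - {p}. state p Y (- 1) \<omega> (i + 1) \<in> A i)" for \<omega>
          unfolding state_shift[OF p, of Y 0] using p unfolding shift_def PiE_iff by (auto split: if_splits)
        then show ?thesis by auto
      qed
      have "emeasure ?\<mu> (Pi\<^sub>E {1..p} A) = emeasure M (?B \<inter> ?C)" by (simp only: emeasure_distr[OF X0 box] vim)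
      also have "\<dots> = ennreal (\<integral>\<omega>\<in>?B. indicator ?C \<omega> \<partial>M)"
        using BM CM by (simp add: set_lebesgue_integral_def emeasure_eq_measure indicator_inter_arith[symmetric])
      \<comment> \<open>\<open>?B\<close> is an event of the past, so the indicator of
        \<open>?C\<close> may be replaced by its conditional expectation, which the Markov property
        evaluates.\<close>
      also have "(\<integral>\<omega>\<in>?B. indicator ?C \<omega> \<partial>M) = (\<integral>\<omega>\<in>?B. real_cond_exp M ?F (indicator ?C) \<omega> \<partial>M)"
        by (rule F.real_cond_exp_intA[OF fin B])
      also have "\<dots> = (\<integral>\<omega>\<in>?B. measure (R 0 (state p Y (- 1) \<omega>)) (A p) \<partial>M)"
        unfolding set_lebesgue_integral_def by (rule integral_cong_AE) (use AE BM Rm in auto)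
      also have "ennreal \<dots> = (\<integral>\<^sup>+\<omega>. ennreal (indicator ?B \<omega> * measure (R 0 (state p Y (- 1) \<omega>)) (A p)) \<partial>M)"
        unfolding set_lebesgue_integral_def real_scaleR_def
      proof (rule nn_integral_eq_integral[symmetric])
        show "integrable M (\<lambda>\<omega>. indicator ?B \<omega> * measure (R 0 (state p Y (- 1) \<omega>)) (A p))"
          by (rule integrable_const_bound[of _ 1])
             (use BM Rm prob_space.prob_le_1[OF prob_space_R[OF z]] in \<open>auto simp: indicator_def\<close>)
      qed (auto intro!: AE_I2)
      also have "\<dots> = (\<integral>\<^sup>+\<omega>. emeasure (Q 0 (state p Y (- 1) \<omega>)) (Pi\<^sub>E {1..p} A) \<partial>M)"
      proof (rule nn_integral_cong)
        fix \<omega> assume w: "\<omega> \<in> space M"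
        interpret R: prob_space "R 0 (state p Y (- 1) \<omega>)" by (rule prob_space_R[OF z])
        show "ennreal (indicator ?B \<omega> * measure (R 0 (state p Y (- 1) \<omega>)) (A p)) = emeasure (Q 0 (state p Y (- 1) \<omega>)) (Pi\<^sub>E {1..p} A)"
          using w unfolding Q_eq[OF z measurable_space[OF X1 w]]
          by (subst emeasure_shift_box[OF measurable_space[OF X1 w] A]) (auto simp: R.emeasure_eq_measure)
      qed
      also have "\<dots> = (\<integral>\<^sup>+x. emeasure (Q 0 x) (Pi\<^sub>E {1..p} A) \<partial>?\<mu>)"
      proof -
        have "(\<lambda>x. emeasure (Q 0 x) (Pi\<^sub>E {1..p} A)) \<in> borel_measurable (Rp p)"
          by (rule measurable_compose[OF Q_measurable[OF z] measurable_emeasure_subprob_algebra[OF box]])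
        then show ?thesis unfolding same[symmetric] by (subst nn_integral_distr[OF X1]) auto
      qed
      also have "\<dots> = emeasure (?\<mu> \<bind> Q 0) (Pi\<^sub>E {1..p} A)"
        by (rule emeasure_bind[OF _ Qm box, symmetric]) (rule \<mu>.not_empty)
      finally show "emeasure ?\<mu> (Pi\<^sub>E {1..p} A) = emeasure (?\<mu> \<bind> Q 0) (Pi\<^sub>E {1..p} A)" .
    qed auto
  qed (rule \<mu>.prob_space_axioms, rule sets_distr)
qed

text \<open>The recursion at time \<open>s\<close> has the form that \<open>step_law_process\<close>
  asks for, with \<open>shift\<close> or \<open>snoc\<close> as the extension; the current state or
  block is measurable with respect to the past, from which the noise at \<open>s\<close> is
  independent.\<close>

lemma
  fixes M :: "'w measure" and Y :: "int \<Rightarrow> 'w \<Rightarrow> real"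
  assumes M: "prob_space M" and n: "1 \<le> n" and Y: "\<And>t. t \<le> int n \<Longrightarrow> Y t \<in> borel_measurable M"
    and rec: "\<And>t \<omega>. t \<in> {1..int n} \<Longrightarrow> \<omega> \<in> space M \<Longrightarrow>
      Y t \<omega> = m (real_of_int t / real n) (\<lambda>i\<in>{1..p}. Y (t - int i) \<omega>) + \<sigma> (real_of_int t / real n) * e t \<omega>"
    and stat: "stationary_upto_0 M Y" and markov: "markov_upto_0 M p (R 0) Y"
    and e: "\<And>t. distributed M lborel (e t) (\<lambda>y. ennreal (f y))"
    and ind: "\<And>t. t \<in> {1..int n} \<Longrightarrow>
      prob_space.indep_set M (sets (vimage_algebra (space M) (e t) borel)) (sets (past_algebra M Y t))"
  shows process_chain_laws: "chain_laws n (\<lambda>t. distr M (Rp p) (state p Y (int t)))"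
    and process_block_laws: "t \<le> n \<Longrightarrow>
      block_laws n t (distr M (Rp p) (state p Y (int t))) (\<lambda>j. block_law M (Rp p) (state p Y) (int t) (Suc j))"
proof -
  have past: "sets (past_algebra M Y s) \<subseteq> sets M" if "s \<in> {1..int n}" for s
    by (rule sets_past_algebra, rule Y) (use that in auto)
  have rec': "Y s \<omega> = m (real_of_int s / real n) (rev_vec p (state p Y (s - 1) \<omega>)) + \<sigma> (real_of_int s / real n) * e s \<omega>"
    if "s \<in> {1..int n}" "\<omega> \<in> space M" for s \<omega>
    using rec[OF that] unfolding rev_vec_state .
  show "chain_laws n (\<lambda>t. distr M (Rp p) (state p Y (int t)))"
    unfolding chain_laws_def
  proof (intro conjI allI impI)
    show "distr M (Rp p) (state p Y (int 0)) = inv_law (Rp p) (Q 0)"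
      using initial_law[OF M Y stat markov] by simp
    fix t assume t: "t < n"
    define s where "s = int (Suc t)"
    have s: "s \<in> {1..int n}" "s - 1 = int t" "real_of_int s = real (Suc t)" using t by (auto simp: s_def)
    have u: "real (Suc t) / real n \<in> {0..1}" by (rule unit_frac[OF n]) (use t in simp)
    have X: "state p Y (int t) \<in> measurable (past_algebra M Y s) (Rp p)"
      by (rule state_measurable, rule past_algebra_measurable) (simp add: s_def)
    show "st.step_law (real (Suc t) / real n) (distr M (Rp p) (state p Y (int t))) (distr M (Rp p) (state p Y (int (Suc t))))"
    proof (rule st.step_law_process[OF M u space_past_algebra past[OF s(1)] X e ind[OF s(1)]])
      fix \<omega> assume w: "\<omega> \<in> space M"
      show "state p Y (int (Suc t)) \<omega> = shift p (state p Y (int t) \<omega>)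
          (m (real (Suc t) / real n) (rev_vec p (state p Y (int t) \<omega>)) + \<sigma> (real (Suc t) / real n) * e s \<omega>)"
        using rec'[OF s(1) w] state_shift[OF p, of Y s \<omega>] unfolding s(2,3) s_def[symmetric] by simp
    qed
  qed
  assume t: "t \<le> n"
  have bl: "block_law M (Rp p) (state p Y) (int t) j = distr M (Rpj p j) (block p Y (int t) j)" for j
    by (simp add: block_law_def block_def[abs_def])
  show "block_laws n t (distr M (Rp p) (state p Y (int t))) (\<lambda>j. block_law M (Rp p) (state p Y) (int t) (Suc j))"
    unfolding block_laws_def bl
  proof (intro conjI allI impI)
    show "distr M (Rpj p (Suc 0)) (block p Y (int t) (Suc 0)) = distr (distr M (Rp p) (state p Y (int t))) (Rpj p 1) emb"
    proof -
      have "state p Y (int t) \<in> measurable M (Rp p)" by (rule state_measurable, rule Y) (use t in simp)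
      from distr_distr[OF emb_measurable this] show ?thesis by (simp add: comp_def block_1[abs_def])
    qed
    fix j assume j: "t + Suc j \<le> n"
    define s where "s = int (t + Suc j)"
    have s: "s \<in> {1..int n}" "real_of_int s = real (t + Suc j)" using j by (auto simp: s_def)
    have u: "real (t + Suc j) / real n \<in> {0..1}" by (rule unit_frac[OF n j])
    have X: "block p Y (int t) (Suc j) \<in> measurable (past_algebra M Y s) (Rpj p (Suc j))"
      by (rule block_measurable, rule past_algebra_measurable) (simp add: s_def)
    have last: "block p Y (int t) (Suc j) \<omega> (Suc j) = state p Y (s - 1) \<omega>" for \<omega>
      by (simp add: block_def s_def)
    show "bl.step_law j (real (t + Suc j) / real n) (distr M (Rpj p (Suc j)) (block p Y (int t) (Suc j)))
       (distr M (Rpj p (Suc (Suc j))) (block p Y (int t) (Suc (Suc j))))"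
    proof (rule bl.step_law_process[OF M u space_past_algebra past[OF s(1)] X e ind[OF s(1)]])
      fix \<omega> assume w: "\<omega> \<in> space M"
      have "int t + int (Suc j) = s" by (simp add: s_def)
      then show "block p Y (int t) (Suc (Suc j)) \<omega> = snoc p (Suc j) (block p Y (int t) (Suc j) \<omega>)
          (m (real (t + Suc j) / real n) (rev_vec p (block p Y (int t) (Suc j) \<omega> (Suc j))) + \<sigma> (real (t + Suc j) / real n) * e s \<omega>)"
        using rec'[OF s(1) w] block_Suc[OF p, of Y "int t" j \<omega>] unfolding last s(2) by simp
    qed
  qed
qed

section \<open>The weight of the statement and the final estimates\<close>

definition V :: "(nat \<Rightarrow> real) \<Rightarrow> real" where
  "V x = (\<Sum>i=1..p. (1 + \<bar>x i\<bar>) powr dl k)"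

lemma V_ge1: "1 \<le> V x"
proof -
  have d: "0 \<le> dl k" using dl_pos[of k] by simp
  have "1 \<le> (1 + \<bar>x 1\<bar>) powr dl k" by (rule ge_one_powr_ge_zero) (use d in auto)
  also have "\<dots> \<le> V x" unfolding V_def by (rule member_le_sum) (use p in auto)
  finally show ?thesis .
qed

lemma V_measurable: "V \<in> borel_measurable (Rp p)"
  unfolding V_def[abs_def]
proof (rule borel_measurable_sum)
  fix i assume "i \<in> {1..p}"
  then have "(\<lambda>x. x i) \<in> borel_measurable (Rp p)" by (rule measurable_component_singleton)
  then show "(\<lambda>x. (1 + \<bar>x i\<bar>) powr dl k) \<in> borel_measurable (Rp p)" by measurable
qed

lemma sum_weight_ge1: "1 \<le> sum_weight V (Suc j) z"
proof -
  have "1 \<le> V (z 1)" by (rule V_ge1)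
  also have "\<dots> \<le> sum_weight V (Suc j) z"
    unfolding sum_weight_def by (rule member_le_sum) (use V_ge1 in \<open>auto intro: order.trans[OF zero_le_one]\<close>)
  finally show ?thesis .
qed

lemma sum_weight_measurable: "sum_weight V j \<in> borel_measurable (Rpj p j)"
  unfolding sum_weight_def[abs_def]
proof (rule borel_measurable_sum)
  fix i assume "i \<in> {1..j}"
  then have "(\<lambda>z. z i) \<in> measurable (Rpj p j) (Rp p)" by (rule measurable_component_singleton)
  then show "(\<lambda>z. V (z i)) \<in> borel_measurable (Rpj p j)" by (rule measurable_compose[OF _ V_measurable])
qed

text \<open>Each of the \<open>j * p\<close> summands is at most the last weight of the scale,
  because a single coordinate is bounded by the size of the block.\<close>

lemma sum_weight_le: "sum_weight V j z \<le> real (j * p) * wt (szj j) k z"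
proof -
  have d: "0 \<le> dl k" using dl_pos[of k] by simp
  have "sum_weight V j z \<le> (\<Sum>i=1..j. \<Sum>l=1..p. wt (szj j) k z)"
    unfolding sum_weight_def V_def
  proof (rule sum_mono, rule sum_mono)
    fix i l assume i: "i \<in> {1..j}" and l: "l \<in> {1..p}"
    have "1 + \<bar>z i l\<bar> \<le> szj j z" using one_plus_le_sz[OF l, of "z i"] sz_le_szj[OF i, of z] by linarith
    then show "(1 + \<bar>z i l\<bar>) powr dl k \<le> wt (szj j) k z" unfolding wt_def by (intro powr_mono2 d) auto
  qed
  then show ?thesis by simp
qed

text \<open>Test functions bounded by \<open>V\<close> belong to the last and smallest weight, so
  the estimates of every order apply to them.\<close>

lemma sum_weight_wball:
  assumes g: "g \<in> wball (Rpj p (Suc j)) (sum_weight V (Suc j)) 1" and l: "l \<le> k"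
  shows "g \<in> Wb j l (real (Suc j * p))"
proof -
  have "g \<in> Wb j k (real (Suc j * p))"
    by (rule wball_mono[OF g]) (use sum_weight_le[of "Suc j"] in simp)
  then show ?thesis by (rule weight_scale_wball[OF bl.weight_scale_A l order.refl of_nat_0_le_iff])
qed

lemma sum_weight_functional:
  assumes L: "wfunctional (Rpj p (Suc j)) (wt (szj (Suc j)) 0) L"
  shows "wfunctional (Rpj p (Suc j)) (sum_weight V (Suc j)) L"
proof (rule wfunctional_mono[OF L])
  show "0 \<le> sum_weight V (Suc j) z" for z using sum_weight_ge1[of j z] by simp
  show "sum_weight V (Suc j) z \<le> real (Suc j * p) * wt (szj (Suc j)) 0 z" if "z \<in> space (Rpj p (Suc j))" for z
  proof -
    have "wt (szj (Suc j)) k z \<le> wt (szj (Suc j)) 0 z"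
      using bl.weight_scale_A[of j] that by (simp add: weight_scale_def)
    then show ?thesis using order.trans[OF sum_weight_le mult_left_mono[OF _ of_nat_0_le_iff]] by blast
  qed
qed

lemma stat_law_Ck: "Ck_on_measures k {0..1} (Rpj p (Suc j)) (sum_weight V (Suc j)) (\<lambda>u. measure (stat_law p m \<sigma> f u (Suc j)))"
proof (rule smooth_family_Ck_on_measures[OF blk_smooth bl.weight_scale_A sum_weight_ge1 sum_weight_measurable sum_weight_le])
  fix u :: real assume u: "u \<in> {0..1}"
  show "measure (stat_law p m \<sigma> f u (Suc j)) = functional_measure (Rpj p (Suc j)) (blk j 0 u)"
  proof
    fix A
    show "measure (stat_law p m \<sigma> f u (Suc j)) A = functional_measure (Rpj p (Suc j)) (blk j 0 u) A"
    proof (cases "A \<in> sets (Rpj p (Suc j))")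
      case True
      have "(indicator A :: _ \<Rightarrow> real) \<in> Wb j 0 1"
        by (rule wball_bounded[OF weight_scale_ge1[OF bl.weight_scale_A le0]]) (use True in \<open>auto simp: indicator_def\<close>)
      from stat_law_integral[OF u this] show ?thesis
        using True sets_eq_imp_space_eq[OF stat_law_sets[OF u, of j]] sets.sets_into_space[OF True]
        by (simp add: functional_measure_def stat_law_sets[OF u] Int_absorb2)
    next
      case False
      then have "A \<notin> sets (stat_law p m \<sigma> f u (Suc j))" unfolding stat_law_sets[OF u] .
      then show ?thesis using False unfolding functional_measure_def by (simp only: measure_notin_sets if_False not_False_eq_True)
    qed
  qed
qed

text \<open>A test function for \<open>V\<close> is admissible both in weight 0, where
  \<open>blk\<close> represents the integrals against \<open>stat_law\<close>, and in weight 1,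
  where the approximation error is controlled.\<close>

lemma block_laws_weighted_norm:
  "\<exists>C>0. \<forall>n \<nu> t \<mu> u. 1 \<le> n \<longrightarrow> chain_laws n \<nu> \<longrightarrow> block_laws n t (\<nu> t) \<mu> \<longrightarrow> t + j \<le> n \<longrightarrow> u \<in> {0..1} \<longrightarrow>
     weighted_norm (Rpj p (Suc j)) (sum_weight V (Suc j)) (\<lambda>A. measure (\<mu> j) A - measure (stat_law p m \<sigma> f u (Suc j)) A)
       \<le> ennreal (C * (\<bar>u - real t / real n\<bar> + 1 / real n))"
proof -
  obtain C where C: "C > 0" "\<And>n \<nu> t \<mu>. 1 \<le> n \<Longrightarrow> chain_laws n \<nu> \<Longrightarrow> block_laws n t (\<nu> t) \<mu> \<Longrightarrow> t + j \<le> n \<Longrightarrow>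
     sets (\<mu> j) = sets (Rpj p (Suc j)) \<and> integrable (\<mu> j) (wt (szj (Suc j)) 0) \<and> (\<integral>z. wt (szj (Suc j)) 0 z \<partial>\<mu> j) \<le> C \<and>
     (\<forall>u c g. u \<in> {0..1} \<longrightarrow> 0 \<le> c \<longrightarrow> g \<in> Wb j 1 c \<longrightarrow>
        \<bar>(\<integral>z. g z \<partial>\<mu> j) - blk j 0 u g\<bar> \<le> C * c * (\<bar>u - real t / real n\<bar> + 1 / real n))"
    using block_laws_stat[of j] by blast
  let ?M = "Rpj p (Suc j)" and ?W = "sum_weight V (Suc j)" and ?K = "real (Suc j * p)"
  show ?thesis
  proof (intro exI[of _ "C * ?K"] conjI allI impI)
    have "0 < Suc j * p" using p by simp
    then show "0 < C * ?K" using C(1) by (simp only: of_nat_0_less_iff zero_less_mult_iff simp_thms)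
    fix n t and \<nu> :: "nat \<Rightarrow> (nat \<Rightarrow> real) measure" and \<mu> :: "nat \<Rightarrow> (nat \<Rightarrow> nat \<Rightarrow> real) measure" and u :: real
    assume n: "1 \<le> n" "chain_laws n \<nu>" "block_laws n t (\<nu> t) \<mu>" "t + j \<le> n" and u: "u \<in> {0..1}"
    have s: "sets (\<mu> j) = sets ?M" and int: "integrable (\<mu> j) (wt (szj (Suc j)) 0)"
      and approx: "\<And>c g. 0 \<le> c \<Longrightarrow> g \<in> wball ?M (wt (szj (Suc j)) 1) c \<Longrightarrow>
        \<bar>(\<integral>z. g z \<partial>\<mu> j) - blk j 0 u g\<bar> \<le> C * c * (\<bar>u - real t / real n\<bar> + 1 / real n)"
      using C(2)[OF n] u by blast+
    let ?s = "stat_law p m \<sigma> f u (Suc j)"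
    let ?L = "\<lambda>g. (\<integral>z. g z \<partial>\<mu> j) - (\<integral>z. g z \<partial>?s)"
    note sp = sets_eq_imp_space_eq[OF s] sets_eq_imp_space_eq[OF stat_law_sets[OF u, of j]]
    have "wfunctional (\<mu> j) (wt (szj (Suc j)) 0) (\<lambda>g. \<integral>z. g z \<partial>\<mu> j)" by (rule wfunctional_integral[OF int])
    then have L1: "wfunctional ?M ?W (\<lambda>g. \<integral>z. g z \<partial>\<mu> j)"
      by (intro sum_weight_functional) (simp only: wfunctional_def wball_def sp measurable_cong_sets[OF s refl])
    have "wfunctional ?s (wt (szj (Suc j)) 0) (\<lambda>g. \<integral>z. g z \<partial>?s)" by (rule wfunctional_integral[OF stat_law_integrable[OF u]])
    then have L2: "wfunctional ?M ?W (\<lambda>g. \<integral>z. g z \<partial>?s)"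
      by (intro sum_weight_functional) (simp only: wfunctional_def wball_def sp measurable_cong_sets[OF stat_law_sets[OF u] refl])
    have L: "wfunctional ?M ?W ?L" using wfunctional_lincomb_functional[OF L1 L2, of 1 "-1"] by simp
    have "(\<lambda>A. measure (\<mu> j) A - measure ?s A) = functional_measure ?M ?L"
    proof
      fix A show "measure (\<mu> j) A - measure ?s A = functional_measure ?M ?L A"
      proof (cases "A \<in> sets ?M")
        case True
        then show ?thesis using sets.sets_into_space[OF True] by (simp add: functional_measure_def sp Int_absorb2)
      next
        case False
        then have "A \<notin> sets (\<mu> j)" "A \<notin> sets ?s" unfolding s stat_law_sets[OF u] by blast+
        then show ?thesis using False unfolding functional_measure_def by (simp only: measure_notin_sets if_False not_False_eq_True diff_self)
      qed
    qed
    moreover have "weighted_norm ?M ?W (functional_measure ?M ?L) \<le> ennreal (C * ?K * (\<bar>u - real t / real n\<bar> + 1 / real n))"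
    proof (rule weighted_norm_functional_le[OF sum_weight_ge1 sum_weight_measurable L])
      fix g assume g: "g \<in> wball ?M ?W 1"
      have "(\<integral>z. g z \<partial>?s) = blk j 0 u g" by (rule stat_law_integral[OF u sum_weight_wball[OF g le0]])
      then show "?L g \<le> C * ?K * (\<bar>u - real t / real n\<bar> + 1 / real n)"
        using approx[OF of_nat_0_le_iff sum_weight_wball[OF g k]] by simp
    qed
    ultimately show "weighted_norm ?M ?W (\<lambda>A. measure (\<mu> j) A - measure ?s A) \<le> ennreal (C * ?K * (\<bar>u - real t / real n\<bar> + 1 / real n))"
      by simp
  qed
qed

end

theorem proposition4:
  fixes M :: "'w measure"
    and p k :: nat
    and m :: "real \<Rightarrow> (nat \<Rightarrow> real) \<Rightarrow> real"
    and \<sigma> :: "real \<Rightarrow> real"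
    and \<epsilon> :: "int \<Rightarrow> 'w \<Rightarrow> real"
    and Y :: "nat \<Rightarrow> int \<Rightarrow> 'w \<Rightarrow> real"
    and \<beta> :: "nat \<Rightarrow> real \<Rightarrow> real"
    and \<beta>0 q' C1 C2 d0 d1 :: real
    and f :: "real \<Rightarrow> real"
    and V0 :: "(nat \<Rightarrow> real) \<Rightarrow> real"
  assumes M: "prob_space M"
    and p: "p \<ge> 1" and k: "k \<ge> 1"
    and m_meas: "(\<lambda>(u, y). m u y) \<in> borel_measurable (restrict_space borel {0..1} \<Otimes>\<^sub>M Rp p)"
    and \<sigma>_meas: "\<sigma> \<in> borel_measurable (restrict_space borel {0..1})"
    and \<sigma>_nonneg: "\<forall>u\<in>{0..1}. \<sigma> u \<ge> 0"
    \<comment> \<open>the noise is i.i.d.\<close>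
    and \<epsilon>_indep: "prob_space.indep_vars M (\<lambda>_. borel) \<epsilon> UNIV"
    and \<epsilon>_ident: "\<forall>t. distr M borel (\<epsilon> t) = distr M borel (\<epsilon> 1)"
    \<comment> \<open>the process and its initial conditions\<close>
    and Y_meas: "\<forall>n\<ge>1. \<forall>t\<le>int n. Y n t \<in> borel_measurable M"
    and Y_rec: "\<forall>n\<ge>1. \<forall>t\<in>{1..int n}. \<forall>\<omega>\<in>space M.
      Y n t \<omega> = m (real_of_int t / real n) (\<lambda>i\<in>{1..p}. Y n (t - int i) \<omega>)
                 + \<sigma> (real_of_int t / real n) * \<epsilon> t \<omega>"
    and Y_stationary: "\<forall>n\<ge>1. stationary_upto_0 M (Y n)"
    and Y_markov: "\<forall>n\<ge>1. markov_upto_0 M p (R_kernel p m \<sigma> f 0) (Y n)"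
    and Y_indep: "\<forall>n\<ge>1. \<forall>t\<in>{1..int n}.
      prob_space.indep_set M (sets (vimage_algebra (space M) (\<epsilon> t) borel))
        (sets (past_algebra M (Y n) t))"
    \<comment> \<open>(E21)\<close>
    and \<sigma>_Ck: "Ck_on k {0..1} \<sigma>"
    and \<sigma>_inf: "(INF u\<in>{0..1}. \<sigma> u) > 0"
    and \<sigma>_bdd: "\<forall>l\<le>k. bdd_above ((\<lambda>u. \<bar>nderiv {0..1} \<sigma> l u\<bar>) ` {0..1})"
    \<comment> \<open>(E22)\<close>
    and m_Ck: "\<forall>y\<in>space (Rp p). Ck_on k {0..1} (\<lambda>u. m u y)"
    and \<beta>_nonneg: "\<forall>i\<in>{1..p}. \<forall>u\<in>{0..1}. \<beta> i u \<ge> 0"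
    and \<beta>_sup: "(SUP u\<in>{0..1}. ereal (\<Sum>i=1..p. \<beta> i u)) < 1"
    and const_pos: "\<beta>0 > 0" "q' > 0" "C1 > 0" "C2 > 0"
    and m_growth: "\<forall>u\<in>{0..1}. \<forall>y\<in>space (Rp p).
      \<bar>m u y\<bar> \<le> (\<Sum>i=1..p. \<beta> i u * \<bar>y i\<bar>) + \<beta>0"
    and m_deriv_growth: "\<forall>l\<in>{1..k}. \<forall>u\<in>{0..1}. \<forall>y\<in>space (Rp p).
      \<bar>nderiv {0..1} (\<lambda>u. m u y) l u\<bar> \<le> C1 * (\<Sum>i=1..p. \<bar>y i\<bar>) powr q' + C2"
    \<comment> \<open>(E23)\<close>
    and d0: "d0 \<ge> 1" "d0 - q' * real k > 0"
    and \<epsilon>_moment: "integrable M (\<lambda>\<omega>. \<bar>\<epsilon> 1 \<omega>\<bar> powr d0)"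
    and \<epsilon>_density: "distributed M lborel (\<epsilon> 1) (\<lambda>y. ennreal (f y))"
    and f_Ck: "Ck_on k UNIV f"
    and f_pos: "\<forall>y. f y > 0"
    and f_int: "\<forall>s\<le>k. integrable lborel
      (\<lambda>y. \<bar>y\<bar> powr (d0 + (1 - q') * real s) * \<bar>nderiv UNIV f s y\<bar>)"
    \<comment> \<open>the weight function\<close>
    and d1_def: "d1 = d0 - q' * real k"
    and V0_def: "V0 = (\<lambda>x. \<Sum>i=1..p. (1 + \<bar>x i\<bar>) powr d1)"
  shows "locally_stationary M (Rp p) V0 (\<lambda>n. state p (Y n)) (stat_law p m \<sigma> f) \<and>
    (\<forall>j\<ge>1. Ck_on_measures k {0..1} (Rpj p j) (sum_weight V0 j)
       (\<lambda>u. measure (stat_law p m \<sigma> f u j)))"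
proof -
  interpret prob_space M by (rule M)
  have \<epsilon>_rv: "\<epsilon> t \<in> borel_measurable M" for t
    using \<epsilon>_indep by (simp add: indep_vars_def)
  \<comment> \<open>The density is given for one noise variable and passes to the others because
    they have the same law.\<close>
  have dens: "distributed M lborel (\<epsilon> t) (\<lambda>y. ennreal (f y))" for t
  proof -
    have "distr M lborel (\<epsilon> t) = distr M borel (\<epsilon> t)" by (rule distr_cong) auto
    also have "\<dots> = distr M borel (\<epsilon> 1)" using \<epsilon>_ident by blast
    also have "\<dots> = distr M lborel (\<epsilon> 1)" by (rule distr_cong) auto
    finally show ?thesis using \<epsilon>_density \<epsilon>_rv unfolding distributed_def by simp
  qed
  \<comment> \<open>A supremum below 1 leaves room for one real \<open>b < 1\<close> that bounds all
    the sums.\<close>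
  obtain b where b: "(SUP u\<in>{0..1}. ereal (\<Sum>i=1..p. \<beta> i u)) < ereal b" "ereal b < 1"
    using ereal_dense2[OF \<beta>_sup] by blast
  have \<beta>b: "(\<Sum>i=1..p. \<beta> i u) \<le> b" if "u \<in> {0..1}" for u
  proof -
    have "ereal (\<Sum>i=1..p. \<beta> i u) \<le> (SUP u\<in>{0..1}. ereal (\<Sum>i=1..p. \<beta> i u))" by (rule SUP_upper[OF that])
    with b(1) have "ereal (\<Sum>i=1..p. \<beta> i u) < ereal b" by (rule le_less_trans[rotated])
    then show ?thesis by simp
  qed
  interpret ar_kernel p k m \<sigma> f b \<beta>0 q' C1 C2 d0
  proof
    fix u :: real assume u: "u \<in> {0..1}"
    show "m u \<in> borel_measurable (Rp p)"
      using measurable_compose[OF measurable_Pair1' m_meas, of u] u by simp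
    have "bdd_below (\<sigma> ` {0..1})" using \<sigma>_nonneg by (intro bdd_belowI[of _ 0]) auto
    from cINF_lower[OF this u] show "0 < \<sigma> u" using \<sigma>_inf by simp
    fix y B assume y: "y \<in> space (Rp p)" and B: "\<forall>i\<in>{1..p}. \<bar>y i\<bar> \<le> (B::real)"
    \<comment> \<open>\<open>p \<ge> 1\<close> provides a coordinate, so the bound \<open>B\<close>
      cannot be negative.\<close>
    have "0 \<le> B" using B p by (force intro: order.trans[OF abs_ge_zero])
    have "\<bar>m u y\<bar> \<le> (\<Sum>i=1..p. \<beta> i u * \<bar>y i\<bar>) + \<beta>0" using m_growth u y by blast
    also have "(\<Sum>i=1..p. \<beta> i u * \<bar>y i\<bar>) \<le> (\<Sum>i=1..p. \<beta> i u * B)"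
      by (intro sum_mono mult_left_mono) (use B \<beta>_nonneg u in auto)
    also have "\<dots> \<le> b * B" unfolding sum_distrib_right[symmetric] by (rule mult_right_mono[OF \<beta>b[OF u] \<open>0 \<le> B\<close>])
    finally show "\<bar>m u y\<bar> \<le> b * B + \<beta>0" by simp
  next
    have "0 \<le> (\<Sum>i=1..p. \<beta> i 0)" using \<beta>_nonneg by (intro sum_nonneg) auto
    then show "0 \<le> b" using \<beta>b[of 0] by simp
    \<comment> \<open>\<open>f\<close> has integral 1 because it is the density of a probability
      law.\<close>
    have "emeasure (density lborel (\<lambda>y. ennreal (f y))) UNIV = emeasure (distr M lborel (\<epsilon> 1)) UNIV"
      using distributed_distr_eq_density[OF \<epsilon>_density] by simp
    also have "\<dots> = 1" using \<epsilon>_rv by (subst emeasure_distr) (auto simp: emeasure_space_1)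
    finally show "(\<integral>\<^sup>+y. ennreal (f y) \<partial>lborel) = 1"
      using distributed_borel_measurable[OF \<epsilon>_density] by (simp add: emeasure_density)
  qed (use p k \<sigma>_Ck m_Ck b const_pos m_deriv_growth d0 f_Ck f_pos f_int in auto)
  have V: "V0 = V" unfolding V0_def d1_def V_def[abs_def] dl_def ..
  have "locally_stationary M (Rp p) V0 (\<lambda>n. state p (Y n)) (stat_law p m \<sigma> f)"
    unfolding locally_stationary_def
  proof (intro allI impI)
    fix j :: nat assume "1 \<le> j"
    \<comment> \<open>The results on blocks are indexed by the length minus 1.\<close>
    then obtain i where j: "j = Suc i" by (cases j) auto
    obtain C where C: "C > 0" "\<And>n \<nu> t \<mu> u. 1 \<le> n \<Longrightarrow> chain_laws n \<nu> \<Longrightarrow> block_laws n t (\<nu> t) \<mu> \<Longrightarrow> t + i \<le> n \<Longrightarrow> u \<in> {0..1} \<Longrightarrow>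
       weighted_norm (Rpj p (Suc i)) (sum_weight V (Suc i)) (\<lambda>A. measure (\<mu> i) A - measure (stat_law p m \<sigma> f u (Suc i)) A)
         \<le> ennreal (C * (\<bar>u - real t / real n\<bar> + 1 / real n))"
      using block_laws_weighted_norm[of i] by blast
    show "\<exists>C>0. \<forall>u\<in>{0..1}. \<forall>n\<ge>1. \<forall>t\<in>{1..int n - int j + 1}.
        weighted_norm (Rpj p j) (sum_weight V0 j)
          (\<lambda>A. measure (block_law M (Rp p) (state p (Y n)) t j) A - measure (stat_law p m \<sigma> f u j) A)
        \<le> ennreal (C * (\<bar>u - real_of_int t / real n\<bar> + 1 / real n))"
    proof (intro exI[of _ C] conjI ballI allI impI C(1))
      fix u :: real and n :: nat and t :: int
      assume u: "u \<in> {0..1}" and n: "1 \<le> n" and t: "t \<in> {1..int n - int j + 1}"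
      define s where "s = nat t"
      have s: "t = int s" "s + i \<le> n" "s \<le> n" using t j by (auto simp: s_def)
      have Yt: "Y n t \<in> borel_measurable M" if "t \<le> int n" for t using Y_meas n that by blast
      have rec: "Y n t \<omega> = m (real_of_int t / real n) (\<lambda>i\<in>{1..p}. Y n (t - int i) \<omega>) + \<sigma> (real_of_int t / real n) * \<epsilon> t \<omega>"
        if "t \<in> {1..int n}" "\<omega> \<in> space M" for t \<omega> using Y_rec n that by blast
      have init: "stationary_upto_0 M (Y n)" "markov_upto_0 M p (R 0) (Y n)" using Y_stationary Y_markov n by blast+
      have ind: "indep_set (sets (vimage_algebra (space M) (\<epsilon> t) borel)) (sets (past_algebra M (Y n) t))" if "t \<in> {1..int n}" for t
        using Y_indep n that by blast
      have laws: "chain_laws n (\<lambda>t. distr M (Rp p) (state p (Y n) (int t)))"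
        "block_laws n s (distr M (Rp p) (state p (Y n) (int s))) (\<lambda>j. block_law M (Rp p) (state p (Y n)) (int s) (Suc j))"
        by (rule process_chain_laws[OF M n _ _ init dens], fact Yt, erule (1) rec, erule ind)
           (rule process_block_laws[OF M n _ _ init dens], fact Yt, erule (1) rec, erule ind, rule s(3))
      show "weighted_norm (Rpj p j) (sum_weight V0 j)
          (\<lambda>A. measure (block_law M (Rp p) (state p (Y n)) t j) A - measure (stat_law p m \<sigma> f u j) A)
        \<le> ennreal (C * (\<bar>u - real_of_int t / real n\<bar> + 1 / real n))"
        using C(2)[OF n laws s(2) u] unfolding j V s(1) by simp
    qed
  qed
  moreover have "Ck_on_measures k {0..1} (Rpj p j) (sum_weight V0 j) (\<lambda>u. measure (stat_law p m \<sigma> f u j))" if "1 \<le> j" for j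
    using stat_law_Ck[of "j - 1"] that unfolding V by simp
  ultimately show ?thesis by blast
qed

end
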